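(* Let $X=\{X_k\}_{k\ge1}$ be a contraction system. The free contraction algebra $\mathbb H(X)$ has a natural structure of a graded Hopf algebra whose coproduct $\Delta_X$ is induced by the coproduct $\Delta$ on $\mathbb H^{\mathrm{symb}}$; namely $\Delta_X$ is the algebra homomorphism with $$\Delta_X([\alpha]_0)=1\otimes[\alpha]_0+[\alpha]_0\otimes1,\qquad\Delta_X([\alpha]_{n_1,\dots,n_d})=(\mathrm{ev}_\alpha\otimes\mathrm{ev}_\alpha)\big(\Delta([x_1,\dots,x_d]_{n_1,\dots,n_d})\big)\quad(\alpha\in X_d).$$
   Context: **Contraction systems.** For a strictly increasing sequence of positive integers $\mathbf i=(i_1,\dots,i_{d+1})$, $d\ge1$, with $i_{d+1}\le n+1$, and $\mathbf j=(j_1,\dots,j_{f+1})$ strictly increasing with $j_{f+1}\le d+1$, put $\mathbf i|\mathbf j=(i_{j_1},\dots,i_{j_{f+1}})$. A contraction system is a collection of sets $X_1,X_2,\dots$ together with maps $\mathbf i\colon X_n\to X_d$, one for each $n$ and each $\mathbf i=(i_1,\dots,i_{d+1})$ with $i_{d+1}\le n+1$, satisfying $\mathbf j\circ\mathbf i=\mathbf i|\mathbf j\colon X_n\to X_f$. The free contraction algebra $\mathbb H(X)$ is the commutative $\mathbb Q$-algebra generated by symbols $[\alpha]_{n_1,\dots,n_d}$ ($d\ge1$, $\alpha\in X_d$, $n_i\ge1$) in weight $n_1+\dots+n_d$ and $[\alpha]_0$ ($\alpha\in X_1$) in weight $1$, modulo the relations $[(i_1,i_2)\alpha]_0+[(i_2,i_3)\alpha]_0=[(i_1,i_3)\alpha]_0$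 for $\alpha\in X_n$, $1\le i_1<i_2<i_3\le n+1$. **The algebras.** Let $x_1,x_2,\dots$ be free variables and $x_{i\to j}=\prod_{r=i}^{j-1}x_r$ for $i<j$. $\overline{\mathbb H}^{\mathrm{symb}}$ is the free commutative graded $\mathbb Q$-algebra generated by: elements $[x_i]_0$, $i\ge1$, of weight $1$; regular symbols $[x_{i_1\to i_2},\dots,x_{i_d\to i_{d+1}}]_{n_1,\dots,n_d}$ ($d\ge1$, $1\le i_1<\dots<i_{d+1}$, $n_r\ge1$) of weight $n_1+\dots+n_d$; and inverted symbols $[x_{i_d\to i_{d+1}}^{-1},\dots,x_{i_1\to i_2}^{-1}]_{n_d,\dots,n_1}$ of weight $n_1+\dots+n_d$. $\mathbb H^{\mathrm{symb}}$ is the subalgebra generated by the $[x_i]_0$ and the regular symbols. Put $[x_{i\to j}]_0=-[x_{i\to j}^{-1}]_0=\sum_{r=i}^{j-1}[x_r]_0$, $[1]_0=0$. Generating series: $[y_1,\dots,y_d|t_1,\dots,t_d]=\sum_{n_i\ge1}[y_1,\dots,y_d]_{n_1,\dots,n_d}t_1^{n_1-1}\cdots t_d^{n_d-1}$, $[\emptyset|\emptyset]=1$, $\exp([y]_0t)=\sum_{n\ge0}[y]_0^nt^n/n!$; linear forms in the $t$'s may be substituted for the $t_i$. **Evaluation.** With $\mathbf i(x_1,\dots,x_n)=(x_{i_1\to i_2},\dots,x_{i_d\to i_{d+1}})$, for $\alpha\in X_n$ the map $\mathrm{ev}_\alpha$ is the algebra homomorphism to $\mathbb H(X)$ from the subalgebra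 of $\mathbb H^{\mathrm{symb}}$ generated by elements involving only $x_1,\dots,x_n$, given by $\mathrm{ev}_\alpha([\mathbf i(x_1,\dots,x_n)]_{\mathbf n})=[\mathbf i(\alpha)]_{\mathbf n}$, where $\mathbf n$ is a vector $(n_1,\dots,n_d)$ or $0$ (the latter with $d=1$). The coproduct of $[x_1,\dots,x_n]_{\mathbf n}$ lies in the tensor square of this subalgebra. **Coproduct on $\overline{\mathbb H}^{\mathrm{symb}}$.** $\Delta_{\overline{\mathbb H}}$ is the algebra homomorphism with $\Delta([x_i]_0)=[x_i]_0\otimes1+1\otimes[x_i]_0$ and, for $(y_1,\dots,y_d)$ the argument of a regular or inverted symbol and $y_{i\to j}=\prod_{r=i}^{j-1}y_r$, $$\Delta[y_1,\dots,y_d|t_1,\dots,t_d]=\sum[y_{i_1\to i_2},\dots,y_{i_k\to i_{k+1}}|t_{j_1},\dots,t_{j_k}]\otimes[y_1,\dots,y_{i_1-1}|t_1,\dots,t_{i_1-1}]\prod_{\alpha=1}^k(-1)^{j_\alpha-i_\alpha}\exp([y_{i_\alpha\to i_{\alpha+1}}]_0t_{j_\alpha})\,[y_{j_\alpha-1}^{-1},\dots,y_{i_\alpha}^{-1}|t_{j_\alpha}-t_{j_\alpha-1},\dots,t_{j_\alpha}-t_{i_\alpha}]\,[y_{j_\alpha+1},\dots,y_{i_{\alpha+1}-1}|t_{j_\alpha+1}-t_{j_\alpha},\dots,t_{i_{\alpha+1}-1}-t_{j_\alpha}],$$ summed over $k\ge0$ and $1\le i_1\le j_1<i_2\le j_2<\dots<i_k\le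 j_k<i_{k+1}=d+1$. **Inversion.** $\mathrm{INV}\colon\overline{\mathbb H}^{\mathrm{symb}}\to\mathbb H^{\mathrm{symb}}$ is the algebra homomorphism fixing $[x_i]_0$ and the regular symbols and given on inverted symbols inductively (for $[y_1,\dots,y_d]$ regular) by $$\mathrm{INV}[y_d^{-1},\dots,y_1^{-1}|-t_d,\dots,-t_1]=\sum_{j=0}^{d-1}(-1)^{d-1+j}\,\mathrm{INV}[y_j^{-1},\dots,y_1^{-1}|-t_j,\dots,-t_1]\,[y_{j+1},\dots,y_d|t_{j+1},\dots,t_d]$$ $$+\sum_{j=1}^d\tfrac{(-1)^{d-1+j}}{t_j}\mathrm{INV}[y_{j-1}^{-1},\dots,y_1^{-1}|-t_{j-1},\dots,-t_1]\,[y_{j+1},\dots,y_d|t_{j+1},\dots,t_d]$$ $$+\sum_{j=1}^d\tfrac{(-1)^{d+j}}{t_j}\mathrm{INV}[y_{j-1}^{-1},\dots,y_1^{-1}|t_j-t_{j-1},\dots,t_j-t_1]\exp([y_{1\to d+1}]_0t_j)\,[y_{j+1},\dots,y_d|t_{j+1}-t_j,\dots,t_d-t_j].$$ The coproduct on $\mathbb H^{\mathrm{symb}}$ is $\Delta=(\mathrm{INV}\otimes\mathrm{INV})\circ\Delta_{\overline{\mathbb H}}|_{\mathbb H^{\mathrm{symb}}}$; it makes $\mathbb H^{\mathrm{symb}}$ a connected graded commutative Hopf algebra.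
   Formalization: A contraction system is additionally required to satisfy (1,…,n+1)=id on each X_n; without this the claim fails, since if (1,…,n+1)α=α'≠α then Δ_X takes the same values on the symbols of α and α', and no counit exists. *)

theory Defs
  imports
    Complex_Main
    "HOL-Library.Poly_Mapping"
    "HOL-Library.Product_Plus"
    "HOL-Algebra.Module"
    "HOL-Algebra.QuotRing"
begin

abbreviation "lookup \<equiv> Poly_Mapping.lookup"
abbreviation "keys \<equiv> Poly_Mapping.keys"


section \<open>Algebras over the rationals\<close>

definition rat_alg :: "(rat, rat) module" where
  "rat_alg = \<lparr>carrier = UNIV, mult = (*), one = 1, zero = 0, add = (+), smult = (*)\<rparr>"

definition alg_hom :: "(rat, 'a, 'x) module_scheme \<Rightarrow> (rat, 'b, 'y) module_scheme \<Rightarrow> ('a \<Rightarrow> 'b) set" where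
  "alg_hom A B = {h \<in> ring_hom A B. \<forall>c. \<forall>a\<in>carrier A. h (c \<odot>\<^bsub>A\<^esub> a) = c \<odot>\<^bsub>B\<^esub> h a}"

definition lin_map :: "(rat, 'a, 'x) module_scheme \<Rightarrow> (rat, 'b, 'y) module_scheme \<Rightarrow> ('a \<Rightarrow> 'b) set" where
  "lin_map A B = {h \<in> carrier A \<rightarrow> carrier B.
     (\<forall>a\<in>carrier A. \<forall>b\<in>carrier A. h (a \<oplus>\<^bsub>A\<^esub> b) = h a \<oplus>\<^bsub>B\<^esub> h b) \<and>
     (\<forall>c. \<forall>a\<in>carrier A. h (c \<odot>\<^bsub>A\<^esub> a) = c \<odot>\<^bsub>B\<^esub> h a)}"

definition alg_quot :: "(rat, 'a, 'x) module_scheme \<Rightarrow> 'a set \<Rightarrow> (rat, 'a set) module" where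
  "alg_quot A I = \<lparr>carrier = carrier (A Quot I), mult = mult (A Quot I), one = one (A Quot I),
     zero = zero (A Quot I), add = add (A Quot I),
     smult = (\<lambda>c U. \<Union>u\<in>U. I +>\<^bsub>A\<^esub> (c \<odot>\<^bsub>A\<^esub> u))\<rparr>"


section \<open>Tensor products of commutative algebras\<close>

text \<open>
  The free vector space on the set \<open>A \<times> B\<close>, multiplied by
  \<open>(a, b) (a', b') = (a a', b b')\<close>.
\<close>

definition tensor_free ::
  "(rat, 'a, 'x) module_scheme \<Rightarrow> (rat, 'b, 'y) module_scheme \<Rightarrow> (rat, 'a \<times> 'b \<Rightarrow>\<^sub>0 rat) module" where
  "tensor_free A B =
    \<lparr>carrier = {u. keys u \<subseteq> carrier A \<times> carrier B},
     mult = (\<lambda>u v. \<Sum>x\<in>keys u. \<Sum>y\<in>keys v.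
       Poly_Mapping.single (fst x \<otimes>\<^bsub>A\<^esub> fst y, snd x \<otimes>\<^bsub>B\<^esub> snd y) (lookup u x * lookup v y)),
     one = Poly_Mapping.single (\<one>\<^bsub>A\<^esub>, \<one>\<^bsub>B\<^esub>) 1,
     zero = 0, add = (+), smult = (\<lambda>c. Poly_Mapping.map ((*) c))\<rparr>"

definition tensor_relations ::
  "(rat, 'a, 'x) module_scheme \<Rightarrow> (rat, 'b, 'y) module_scheme \<Rightarrow> ('a \<times> 'b \<Rightarrow>\<^sub>0 rat) set" where
  "tensor_relations A B =
    {Poly_Mapping.single (a \<oplus>\<^bsub>A\<^esub> a', b) 1 - Poly_Mapping.single (a, b) 1 - Poly_Mapping.single (a', b) 1
       | a a' b. a \<in> carrier A \<and> a' \<in> carrier A \<and> b \<in> carrier B} \<union>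
    {Poly_Mapping.single (a, b \<oplus>\<^bsub>B\<^esub> b') 1 - Poly_Mapping.single (a, b) 1 - Poly_Mapping.single (a, b') 1
       | a b b'. a \<in> carrier A \<and> b \<in> carrier B \<and> b' \<in> carrier B} \<union>
    {Poly_Mapping.single (c \<odot>\<^bsub>A\<^esub> a, b) 1 - Poly_Mapping.single (a, b) c
       | c a b. a \<in> carrier A \<and> b \<in> carrier B} \<union>
    {Poly_Mapping.single (a, c \<odot>\<^bsub>B\<^esub> b) 1 - Poly_Mapping.single (a, b) c
       | c a b. a \<in> carrier A \<and> b \<in> carrier B}"

text \<open>
  A multiple of a relation by a basis element is again a relation of the same kind, so for
  algebras \<open>A\<close>, \<open>B\<close> the ideal below is just the linear span of the relations.
\<close>

definition tensor_ideal ::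
  "(rat, 'a, 'x) module_scheme \<Rightarrow> (rat, 'b, 'y) module_scheme \<Rightarrow> ('a \<times> 'b \<Rightarrow>\<^sub>0 rat) set" where
  "tensor_ideal A B = Idl\<^bsub>tensor_free A B\<^esub> (tensor_relations A B)"

definition tensor ::
  "(rat, 'a, 'x) module_scheme \<Rightarrow> (rat, 'b, 'y) module_scheme \<Rightarrow> (rat, ('a \<times> 'b \<Rightarrow>\<^sub>0 rat) set) module" where
  "tensor A B = alg_quot (tensor_free A B) (tensor_ideal A B)"

definition pure_tensor ::
  "(rat, 'a, 'x) module_scheme \<Rightarrow> (rat, 'b, 'y) module_scheme \<Rightarrow> 'a \<Rightarrow> 'b \<Rightarrow> ('a \<times> 'b \<Rightarrow>\<^sub>0 rat) set" where
  "pure_tensor A B a b = tensor_ideal A B +>\<^bsub>tensor_free A B\<^esub> Poly_Mapping.single (a, b) 1"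

text \<open>
  The linear map on \<open>tensor A B\<close> induced by a bilinear map \<open>\<phi>\<close> with values in \<open>M\<close>: choose a
  representative of the class and apply \<open>\<phi>\<close> to its terms.
\<close>

definition tensor_lift ::
  "(rat, 'c, 'z) module_scheme \<Rightarrow> ('a \<Rightarrow> 'b \<Rightarrow> 'c) \<Rightarrow> ('a \<times> 'b \<Rightarrow>\<^sub>0 rat) set \<Rightarrow> 'c" where
  "tensor_lift M \<phi> U = (let u = (SOME u. u \<in> U) in
     \<Oplus>\<^bsub>M\<^esub>x\<in>keys u. lookup u x \<odot>\<^bsub>M\<^esub> \<phi> (fst x) (snd x))"

definition tensor_map ::
  "(rat, 'c, 'x) module_scheme \<Rightarrow> (rat, 'd, 'y) module_scheme \<Rightarrow> ('a \<Rightarrow> 'c) \<Rightarrow> ('b \<Rightarrow> 'd) \<Rightarrow>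
    ('a \<times> 'b \<Rightarrow>\<^sub>0 rat) set \<Rightarrow> ('c \<times> 'd \<Rightarrow>\<^sub>0 rat) set" where
  "tensor_map C D f g = tensor_lift (tensor C D) (\<lambda>a b. pure_tensor C D (f a) (g b))"

text \<open>The canonical map from \<open>(A \<otimes> B) \<otimes> C\<close> to \<open>A \<otimes> (B \<otimes> C)\<close>.\<close>

definition tensor_assoc ::
  "(rat, 'a, 'x) module_scheme \<Rightarrow> (rat, 'b, 'y) module_scheme \<Rightarrow> (rat, 'c, 'z) module_scheme \<Rightarrow>
    (('a \<times> 'b \<Rightarrow>\<^sub>0 rat) set \<times> 'c \<Rightarrow>\<^sub>0 rat) set \<Rightarrow> ('a \<times> ('b \<times> 'c \<Rightarrow>\<^sub>0 rat) set \<Rightarrow>\<^sub>0 rat) set" where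
  "tensor_assoc A B C =
    (let T = tensor A (tensor B C) in
     tensor_lift T (\<lambda>U c. tensor_lift T
       (\<lambda>a b. pure_tensor A (tensor B C) a (pure_tensor B C b c)) U))"


section \<open>Graded Hopf algebras\<close>

text \<open>In \<open>counit_left\<close> and \<open>counit_right\<close>, \<open>\<rat> \<otimes> H\<close> and \<open>H \<otimes> \<rat>\<close> are identified with \<open>H\<close>.\<close>

locale hopf_algebra = algebra rat_alg H for H :: "(rat, 'a) module" (structure) +
  fixes \<Delta> :: "'a \<Rightarrow> ('a \<times> 'a \<Rightarrow>\<^sub>0 rat) set" and \<epsilon> :: "'a \<Rightarrow> rat" and S :: "'a \<Rightarrow> 'a"
  assumes comult_hom: "\<Delta> \<in> alg_hom H (tensor H H)"
    and counit_hom: "\<epsilon> \<in> alg_hom H rat_alg"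
    and coassoc: "x \<in> carrier H \<Longrightarrow>
      tensor_assoc H H H (tensor_map (tensor H H) H \<Delta> (\<lambda>b. b) (\<Delta> x)) =
      tensor_map H (tensor H H) (\<lambda>a. a) \<Delta> (\<Delta> x)"
    and counit_left: "x \<in> carrier H \<Longrightarrow> tensor_lift H (\<lambda>a b. \<epsilon> a \<odot> b) (\<Delta> x) = x"
    and counit_right: "x \<in> carrier H \<Longrightarrow> tensor_lift H (\<lambda>a b. \<epsilon> b \<odot> a) (\<Delta> x) = x"
    and antipode_linear: "S \<in> lin_map H H"
    and antipode_left: "x \<in> carrier H \<Longrightarrow> tensor_lift H (\<lambda>a b. S a \<otimes> b) (\<Delta> x) = \<epsilon> x \<odot> \<one>"
    and antipode_right: "x \<in> carrier H \<Longrightarrow> tensor_lift H (\<lambda>a b. a \<otimes> S b) (\<Delta> x) = \<epsilon> x \<odot> \<one>"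

text \<open>The degree \<open>n\<close> part of \<open>H \<otimes> H\<close>: the span of all \<open>G i \<otimes> G j\<close> with \<open>i + j = n\<close>.\<close>

definition tensor_degree ::
  "(rat, 'a) module \<Rightarrow> (nat \<Rightarrow> 'a set) \<Rightarrow> nat \<Rightarrow> ('a \<times> 'a \<Rightarrow>\<^sub>0 rat) set set" where
  "tensor_degree H G n = {tensor_ideal H H +>\<^bsub>tensor_free H H\<^esub> u | u.
     \<forall>(a, b)\<in>keys u. \<exists>i j. i + j = n \<and> a \<in> G i \<and> b \<in> G j}"

locale graded_hopf_algebra = hopf_algebra H \<Delta> \<epsilon> S
  for H :: "(rat, 'a) module" (structure) and G :: "nat \<Rightarrow> 'a set" and \<Delta> \<epsilon> S +
  assumes degree_submodule: "submodule (G n) rat_alg H"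
    and direct_sum: "x \<in> carrier H \<Longrightarrow>
      \<exists>!f. (\<forall>n. f n \<in> G n) \<and> finite {n. f n \<noteq> \<zero>} \<and> x = (\<Oplus>n\<in>{n. f n \<noteq> \<zero>}. f n)"
    and degree_one: "\<one> \<in> G 0"
    and degree_mult: "a \<in> G m \<Longrightarrow> b \<in> G n \<Longrightarrow> a \<otimes> b \<in> G (m + n)"
    and degree_comult: "a \<in> G n \<Longrightarrow> \<Delta> a \<in> tensor_degree H G n"
    and degree_counit: "a \<in> G n \<Longrightarrow> n > 0 \<Longrightarrow> \<epsilon> a = 0"
    and degree_antipode: "a \<in> G n \<Longrightarrow> S a \<in> G n"


section \<open>Polynomial algebras\<close>

type_synonym 'g mpoly = "('g \<Rightarrow>\<^sub>0 nat) \<Rightarrow>\<^sub>0 rat"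

text \<open>
  The tensor square of a polynomial algebra has the pairs of monomials as a basis; with the
  componentwise addition of exponents it is again a monoid algebra.
\<close>

type_synonym 'g mpoly2 = "(('g \<Rightarrow>\<^sub>0 nat) \<times> ('g \<Rightarrow>\<^sub>0 nat)) \<Rightarrow>\<^sub>0 rat"

definition pvar :: "'g \<Rightarrow> 'g mpoly" where
  "pvar g = Poly_Mapping.single (Poly_Mapping.single g 1) 1"

definition pconst :: "rat \<Rightarrow> ('m::cancel_comm_monoid_add \<Rightarrow>\<^sub>0 rat)" where
  "pconst c = Poly_Mapping.single 0 c"

definition ptensor :: "'g mpoly \<Rightarrow> 'g mpoly \<Rightarrow> 'g mpoly2" where
  "ptensor p q = (\<Sum>m\<in>keys p. \<Sum>n\<in>keys q. Poly_Mapping.single (m, n) (lookup p m * lookup q n))"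

definition phom :: "('g \<Rightarrow> ('m::cancel_comm_monoid_add \<Rightarrow>\<^sub>0 rat)) \<Rightarrow> 'g mpoly \<Rightarrow> ('m \<Rightarrow>\<^sub>0 rat)" where
  "phom f p = (\<Sum>m\<in>keys p. pconst (lookup p m) * (\<Prod>g\<in>keys m. f g ^ lookup m g))"

definition ptensor_map :: "('g mpoly \<Rightarrow> 'g mpoly) \<Rightarrow> ('g mpoly \<Rightarrow> 'g mpoly) \<Rightarrow> 'g mpoly2 \<Rightarrow> 'g mpoly2" where
  "ptensor_map f h z = (\<Sum>(m, n)\<in>keys z.
     pconst (lookup z (m, n)) * ptensor (f (Poly_Mapping.single m 1)) (h (Poly_Mapping.single n 1)))"

definition free_alg :: "'g set \<Rightarrow> (rat, 'g mpoly) module" where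
  "free_alg V = \<lparr>carrier = {p. \<forall>m\<in>keys p. keys m \<subseteq> V}, mult = (*), one = 1, zero = 0, add = (+),
     smult = (\<lambda>c p. pconst c * p)\<rparr>"

text \<open>\<open>alg_eval A f\<close> is the homomorphism to \<open>A\<close> with \<open>g \<mapsto> f g\<close>.\<close>

definition alg_eval :: "(rat, 'a, 'x) module_scheme \<Rightarrow> ('g \<Rightarrow> 'a) \<Rightarrow> 'g mpoly \<Rightarrow> 'a" where
  "alg_eval A f p = (\<Oplus>\<^bsub>A\<^esub>m\<in>keys p. lookup p m \<odot>\<^bsub>A\<^esub> (\<Otimes>\<^bsub>A\<^esub>g\<in>keys m. f g [^]\<^bsub>A\<^esub> lookup m g))"

definition alg_eval_tensor ::
  "(rat, 'a, 'x) module_scheme \<Rightarrow> ('g mpoly \<Rightarrow> 'a) \<Rightarrow> 'g mpoly2 \<Rightarrow> ('a \<times> 'a \<Rightarrow>\<^sub>0 rat) set" where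
  "alg_eval_tensor A h z = (\<Oplus>\<^bsub>tensor A A\<^esub>mn\<in>keys z. lookup z mn \<odot>\<^bsub>tensor A A\<^esub>
     pure_tensor A A (h (Poly_Mapping.single (fst mn) 1)) (h (Poly_Mapping.single (snd mn) 1)))"


section \<open>Formal power series in the variables \<open>t\<^sub>1, t\<^sub>2, \<dots>\<close>\<close>

typedef 'r mseries = "UNIV :: ((nat \<Rightarrow>\<^sub>0 nat) \<Rightarrow> 'r) set"
  morphisms scoeff Series ..

lemma scoeff_Series [simp]: "scoeff (Series f) = f"
  by (simp add: Series_inverse)

lemma mseries_eqI: "(\<And>m. scoeff f m = scoeff g m) \<Longrightarrow> f = g"
  by (metis ext scoeff_inject)

lemma finite_splits: "finite {(a, b). a + b = (m :: nat \<Rightarrow>\<^sub>0 nat)}"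
proof -
  let ?S = "{a. \<forall>i. lookup a i \<le> lookup m i}"
  have "finite ?S"
  proof (rule finite_imageD)
    have "(\<lambda>a. restrict (lookup a) (keys m)) ` ?S \<subseteq> (\<Pi>\<^sub>E i\<in>keys m. {..lookup m i})"
      by auto
    then show "finite ((\<lambda>a. restrict (lookup a) (keys m)) ` ?S)"
      by (rule finite_subset) (auto intro: finite_PiE)
    show "inj_on (\<lambda>a. restrict (lookup a) (keys m)) ?S"
    proof (rule inj_onI, rule poly_mapping_eqI)
      fix a b i
      assume ab: "a \<in> ?S" "b \<in> ?S"
        and eq: "restrict (lookup a) (keys m) = restrict (lookup b) (keys m)"
      show "lookup a i = lookup b i"
      proof (cases "i \<in> keys m")
        case True
        then show ?thesis using fun_cong[OF eq, of i] by simp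
      next
        case False
        then have "lookup m i = 0" by (simp add: in_keys_iff)
        then show ?thesis using ab by (metis (mono_tags, lifting) le_zero_eq mem_Collect_eq)
      qed
    qed
  qed
  then have "finite (?S \<times> ?S)" by simp
  moreover have "{(a, b). a + b = m} \<subseteq> ?S \<times> ?S"
    by (auto simp: lookup_add)
  ultimately show ?thesis by (rule finite_subset[rotated])
qed

instantiation mseries :: (comm_ring_1) comm_ring_1
begin

definition "0 = Series (\<lambda>_. 0)"
definition "1 = Series (\<lambda>m. if m = 0 then 1 else 0)"
definition "f + g = Series (\<lambda>m. scoeff f m + scoeff g m)"
definition "- f = Series (\<lambda>m. - scoeff f m)"
definition "f - g = Series (\<lambda>m. scoeff f m - scoeff g m)"
definition "f * g = Series (\<lambda>m. \<Sum>(a, b)\<in>{(a, b). a + b = m}. scoeff f a * scoeff g b)"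

instance
proof
  fix f g h :: "'a mseries"
  show "f + g + h = f + (g + h)" "f + g = g + f" "0 + f = f" "- f + f = 0" "f - g = f + - g"
    by (auto intro!: mseries_eqI simp: plus_mseries_def zero_mseries_def uminus_mseries_def
        minus_mseries_def)
  show "(0 :: 'a mseries) \<noteq> 1"
  proof
    assume "(0 :: 'a mseries) = 1"
    then have "scoeff (0 :: 'a mseries) 0 = scoeff 1 0" by simp
    then show False by (simp add: zero_mseries_def one_mseries_def)
  qed
  show "(f + g) * h = f * h + g * h"
    by (auto intro!: mseries_eqI simp: plus_mseries_def times_mseries_def
        sum.distrib[symmetric] distrib_right split_def)
  show "f * g = g * f"
  proof (rule mseries_eqI)
    fix m
    show "scoeff (f * g) m = scoeff (g * f) m"
      unfolding times_mseries_def scoeff_Series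
      by (rule sum.reindex_bij_witness[where i = prod.swap and j = prod.swap])
        (auto simp: add.commute mult.commute)
  qed
  show "1 * f = f"
  proof (rule mseries_eqI)
    fix m
    have "scoeff (1 * f) m =
        (\<Sum>(a, b)\<in>{(a, b). a + b = m}. (if a = 0 then 1 else 0) * scoeff f b)"
      by (simp add: times_mseries_def one_mseries_def)
    also have "\<dots> = (\<Sum>(a, b)\<in>{(0 :: nat \<Rightarrow>\<^sub>0 nat, m)}. (if a = 0 then 1 else 0) * scoeff f b)"
      by (rule sum.mono_neutral_right) (auto simp: finite_splits split: if_splits)
    finally show "scoeff (1 * f) m = scoeff f m" by simp
  qed
  show "f * g * h = f * (g * h)"
  proof (rule mseries_eqI)
    fix m
    have "scoeff (f * g * h) m =
        (\<Sum>(x, c)\<in>{(x, c). x + c = m}. \<Sum>(a, b)\<in>{(a, b). a + b = x}.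
          scoeff f a * scoeff g b * scoeff h c)"
      by (simp add: times_mseries_def sum_distrib_right split_def)
    also have "\<dots> = (\<Sum>(z, w)\<in>Sigma {(x, c). x + c = m} (\<lambda>(x, c). {(a, b). a + b = x}).
        scoeff f (fst w) * scoeff g (snd w) * scoeff h (snd z))"
      by (subst sum.Sigma[symmetric]) (auto simp: split_def finite_splits[unfolded split_def])
    also have "\<dots> = (\<Sum>(z, w)\<in>Sigma {(a, y). a + y = m} (\<lambda>(a, y). {(b, c). b + c = y}).
        scoeff f (fst z) * (scoeff g (fst w) * scoeff h (snd w)))"
      by (rule sum.reindex_bij_witness
          [where i = "\<lambda>((a, y), (b, c)). ((a + b, c), (a, b))"
             and j = "\<lambda>((x, c), (a, b)). ((a, b + c), (b, c))"])
        (auto simp: add.assoc mult.assoc)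
    also have "\<dots> = (\<Sum>(a, y)\<in>{(a, y). a + y = m}. \<Sum>(b, c)\<in>{(b, c). b + c = y}.
        scoeff f a * (scoeff g b * scoeff h c))"
      by (subst sum.Sigma[symmetric]) (auto simp: split_def finite_splits[unfolded split_def])
    also have "\<dots> = scoeff (f * (g * h)) m"
      by (simp add: times_mseries_def sum_distrib_left split_def)
    finally show "scoeff (f * g * h) m = scoeff (f * (g * h)) m" .
  qed
qed

end

definition tvar :: "nat \<Rightarrow> 'r::comm_ring_1 mseries" where
  "tvar i = Series (\<lambda>m. if m = Poly_Mapping.single i 1 then 1 else 0)"

definition sdegree :: "(nat \<Rightarrow>\<^sub>0 nat) \<Rightarrow> nat" where
  "sdegree m = (\<Sum>i\<in>keys m. lookup m i)"

text \<open>The exponent of \<open>t\<^sub>1\<^bsup>n\<^sub>1-1\<^esup> \<cdots> t\<^sub>d\<^bsup>n\<^sub>d-1\<^esup>\<close>.\<close>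

definition texp :: "nat list \<Rightarrow> (nat \<Rightarrow>\<^sub>0 nat)" where
  "texp ns = (\<Sum>i<length ns. Poly_Mapping.single (i + 1) (ns ! i - 1))"

text \<open>
  For linear forms \<open>L\<^sub>1, \<dots>, L\<^sub>d\<close> this is the sum of \<open>c (n\<^sub>1, \<dots>, n\<^sub>d) L\<^sub>1\<^bsup>n\<^sub>1-1\<^esup> \<cdots> L\<^sub>d\<^bsup>n\<^sub>d-1\<^esup>\<close> over all
  \<open>n\<^sub>1, \<dots>, n\<^sub>d \<ge> 1\<close>: the product is homogeneous of degree \<open>n\<^sub>1 + \<dots> + n\<^sub>d - d\<close>, so that only the
  finitely many terms kept here contribute to a given coefficient.
\<close>

definition gen_series :: "(nat list \<Rightarrow> 'r::comm_ring_1) \<Rightarrow> 'r mseries list \<Rightarrow> 'r mseries" where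
  "gen_series c L = Series (\<lambda>m.
     \<Sum>ns\<in>{ns. length ns = length L \<and> 0 \<notin> set ns \<and> sum_list ns = sdegree m + length L}.
       c ns * scoeff (\<Prod>i<length L. (L ! i) ^ (ns ! i - 1)) m)"

text \<open>\<open>exp (a t\<^sub>j)\<close>\<close>

definition exp_series ::
  "('m::cancel_comm_monoid_add \<Rightarrow>\<^sub>0 rat) \<Rightarrow> nat \<Rightarrow> ('m \<Rightarrow>\<^sub>0 rat) mseries" where
  "exp_series a j = Series (\<lambda>m. if keys m \<subseteq> {j}
     then pconst (1 / fact (lookup m j)) * a ^ lookup m j else 0)"

text \<open>The part of \<open>F / t\<^sub>j\<close> without negative powers of \<open>t\<^sub>j\<close>.\<close>

definition div_t :: "nat \<Rightarrow> 'r mseries \<Rightarrow> 'r mseries" where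
  "div_t j F = Series (\<lambda>m. scoeff F (m + Poly_Mapping.single j 1))"


section \<open>The algebra of symbols\<close>

text \<open>
  The arguments of a symbol are encoded by endpoints. With the convention that \<open>x\<^bsub>i\<rightarrow>j\<^esub>\<close> stands
  for \<open>x\<^bsub>j\<rightarrow>i\<^esub>\<^bsup>-1\<^esup>\<close> if \<open>i > j\<close>, \<open>Sym [p\<^sub>1, \<dots>, p\<^bsub>d+1\<^esub>] [n\<^sub>1, \<dots>, n\<^sub>d]\<close> is the symbol with arguments
  \<open>y\<^sub>r = x\<^bsub>p\<^sub>r\<rightarrow>p\<^bsub>r+1\<^esub>\<^esub>\<close> and indices \<open>n\<^sub>1, \<dots>, n\<^sub>d\<close>. It is a regular symbol if \<open>p\<close> is strictly increasing,
  an inverted symbol if \<open>p\<close> is strictly decreasing, and junk otherwise. In either case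
  \<open>y\<^bsub>i\<rightarrow>j\<^esub>\<close> has the endpoints \<open>p\<^sub>i\<close>, \<open>p\<^sub>j\<close>, and inverting and reversing a sequence of arguments
  reverses its list of endpoints. \<open>Log i\<close> is \<open>[x\<^sub>i]\<^sub>0\<close>.
\<close>

datatype symb = Log nat | Sym "nat list" "nat list"

fun sym_coeff :: "nat list \<Rightarrow> nat list \<Rightarrow> symb mpoly" where
  "sym_coeff p ns = (if ns = [] then 1 else pvar (Sym p ns))"

definition symb_gens :: "symb set" where
  "symb_gens = {Log i | i. i \<ge> 1} \<union>
     {Sym p ns | p ns. ns \<noteq> [] \<and> length p = length ns + 1 \<and> 0 \<notin> set p \<and> 0 \<notin> set ns \<and>
        sorted_wrt (<) p}"

definition symb_bar_gens :: "symb set" where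
  "symb_bar_gens = symb_gens \<union>
     {Sym p ns | p ns. ns \<noteq> [] \<and> length p = length ns + 1 \<and> 0 \<notin> set p \<and> 0 \<notin> set ns \<and>
        sorted_wrt (>) p}"

definition H_symb :: "(rat, symb mpoly) module" where
  "H_symb = free_alg symb_gens"

definition H_symb_bar :: "(rat, symb mpoly) module" where
  "H_symb_bar = free_alg symb_bar_gens"

text \<open>\<open>[x\<^bsub>a\<rightarrow>b\<^esub>]\<^sub>0\<close>\<close>

definition log_coeff :: "nat \<Rightarrow> nat \<Rightarrow> symb mpoly" where
  "log_coeff a b =
     (if a \<le> b then (\<Sum>r=a..<b. pvar (Log r)) else - (\<Sum>r=b..<a. pvar (Log r)))"


subsection \<open>The coproduct on symbols and inverted symbols\<close>

definition left_coeff :: "nat list \<Rightarrow> nat list \<Rightarrow> symb mpoly2" where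
  "left_coeff p ns = ptensor (sym_coeff p ns) 1"

definition right_coeff :: "nat list \<Rightarrow> nat list \<Rightarrow> symb mpoly2" where
  "right_coeff p ns = ptensor 1 (sym_coeff p ns)"

text \<open>
  The pairs \<open>([i\<^sub>1, \<dots>, i\<^bsub>k+1\<^esub>], [j\<^sub>1, \<dots>, j\<^sub>k])\<close>, \<open>k \<ge> 0\<close>, with
  \<open>1 \<le> i\<^sub>1 \<le> j\<^sub>1 < i\<^sub>2 \<le> \<dots> \<le> j\<^sub>k < i\<^bsub>k+1\<^esub> = d + 1\<close>.
\<close>

definition cut_points :: "nat \<Rightarrow> (nat list \<times> nat list) set" where
  "cut_points d = {(is, js). length is = length js + 1 \<and> 1 \<le> hd is \<and> last is = d + 1 \<and>
     (\<forall>a<length js. is ! a \<le> js ! a \<and> js ! a < is ! (a + 1))}"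

definition cop_series :: "nat list \<Rightarrow> symb mpoly2 mseries" where
  "cop_series p = (let d = length p - 1; P = (\<lambda>i. p ! (i - 1)) in
     \<Sum>(is, js)\<in>cut_points d.
       gen_series (left_coeff (map P is)) (map tvar js) *
       gen_series (right_coeff (map P [1..<hd is + 1])) (map tvar [1..<hd is]) *
       (\<Prod>a<length js. let i = is ! a; j = js ! a; i' = is ! (a + 1) in
          (-1) ^ (j - i) *
          exp_series (ptensor 1 (log_coeff (P i) (P i'))) j *
          gen_series (right_coeff (map P (rev [i..<j + 1]))) (map (\<lambda>r. tvar j - tvar r) (rev [i..<j])) *
          gen_series (right_coeff (map P [j + 1..<i' + 1])) (map (\<lambda>r. tvar r - tvar j) [j + 1..<i'])))"

fun cop_gen :: "symb \<Rightarrow> symb mpoly2" where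
  "cop_gen (Log i) = ptensor (pvar (Log i)) 1 + ptensor 1 (pvar (Log i))"
| "cop_gen (Sym p ns) = scoeff (cop_series p) (texp ns)"

definition cop_bar :: "symb mpoly \<Rightarrow> symb mpoly2" where
  "cop_bar = phom cop_gen"


subsection \<open>Inversion\<close>

text \<open>
  For \<open>p = [p\<^sub>1, \<dots>, p\<^bsub>d+1\<^esub>]\<close> strictly increasing, \<open>inv_coeff p [n\<^sub>d, \<dots>, n\<^sub>1]\<close> is the image under the
  inversion of the inverted symbol \<open>[y\<^sub>d\<^bsup>-1\<^esup>, \<dots>, y\<^sub>1\<^bsup>-1\<^esup>]\<close> with indices \<open>n\<^sub>d, \<dots>, n\<^sub>1\<close>, where
  \<open>y\<^sub>r = x\<^bsub>p\<^sub>r\<rightarrow>p\<^bsub>r+1\<^esub>\<^esub>\<close>. The defining recursion determines the series in \<open>-t\<^sub>d, \<dots>, -t\<^sub>1\<close>, whence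
  the sign in front. The summands with the same \<open>j\<close> in its second and third sum add up to
  \<open>F / t\<^sub>j\<close> with \<open>F\<close> vanishing at \<open>t\<^sub>j = 0\<close>, so their polar parts, which \<open>div_t\<close> discards, cancel.
\<close>

function inv_coeff :: "nat list \<Rightarrow> nat list \<Rightarrow> symb mpoly" where
  "inv_coeff p = (let d = length p - 1 in
     if d = 0 then (\<lambda>_. 1) else (\<lambda>ns. (-1) ^ (\<Sum>n\<leftarrow>ns. n - 1) * scoeff
       ((\<Sum>j\<in>{0..<d}. (-1) ^ (d - 1 + j) *
           gen_series (inv_coeff (take (j + 1) p)) (map (\<lambda>r. - tvar r) (rev [1..<j + 1])) *
           gen_series (sym_coeff (drop j p)) (map tvar [j + 1..<d + 1])) +
        (\<Sum>j\<in>{1..d}. div_t j ((-1) ^ (d - 1 + j) *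
           gen_series (inv_coeff (take j p)) (map (\<lambda>r. - tvar r) (rev [1..<j])) *
           gen_series (sym_coeff (drop j p)) (map tvar [j + 1..<d + 1]))) +
        (\<Sum>j\<in>{1..d}. div_t j ((-1) ^ (d + j) *
           gen_series (inv_coeff (take j p)) (map (\<lambda>r. tvar j - tvar r) (rev [1..<j])) *
           exp_series (log_coeff (hd p) (last p)) j *
           gen_series (sym_coeff (drop j p)) (map (\<lambda>r. tvar r - tvar j) [j + 1..<d + 1]))))
       (texp (rev ns))))"
  by pat_completeness auto
termination by (relation "measure length") auto

declare inv_coeff.simps [simp del]

fun inversion_gen :: "symb \<Rightarrow> symb mpoly" where
  "inversion_gen (Log i) = pvar (Log i)"
| "inversion_gen (Sym p ns) =
     (if sorted_wrt (>) p then inv_coeff (rev p) ns else pvar (Sym p ns))"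

definition inversion :: "symb mpoly \<Rightarrow> symb mpoly" where
  "inversion = phom inversion_gen"

text \<open>The coproduct on \<^const>\<open>H_symb\<close>.\<close>

definition cop :: "symb mpoly \<Rightarrow> symb mpoly2" where
  "cop p = ptensor_map inversion inversion (cop_bar p)"


section \<open>Contraction systems\<close>

definition index_seq :: "nat \<Rightarrow> nat list \<Rightarrow> bool" where
  "index_seq n is \<longleftrightarrow> length is \<ge> 2 \<and> sorted_wrt (<) is \<and> set is \<subseteq> {1..n + 1}"

definition restrict_seq :: "nat list \<Rightarrow> nat list \<Rightarrow> nat list" where
  "restrict_seq is js = map (\<lambda>j. is ! (j - 1)) js"

text \<open>
  \<open>con n is\<close> is the map \<open>X n \<rightarrow> X d\<close> attached to \<open>is = [i\<^sub>1, \<dots>, i\<^bsub>d+1\<^esub>]\<close>. The value \<open>X 0\<close> is irrelevant.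
  The last condition does not follow from the other ones, which only make \<open>con n [1, \<dots>, n + 1]\<close>
  idempotent; without it \<open>con n [1, \<dots>, n + 1] \<alpha>\<close> would take the place of \<open>\<alpha>\<close> in the coproduct of
  \<open>[\<alpha>]\<close>, and there would be no counit.
\<close>

locale contraction_system =
  fixes X :: "nat \<Rightarrow> 'a set" and con :: "nat \<Rightarrow> nat list \<Rightarrow> 'a \<Rightarrow> 'a"
  assumes con_closed: "n \<ge> 1 \<Longrightarrow> index_seq n is \<Longrightarrow> \<alpha> \<in> X n \<Longrightarrow> con n is \<alpha> \<in> X (length is - 1)"
    and con_comp: "n \<ge> 1 \<Longrightarrow> index_seq n is \<Longrightarrow> index_seq (length is - 1) js \<Longrightarrow> \<alpha> \<in> X n \<Longrightarrow>
      con (length is - 1) js (con n is \<alpha>) = con n (restrict_seq is js) \<alpha>"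
    and con_id: "n \<ge> 1 \<Longrightarrow> \<alpha> \<in> X n \<Longrightarrow> con n [1..<n + 2] \<alpha> = \<alpha>"

text \<open>\<open>CLog \<alpha>\<close> and \<open>CSym \<alpha> [n\<^sub>1, \<dots>, n\<^sub>d]\<close> stand for \<open>[\<alpha>]\<^sub>0\<close> and \<open>[\<alpha>]\<close> with indices \<open>n\<^sub>1, \<dots>, n\<^sub>d\<close>.\<close>

datatype 'a cgen = CLog 'a | CSym 'a "nat list"

definition con_gens :: "(nat \<Rightarrow> 'a set) \<Rightarrow> 'a cgen set" where
  "con_gens X = {CLog \<alpha> | \<alpha>. \<alpha> \<in> X 1} \<union>
     {CSym \<alpha> ns | \<alpha> ns. ns \<noteq> [] \<and> 0 \<notin> set ns \<and> \<alpha> \<in> X (length ns)}"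

definition con_relations ::
  "(nat \<Rightarrow> 'a set) \<Rightarrow> (nat \<Rightarrow> nat list \<Rightarrow> 'a \<Rightarrow> 'a) \<Rightarrow> 'a cgen mpoly set" where
  "con_relations X con =
     {pvar (CLog (con n [i1, i2] \<alpha>)) + pvar (CLog (con n [i2, i3] \<alpha>)) - pvar (CLog (con n [i1, i3] \<alpha>))
       | n \<alpha> i1 i2 i3. n \<ge> 1 \<and> \<alpha> \<in> X n \<and> 1 \<le> i1 \<and> i1 < i2 \<and> i2 < i3 \<and> i3 \<le> n + 1}"

definition con_ideal ::
  "(nat \<Rightarrow> 'a set) \<Rightarrow> (nat \<Rightarrow> nat list \<Rightarrow> 'a \<Rightarrow> 'a) \<Rightarrow> 'a cgen mpoly set" where
  "con_ideal X con = Idl\<^bsub>free_alg (con_gens X)\<^esub> (con_relations X con)"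

definition con_alg ::
  "(nat \<Rightarrow> 'a set) \<Rightarrow> (nat \<Rightarrow> nat list \<Rightarrow> 'a \<Rightarrow> 'a) \<Rightarrow> (rat, 'a cgen mpoly set) module" where
  "con_alg X con = alg_quot (free_alg (con_gens X)) (con_ideal X con)"

definition con_class ::
  "(nat \<Rightarrow> 'a set) \<Rightarrow> (nat \<Rightarrow> nat list \<Rightarrow> 'a \<Rightarrow> 'a) \<Rightarrow> 'a cgen mpoly \<Rightarrow> 'a cgen mpoly set" where
  "con_class X con p = con_ideal X con +>\<^bsub>free_alg (con_gens X)\<^esub> p"

fun cgen_weight :: "'a cgen \<Rightarrow> nat" where
  "cgen_weight (CLog \<alpha>) = 1"
| "cgen_weight (CSym \<alpha> ns) = sum_list ns"

definition con_degree ::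
  "(nat \<Rightarrow> 'a set) \<Rightarrow> (nat \<Rightarrow> nat list \<Rightarrow> 'a \<Rightarrow> 'a) \<Rightarrow> nat \<Rightarrow> 'a cgen mpoly set set" where
  "con_degree X con n = {con_class X con p | p. p \<in> carrier (free_alg (con_gens X)) \<and>
     (\<forall>m\<in>keys p. (\<Sum>g\<in>keys m. lookup m g * cgen_weight g) = n)}"

definition con_log ::
  "(nat \<Rightarrow> 'a set) \<Rightarrow> (nat \<Rightarrow> nat list \<Rightarrow> 'a \<Rightarrow> 'a) \<Rightarrow> 'a \<Rightarrow> 'a cgen mpoly set" where
  "con_log X con \<alpha> = con_class X con (pvar (CLog \<alpha>))"

definition con_sym ::
  "(nat \<Rightarrow> 'a set) \<Rightarrow> (nat \<Rightarrow> nat list \<Rightarrow> 'a \<Rightarrow> 'a) \<Rightarrow> 'a \<Rightarrow> nat list \<Rightarrow> 'a cgen mpoly set" where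
  "con_sym X con \<alpha> ns = con_class X con (pvar (CSym \<alpha> ns))"

text \<open>The evaluation at \<open>\<alpha> \<in> X n\<close>, relevant on regular symbols in \<open>x\<^sub>1, \<dots>, x\<^sub>n\<close> only.\<close>

fun ev_gen :: "(nat \<Rightarrow> 'a set) \<Rightarrow> (nat \<Rightarrow> nat list \<Rightarrow> 'a \<Rightarrow> 'a) \<Rightarrow> nat \<Rightarrow> 'a \<Rightarrow> symb \<Rightarrow> 'a cgen mpoly set" where
  "ev_gen X con n \<alpha> (Log i) = con_log X con (con n [i, i + 1] \<alpha>)"
| "ev_gen X con n \<alpha> (Sym p ns) = con_sym X con (con n p \<alpha>) ns"

definition ev ::
  "(nat \<Rightarrow> 'a set) \<Rightarrow> (nat \<Rightarrow> nat list \<Rightarrow> 'a \<Rightarrow> 'a) \<Rightarrow> nat \<Rightarrow> 'a \<Rightarrow> symb mpoly \<Rightarrow> 'a cgen mpoly set" where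
  "ev X con n \<alpha> = alg_eval (con_alg X con) (ev_gen X con n \<alpha>)"

text \<open>
  The algebra homomorphisms with the prescribed values on generators;
  \<open>[1..<d + 2]\<close> are the endpoints of \<open>x\<^sub>1, \<dots>, x\<^sub>d\<close>.
\<close>

definition induced_coproduct ::
  "(nat \<Rightarrow> 'a set) \<Rightarrow> (nat \<Rightarrow> nat list \<Rightarrow> 'a \<Rightarrow> 'a) \<Rightarrow>
    ('a cgen mpoly set \<Rightarrow> ('a cgen mpoly set \<times> 'a cgen mpoly set \<Rightarrow>\<^sub>0 rat) set) \<Rightarrow> bool" where
  "induced_coproduct X con \<Delta> \<longleftrightarrow> (let H = con_alg X con in
     \<Delta> \<in> alg_hom H (tensor H H) \<and>
     (\<forall>\<alpha>\<in>X 1. \<Delta> (con_log X con \<alpha>) =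
        pure_tensor H H \<one>\<^bsub>H\<^esub> (con_log X con \<alpha>) \<oplus>\<^bsub>tensor H H\<^esub> pure_tensor H H (con_log X con \<alpha>) \<one>\<^bsub>H\<^esub>) \<and>
     (\<forall>d \<alpha> ns. d \<ge> 1 \<and> \<alpha> \<in> X d \<and> length ns = d \<and> 0 \<notin> set ns \<longrightarrow>
        \<Delta> (con_sym X con \<alpha> ns) =
          alg_eval_tensor H (ev X con d \<alpha>) (cop (pvar (Sym [1..<d + 2] ns)))))"

end

theory Submission
  imports Defs "HOL-Computational_Algebra.Formal_Power_Series" "HOL-Library.Sublist" "HOL-Computational_Algebra.Polynomial"
begin

text \<open>
  Specialising the series variables to rational multiples \<open>t\<^sub>i = \<tau>\<^sub>i z\<close> of one variable turns a
  homomorphism \<open>f\<close> from the algebra of symbols into moulds, that is, functions on words: \<open>A\<close> from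
  the regular symbols, \<open>R\<close> from the inverted ones. The inversion formula reads
  \<open>R (1 - Q) A = T (1 - Q)\<close>, where \<open>Q\<close> is the one-letter mould \<open>1 / t\<close> and \<open>T\<close> is the
  substitution that cuts words into blocks and contracts each block to one letter, with weights made
  of \<open>R\<close>, \<open>exp\<close> and \<open>A\<close>. In these terms the convolution of \<open>f\<close> and \<open>g\<close> has the regular mould
  \<open>A\<^sub>g (T\<^sub>g A\<^sub>f)\<close>, and the inversion formula forces \<open>T\<close> of the convolution to be \<open>T\<^sub>g T\<^sub>f\<close>, whence
  coassociativity. Relabelling the variables commutes with all of this, so the identities pass to the
  contraction algebra along the evaluations, whose images generate it. The antipode exists because
  the coproduct is connected graded.
\<close>

section \<open>Sums over factorisations of words\<close>

text \<open>The inverted symbols are the obstacle: the coproduct of a regular symbol involves their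
  images under the inversion, which are known only through a recursion. The way out is that the
  inversion formula has exactly one solution \<open>R\<close> for given \<open>A\<close>. A
  candidate for the mould \<open>R\<close> of a convolution, of a relabelling or of the augmentation
  only has to be checked against that formula. One variable z suffices: t_i = \<tau>_i z turns 1 /
  t_i into (1 / \<tau>_i) / z, one multiplication by z clears all denominators, and nothing is lost,
  since a rational polynomial vanishing at all points with distinct nonzero coordinates is zero.
  Distinctness is forced by contraction, which replaces the other t_i of a block by t_i - t_j.
  Identities between maps into tensor powers are stated for arbitrary homomorphisms f, g, k into one
  commutative algebra; the inclusions of the tensor factors are the special case that is used. The
  antipode is built on symbols, where the recursion on weights runs over free generators, and
  transported by evaluation.\<close>

fun split_sum :: "('l list \<Rightarrow> 'l list \<Rightarrow> 'k::comm_ring_1) \<Rightarrow> 'l list \<Rightarrow> 'k" where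
  "split_sum F [] = F [] []"
| "split_sum F (x # w) = F [] (x # w) + split_sum (\<lambda>u v. F (x # u) v) w"

fun mark_sum :: "('l list \<Rightarrow> 'l \<Rightarrow> 'l list \<Rightarrow> 'k::comm_ring_1) \<Rightarrow> 'l list \<Rightarrow> 'k" where
  "mark_sum F [] = 0"
| "mark_sum F (x # w) = F [] x w + mark_sum (\<lambda>u y v. F (x # u) y v) w"

text \<open>The factorisation is kept as an assumption for the function package: it bounds the
  lengths in the recursive calls of \<open>block_sum\<close>.\<close>

lemma split_sum_cong [fundef_cong]:
  assumes "w = w'" and "\<And>u v. u @ v = w' \<Longrightarrow> F u v = G u v"
  shows "split_sum F w = split_sum G w'"
proof -
  have "(\<forall>u v. u @ v = w \<longrightarrow> F u v = G u v) \<Longrightarrow> split_sum F w = split_sum G w"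
  proof (induction w arbitrary: F G)
    case (Cons x w)
    have "split_sum (\<lambda>u v. F (x # u) v) w = split_sum (\<lambda>u v. G (x # u) v) w"
      by (rule Cons.IH) (use Cons.prems in auto)
    then show ?case using Cons.prems by simp
  qed simp
  then show ?thesis using assms by blast
qed

lemma mark_sum_cong [fundef_cong]:
  assumes "w = w'" and "\<And>u x v. u @ x # v = w' \<Longrightarrow> F u x v = G u x v"
  shows "mark_sum F w = mark_sum G w'"
proof -
  have "(\<forall>u x v. u @ x # v = w \<longrightarrow> F u x v = G u x v) \<Longrightarrow> mark_sum F w = mark_sum G w"
  proof (induction w arbitrary: F G)
    case (Cons x w)
    have "mark_sum (\<lambda>u y v. F (x # u) y v) w = mark_sum (\<lambda>u y v. G (x # u) y v) w"
      by (rule Cons.IH) (use Cons.prems in auto)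
    then show ?case using Cons.prems by simp
  qed simp
  then show ?thesis using assms by blast
qed

lemma split_sum_add: "split_sum (\<lambda>u v. F u v + G u v) w = split_sum F w + split_sum G w"
  by (induction w arbitrary: F G) (auto simp: algebra_simps)

lemma mark_sum_add: "mark_sum (\<lambda>u x v. F u x v + G u x v) w = mark_sum F w + mark_sum G w"
  by (induction w arbitrary: F G) (auto simp: algebra_simps)

lemma split_sum_mult_left: "split_sum (\<lambda>u v. c * F u v) w = c * split_sum F w"
  by (induction w arbitrary: F) (auto simp: algebra_simps)

lemma split_sum_mult_right: "split_sum (\<lambda>u v. F u v * c) w = split_sum F w * c"
  by (induction w arbitrary: F) (auto simp: algebra_simps)

lemma mark_sum_mult_left: "mark_sum (\<lambda>u x v. c * F u x v) w = c * mark_sum F w"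
  by (induction w arbitrary: F) (auto simp: algebra_simps)

text \<open>Unapplied forms: inside an outer sum the last argument of an inner sum is eta-contracted
  away, and the applied rules do not match.\<close>

lemmas sum_fun_distribs =
  ext[of "split_sum (\<lambda>u v. F u v + G u v)" "\<lambda>w. split_sum F w + split_sum G w" for F G, OF split_sum_add]
  ext[of "mark_sum (\<lambda>u x v. F u x v + G u x v)" "\<lambda>w. mark_sum F w + mark_sum G w" for F G, OF mark_sum_add]

lemma split_sum_zero [simp]: "split_sum (\<lambda>u v. 0) w = 0"
  by (induction w) auto

lemma mark_sum_zero [simp]: "mark_sum (\<lambda>u x v. 0) w = 0"
  by (induction w) auto

lemma split_sum_Nil_left: "split_sum (\<lambda>u v. if u = [] then f v else 0) w = f w"
  by (cases w) auto

text \<open>Both sides run over the factorisations of \<open>w\<close> into three words.\<close>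

lemma split_sum_assoc:
  "split_sum (\<lambda>u v. split_sum (\<lambda>u1 u2. g u1 u2 v) u) w =
   split_sum (\<lambda>u1 v'. split_sum (\<lambda>u2 v. g u1 u2 v) v') w"
proof (induction w arbitrary: g)
  case (Cons x w)
  then show ?case by (simp add: split_sum_add add.assoc)
qed simp

lemma split_mark_sum_assoc:
  "split_sum (\<lambda>u v. mark_sum (\<lambda>u1 x v0. k u1 x v0 v) u) w =
   mark_sum (\<lambda>u1 x v'. split_sum (\<lambda>v0 v. k u1 x v0 v) v') w"
proof (induction w arbitrary: k)
  case (Cons x w)
  then show ?case by (simp add: split_sum_add)
qed simp

text \<open>Both sides run over the factorisations \<open>u @ u1 @ x # v\<close> of
  \<open>w\<close>; only the order of the cuts differs.\<close>

lemma split_sum_mark_sum: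
  "split_sum (\<lambda>u w2. mark_sum (\<lambda>u1 x v. k u u1 x v) w2) w =
   mark_sum (\<lambda>uu x v. split_sum (\<lambda>u u1. k u u1 x v) uu) w"
proof (induction w arbitrary: k)
  case (Cons x w)
  then show ?case by (simp add: mark_sum_add add.assoc)
qed simp

text \<open>Marking a letter is cutting before a nonempty right part, so facts about split sums
  carry over to marked sums.\<close>

lemma mark_sum_eq_split_sum:
  "mark_sum G w = split_sum (\<lambda>u v. case v of [] \<Rightarrow> 0 | x # v' \<Rightarrow> G u x v') w"
  by (induction w arbitrary: G) auto

lemma split_sum_map:
  "split_sum F (map f w) = split_sum (\<lambda>u v. F (map f u) (map f v)) w"
  by (induction w arbitrary: F) auto

lemma mark_sum_map:
  "mark_sum F (map f w) = mark_sum (\<lambda>u x v. F (map f u) (f x) (map f v)) w"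
  by (induction w arbitrary: F) auto

text \<open>Isolates the term with empty right part, the one that carries the unknown value when the
  inversion equation is solved.\<close>

lemma split_sum_last_cong:
  "(\<And>u v. u @ v = w \<Longrightarrow> v \<noteq> [] \<Longrightarrow> F u v = G u v) \<Longrightarrow>
    split_sum F w - F w [] = split_sum G w - G w []"
proof (induction w arbitrary: F G)
  case (Cons x w)
  have "split_sum (\<lambda>u v. F (x # u) v) w - F (x # w) [] =
      split_sum (\<lambda>u v. G (x # u) v) w - G (x # w) []"
    by (rule Cons.IH[of "\<lambda>u v. F (x # u) v" "\<lambda>u v. G (x # u) v"]) (use Cons.prems in auto)
  moreover have "F [] (x # w) = G [] (x # w)" by (rule Cons.prems) auto
  ultimately show ?case by simp
qed simp

lemma split_sum_index:
  "split_sum F w = (\<Sum>i\<le>length w. F (take i w) (drop i w))"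
  by (induction w arbitrary: F) (auto simp: sum.atMost_Suc_shift simp del: sum.atMost_Suc)

lemma mark_sum_index:
  "mark_sum F w = (\<Sum>i<length w. F (take i w) (w ! i) (drop (Suc i) w))"
  by (induction w arbitrary: F) (auto simp: sum.lessThan_Suc_shift simp del: sum.lessThan_Suc)

section \<open>Moulds\<close>

text \<open>
  A word with starting point \<open>a\<close> is a list of letters \<open>(b\<^sub>1, \<tau>\<^sub>1), \<dots>, (b\<^sub>d, \<tau>\<^sub>d)\<close>; it stands for the
  arguments \<open>x\<^bsub>a\<rightarrow>b\<^sub>1\<^esub>, x\<^bsub>b\<^sub>1\<rightarrow>b\<^sub>2\<^esub>, \<dots>\<close> with the series variables specialised to rational multiples
  \<open>t\<^sub>i = \<tau>\<^sub>i z\<close> of a single variable.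
\<close>

type_synonym word = "(nat \<times> rat) list"
type_synonym 'k mould = "nat \<Rightarrow> word \<Rightarrow> 'k"

definition endp :: "nat \<Rightarrow> word \<Rightarrow> nat" where
  "endp a w = (if w = [] then a else fst (last w))"

text \<open>The substitution of t_i - c for t_i, which the coproduct applies to the letters around a
  marked one.\<close>

definition shift :: "rat \<Rightarrow> word \<Rightarrow> word" where
  "shift c = map (\<lambda>(b, t). (b, t - c))"

lemma endp_Nil [simp]: "endp a [] = a"
  by (simp add: endp_def)

lemma endp_Cons [simp]: "endp a (x # w) = endp (fst x) w"
  by (simp add: endp_def)

lemma endp_append [simp]: "endp a (u @ v) = endp (endp a u) v"
  by (simp add: endp_def)

lemma endp_shift [simp]: "endp a (shift c w) = endp a w"
  by (induction w arbitrary: a) (auto simp: shift_def)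

lemma shift_simps [simp]: "shift c [] = []" "shift c (x # w) = (fst x, snd x - c) # shift c w"
  "shift c (u @ v) = shift c u @ shift c v" "length (shift c w) = length w"
  "map fst (shift c w) = map fst w" "map snd (shift c w) = map (\<lambda>t. t - c) (map snd w)"
  by (auto simp: shift_def split_def)

text \<open>The usual product of moulds, adapted to words that carry a starting point.\<close>

definition mm :: "'k::comm_ring_1 mould \<Rightarrow> 'k mould \<Rightarrow> 'k mould" where
  "mm U V a w = split_sum (\<lambda>u v. U a u * V (endp a u) v) w"

lemma mm_assoc: "mm (mm U V) W a w = mm U (mm V W) a w"
proof -
  have "mm (mm U V) W a w =
      split_sum (\<lambda>u v. split_sum (\<lambda>u1 u2. U a u1 * V (endp a u1) u2 * W (endp (endp a u1) u2) v) u) w"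
    unfolding mm_def
    by (rule split_sum_cong[OF refl], subst split_sum_mult_right[symmetric],
        rule split_sum_cong[OF refl]) auto
  then show ?thesis
    by (simp add: split_sum_assoc mm_def mult.assoc split_sum_mult_left)
qed

text \<open>
  \<open>block_sum B F\<close> sums over all ways to cut a word into nonempty blocks \<open>u x v\<close> with a marked letter
  \<open>x\<close>; a block is contracted to a single letter with the \<open>\<tau>\<close> of \<open>x\<close>, and \<open>F\<close> is applied to the
  contracted word.
\<close>

type_synonym 'k blockfun = "nat \<Rightarrow> word \<Rightarrow> nat \<times> rat \<Rightarrow> word \<Rightarrow> 'k"

function block_sum :: "'k::comm_ring_1 blockfun \<Rightarrow> (word \<Rightarrow> 'k) \<Rightarrow> nat \<Rightarrow> word \<Rightarrow> 'k" where
  "block_sum B F a w = (if w = [] then F [] else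
     mark_sum (\<lambda>u x v0. split_sum (\<lambda>v r. B a u x v *
       block_sum B (\<lambda>w'. F ((endp (fst x) v, snd x) # w')) (endp (fst x) v) r) v0) w)"
  by pat_completeness auto
termination by (relation "measure (\<lambda>(B, F, a, w). length w)") auto

declare block_sum.simps [simp del]

text \<open>The marked sum vanishes on the empty word, so the case distinction of the recursion
  becomes an addition, to which linearity applies.\<close>

lemma block_sum_unfold:
  "block_sum B F a w = (if w = [] then F [] else 0) +
     mark_sum (\<lambda>u x v0. split_sum (\<lambda>v r. B a u x v *
       block_sum B (\<lambda>w'. F ((endp (fst x) v, snd x) # w')) (endp (fst x) v) r) v0) w"
  by (subst block_sum.simps) auto

lemma block_sum_Nil [simp]: "block_sum B F a [] = F []"
  by (simp add: block_sum.simps)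

text \<open>A contracted letter takes its end point from the last letter of the block and its \<tau>
  from the marked one. In general the contracted word is therefore no subsequence of
  \<open>w\<close>, but its end points and its \<tau>'s, taken separately, are; the predicate
  \<open>good\<close> looks at nothing else.\<close>

lemma block_sum_cong:
  assumes "\<And>w'. endp a w' = endp a w \<Longrightarrow> subseq (map fst w') (map fst w) \<Longrightarrow>
      subseq (map snd w') (map snd w) \<Longrightarrow> F w' = G w'"
    and "\<And>a' u x v w1 w2. w = w1 @ u @ x # v @ w2 \<Longrightarrow> a' = endp a w1 \<Longrightarrow> B a' u x v = C a' u x v"
  shows "block_sum B F a w = block_sum C G a w"
  using assms
proof (induction "length w" arbitrary: F G a w rule: less_induct)
  case less
  show ?case
  proof (subst (1 2) block_sum_unfold, rule arg_cong2[where f = "(+)"])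
    show "(if w = [] then F [] else 0) = (if w = [] then G [] else 0)"
      using less.prems(1)[of "[]"] by auto
    show "mark_sum (\<lambda>u x v0. split_sum (\<lambda>v r. B a u x v *
       block_sum B (\<lambda>w'. F ((endp (fst x) v, snd x) # w')) (endp (fst x) v) r) v0) w =
      mark_sum (\<lambda>u x v0. split_sum (\<lambda>v r. C a u x v *
       block_sum C (\<lambda>w'. G ((endp (fst x) v, snd x) # w')) (endp (fst x) v) r) v0) w"
    proof (intro mark_sum_cong split_sum_cong refl arg_cong2[where f = "(*)"])
      fix u x v0 v r
      assume "u @ x # v0 = w" and "v @ r = v0"
      then have w: "w = u @ x # v @ r" by simp
      show "B a u x v = C a u x v" using less.prems(2)[of "[]" u x v r] w by simp
      show "block_sum B (\<lambda>w'. F ((endp (fst x) v, snd x) # w')) (endp (fst x) v) r =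
        block_sum C (\<lambda>w'. G ((endp (fst x) v, snd x) # w')) (endp (fst x) v) r"
      proof (rule less.hyps)
        show "length r < length w" using w by simp
        show "F ((endp (fst x) v, snd x) # w') = G ((endp (fst x) v, snd x) # w')"
          if "endp (endp (fst x) v) w' = endp (endp (fst x) v) r"
            "subseq (map fst w') (map fst r)" "subseq (map snd w') (map snd r)" for w'
        proof (rule less.prems(1))
          show "endp a ((endp (fst x) v, snd x) # w') = endp a w"
            using that w by simp
          have "subseq [endp (fst x) v] (map fst (u @ x # v))"
            by (auto simp: endp_def subseq_singleton_left)
          then have "subseq ([endp (fst x) v] @ map fst w') (map fst (u @ x # v) @ map fst r)"
            by (rule list_emb_append_mono) (use that in auto)
          then show "subseq (map fst ((endp (fst x) v, snd x) # w')) (map fst w)"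
            using w by simp
          have "subseq [snd x] (map snd (u @ x # v))"
            by (auto simp: subseq_singleton_left)
          then have "subseq ([snd x] @ map snd w') (map snd (u @ x # v) @ map snd r)"
            by (rule list_emb_append_mono) (use that in auto)
          then show "subseq (map snd ((endp (fst x) v, snd x) # w')) (map snd w)"
            using w by simp
        qed
        show "B a' u' x' v' = C a' u' x' v'"
          if "r = w1 @ u' @ x' # v' @ w2" "a' = endp (endp (fst x) v) w1" for a' u' x' v' w1 w2
          by (rule less.prems(2)[of "u @ x # v @ w1" _ _ _ w2]) (use that w in auto)
      qed
    qed
  qed
qed

lemma block_sum_add: "block_sum B (\<lambda>w'. F w' + G w') a w = block_sum B F a w + block_sum B G a w"
proof (induction "length w" arbitrary: F G a w rule: less_induct)
  case less
  have "mark_sum (\<lambda>u x v0. split_sum (\<lambda>v r. B a u x v *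
       block_sum B (\<lambda>w'. F ((endp (fst x) v, snd x) # w') + G ((endp (fst x) v, snd x) # w'))
         (endp (fst x) v) r) v0) w =
     mark_sum (\<lambda>u x v0. split_sum (\<lambda>v r. B a u x v *
       (block_sum B (\<lambda>w'. F ((endp (fst x) v, snd x) # w')) (endp (fst x) v) r +
        block_sum B (\<lambda>w'. G ((endp (fst x) v, snd x) # w')) (endp (fst x) v) r)) v0) w"
    by (intro mark_sum_cong split_sum_cong refl arg_cong2[where f = "(*)"] less) auto
  then show ?case
    by (subst (1 2 3) block_sum_unfold) (simp add: distrib_left split_sum_add mark_sum_add)
qed

lemma block_sum_mult_left: "block_sum B (\<lambda>w'. c * F w') a w = c * block_sum B F a w"
proof (induction "length w" arbitrary: F a w rule: less_induct)
  case less
  have "mark_sum (\<lambda>u x v0. split_sum (\<lambda>v r. B a u x v *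
       block_sum B (\<lambda>w'. c * F ((endp (fst x) v, snd x) # w')) (endp (fst x) v) r) v0) w =
     mark_sum (\<lambda>u x v0. split_sum (\<lambda>v r. c * (B a u x v *
       block_sum B (\<lambda>w'. F ((endp (fst x) v, snd x) # w')) (endp (fst x) v) r)) v0) w"
    by (intro mark_sum_cong split_sum_cong refl) (subst less, auto simp: algebra_simps)
  then show ?case
    by (subst (1 2) block_sum_unfold) (simp add: split_sum_mult_left mark_sum_mult_left algebra_simps)
qed

lemma block_sum_mult_right: "block_sum B (\<lambda>w'. F w' * c) a w = block_sum B F a w * c"
  using block_sum_mult_left[of B c F a w] by (simp add: mult.commute)

lemma block_sum_zero [simp]: "block_sum B (\<lambda>w'. 0) a w = 0"
  using block_sum_mult_left[of B 0 "\<lambda>_. 0" a w] by simp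

text \<open>Linearity, for a sum over a second word that takes no part in the contraction.\<close>

lemma block_sum_split_sum:
  "block_sum B (\<lambda>u'. split_sum (k u') w2) a w = split_sum (\<lambda>u v. block_sum B (\<lambda>u'. k u' u v) a w) w2"
  by (induction w2 arbitrary: k) (auto simp: block_sum_add)

lemma block_sum_mark_sum:
  "block_sum B (\<lambda>u'. mark_sum (k u') w2) a w = mark_sum (\<lambda>u x v. block_sum B (\<lambda>u'. k u' u x v) a w) w2"
  by (induction w2 arbitrary: k) (auto simp: block_sum_add)

text \<open>A cut of the contracted word falls between two blocks, hence comes from a cut of
  \<open>w\<close> whose two parts are contracted independently.\<close>

lemma block_sum_of_split_sum:
  "block_sum B (split_sum g) a w =
   split_sum (\<lambda>u v. block_sum B (\<lambda>u'. block_sum B (g u') (endp a u) v) a u) w"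
proof (induction "length w" arbitrary: g a w rule: less_induct)
  case less
  define h where "h = (\<lambda>u x v r1 r2. B a u x v * block_sum B (\<lambda>u'. block_sum B
     (g ((endp (fst x) v, snd x) # u')) (endp (endp (fst x) v) r1) r2) (endp (fst x) v) r1)"
  have eq: "mark_sum (\<lambda>u x v0. split_sum (\<lambda>v r. B a u x v *
       block_sum B (\<lambda>w'. split_sum (\<lambda>u'. g ((endp (fst x) v, snd x) # u')) w') (endp (fst x) v) r) v0) w
     = mark_sum (\<lambda>u x v0. split_sum (\<lambda>v r. split_sum (h u x v) r) v0) w"
    unfolding h_def split_sum_mult_left
    by (intro mark_sum_cong split_sum_cong refl arg_cong2[where f = "(*)"] less) auto
  have "block_sum B (split_sum g) a w = (if w = [] then g [] [] else 0) +
     mark_sum (\<lambda>u x v0. split_sum (\<lambda>v r. B a u x v *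
       (block_sum B (\<lambda>w'. g [] ((endp (fst x) v, snd x) # w')) (endp (fst x) v) r +
       block_sum B (\<lambda>w'. split_sum (\<lambda>u'. g ((endp (fst x) v, snd x) # u')) w') (endp (fst x) v) r)) v0) w"
    by (subst block_sum_unfold) (simp add: block_sum_add)
  also have "\<dots> = block_sum B (g []) a w + mark_sum (\<lambda>u x v0. split_sum (\<lambda>v r. split_sum (h u x v) r) v0) w"
    by (subst block_sum_unfold[of B "g []" a w]) (use eq in \<open>simp add: distrib_left sum_fun_distribs add.assoc\<close>)
  also have "mark_sum (\<lambda>u x v0. split_sum (\<lambda>v r. split_sum (h u x v) r) v0) w =
      split_sum (\<lambda>uu r2. mark_sum (\<lambda>u x v0. split_sum (\<lambda>v r1. h u x v r1 r2) v0) uu) w"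
    by (simp add: split_mark_sum_assoc split_sum_assoc)
  \<comment> \<open>The cut before the first block, written as a split sum so that it can be joined
    to the later cuts.\<close>
  also have "block_sum B (g []) a w = split_sum (\<lambda>u v. if u = [] then block_sum B (g []) a v else 0) w"
    by (simp add: split_sum_Nil_left)
  also have "\<dots> + split_sum (\<lambda>uu r2. mark_sum (\<lambda>u x v0. split_sum (\<lambda>v r1. h u x v r1 r2) v0) uu) w =
      split_sum (\<lambda>u v. block_sum B (\<lambda>u'. block_sum B (g u') (endp a u) v) a u) w"
    unfolding split_sum_add[symmetric] h_def
  proof (intro split_sum_cong refl)
    fix u v
    show "(if u = [] then block_sum B (g []) a v else 0) +
        mark_sum (\<lambda>u x v0. split_sum (\<lambda>v' r1. B a u x v' * block_sum B (\<lambda>u'. block_sum B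
         (g ((endp (fst x) v', snd x) # u')) (endp (endp (fst x) v') r1) v) (endp (fst x) v') r1) v0) u =
        block_sum B (\<lambda>u'. block_sum B (g u') (endp a u) v) a u"
      by (subst block_sum_unfold[of B "\<lambda>u'. block_sum B (g u') (endp a u) v" a u])
        (auto intro!: mark_sum_cong split_sum_cong)
  qed
  finally show ?case .
qed

text \<open>Contraction keeps the end point of each part, so the factor \<open>V\<close> starts at
  the same point before and after it. Hence substitution is an endomorphism for the product of
  moulds.\<close>

lemma block_sum_mm:
  "block_sum B (mm U V a) a w =
   mm (\<lambda>a. block_sum B (U a) a) (\<lambda>a. block_sum B (V a) a) a w"
proof -
  have "block_sum B (mm U V a) a w =
     split_sum (\<lambda>u v. block_sum B (\<lambda>u'. block_sum B (\<lambda>v. U a u' * V (endp a u') v) (endp a u) v) a u) w"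
    by (simp add: mm_def[abs_def] block_sum_of_split_sum)
  also have "\<dots> = split_sum (\<lambda>u v. block_sum B (\<lambda>u'. block_sum B (\<lambda>v. U a u' * V (endp a u) v) (endp a u) v) a u) w"
    by (intro split_sum_cong refl block_sum_cong) auto
  finally show ?thesis
    by (simp add: mm_def block_sum_mult_left block_sum_mult_right)
qed

lemma block_sum_case:
  "block_sum B (\<lambda>w'. case w' of [] \<Rightarrow> 0 | x # w'' \<Rightarrow> g x w'') a w =
   mark_sum (\<lambda>u x v0. split_sum (\<lambda>v r. B a u x v *
     block_sum B (g (endp (fst x) v, snd x)) (endp (fst x) v) r) v0) w"
  by (subst block_sum_unfold) simp

lemma shift_shift [simp]: "shift s (shift c w) = shift (s + c) w"
  by (simp add: shift_def split_def algebra_simps)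

lemma shift_eq_Nil [simp]: "shift c w = [] \<longleftrightarrow> w = []"
  by (simp add: shift_def)

lemma shift_zero [simp]: "shift 0 w = w"
  by (simp add: shift_def)

lemma split_sum_shift: "split_sum F (shift c w) = split_sum (\<lambda>u v. F (shift c u) (shift c v)) w"
  unfolding shift_def by (rule split_sum_map)

lemma mark_sum_shift:
  "mark_sum F (shift c w) = mark_sum (\<lambda>u x v. F (shift c u) (fst x, snd x - c) (shift c v)) w"
  unfolding shift_def by (simp add: mark_sum_map split_def)

lemma split_sum_swap:
  "split_sum (\<lambda>u u'. split_sum (k u u') w2) w1 = split_sum (\<lambda>v v'. split_sum (\<lambda>u u'. k u u' v v') w1) w2"
  by (induction w1 arbitrary: k) (auto simp: split_sum_add)

lemma split_sum_zero_fun [simp]: "split_sum (\<lambda>u v. 0) = (\<lambda>w. 0)"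
  by (rule ext) simp

lemma block_sum_delta [simp]:
  "block_sum B (\<lambda>w'. if w' = [] then c else 0) a w = (if w = [] then c else 0)"
  by (subst block_sum_unfold) simp

text \<open>The laws of exp([x_(a->b)]_0 t): additivity along paths and additivity in t.\<close>

definition exp_mould :: "(nat \<Rightarrow> nat \<Rightarrow> rat \<Rightarrow> 'k::comm_ring_1) \<Rightarrow> bool" where
  "exp_mould e \<longleftrightarrow> (\<forall>a b c t. e a b t * e b c t = e a c t) \<and>
     (\<forall>a b s t. e a b s * e a b t = e a b (s + t)) \<and> (\<forall>a t. e a a t = 1)"

text \<open>The factor of one block in the coproduct of a regular symbol; the sign (-1)^(j-i) is
  absorbed in \<open>R\<close>, see \<open>inv_mould\<close>.\<close>

definition block :: "(nat \<Rightarrow> nat \<Rightarrow> rat \<Rightarrow> 'k::comm_ring_1) \<Rightarrow> 'k mould \<Rightarrow> 'k mould \<Rightarrow> 'k blockfun" where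
  "block e R A a u x v =
     e a (endp (fst x) v) (snd x) * R a (shift (snd x) u) * A (fst x) (shift (snd x) v)"

text \<open>Shifting the contracted word lowers the \<tau> of every marked letter by c. Since
  e(\<tau>) = e(c) e(\<tau> - c), each block splits off one factor e(c) along its path, and these
  multiply to the factor of the whole path.\<close>

lemma block_sum_shift:
  assumes e: "exp_mould e"
  shows "block_sum (block e R A) (\<lambda>w'. F (shift c w')) a w =
    e a (endp a w) c * block_sum (block e R A) F a (shift c w)"
proof (induction "length w" arbitrary: F a w rule: less_induct)
  case less
  let ?B = "block e R A"
  have e1: "e a b s * e b d s = e a d s" for a b d s using e by (auto simp: exp_mould_def)
  have e2: "e a b s * e a b t = e a b (s + t)" for a b s t using e by (auto simp: exp_mould_def)
  have "mark_sum (\<lambda>u x v0. split_sum (\<lambda>v r. ?B a u x v *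
       block_sum ?B (\<lambda>w'. F (shift c ((endp (fst x) v, snd x) # w'))) (endp (fst x) v) r) v0) w =
     mark_sum (\<lambda>u x v0. split_sum (\<lambda>v r. e a (endp a w) c *
       (?B a (shift c u) (fst x, snd x - c) (shift c v) *
       block_sum ?B (\<lambda>w'. F ((endp (fst x) v, snd x - c) # w')) (endp (fst x) v) (shift c r))) v0) w"
  proof (intro mark_sum_cong split_sum_cong refl)
    fix u x v0 v r assume "u @ x # v0 = w" "v @ r = v0"
    then have w: "w = u @ x # v @ r" by simp
    let ?E = "endp (fst x) v"
    have "block_sum ?B (\<lambda>w'. F (shift c ((?E, snd x) # w'))) ?E r =
        block_sum ?B (\<lambda>w'. F ((?E, snd x - c) # shift c w')) ?E r" by simp
    also have "\<dots> = e ?E (endp ?E r) c *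
        block_sum ?B (\<lambda>w'. F ((?E, snd x - c) # w')) ?E (shift c r)"
      by (rule less) (simp add: w)
    finally have 1: "block_sum ?B (\<lambda>w'. F (shift c ((?E, snd x) # w'))) ?E r = \<dots>" .
    have 0: "e a ?E c * e a ?E (snd x - c) = e a ?E (snd x)" by (simp add: e2)
    have "e a ?E (snd x) * e ?E (endp ?E r) c = e a ?E c * e ?E (endp ?E r) c * e a ?E (snd x - c)"
      unfolding 0[symmetric] by (simp add: mult_ac)
    also have "\<dots> = e a (endp a w) c * e a ?E (snd x - c)"
      by (simp add: e1 w)
    finally have 2: "e a ?E (snd x) * e ?E (endp ?E r) c = e a (endp a w) c * e a ?E (snd x - c)" .
    have "?B a u x v * e ?E (endp ?E r) c = (e a ?E (snd x) * e ?E (endp ?E r) c) *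
        R a (shift (snd x) u) * A (fst x) (shift (snd x) v)"
      by (simp add: block_def)
    also have "\<dots> = e a (endp a w) c * ?B a (shift c u) (fst x, snd x - c) (shift c v)"
      by (simp add: 2) (simp add: block_def)
    finally show "?B a u x v * block_sum ?B (\<lambda>w'. F (shift c ((?E, snd x) # w'))) ?E r =
      e a (endp a w) c * (?B a (shift c u) (fst x, snd x - c) (shift c v) *
       block_sum ?B (\<lambda>w'. F ((?E, snd x - c) # w')) ?E (shift c r))"
      unfolding 1 by (metis (no_types, lifting) mult.assoc)
  qed
  moreover have "e a a c = 1"
    using e by (auto simp: exp_mould_def)
  ultimately show ?case
    by (subst (1 2) block_sum_unfold)
      (simp add: split_sum_mult_left mark_sum_mult_left mark_sum_shift split_sum_shift distrib_left)
qed

text \<open>A block of the second cut is a word of contracted letters, one of them marked. Undoing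
  the first contraction gives \<open>u @ u1 @ x # v1 @ v2\<close>, where \<open>u1 @ x # v1\<close>
  is the block behind the marked letter while \<open>u\<close> and \<open>v2\<close> are cut into
  further blocks. Hence the composite is again a substitution: \<open>u\<close> and
  \<open>u1\<close> yield the new left weight, \<open>v1\<close> and \<open>v2\<close> the new right
  one.\<close>

lemma block_sum_block_sum:
  fixes A2 R2 :: "'k::comm_ring_1 mould"
  assumes e: "exp_mould e2"
  defines "B \<equiv> block e2 R2 A2"
  shows "block_sum B (block_sum (block e1 R1 A1) F a) a w =
    block_sum (block (\<lambda>a b t. e1 a b t * e2 a b t) (mm (\<lambda>a. block_sum B (R1 a) a) R2)
       (mm A2 (\<lambda>a. block_sum B (A1 a) a))) F a w"
proof (induction "length w" arbitrary: F a w rule: less_induct)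
  case less
  let ?B1 = "block e1 R1 A1"
  define B3 where "B3 = block (\<lambda>a b t. e1 a b t * e2 a b t) (mm (\<lambda>a. block_sum B (R1 a) a) R2)
       (mm A2 (\<lambda>a. block_sum B (A1 a) a))"
  \<comment> \<open>The contribution of a first \<open>?B1\<close>-block with left part
    \<open>u\<close> and marked letter \<open>x\<close> to the value at a contracted word.\<close>
  define G where "G = (\<lambda>u x w3. split_sum (\<lambda>v r. ?B1 a u x v *
       block_sum ?B1 (\<lambda>w'. F ((endp (fst x) v, snd x) # w')) (endp (fst x) v) r) w3)"
  have ee: "e2 a b s * e2 b c s = e2 a c s" for a b c s using e by (auto simp: exp_mould_def)
  \<comment> \<open>One summand of the composite: \<open>u\<close> and \<open>v2\<close> are still
    to be cut into \<open>B\<close>-blocks, \<open>u1 @ x # v1\<close> is the \<open>B\<close>-block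
    behind the marked letter, and \<open>r2\<close> is the rest of the word.\<close>
  define K where "K = (\<lambda>u u1 x v1 v2 r2. 
       e1 a (endp (endp (fst x) v1) v2) (snd x) * block_sum B (\<lambda>u'. R1 a (shift (snd x) u')) a u *
       B (endp a u) u1 x v1 *
       block_sum B (\<lambda>v'. A1 (endp (fst x) v1) (shift (snd x) v')) (endp (fst x) v1) v2 *
       block_sum B3 (\<lambda>w'. F ((endp (endp (fst x) v1) v2, snd x) # w')) (endp (endp (fst x) v1) v2) r2)"
  have "block_sum B (block_sum ?B1 F a) a w =
      (if w = [] then F [] else 0) + block_sum B (mark_sum G) a w"
  proof -
    have "block_sum ?B1 F a = (\<lambda>w'. (if w' = [] then F [] else 0) + mark_sum G w')"
      by (rule ext, subst block_sum_unfold) (simp add: G_def)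
    then show ?thesis by (simp add: block_sum_add)
  qed
  also have "block_sum B (mark_sum G) a w =
     split_sum (\<lambda>u w2. block_sum B (\<lambda>u'. block_sum B
         (\<lambda>w2'. case w2' of [] \<Rightarrow> 0 | x # v' \<Rightarrow> G u' x v') (endp a u) w2) a u) w"
    by (simp add: mark_sum_eq_split_sum[abs_def] block_sum_of_split_sum)
  also have "\<dots> = split_sum (\<lambda>u w2. mark_sum (\<lambda>u1 x v0. split_sum (\<lambda>v1 r. 
       block_sum B (\<lambda>u'. B (endp a u) u1 x v1 *
         block_sum B (G u' (endp (fst x) v1, snd x)) (endp (fst x) v1) r) a u) v0) w2) w"
    by (simp add: block_sum_case block_sum_mark_sum block_sum_split_sum)
  also have "\<dots> = split_sum (\<lambda>u w2. mark_sum (\<lambda>u1 x v0. split_sum (\<lambda>v1 r. 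
       split_sum (\<lambda>v2 r2. K u u1 x v1 v2 r2) r) v0) w2) w"
  proof (intro split_sum_cong mark_sum_cong refl)
    fix u w2 u1 x v0 v1 r
    assume "u @ w2 = w" "u1 @ x # v0 = w2" "v1 @ r = v0"
    then have w: "w = u @ u1 @ x # v1 @ r" by simp
    let ?e = "endp (fst x) v1"
    have 1: "block_sum B (G u' (?e, snd x)) ?e r = split_sum (\<lambda>v2 r2.
        e1 a (endp ?e v2) (snd x) * R1 a (shift (snd x) u') *
        block_sum B (\<lambda>v'. A1 ?e (shift (snd x) v')) ?e v2 *
        block_sum B3 (\<lambda>w'. F ((endp ?e v2, snd x) # w')) (endp ?e v2) r2) r" for u'
    proof -
      have "block_sum B (G u' (?e, snd x)) ?e r = split_sum (\<lambda>v2 r2.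
        block_sum B (\<lambda>v'. block_sum B (\<lambda>r'. ?B1 a u' (?e, snd x) v' *
          block_sum ?B1 (\<lambda>w'. F ((endp ?e v', snd x) # w')) (endp ?e v') r') (endp ?e v2) r2) ?e v2) r"
        unfolding G_def by (simp add: block_sum_of_split_sum)
      also have "\<dots> = split_sum (\<lambda>v2 r2.
        block_sum B (\<lambda>v'. block_sum B (\<lambda>r'. e1 a (endp ?e v2) (snd x) * R1 a (shift (snd x) u') *
            A1 ?e (shift (snd x) v') *
          block_sum ?B1 (\<lambda>w'. F ((endp ?e v2, snd x) # w')) (endp ?e v2) r') (endp ?e v2) r2) ?e v2) r"
        by (intro split_sum_cong refl block_sum_cong) (simp add: block_def)
      also have "\<dots> = split_sum (\<lambda>v2 r2. block_sum B (\<lambda>v'. e1 a (endp ?e v2) (snd x) *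
            R1 a (shift (snd x) u') * A1 ?e (shift (snd x) v') *
          block_sum B3 (\<lambda>w'. F ((endp ?e v2, snd x) # w')) (endp ?e v2) r2) ?e v2) r"
        unfolding block_sum_mult_left B3_def B_def
        by (intro split_sum_cong refl block_sum_cong arg_cong2[where f = "(*)"] less[unfolded B_def])
          (auto simp: w)
      finally show ?thesis
        by (simp add: block_sum_mult_left block_sum_mult_right)
    qed
    show "block_sum B (\<lambda>u'. B (endp a u) u1 x v1 * block_sum B (G u' (?e, snd x)) ?e r) a u =
       split_sum (\<lambda>v2 r2. K u u1 x v1 v2 r2) r"
      unfolding 1 K_def
      by (simp add: block_sum_mult_left block_sum_mult_right block_sum_split_sum mult.assoc
          split_sum_mult_left[symmetric] mult.left_commute)
  qed
  \<comment> \<open>Regrouped by the complete parts \<open>uu = u @ u1\<close> and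
    \<open>vv = v1 @ v2\<close> of the composite block.\<close>
  also have "\<dots> = mark_sum (\<lambda>uu x v0. split_sum (\<lambda>vv r. split_sum (\<lambda>u u1. 
       split_sum (\<lambda>v1 v2. K u u1 x v1 v2 r) vv) uu) v0) w"
    unfolding split_sum_mark_sum split_sum_assoc[symmetric]
    by (intro mark_sum_cong refl) (subst split_sum_swap, rule refl)
  also have "\<dots> = mark_sum (\<lambda>u x v0. split_sum (\<lambda>v r. B3 a u x v *
       block_sum B3 (\<lambda>w'. F ((endp (fst x) v, snd x) # w')) (endp (fst x) v) r) v0) w"
  proof (intro split_sum_cong mark_sum_cong refl)
    fix uu :: word and x :: "nat \<times> rat" and v0 vv r :: word
    let ?E = "endp (fst x) vv" let ?T = "block_sum B3 (\<lambda>w'. F ((endp (fst x) vv, snd x) # w')) (endp (fst x) vv) r"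
    have "split_sum (\<lambda>u u1. split_sum (\<lambda>v1 v2. K u u1 x v1 v2 r) vv) uu =
      split_sum (\<lambda>u u1. split_sum (\<lambda>v1 v2. (e1 a ?E (snd x) * e2 a ?E (snd x) * ?T) *
        (block_sum B (R1 a) a (shift (snd x) u) * R2 (endp a u) (shift (snd x) u1)) *
        (A2 (fst x) (shift (snd x) v1) * block_sum B (A1 (endp (fst x) v1)) (endp (fst x) v1) (shift (snd x) v2))) vv) uu"
    proof (intro split_sum_cong refl)
      fix u u1 v1 v2 assume "u @ u1 = uu" "v1 @ v2 = vv"
      then have *: "uu = u @ u1" "vv = v1 @ v2" by auto
      let ?c = "snd x" let ?e = "endp (fst x) v1"
      \<comment> \<open>The factor \<open>e2\<close> of the composite block splits along its path:
        the first and the last part come from \<open>block_sum_shift\<close>, the middle one from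
        the inner block.\<close>
      have "e2 a (endp ?e v2) ?c = e2 a (endp a u) ?c * e2 (endp a u) ?e ?c * e2 ?e (endp ?e v2) ?c"
        by (simp add: ee)
      then show "K u u1 x v1 v2 r = (e1 a ?E (snd x) * e2 a ?E (snd x) * ?T) *
        (block_sum B (R1 a) a (shift (snd x) u) * R2 (endp a u) (shift (snd x) u1)) *
        (A2 (fst x) (shift (snd x) v1) * block_sum B (A1 (endp (fst x) v1)) (endp (fst x) v1) (shift (snd x) v2))"
        unfolding K_def B_def block_sum_shift[OF e] by (simp add: block_def * mult_ac)
    qed
    also have "\<dots> = B3 a uu x vv * ?T"
      unfolding split_sum_mult_left split_sum_mult_right
      by (simp add: B3_def block_def mm_def split_sum_shift mult_ac)
    finally show "split_sum (\<lambda>u u1. split_sum (\<lambda>v1 v2. K u u1 x v1 v2 r) vv) uu = B3 a uu x vv * ?T" .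
  qed
  finally show ?case unfolding B3_def[symmetric] by (subst block_sum_unfold)
qed

text \<open>
  \<open>pole q z\<close> is \<open>z (1 - Q)\<close>, where \<open>Q\<close> has the one-letter component \<open>1 / t\<close>. With \<open>t = \<tau> z\<close> and
  \<open>q \<tau> = 1 / \<tau>\<close> no denominators \<open>z\<close> remain.
\<close>

definition pole :: "(rat \<Rightarrow> 'k::comm_ring_1) \<Rightarrow> 'k \<Rightarrow> word \<Rightarrow> 'k" where
  "pole q z w = (case w of [] \<Rightarrow> z | [x] \<Rightarrow> - q (snd x) | _ \<Rightarrow> 0)"

text \<open>Subtracting the \<tau> of a marked letter from the others must leave nonzero values,
  because the inversion equation divides by them; hence distinctness. The increasing end points are
  those of a regular symbol.\<close>

definition good :: "nat \<Rightarrow> word \<Rightarrow> bool" where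
  "good a w \<longleftrightarrow> sorted_wrt (<) (a # map fst w) \<and> distinct (map snd w) \<and> 0 \<notin> set (map snd w)"

text \<open>The recursion defining the inversion says that \<open>R (1 - Q) A\<close> is the block sum of \<open>1 - Q\<close>.\<close>

definition inverse_moulds ::
  "(rat \<Rightarrow> 'k::comm_ring_1) \<Rightarrow> 'k \<Rightarrow> (nat \<Rightarrow> nat \<Rightarrow> rat \<Rightarrow> 'k) \<Rightarrow> 'k mould \<Rightarrow> 'k mould \<Rightarrow> bool" where
  "inverse_moulds q z e R A \<longleftrightarrow> (\<forall>a. A a [] = 1) \<and> (\<forall>a w. good a w \<longrightarrow>
     mm R (mm (\<lambda>_. pole q z) A) a w = block_sum (block e R A) (pole q z) a w)"

lemma good_append: "good a (u @ v) \<Longrightarrow> good a u \<and> good (endp a u) v"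
  by (induction u arbitrary: a) (auto simp: good_def)

lemma good_subseq:
  assumes "good a w" "subseq (map fst w') (map fst w)" "subseq (map snd w') (map snd w)"
  shows "good a w'"
proof -
  have "sorted_wrt (<) xs" if "subseq xs ys" "sorted_wrt (<) ys" for xs ys :: "nat list"
    using that
  proof (induction rule: list_emb.induct)
    case (list_emb_Cons2 x y xs ys)
    then show ?case using subseq_order.order_refl set_nths_subset[of xs] list_emb_set[of "(=)" xs ys]
      by fastforce
  qed auto
  moreover have "subseq (a # map fst w') (a # map fst w)" using assms(2) by simp
  moreover have "set xs \<subseteq> set ys" "distinct ys \<Longrightarrow> distinct xs" if "subseq xs ys" for xs ys :: "rat list"
    using that by (auto simp: subseq_conv_nths dest: in_set_nthsD)
  ultimately show ?thesis using assms(1,3) unfolding good_def by blast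
qed

section \<open>The inversion equation: composition and uniqueness of its solutions\<close>

lemma mm_cong:
  "(\<And>u v. u @ v = w \<Longrightarrow> U a u = U' a u) \<Longrightarrow> (\<And>u v. u @ v = w \<Longrightarrow> V (endp a u) v = V' (endp a u) v) \<Longrightarrow>
    mm U V a w = mm U' V' a w"
  unfolding mm_def by (intro split_sum_cong refl) auto

lemma mm_assoc_fun: "mm (mm U V) W = mm U (mm V W)"
  by (intro ext) (rule mm_assoc)

lemma block_sum_mm_fun:
  "(\<lambda>a. block_sum B (mm U V a) a) = mm (\<lambda>a. block_sum B (U a) a) (\<lambda>a. block_sum B (V a) a)"
  by (intro ext) (rule block_sum_mm)

text \<open>Let T_i be the substitution of (e_i, R_i, A_i) and D = z (1 - Q). Then (T_2 R_1) R_2 D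
  A_2 (T_2 A_1) = (T_2 R_1) (T_2 D) (T_2 A_1) = T_2 (R_1 D A_1) = T_2 (T_1 D), by multiplicativity
  of T_2 and the two given equations, and the composite of the substitutions is identified by
  \<open>block_sum_block_sum\<close>.\<close>

lemma inverse_moulds_comp:
  fixes A1 R1 A2 R2 :: "'k::comm_ring_1 mould"
  assumes 1: "inverse_moulds q z e1 R1 A1" and 2: "inverse_moulds q z e2 R2 A2" and e: "exp_mould e2"
  defines "B \<equiv> block e2 R2 A2"
  shows "inverse_moulds q z (\<lambda>a b t. e1 a b t * e2 a b t)
    (mm (\<lambda>a. block_sum B (R1 a) a) R2) (mm A2 (\<lambda>a. block_sum B (A1 a) a))"
  unfolding inverse_moulds_def
proof (intro conjI allI impI)
  show "mm A2 (\<lambda>a. block_sum B (A1 a) a) a [] = 1" for a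
    using 1 2 by (simp add: mm_def inverse_moulds_def)
next
  fix a w assume g: "good a w"
  let ?D = "\<lambda>_ :: nat. pole q z"
  let ?T = "\<lambda>U a. block_sum B (U a) a"
  have g2: "mm R2 (mm ?D A2) a w = ?T ?D a w" if "good a w" for a w
    using 2 that by (simp add: inverse_moulds_def B_def)
  have "mm (mm (?T R1) R2) (mm ?D (mm A2 (?T A1))) a w =
      mm (?T R1) (mm (mm R2 (mm ?D A2)) (?T A1)) a w"
    by (simp add: mm_assoc_fun)
  also have "\<dots> = mm (?T R1) (mm (?T ?D) (?T A1)) a w"
    by (intro mm_cong refl g2) (use g in \<open>auto dest!: good_append\<close>)
  also have "\<dots> = block_sum B (mm R1 (mm ?D A1) a) a w"
    by (simp add: block_sum_mm[of B R1 "mm ?D A1"] block_sum_mm_fun[of B ?D A1])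
  also have "\<dots> = block_sum B (block_sum (block e1 R1 A1) (pole q z) a) a w"
    by (intro block_sum_cong refl)
      (use 1 good_subseq[OF g] in \<open>auto simp: inverse_moulds_def\<close>)
  also have "\<dots> = block_sum (block (\<lambda>a b t. e1 a b t * e2 a b t) (mm (?T R1) R2) (mm A2 (?T A1)))
      (pole q z) a w"
    unfolding B_def by (rule block_sum_block_sum[OF e])
  finally show "mm (mm (?T R1) R2) (mm ?D (mm A2 (?T A1))) a w = \<dots>" .
qed

lemma good_shift:
  assumes "good a (u @ x # v)"
  shows "good a (shift (snd x) u)" "good (fst x) (shift (snd x) v)"
  using assms by (auto simp: good_def inj_on_def distinct_map sorted_wrt_append image_iff)

text \<open>\<open>pole\<close> vanishes on words of length two or more, so only the cut into a
  single block survives. In the inversion equation at \<open>w\<close> the right side therefore sees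
  \<open>R\<close> only on words shorter than \<open>w\<close>.\<close>

lemma block_sum_pole:
  "block_sum B (pole q z) a w = (if w = [] then z else 0) -
     mark_sum (\<lambda>u x v. q (snd x) * B a u x v) w"
proof -
  \<comment> \<open>After a first block, what remains of \<open>pole\<close> is nonzero on the empty
    word only.\<close>
  have "block_sum B (\<lambda>w'. pole q z ((E, t) # w')) a' r = (if r = [] then - q t else 0)" for E t a' r
  proof -
    have "(\<lambda>w'. pole q z ((E, t) # w')) = (\<lambda>w'. if w' = [] then - q t else 0)"
      by (auto simp: pole_def split: list.splits)
    then show ?thesis by simp
  qed
  then have *: "block_sum B (pole q z) a w = (if w = [] then pole q z [] else 0) +
     mark_sum (\<lambda>u x v0. split_sum (\<lambda>v r. B a u x v * (if r = [] then - q (snd x) else 0)) v0) w"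
    by (subst block_sum_unfold) simp
  have "split_sum (\<lambda>v r. F v * (if r = [] then c else 0)) v0 = F v0 * c" for F :: "word \<Rightarrow> 'a" and c v0
  proof (induction v0 arbitrary: F)
    case (Cons x v0)
    show ?case using Cons.IH[of "\<lambda>v. F (x # v)"] by simp
  qed simp
  then have **: "split_sum (\<lambda>v r. F v * (if r = [] then c else 0)) = (\<lambda>v0. F v0 * c)" for F :: "word \<Rightarrow> 'a" and c
    by (rule ext)
  show ?thesis
    using mark_sum_mult_left[of "-1" "\<lambda>u x v. q (snd x) * B a u x v" w]
    by (simp add: * ** mult.commute pole_def)
qed

text \<open>The equation is triangular in the length of the word. At \<open>w\<close> the only value
  of \<open>R\<close> on a word of this length occurs as z R(w): it belongs to the empty right part,
  where \<open>A\<close> is 1 and \<open>pole\<close> is z, and z can be cancelled.\<close>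

lemma inverse_moulds_unique:
  fixes A A' R R' :: "'k::comm_ring_1 mould"
  assumes 1: "inverse_moulds q z e R A" and 2: "inverse_moulds q z e R' A'"
    and z: "\<And>x y. z * x = z * y \<Longrightarrow> x = y"
    and A: "\<And>a w. good a w \<Longrightarrow> A a w = A' a w"
    and g: "good a w"
  shows "R a w = R' a w"
  using g
proof (induction "length w" arbitrary: a w rule: less_induct)
  case less
  let ?D = "\<lambda>_ :: nat. pole q z"
  note g = less.prems
  have A1: "A a [] = 1" "A' a [] = 1" for a using 1 2 by (auto simp: inverse_moulds_def)
  have eq1: "block_sum (block e R A) (pole q z) a w = block_sum (block e R' A') (pole q z) a w"
    unfolding block_sum_pole block_def
  proof (intro arg_cong2[where f = "(-)"] mark_sum_cong refl arg_cong2[where f = "(*)"])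
    fix u x v assume w: "u @ x # v = w"
    then show "R a (shift (snd x) u) = R' a (shift (snd x) u)"
      by (intro less good_shift[of a u x v]) (use g in auto)
    show "A (fst x) (shift (snd x) v) = A' (fst x) (shift (snd x) v)"
      by (intro A good_shift[of a u x v]) (use g w in auto)
  qed
  let ?F = "\<lambda>R A u v. R a u * mm ?D A (endp a u) v"
  have "split_sum (?F R A) w - ?F R A w [] = split_sum (?F R' A') w - ?F R' A' w []"
  proof (rule split_sum_last_cong)
    fix u v assume w: "u @ v = w" and v: "v \<noteq> []"
    have "R a u = R' a u" using g w v good_append[of a u v] by (intro less) auto
    moreover have "mm ?D A (endp a u) v = mm ?D A' (endp a u) v"
      by (rule mm_cong) (use good_append g w A in blast)+
    ultimately show "?F R A u v = ?F R' A' u v" by simp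
  qed
  moreover have "split_sum (?F R A) w = split_sum (?F R' A') w"
    using eq1 1 2 g by (simp add: inverse_moulds_def mm_def[of R] mm_def[of R'])
  moreover have "mm ?D A b [] = z" "mm ?D A' b [] = z" for b
    by (simp_all add: mm_def A1 pole_def)
  ultimately have "z * R a w = z * R' a w" by (simp add: mult.commute)
  then show ?case by (rule z)
qed

text \<open>With trivial weights only the cut into single letters survives, so the substitution is
  the identity; this is the case of the augmentation.\<close>

lemma block_sum_single_letters:
  assumes "\<And>a u x v. B a u x v = (if u = [] \<and> v = [] then 1 else 0)"
  shows "block_sum B F a w = F w"
proof (induction w arbitrary: F a)
  case (Cons y w)
  have "split_sum (\<lambda>v r. (if v = [] then 1 else 0) * h v r) w = h [] w" for h :: "word \<Rightarrow> word \<Rightarrow> 'a"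
    by (cases w) auto
  then have "split_sum (\<lambda>v r. B a [] y v *
       block_sum B (\<lambda>w'. F ((endp (fst y) v, snd y) # w')) (endp (fst y) v) r) w = F (y # w)"
    by (simp add: assms Cons.IH)
  moreover have "mark_sum (\<lambda>u x v0. split_sum (\<lambda>v r. B a (y # u) x v *
       block_sum B (\<lambda>w'. F ((endp (fst x) v, snd x) # w')) (endp (fst x) v) r) v0) w = 0"
    by (simp add: assms)
  ultimately show ?case by (subst block_sum_unfold) simp
qed simp

section \<open>Relabelling of end points\<close>

definition relabel :: "(nat \<Rightarrow> nat) \<Rightarrow> word \<Rightarrow> word" where
  "relabel P = map (\<lambda>(b, t). (P b, t))"

lemma relabel_simps [simp]: "relabel P [] = []" "relabel P (x # w) = (P (fst x), snd x) # relabel P w"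
  "relabel P (u @ v) = relabel P u @ relabel P v" "map fst (relabel P w) = map P (map fst w)"
  "map snd (relabel P w) = map snd w" "length (relabel P w) = length w"
  "endp (P a) (relabel P w) = P (endp a w)" "relabel P (shift c w) = shift c (relabel P w)"
  by (auto simp: relabel_def shift_def split_def endp_def last_map)

lemma block_sum_relabel:
  assumes "\<And>a u x v. B a u x v = C (P a) (relabel P u) (P (fst x), snd x) (relabel P v)"
  shows "block_sum B (\<lambda>w'. F (relabel P w')) a w = block_sum C F (P a) (relabel P w)"
proof (induction "length w" arbitrary: F a w rule: less_induct)
  case less
  have "mark_sum (\<lambda>u x v0. split_sum (\<lambda>v r. B a u x v *
       block_sum B (\<lambda>w'. F (relabel P ((endp (fst x) v, snd x) # w'))) (endp (fst x) v) r) v0) w =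
     mark_sum (\<lambda>u x v0. split_sum (\<lambda>v r. C (P a) (relabel P u) (P (fst x), snd x) (relabel P v) *
       block_sum C (\<lambda>w'. F ((P (endp (fst x) v), snd x) # w')) (P (endp (fst x) v)) (relabel P r)) v0) w"
  proof (intro mark_sum_cong split_sum_cong refl arg_cong2[where f = "(*)"] assms)
    fix u x v0 v r assume "u @ x # v0 = w" "v @ r = v0"
    then have w: "w = u @ x # v @ r" by simp
    show "block_sum B (\<lambda>w'. F (relabel P ((endp (fst x) v, snd x) # w'))) (endp (fst x) v) r =
        block_sum C (\<lambda>w'. F ((P (endp (fst x) v), snd x) # w')) (P (endp (fst x) v)) (relabel P r)"
      using less[of r "\<lambda>w'. F ((P (endp (fst x) v), snd x) # w')"] by (simp add: w)
  qed
  then show ?case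
    by (subst (1 2) block_sum_unfold)
      (simp add: relabel_def mark_sum_map split_sum_map split_def flip: relabel_simps(7))
qed

lemma mm_relabel:
  "mm (\<lambda>a w. U (P a) (relabel P w)) (\<lambda>a w. V (P a) (relabel P w)) a w = mm U V (P a) (relabel P w)"
  by (simp add: mm_def relabel_def split_sum_map) (simp flip: relabel_def)

section \<open>Homomorphisms of monoid algebras over the rationals\<close>

type_synonym 'm malg = "'m \<Rightarrow>\<^sub>0 rat"

text \<open>Homomorphisms on whole types, free of carrier conditions; fixing \<open>pconst\<close>
  makes them linear. Supports are controlled separately.\<close>

definition qhom :: "('m::cancel_comm_monoid_add malg \<Rightarrow> 'n::cancel_comm_monoid_add malg) \<Rightarrow> bool" where
  "qhom h \<longleftrightarrow> (\<forall>x y. h (x + y) = h x + h y) \<and> (\<forall>x y. h (x * y) = h x * h y) \<and>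
     (\<forall>c. h (pconst c) = pconst c)"

lemma pconst_simps [simp]: "pconst 0 = 0" "pconst 1 = 1" "pconst (a + b) = pconst a + pconst b"
  "pconst (a * b) = pconst a * pconst b" "pconst (- a) = - pconst a" "pconst (a - b) = pconst a - pconst b"
  "pconst (a ^ n) = pconst a ^ n"
proof -
  show *: "pconst (a * b) = pconst a * pconst b" for a b
    by (simp add: pconst_def mult_single)
  show **: "pconst 1 = 1" by (simp add: pconst_def)
  show "pconst (a ^ n) = pconst a ^ n" by (induction n) (simp_all add: * **)
qed (simp_all add: pconst_def single_add single_uminus single_diff)

lemma pconst_prod: "pconst (prod f A) = (\<Prod>x\<in>A. pconst (f x))"
  by (induction A rule: infinite_finite_induct) auto

lemma qhomD:
  assumes "qhom h"
  shows qhom_add: "h (x + y) = h x + h y" and qhom_mult: "h (x * y) = h x * h y"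
    and qhom_pconst: "h (pconst c) = pconst c" and qhom_0: "h 0 = 0" and qhom_1: "h 1 = 1"
    and qhom_uminus: "h (- x) = - h x" and qhom_diff: "h (x - y) = h x - h y"
    and qhom_power: "h (x ^ n) = h x ^ n"
    and qhom_sum: "h (sum f A) = (\<Sum>i\<in>A. h (f i))" and qhom_prod: "h (prod f A) = (\<Prod>i\<in>A. h (f i))"
proof -
  show add: "h (x + y) = h x + h y" for x y using assms by (simp add: qhom_def)
  show mult: "h (x * y) = h x * h y" for x y using assms by (simp add: qhom_def)
  show c: "h (pconst c) = pconst c" for c using assms by (simp add: qhom_def)
  show 0: "h 0 = 0" using c[of 0] by simp
  show 1: "h 1 = 1" using c[of 1] by simp
  show um: "h (- x) = - h x" for x using mult[of "pconst (-1)" x] c[of "-1"] by simp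
  show "h (x - y) = h x - h y" using add[of x "- y"] um by simp
  show "h (x ^ n) = h x ^ n" by (induction n) (auto simp: mult 1)
  show "h (sum f A) = (\<Sum>i\<in>A. h (f i))" by (induction A rule: infinite_finite_induct) (auto simp: add 0)
  show "h (prod f A) = (\<Prod>i\<in>A. h (f i))" by (induction A rule: infinite_finite_induct) (auto simp: mult 1)
qed

lemma qhom_comp: "qhom f \<Longrightarrow> qhom g \<Longrightarrow> qhom (\<lambda>x. f (g x))"
  by (simp add: qhom_def)

lemma qhom_id: "qhom (\<lambda>x. x)"
  by (simp add: qhom_def)

lemma malg_decomp: "(p :: 'm malg) = (\<Sum>m\<in>keys p. Poly_Mapping.single m (lookup p m))"
  by (rule poly_mapping_eqI) (auto simp: lookup_sum lookup_single when_def in_keys_iff)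

lemma pconst_mult_single: "pconst c * Poly_Mapping.single m d = Poly_Mapping.single m (c * d)"
  by (simp add: pconst_def mult_single)

lemma single_eq_pconst: "Poly_Mapping.single m c = pconst c * Poly_Mapping.single m 1"
  by (simp add: pconst_mult_single)

lemma qhom_eqI:
  assumes "qhom f" "qhom g" and eq: "\<And>m. m \<in> keys p \<Longrightarrow> f (Poly_Mapping.single m 1) = g (Poly_Mapping.single m 1)"
  shows "f p = g p"
proof -
  have 1: "h p = (\<Sum>m\<in>keys p. pconst (lookup p m) * h (Poly_Mapping.single m 1))" if "qhom h"
    for h :: "'a malg \<Rightarrow> 'b malg"
  proof -
    have "h p = (\<Sum>m\<in>keys p. h (Poly_Mapping.single m (lookup p m)))"
      by (subst malg_decomp) (simp add: qhom_sum[OF that])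
    also have "\<dots> = (\<Sum>m\<in>keys p. pconst (lookup p m) * h (Poly_Mapping.single m 1))"
      by (intro sum.cong refl, subst single_eq_pconst) (simp add: qhom_mult[OF that] qhom_pconst[OF that])
    finally show ?thesis .
  qed
  show ?thesis using 1[OF assms(1)] 1[OF assms(2)] eq by simp
qed

definition monoid_lift :: "('m \<Rightarrow> 'n::cancel_comm_monoid_add malg) \<Rightarrow> 'm::cancel_comm_monoid_add malg \<Rightarrow> 'n malg" where
  "monoid_lift M p = (\<Sum>m\<in>keys p. pconst (lookup p m) * M m)"

lemma monoid_lift_superset:
  "finite S \<Longrightarrow> keys p \<subseteq> S \<Longrightarrow> monoid_lift M p = (\<Sum>m\<in>S. pconst (lookup p m) * M m)"
  unfolding monoid_lift_def by (rule sum.mono_neutral_left) (auto simp: in_keys_iff)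

lemma monoid_lift_single [simp]: "monoid_lift M (Poly_Mapping.single m c) = pconst c * M m"
  by (subst monoid_lift_superset[of "{m}"]) auto

lemma monoid_lift_add: "monoid_lift M (p + q) = monoid_lift M p + monoid_lift M q"
  using keys_add[of p q]
  by (subst (1 2 3) monoid_lift_superset[of "keys p \<union> keys q"])
    (auto simp: lookup_add distrib_right sum.distrib)

lemma monoid_lift_sum: "monoid_lift M (sum f A) = (\<Sum>i\<in>A. monoid_lift M (f i))"
  by (induction A rule: infinite_finite_induct) (auto simp: monoid_lift_add monoid_lift_def[of _ 0])

lemma qhom_monoid_lift:
  fixes M :: "'m::cancel_comm_monoid_add \<Rightarrow> 'n::cancel_comm_monoid_add malg"
  assumes "M 0 = 1" "\<And>m n. M (m + n) = M m * M n"
  shows "qhom (monoid_lift M)"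
  unfolding qhom_def
proof (intro conjI allI monoid_lift_add)
  fix x y :: "'m malg" and c
  show "monoid_lift M (pconst c) = pconst c" using monoid_lift_single[of M 0 c] by (simp add: assms pconst_def)
  have "x * y = (\<Sum>m\<in>keys x. \<Sum>n\<in>keys y. Poly_Mapping.single (m + n) (lookup x m * lookup y n))"
    by (subst (1) malg_decomp[of x], subst (1) malg_decomp[of y])
      (simp add: sum_product mult_single)
  then have "monoid_lift M (x * y) = (\<Sum>m\<in>keys x. \<Sum>n\<in>keys y. pconst (lookup x m * lookup y n) * M (m + n))"
    by (simp add: monoid_lift_sum)
  also have "\<dots> = monoid_lift M x * monoid_lift M y"
    by (simp add: monoid_lift_def sum_product assms mult_ac)
  finally show "monoid_lift M (x * y) = monoid_lift M x * monoid_lift M y" .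
qed

lemma pvar_power_single: "pvar g ^ n = Poly_Mapping.single (Poly_Mapping.single g n) 1"
  by (induction n) (auto simp: pvar_def mult_single simp flip: single_add)

lemma single_prod: "(\<Prod>i\<in>A. Poly_Mapping.single (m i) (1::rat)) = Poly_Mapping.single (\<Sum>i\<in>A. m i) 1"
  by (induction A rule: infinite_finite_induct) (auto simp: mult_single)

lemma monomial_prod: "Poly_Mapping.single m 1 = (\<Prod>g\<in>keys m. pvar g ^ lookup m g)"
proof -
  have "m = (\<Sum>g\<in>keys m. Poly_Mapping.single g (lookup m g))"
    by (rule poly_mapping_eqI) (auto simp: lookup_sum lookup_single when_def in_keys_iff)
  then show ?thesis by (simp add: pvar_power_single single_prod)
qed

lemma phom_eq_monoid_lift: "phom f = monoid_lift (\<lambda>m. \<Prod>g\<in>keys m. f g ^ lookup m g)"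
  by (simp add: phom_def[abs_def] monoid_lift_def[abs_def])

lemma qhom_phom: "qhom (phom f)"
  unfolding phom_eq_monoid_lift
proof (rule qhom_monoid_lift)
  fix m n :: "'a \<Rightarrow>\<^sub>0 nat"
  have *: "(\<Prod>g\<in>keys k. f g ^ lookup k g) = (\<Prod>g\<in>keys m \<union> keys n. f g ^ lookup k g)"
    if "keys k \<subseteq> keys m \<union> keys n" for k
    by (rule prod.mono_neutral_left) (use that in \<open>auto simp: in_keys_iff\<close>)
  show "(\<Prod>g\<in>keys (m + n). f g ^ lookup (m + n) g) =
      (\<Prod>g\<in>keys m. f g ^ lookup m g) * (\<Prod>g\<in>keys n. f g ^ lookup n g)"
    using keys_add[of m n] by (subst (1 2 3) *) (auto simp: lookup_add power_add prod.distrib)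
qed simp

lemma phom_pvar [simp]: "phom f (pvar g) = f g"
  by (simp add: phom_eq_monoid_lift pvar_def)

lemma qhom_eq_pvarI:
  assumes "qhom f" "qhom g" "\<And>m x. m \<in> keys p \<Longrightarrow> x \<in> keys m \<Longrightarrow> f (pvar x) = g (pvar x)"
  shows "f p = g p"
  by (rule qhom_eqI[OF assms(1,2)])
    (simp add: monomial_prod qhom_prod[OF assms(1)] qhom_prod[OF assms(2)]
      qhom_power[OF assms(1)] qhom_power[OF assms(2)] assms(3))

text \<open>The tensor product of \<open>f\<close> and \<open>g\<close> followed by multiplication
  in the target, so that \<open>phom2 f g (cop x)\<close> is the convolution of \<open>f\<close> and
  \<open>g\<close> at \<open>x\<close>.\<close>

definition phom2 :: "('g mpoly \<Rightarrow> 'n::cancel_comm_monoid_add malg) \<Rightarrow> ('g mpoly \<Rightarrow> 'n malg) \<Rightarrow> 'g mpoly2 \<Rightarrow> 'n malg" where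
  "phom2 f g = monoid_lift (\<lambda>(m, n). f (Poly_Mapping.single m 1) * g (Poly_Mapping.single n 1))"

lemma qhom_single_0: "qhom f \<Longrightarrow> f (Poly_Mapping.single 0 1) = 1"
  using qhom_1[of f] by simp

lemma qhom_single_add:
  "qhom f \<Longrightarrow> f (Poly_Mapping.single (m + n) 1) = f (Poly_Mapping.single m 1) * f (Poly_Mapping.single n 1)"
  using qhom_mult[of f "Poly_Mapping.single m 1" "Poly_Mapping.single n 1"] by (simp add: mult_single)

lemma qhom_phom2: "qhom f \<Longrightarrow> qhom g \<Longrightarrow> qhom (phom2 f g)"
  unfolding phom2_def
  by (rule qhom_monoid_lift) (auto simp: zero_prod_def qhom_single_add split_def mult_ac simp del: single_one
      simp: qhom_single_0)

lemma ptensor_eq: "ptensor p q = (\<Sum>m\<in>keys p. \<Sum>n\<in>keys q. pconst (lookup p m) * pconst (lookup q n) *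
    Poly_Mapping.single (m, n) 1)"
  unfolding ptensor_def by (intro sum.cong refl) (simp add: pconst_def mult_single zero_prod_def[symmetric])

lemma phom2_ptensor:
  assumes "qhom f" "qhom g" shows "phom2 f g (ptensor p q) = f p * g q"
proof -
  have 1: "h p = (\<Sum>m\<in>keys p. pconst (lookup p m) * h (Poly_Mapping.single m 1))" if "qhom h"
    for h :: "'a mpoly \<Rightarrow> 'b malg" and p
    by (subst malg_decomp, subst qhom_sum[OF that], intro sum.cong refl, subst single_eq_pconst)
      (simp add: qhom_mult[OF that] qhom_pconst[OF that])
  show ?thesis
    by (simp add: 1[OF assms(1), of p] 1[OF assms(2), of q] ptensor_def phom2_def monoid_lift_sum sum_product mult_ac)
qed

definition inl2 :: "'g mpoly \<Rightarrow> 'g mpoly2" where "inl2 p = ptensor p 1"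
definition inr2 :: "'g mpoly \<Rightarrow> 'g mpoly2" where "inr2 p = ptensor 1 p"

lemma inl2_eq: "inl2 = monoid_lift (\<lambda>m. Poly_Mapping.single (m, 0) 1)"
  by (auto simp: inl2_def ptensor_eq monoid_lift_def)

lemma inr2_eq: "inr2 = monoid_lift (\<lambda>m. Poly_Mapping.single (0, m) 1)"
  by (auto simp: inr2_def ptensor_eq monoid_lift_def)

lemma qhom_inl2: "qhom inl2" unfolding inl2_eq
  by (rule qhom_monoid_lift) (auto simp: mult_single zero_prod_def[symmetric])
lemma qhom_inr2: "qhom inr2" unfolding inr2_eq
  by (rule qhom_monoid_lift) (auto simp: mult_single zero_prod_def[symmetric])

lemma ptensor_eq_mult: "ptensor p q = inl2 p * inr2 q"
  by (simp add: inl2_eq inr2_eq monoid_lift_def ptensor_eq sum_product mult_single mult_ac)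

lemma qhom2_eqI:
  assumes "qhom f" "qhom g"
    "\<And>m n x. (m, n) \<in> keys p \<Longrightarrow> x \<in> keys m \<Longrightarrow> f (inl2 (pvar x)) = g (inl2 (pvar x))"
    "\<And>m n x. (m, n) \<in> keys p \<Longrightarrow> x \<in> keys n \<Longrightarrow> f (inr2 (pvar x)) = g (inr2 (pvar x))"
  shows "f p = g p"
proof (rule qhom_eqI[OF assms(1,2)])
  fix k assume "k \<in> keys p"
  obtain m n where k: "k = (m, n)" by force
  have "Poly_Mapping.single k 1 = inl2 (Poly_Mapping.single m 1) * inr2 (Poly_Mapping.single n 1)"
    by (simp add: k inl2_eq inr2_eq mult_single)
  moreover have "f (inl2 (Poly_Mapping.single m 1)) = g (inl2 (Poly_Mapping.single m 1))"
    by (rule qhom_eq_pvarI[OF qhom_comp[OF assms(1) qhom_inl2] qhom_comp[OF assms(2) qhom_inl2]])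
      (use assms(3) \<open>k \<in> keys p\<close> k in \<open>auto split: if_splits\<close>)
  moreover have "f (inr2 (Poly_Mapping.single n 1)) = g (inr2 (Poly_Mapping.single n 1))"
    by (rule qhom_eq_pvarI[OF qhom_comp[OF assms(1) qhom_inr2] qhom_comp[OF assms(2) qhom_inr2]])
      (use assms(4) \<open>k \<in> keys p\<close> k in \<open>auto split: if_splits\<close>)
  ultimately show "f (Poly_Mapping.single k 1) = g (Poly_Mapping.single k 1)"
    by (simp add: qhom_mult[OF assms(1)] qhom_mult[OF assms(2)])
qed

lemma ptensor_map_eq: "ptensor_map f h = phom2 (\<lambda>x. inl2 (f x)) (\<lambda>x. inr2 (h x))"
  by (intro ext) (auto simp: ptensor_map_def phom2_def monoid_lift_def ptensor_eq_mult split_def intro!: sum.cong)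

section \<open>Specialising series to one variable\<close>

text \<open>
  \<open>eval_series h \<tau> d F\<close> applies the homomorphism \<open>h\<close> to the coefficients of \<open>F\<close>, substitutes
  \<open>t\<^sub>i = \<tau>\<^sub>i z\<close> for \<open>1 \<le> i \<le> d\<close>, and sets the other variables to zero.
\<close>

definition monomials :: "nat \<Rightarrow> nat \<Rightarrow> (nat \<Rightarrow>\<^sub>0 nat) set" where
  "monomials d N = {m. keys m \<subseteq> {1..d} \<and> sdegree m = N}"

definition monomial_value :: "nat \<Rightarrow> (nat \<Rightarrow> rat) \<Rightarrow> (nat \<Rightarrow>\<^sub>0 nat) \<Rightarrow> rat" where
  "monomial_value d \<tau> m = (\<Prod>i=1..d. \<tau> i ^ lookup m i)"

definition eval_series :: "('m::cancel_comm_monoid_add malg \<Rightarrow> 'n::cancel_comm_monoid_add malg) \<Rightarrow> (nat \<Rightarrow> rat) \<Rightarrow> nat \<Rightarrow>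
    'm malg mseries \<Rightarrow> 'n malg fps" where
  "eval_series h \<tau> d F = Abs_fps (\<lambda>N. \<Sum>m\<in>monomials d N. pconst (monomial_value d \<tau> m) * h (scoeff F m))"

lemma sdegree_superset: "finite S \<Longrightarrow> keys m \<subseteq> S \<Longrightarrow> sdegree m = (\<Sum>i\<in>S. lookup m i)"
  unfolding sdegree_def by (rule sum.mono_neutral_left) (auto simp: in_keys_iff)

lemma sdegree_add: "sdegree (m + n) = sdegree m + sdegree n"
  using keys_add[of m n]
  by (subst (1 2 3) sdegree_superset[of "keys m \<union> keys n"]) (auto simp: lookup_add sum.distrib)

lemma sdegree_single [simp]: "sdegree (Poly_Mapping.single i k) = k"
  by (subst sdegree_superset[of "{i}"]) auto

lemma sdegree_0 [simp]: "sdegree 0 = 0"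
  by (simp add: sdegree_def)

lemma sdegree_eq_0_iff: "sdegree m = 0 \<longleftrightarrow> m = 0"
  by (auto simp: sdegree_def in_keys_iff intro!: poly_mapping_eqI)

lemma keys_nat_add: "keys (m + n :: nat \<Rightarrow>\<^sub>0 nat) = keys m \<union> keys n"
  by (auto simp: in_keys_iff lookup_add)

lemma finite_monomials: "finite (monomials d N)"
proof (rule finite_imageD)
  have "(\<lambda>m. restrict (lookup m) {1..d}) ` monomials d N \<subseteq> (\<Pi>\<^sub>E i\<in>{1..d}. {..N})"
  proof (intro image_subsetI PiE_I)
    fix m i assume m: "m \<in> monomials d N" and "i \<in> {1..d}"
    then have "lookup m i \<le> sdegree m"
      by (subst sdegree_superset[of "{1..d}"]) (auto simp: monomials_def intro!: member_le_sum)
    then show "restrict (lookup m) {1..d} i \<in> {..N}" using m \<open>i \<in> {1..d}\<close> by (simp add: monomials_def)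
  qed auto
  then show "finite ((\<lambda>m. restrict (lookup m) {1..d}) ` monomials d N)"
    by (rule finite_subset) (auto intro: finite_PiE)
  show "inj_on (\<lambda>m. restrict (lookup m) {1..d}) (monomials d N)"
  proof (rule inj_onI, rule poly_mapping_eqI)
    fix a b i assume ab: "a \<in> monomials d N" "b \<in> monomials d N"
      and eq: "restrict (lookup a) {1..d} = restrict (lookup b) {1..d}"
    show "lookup a i = lookup b i"
    proof (cases "i \<in> {1..d}")
      case True then show ?thesis using fun_cong[OF eq, of i] by simp
    next
      case False
      then have "i \<notin> keys a" "i \<notin> keys b" using ab by (auto simp: monomials_def)
      then show ?thesis by (simp add: in_keys_iff)
    qed
  qed
qed

lemma monomials_0: "monomials d 0 = {0}"
  by (auto simp: monomials_def sdegree_eq_0_iff)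

lemma monomial_value_add: "monomial_value d \<tau> (m + n) = monomial_value d \<tau> m * monomial_value d \<tau> n"
  by (simp add: monomial_value_def lookup_add power_add prod.distrib)

lemma monomial_value_0 [simp]: "monomial_value d \<tau> 0 = 1"
  by (simp add: monomial_value_def)

lemma monomial_value_single:
  "1 \<le> i \<Longrightarrow> i \<le> d \<Longrightarrow> monomial_value d \<tau> (Poly_Mapping.single i k) = \<tau> i ^ k"
  by (simp add: monomial_value_def lookup_single when_def if_distrib prod.delta cong: if_cong)

text \<open>The series exp(a z).\<close>

definition fps_exp_malg :: "'k::cancel_comm_monoid_add malg \<Rightarrow> 'k malg fps" where
  "fps_exp_malg a = Abs_fps (\<lambda>N. pconst (1 / fact N) * a ^ N)"

context
  fixes h :: "'m::cancel_comm_monoid_add malg \<Rightarrow> 'n::cancel_comm_monoid_add malg"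
  assumes h: "qhom h"
begin

lemmas h_simps = qhomD[OF h]

lemma eval_series_add: "eval_series h \<tau> d (F + G) = eval_series h \<tau> d F + eval_series h \<tau> d G"
  by (rule fps_ext) (simp add: eval_series_def plus_mseries_def h_simps distrib_left sum.distrib)

lemma eval_series_uminus: "eval_series h \<tau> d (- F) = - eval_series h \<tau> d F"
  by (rule fps_ext) (simp add: eval_series_def uminus_mseries_def h_simps sum_negf)

lemma eval_series_diff: "eval_series h \<tau> d (F - G) = eval_series h \<tau> d F - eval_series h \<tau> d G"
  by (rule fps_ext) (simp add: eval_series_def minus_mseries_def h_simps right_diff_distrib sum_subtractf)

lemma eval_series_0: "eval_series h \<tau> d 0 = 0"
  by (rule fps_ext) (simp add: eval_series_def zero_mseries_def h_simps)

lemma eval_series_1: "eval_series h \<tau> d 1 = 1"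
proof (rule fps_ext)
  fix N
  show "fps_nth (eval_series h \<tau> d 1) N = fps_nth 1 N"
  proof (cases "N = 0")
    case True then show ?thesis by (simp add: eval_series_def one_mseries_def monomials_0 h_simps)
  next
    case False
    then have "0 \<notin> monomials d N" by (simp add: monomials_def)
    then have "(\<Sum>m\<in>monomials d N. pconst (monomial_value d \<tau> m) * h (scoeff 1 m)) = 0"
      by (intro sum.neutral) (auto simp: one_mseries_def h_simps)
    then show ?thesis using False by (simp add: eval_series_def)
  qed
qed

lemma eval_series_mult: "eval_series h \<tau> d (F * G) = eval_series h \<tau> d F * eval_series h \<tau> d G"
proof (rule fps_ext)
  fix N
  let ?f = "\<lambda>a. pconst (monomial_value d \<tau> a) * h (scoeff F a)"
  let ?g = "\<lambda>a. pconst (monomial_value d \<tau> a) * h (scoeff G a)"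
  have "fps_nth (eval_series h \<tau> d (F * G)) N =
      (\<Sum>m\<in>monomials d N. \<Sum>(a, b)\<in>{(a, b). a + b = m}. ?f a * ?g b)"
    by (auto simp: eval_series_def times_mseries_def h_simps sum_distrib_left split_def
        monomial_value_add[symmetric] intro!: sum.cong)
      (auto simp: monomial_value_add mult_ac)
  also have "\<dots> = (\<Sum>(m, a, b)\<in>Sigma (monomials d N) (\<lambda>m. {(a, b). a + b = m}). ?f a * ?g b)"
    by (subst sum.Sigma) (auto simp: finite_monomials finite_splits[unfolded split_def] split_def)
  \<comment> \<open>Degrees add, so the factorisations of all monomials of degree \<open>N\<close>
    can be sorted by the degree \<open>i\<close> of the left factor.\<close>
  also have "\<dots> = (\<Sum>(i, a, b)\<in>Sigma {0..N} (\<lambda>i. monomials d i \<times> monomials d (N - i)). ?f a * ?g b)"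
    by (rule sum.reindex_bij_witness[where i = "\<lambda>(i, a, b). (a + b, a, b)" and j = "\<lambda>(m, a, b). (sdegree a, a, b)"])
      (auto simp: monomials_def sdegree_add keys_nat_add subset_iff)
  also have "\<dots> = (\<Sum>i=0..N. (\<Sum>a\<in>monomials d i. ?f a) * (\<Sum>b\<in>monomials d (N - i). ?g b))"
    by (subst sum.Sigma[symmetric]) (auto simp: finite_monomials sum_product sum.cartesian_product)
  finally show "fps_nth (eval_series h \<tau> d (F * G)) N = fps_nth (eval_series h \<tau> d F * eval_series h \<tau> d G) N"
    by (simp add: eval_series_def fps_mult_nth)
qed

lemma eval_series_sum: "eval_series h \<tau> d (sum f A) = (\<Sum>i\<in>A. eval_series h \<tau> d (f i))"
  by (induction A rule: infinite_finite_induct) (auto simp: eval_series_add eval_series_0)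

lemma eval_series_prod: "eval_series h \<tau> d (prod f A) = (\<Prod>i\<in>A. eval_series h \<tau> d (f i))"
  by (induction A rule: infinite_finite_induct) (auto simp: eval_series_mult eval_series_1)

lemma eval_series_power: "eval_series h \<tau> d (F ^ n) = eval_series h \<tau> d F ^ n"
  by (induction n) (auto simp: eval_series_mult eval_series_1)

lemma eval_series_sign: "eval_series h \<tau> d ((-1) ^ n) = (-1) ^ n"
  by (simp add: eval_series_power eval_series_uminus eval_series_1)

lemma eval_series_tvar:
  assumes "1 \<le> i" "i \<le> d"
  shows "eval_series h \<tau> d (tvar i) = fps_const (pconst (\<tau> i)) * fps_X"
proof (rule fps_ext)
  fix N
  have "fps_nth (eval_series h \<tau> d (tvar i)) N =
      (\<Sum>m\<in>monomials d N. if m = Poly_Mapping.single i 1 then pconst (\<tau> i) else 0)"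
    unfolding eval_series_def tvar_def fps_nth_Abs_fps scoeff_Series
    by (intro sum.cong refl) (use assms in \<open>auto simp: h_simps monomial_value_single\<close>)
  also have "\<dots> = (if N = 1 then pconst (\<tau> i) else 0)"
    using assms by (auto simp: sum.delta finite_monomials) (auto simp: monomials_def)
  finally show "fps_nth (eval_series h \<tau> d (tvar i)) N = fps_nth (fps_const (pconst (\<tau> i)) * fps_X) N"
    by (auto simp: fps_X_def)
qed

lemma eval_series_exp:
  assumes "1 \<le> j" "j \<le> d"
  shows "eval_series h \<tau> d (exp_series a j) = fps_exp_malg (pconst (\<tau> j) * h a)"
proof (rule fps_ext)
  fix N
  have "fps_nth (eval_series h \<tau> d (exp_series a j)) N =
     (\<Sum>m\<in>monomials d N. if m = Poly_Mapping.single j N then pconst (1 / fact N) * (pconst (\<tau> j) * h a) ^ N else 0)"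
    unfolding eval_series_def exp_series_def fps_nth_Abs_fps scoeff_Series
  proof (intro sum.cong refl)
    fix m assume m: "m \<in> monomials d N"
    have "keys m \<subseteq> {j} \<longleftrightarrow> m = Poly_Mapping.single j N"
    proof
      assume *: "keys m \<subseteq> {j}"
      then have "lookup m j = N" using m sdegree_superset[of "{j}" m] by (simp add: monomials_def)
      with * show "m = Poly_Mapping.single j N"
        by (intro poly_mapping_eqI) (auto simp: lookup_single when_def in_keys_iff)
    qed (auto split: if_splits)
    then show "pconst (monomial_value d \<tau> m) * h (if keys m \<subseteq> {j} then pconst (1 / fact (lookup m j)) * a ^ lookup m j else 0) =
       (if m = Poly_Mapping.single j N then pconst (1 / fact N) * (pconst (\<tau> j) * h a) ^ N else 0)"
      using assms by (auto simp: h_simps monomial_value_single power_mult_distrib)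
  qed
  also have "\<dots> = pconst (1 / fact N) * (pconst (\<tau> j) * h a) ^ N"
    using assms by (auto simp: sum.delta finite_monomials) (auto simp: monomials_def split: if_splits)
  finally show "fps_nth (eval_series h \<tau> d (exp_series a j)) N = fps_nth (fps_exp_malg (pconst (\<tau> j) * h a)) N"
    by (simp add: fps_exp_malg_def)
qed

text \<open>Multiplying by t_j restores exactly the monomials of \<open>F\<close> that contain t_j;
  the others make up the value of \<open>F\<close> at t_j = 0.\<close>

lemma eval_series_div_t:
  assumes "1 \<le> j" "j \<le> d"
  shows "fps_X * fps_const (pconst (\<tau> j)) * eval_series h \<tau> d (div_t j F) =
    eval_series h \<tau> d F - eval_series h (\<tau>(j := 0)) d F"
proof (rule fps_ext)
  fix N
  show "fps_nth (fps_X * fps_const (pconst (\<tau> j)) * eval_series h \<tau> d (div_t j F)) N =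
    fps_nth (eval_series h \<tau> d F - eval_series h (\<tau>(j := 0)) d F) N"
  proof (cases N)
    case 0 then show ?thesis by (simp add: eval_series_def monomials_0 mult.assoc)
  next
    case (Suc M)
    let ?e = "Poly_Mapping.single j (1::nat)"
    have mv: "monomial_value d (\<tau>(j := 0)) m = (if lookup m j = 0 then monomial_value d \<tau> m else 0)" for m
      using assms by (auto simp: monomial_value_def intro!: prod.cong)
    have "fps_nth (eval_series h \<tau> d F - eval_series h (\<tau>(j := 0)) d F) N =
       (\<Sum>m\<in>monomials d N. if lookup m j = 0 then 0 else pconst (monomial_value d \<tau> m) * h (scoeff F m))"
      by (auto simp: eval_series_def mv sum_subtractf[symmetric] intro!: sum.cong)
    also have "\<dots> = (\<Sum>m\<in>{m \<in> monomials d N. lookup m j \<noteq> 0}. pconst (monomial_value d \<tau> m) * h (scoeff F m))"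
      by (rule sum.mono_neutral_cong_right) (auto simp: finite_monomials)
    also have "\<dots> = (\<Sum>m\<in>monomials d M. pconst (monomial_value d \<tau> (m + ?e)) * h (scoeff F (m + ?e)))"
    proof (rule sum.reindex_bij_witness[where i = "\<lambda>m. m + ?e" and j = "\<lambda>m. m - ?e"])
      fix m assume m: "m \<in> {m \<in> monomials d N. lookup m j \<noteq> 0}"
      show eq: "m - ?e + ?e = m"
        using m by (intro poly_mapping_eqI) (auto simp: lookup_add lookup_minus lookup_single when_def)
      have "keys (m - ?e) \<subseteq> keys m" by (auto simp: in_keys_iff lookup_minus)
      moreover have "sdegree m = sdegree (m - ?e) + 1"
        using sdegree_add[of "m - ?e" ?e] unfolding eq by simp
      ultimately show "m - ?e \<in> monomials d M" using m Suc by (auto simp: monomials_def)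
      show "pconst (monomial_value d \<tau> (m - ?e + ?e)) * h (scoeff F (m - ?e + ?e)) =
          pconst (monomial_value d \<tau> m) * h (scoeff F m)"
        unfolding eq ..
    qed (use assms Suc in \<open>auto simp: monomials_def keys_nat_add sdegree_add lookup_add\<close>)
    finally show ?thesis
      using assms by (simp add: Suc eval_series_def div_t_def mult.assoc sum_distrib_left
          monomial_value_add monomial_value_single mult_ac)
  qed
qed

end

lemma fps_exp_malg_add: "fps_exp_malg (a + b) = fps_exp_malg a * fps_exp_malg b"
proof (rule fps_ext)
  fix N
  have "pconst (1 / fact N) * (a + b) ^ N =
      (\<Sum>k=0..N. pconst (1 / fact k) * a ^ k * (pconst (1 / fact (N - k)) * b ^ (N - k)))"
    unfolding binomial_ring sum_distrib_left atMost_atLeast0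
  proof (intro sum.cong refl)
    fix k assume "k \<in> {0..N}"
    then have "(1 / fact N) * of_nat (N choose k) = (1 / fact k) * (1 / fact (N - k) :: rat)"
      by (simp add: binomial_fact field_simps)
    then have "pconst (1 / fact N) * pconst (of_nat (N choose k)) = 
       (pconst (1 / fact k) * pconst (1 / fact (N - k)) :: 'a \<Rightarrow>\<^sub>0 rat)"
      by (metis pconst_simps(4))
    moreover have "pconst (of_nat n) = (of_nat n :: 'a \<Rightarrow>\<^sub>0 rat)" for n by (induction n) auto
    ultimately have *: "pconst (1 / fact N) * of_nat (N choose k) = 
       (pconst (1 / fact k) * pconst (1 / fact (N - k)) :: 'a \<Rightarrow>\<^sub>0 rat)" by simp
    have "pconst (1 / fact N) * (of_nat (N choose k) * a ^ k * b ^ (N - k)) =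
      (pconst (1 / fact N) * of_nat (N choose k)) * (a ^ k * b ^ (N - k))" by (simp only: mult_ac)
    also have "\<dots> = pconst (1 / fact k) * a ^ k * (pconst (1 / fact (N - k)) * b ^ (N - k))"
      unfolding * by (simp only: mult_ac)
    finally show "pconst (1 / fact N) * (of_nat (N choose k) * a ^ k * b ^ (N - k)) = \<dots>" .
  qed
  then show "fps_nth (fps_exp_malg (a + b)) N = fps_nth (fps_exp_malg a * fps_exp_malg b) N"
    by (simp add: fps_exp_malg_def fps_mult_nth)
qed

lemma fps_exp_malg_0 [simp]: "fps_exp_malg 0 = 1"
  by (rule fps_ext) (simp add: fps_exp_malg_def power_0_left)

section \<open>Generating series at a rational point\<close>

definition index_lists :: "nat \<Rightarrow> nat \<Rightarrow> nat list set" where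
  "index_lists l N = {ns. length ns = l \<and> 0 \<notin> set ns \<and> sum_list ns = N + l}"

definition index_value :: "rat list \<Rightarrow> nat list \<Rightarrow> rat" where
  "index_value ts ns = (\<Prod>i<length ts. (ts ! i) ^ (ns ! i - 1))"

text \<open>The generating series of \<open>c\<close> at t_i = \<tau>_i z. An index n_i contributes
  the exponent n_i - 1, whence the total N + l in \<open>index_lists\<close>.\<close>

definition value_series :: "(nat list \<Rightarrow> 'n::cancel_comm_monoid_add malg) \<Rightarrow> rat list \<Rightarrow> 'n malg fps" where
  "value_series c ts = Abs_fps (\<lambda>N. \<Sum>ns\<in>index_lists (length ts) N. pconst (index_value ts ns) * c ns)"

lemma finite_index_lists: "finite (index_lists l N)"
proof (rule finite_subset)
  show "index_lists l N \<subseteq> {ns. set ns \<subseteq> {..N + l} \<and> length ns = l}"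
    by (auto simp: index_lists_def dest: member_le_sum_list)
qed (rule finite_lists_length_eq, simp)

lemma sum_index_lists_minus:
  assumes "ns \<in> index_lists l N"
  shows "(\<Sum>i<l. ns ! i - 1) = N"
proof -
  have "(\<Sum>i<l. ns ! i - 1) + l = (\<Sum>i<l. ns ! i - 1 + 1)" by (simp only: sum.distrib) simp
  also have "\<dots> = (\<Sum>i<l. ns ! i)"
  proof (intro sum.cong refl)
    fix i assume "i \<in> {..<l}"
    then have "ns ! i \<in> set ns" using assms by (auto simp: index_lists_def)
    then have "ns ! i \<noteq> 0" using assms by (metis (mono_tags, lifting) index_lists_def mem_Collect_eq)
    then show "ns ! i - 1 + 1 = ns ! i" by simp
  qed
  also have "\<dots> = N + l" using assms by (auto simp: index_lists_def sum_list_sum_nth atLeast0LessThan)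
  finally show ?thesis by simp
qed

lemma value_series_cong:
  "ts = ts' \<Longrightarrow> (\<And>ns. length ns = length ts \<Longrightarrow> 0 \<notin> set ns \<Longrightarrow> c ns = c' ns) \<Longrightarrow> value_series c ts = value_series c' ts'"
  by (auto simp: value_series_def index_lists_def intro!: arg_cong[where f = Abs_fps] sum.cong)

lemma prod_fps_const: "(\<Prod>i<n. fps_const (f i)) = fps_const (\<Prod>i<(n::nat). f i)"
  by (induction n) auto

text \<open>Each linear form becomes a multiple of z, so the term of index list \<open>ns\<close>
  contributes to a single power of z, with exponent the sum of the n_i - 1. This agrees with the
  truncation by degree in \<open>gen_series\<close>.\<close>

lemma eval_series_gen_series:
  assumes h: "qhom h" and len: "length ts = length L"
    and L: "\<And>i. i < length L \<Longrightarrow> eval_series h \<tau> d (L ! i) = fps_const (pconst (ts ! i)) * fps_X"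
  shows "eval_series h \<tau> d (gen_series c L) = value_series (\<lambda>ns. h (c ns)) ts"
proof (rule fps_ext)
  fix N
  let ?l = "length L"
  let ?P = "\<lambda>ns. \<Prod>i<?l. (L ! i) ^ (ns ! i - 1)"
  have P: "eval_series h \<tau> d (?P ns) = fps_const (pconst (index_value ts ns)) * fps_X ^ (\<Sum>i<?l. ns ! i - 1)" for ns
  proof -
    have "eval_series h \<tau> d (?P ns) = (\<Prod>i<?l. (fps_const (pconst (ts ! i)) * fps_X) ^ (ns ! i - 1))"
      by (simp add: eval_series_prod[OF h] eval_series_power[OF h] L)
    also have "\<dots> = (\<Prod>i<?l. fps_const (pconst (ts ! i) ^ (ns ! i - 1))) * (\<Prod>i<?l. fps_X ^ (ns ! i - 1))"
      by (simp add: power_mult_distrib prod.distrib fps_const_power)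
    also have "(\<Prod>i<?l. fps_const (pconst (ts ! i) ^ (ns ! i - 1))) =
        fps_const (\<Prod>i<?l. pconst (ts ! i) ^ (ns ! i - 1))"
      by (rule prod_fps_const)
    finally show ?thesis by (simp add: power_sum index_value_def len pconst_prod)
  qed
  have "fps_nth (eval_series h \<tau> d (gen_series c L)) N =
      (\<Sum>m\<in>monomials d N. \<Sum>ns\<in>index_lists ?l N. pconst (monomial_value d \<tau> m) * (h (c ns) * h (scoeff (?P ns) m)))"
    unfolding eval_series_def gen_series_def fps_nth_Abs_fps scoeff_Series
    by (intro sum.cong refl)
      (auto simp: qhomD[OF h] sum_distrib_left monomials_def index_lists_def intro!: sum.cong)
  also have "\<dots> = (\<Sum>ns\<in>index_lists ?l N. h (c ns) * fps_nth (eval_series h \<tau> d (?P ns)) N)"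
    by (subst sum.swap) (simp add: eval_series_def sum_distrib_left mult_ac)
  also have "\<dots> = (\<Sum>ns\<in>index_lists ?l N. pconst (index_value ts ns) * h (c ns))"
  proof (intro sum.cong refl)
    fix ns assume ns: "ns \<in> index_lists ?l N"
    show "h (c ns) * fps_nth (eval_series h \<tau> d (?P ns)) N = pconst (index_value ts ns) * h (c ns)"
      unfolding P sum_index_lists_minus[OF ns] by (simp add: mult.commute)
  qed
  finally show "fps_nth (eval_series h \<tau> d (gen_series c L)) N = fps_nth (value_series (\<lambda>ns. h (c ns)) ts) N"
    by (simp add: value_series_def len)
qed

lemma lookup_texp: "lookup (texp ns) i = (if 1 \<le> i \<and> i \<le> length ns then ns ! (i - 1) - 1 else 0)"
proof -
  have "lookup (texp ns) i = (\<Sum>j<length ns. if j = i - 1 \<and> 1 \<le> i then ns ! j - 1 else 0)"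
    by (auto simp: texp_def lookup_sum lookup_single when_def intro!: sum.cong)
  also have "\<dots> = (if 1 \<le> i then \<Sum>j<length ns. if j = i - 1 then ns ! j - 1 else 0 else 0)"
    by auto
  finally show ?thesis by (auto simp: sum.delta)
qed

text \<open>\<open>texp\<close> maps the index lists bijectively onto the monomials in t_1, ...,
  t_d; the inverse adds 1 to every exponent. Variables are counted from 1 and list entries from 0,
  hence \<open>i - 1\<close>.\<close>

lemma eval_series_eq_value_series:
  "eval_series h (\<lambda>i. ts ! (i - 1)) (length ts) F = value_series (\<lambda>ns. h (scoeff F (texp ns))) ts"
proof (rule fps_ext)
  fix N
  let ?d = "length ts"
  have deg: "sdegree m = (\<Sum>i<?d. lookup m (i + 1))" if "keys m \<subseteq> {1..?d}" for m
    by (subst sdegree_superset[OF _ that]) (auto intro!: sum.reindex_bij_witness[where i = "\<lambda>i. i + 1" and j = "\<lambda>i. i - 1"])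
  have val: "monomial_value ?d (\<lambda>i. ts ! (i - 1)) m = (\<Prod>i<?d. ts ! i ^ lookup m (i + 1))" for m
    unfolding monomial_value_def
    by (rule prod.reindex_bij_witness[where i = "\<lambda>i. i + 1" and j = "\<lambda>i. i - 1"]) auto
  have "(\<Sum>m\<in>monomials ?d N. pconst (monomial_value ?d (\<lambda>i. ts ! (i - 1)) m) * h (scoeff F m)) =
    (\<Sum>ns\<in>index_lists ?d N. pconst (index_value ts ns) * h (scoeff F (texp ns)))"
  proof (rule sum.reindex_bij_witness[where i = texp and j = "\<lambda>m. map (\<lambda>i. lookup m (i + 1) + 1) [0..<?d]"])
    fix m assume m: "m \<in> monomials ?d N"
    show eq: "texp (map (\<lambda>i. lookup m (i + 1) + 1) [0..<?d]) = m"
      using m by (intro poly_mapping_eqI) (auto simp: lookup_texp monomials_def in_keys_iff)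
    have "(\<Sum>i<?d. lookup m (i + 1) + 1) = N + ?d"
      using m deg[of m] by (simp only: sum.distrib) (simp add: monomials_def)
    then show "map (\<lambda>i. lookup m (i + 1) + 1) [0..<?d] \<in> index_lists ?d N"
      by (auto simp: index_lists_def sum_list_sum_nth atLeast0LessThan)
    show "pconst (index_value ts (map (\<lambda>i. lookup m (i + 1) + 1) [0..<?d])) *
        h (scoeff F (texp (map (\<lambda>i. lookup m (i + 1) + 1) [0..<?d]))) =
        pconst (monomial_value ?d (\<lambda>i. ts ! (i - 1)) m) * h (scoeff F m)"
      unfolding eq val index_value_def by (auto intro!: arg_cong2[where f = "(*)"] arg_cong[where f = pconst] prod.cong)
  next
    fix ns assume ns: "ns \<in> index_lists ?d N"
    then have l: "length ns = ?d" by (simp add: index_lists_def)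
    have pos: "ns ! i \<noteq> 0" if "i < ?d" for i
    proof -
      have "ns ! i \<in> set ns" using that l by simp
      then show ?thesis using ns by (metis (mono_tags, lifting) index_lists_def mem_Collect_eq)
    qed
    then show "map (\<lambda>i. lookup (texp ns) (i + 1) + 1) [0..<?d] = ns"
      by (intro nth_equalityI) (auto simp: l lookup_texp)
    have keys: "keys (texp ns) \<subseteq> {1..?d}" by (auto simp: in_keys_iff lookup_texp l split: if_splits)
    have "sdegree (texp ns) = (\<Sum>i<?d. ns ! i - 1)" unfolding deg[OF keys]
      by (intro sum.cong) (auto simp: lookup_texp l)
    then show "texp ns \<in> monomials ?d N"
      using keys sum_index_lists_minus[OF ns] by (simp add: monomials_def)
  qed
  then show "fps_nth (eval_series h (\<lambda>i. ts ! (i - 1)) ?d F) N = fps_nth (value_series (\<lambda>ns. h (scoeff F (texp ns))) ts) N"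
    by (simp add: eval_series_def value_series_def)
qed

section \<open>The moulds of a homomorphism from the algebra of symbols\<close>

text \<open>As a difference of potentials the logarithm is visibly additive along paths, whatever
  the order of the end points.\<close>

lemma log_coeff_eq: "log_coeff a b = (\<Sum>r<b. pvar (Log r)) - (\<Sum>r<a. pvar (Log r))"
proof -
  have "(\<Sum>r=a..<b. pvar (Log r)) = (\<Sum>r<b. pvar (Log r)) - (\<Sum>r<a. pvar (Log r))" if "a \<le> b" for a b
    using sum.atLeastLessThan_concat[of 0 a b "\<lambda>r. pvar (Log r)"] that
    by (simp add: atLeast0LessThan algebra_simps)
  from this[of a b] this[of b a] show ?thesis by (auto simp: log_coeff_def)
qed

definition reg_mould :: "(symb mpoly \<Rightarrow> 'n::cancel_comm_monoid_add malg) \<Rightarrow> 'n malg fps mould" where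
  "reg_mould f a w = value_series (\<lambda>ns. f (sym_coeff (a # map fst w) ns)) (map snd w)"

text \<open>Sign, order and negation are chosen so that, after the shift by t_j, this is the factor
  (-1)^(j-i) [y_(j-1)^(-1), ..., y_i^(-1) | t_j - t_(j-1), ..., t_j - t_i] of the coproduct. With
  the same choice the inversion formula becomes an identity between products of moulds.\<close>

definition inv_mould :: "(symb mpoly \<Rightarrow> 'n::cancel_comm_monoid_add malg) \<Rightarrow> 'n malg fps mould" where
  "inv_mould f a w = (-1) ^ length w *
     value_series (\<lambda>ns. f (inv_coeff (a # map fst w) ns)) (map (\<lambda>x. - snd x) (rev w))"

definition log_mould :: "(symb mpoly \<Rightarrow> 'n::cancel_comm_monoid_add malg) \<Rightarrow> nat \<Rightarrow> nat \<Rightarrow> rat \<Rightarrow> 'n malg fps" where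
  "log_mould f a b t = fps_exp_malg (pconst t * f (log_coeff a b))"

definition qinv :: "rat \<Rightarrow> 'n::cancel_comm_monoid_add malg fps" where
  "qinv t = fps_const (pconst (1 / t))"

lemma value_series_Nil [simp]: "value_series c [] = fps_const (c [])"
proof (rule fps_ext)
  fix N
  have "index_lists 0 N = (if N = 0 then {[]} else {})" by (auto simp: index_lists_def)
  then show "fps_nth (value_series c []) N = fps_nth (fps_const (c [])) N"
    by (simp add: value_series_def index_value_def)
qed

lemma exp_mould_log_mould: "qhom f \<Longrightarrow> exp_mould (log_mould f)"
  by (auto simp: exp_mould_def log_mould_def log_coeff_eq qhomD fps_exp_malg_add[symmetric] algebra_simps)

lemma reg_mould_Nil: "qhom f \<Longrightarrow> reg_mould f a [] = 1"
  by (simp add: reg_mould_def qhomD)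

lemma inv_coeff_singleton: "inv_coeff [a] ns = 1"
  by (subst inv_coeff.simps) simp

lemma inv_mould_Nil: "qhom f \<Longrightarrow> inv_mould f a [] = 1"
  by (simp add: inv_mould_def inv_coeff_singleton qhomD)

lemma eval_gen_series_map:
  assumes h: "qhom h" and L: "\<And>r. r \<in> set rs \<Longrightarrow> eval_series h \<tau> d (F r) = fps_const (pconst (g r)) * fps_X"
  shows "eval_series h \<tau> d (gen_series c (map F rs)) = value_series (\<lambda>ns. h (c ns)) (map g rs)"
  by (rule eval_series_gen_series[OF h]) (auto intro: L nth_mem)

lemma eval_series_minus_tvar:
  assumes "qhom h" "1 \<le> i" "i \<le> d"
  shows "eval_series h \<tau> d (- tvar i) = fps_const (pconst (- \<tau> i)) * fps_X"
  using assms by (simp add: eval_series_uminus eval_series_tvar) (simp flip: fps_const_neg)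

lemma eval_series_tvar_diff:
  assumes "qhom h" "1 \<le> i" "i \<le> d" "1 \<le> j" "j \<le> d"
  shows "eval_series h \<tau> d (tvar i - tvar j) = fps_const (pconst (\<tau> i - \<tau> j)) * fps_X"
  using assms by (simp add: eval_series_diff eval_series_tvar) (simp add: left_diff_distrib flip: fps_const_sub)

text \<open>Negating an argument multiplies its power by (-1)^(n-1); the sign in the coefficients,
  the same as in \<open>inv_coeff\<close>, compensates for this.\<close>

lemma value_series_rev_neg:
  "value_series (\<lambda>ns. (-1) ^ (\<Sum>n\<leftarrow>ns. n - 1) * c (rev ns)) (map uminus (rev ts)) = value_series c ts"
proof (rule fps_ext)
  fix N
  have val: "index_value (map uminus (rev ts)) (rev ns) = (-1) ^ (\<Sum>n\<leftarrow>ns. n - 1) * index_value ts ns"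
    if "length ns = length ts" for ns
  proof -
    have "index_value (map uminus (rev ts)) (rev ns) = (\<Prod>i<length ts. (- ts ! i) ^ (ns ! i - 1))"
      unfolding index_value_def
      by (rule prod.reindex_bij_witness[where i = "\<lambda>i. length ts - 1 - i" and j = "\<lambda>i. length ts - 1 - i"])
        (auto simp: rev_nth that)
    also have "\<dots> = (\<Prod>i<length ts. (-1) ^ (ns ! i - 1) * (ts ! i) ^ (ns ! i - 1))"
      by (intro prod.cong refl) (simp flip: power_mult_distrib)
    also have "\<dots> = (-1) ^ (\<Sum>i<length ts. ns ! i - 1) * index_value ts ns"
      by (simp add: prod.distrib power_sum index_value_def)
    also have "(\<Sum>i<length ts. ns ! i - 1) = (\<Sum>n\<leftarrow>ns. n - 1)"
      by (simp add: sum_list_sum_nth atLeast0LessThan that)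
    finally show ?thesis .
  qed
  have "(\<Sum>ns\<in>index_lists (length ts) N. pconst (index_value (map uminus (rev ts)) ns) * ((-1) ^ (\<Sum>n\<leftarrow>ns. n - 1) * c (rev ns))) =
     (\<Sum>ns\<in>index_lists (length ts) N. pconst (index_value ts ns) * c ns)"
  proof (rule sum.reindex_bij_witness[where i = rev and j = rev])
    fix ns assume ns: "ns \<in> index_lists (length ts) N"
    then show "rev ns \<in> index_lists (length ts) N" by (auto simp: index_lists_def sum_list_rev)
    have "(\<Sum>n\<leftarrow>rev ns. n - 1) = (\<Sum>n\<leftarrow>ns. n - 1)" by (simp flip: rev_map add: sum_list_rev)
    moreover have "((-1) ^ k * (-1) ^ k :: 'a malg) = 1" for k by (simp flip: power_add mult_2)
    moreover have "pconst ((-1) ^ k) = ((-1) ^ k :: 'a malg)" for k by (simp only: pconst_simps)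
    ultimately show "pconst (index_value ts (rev ns)) * c (rev ns) =
        pconst (index_value (map uminus (rev ts)) ns) * ((-1) ^ (\<Sum>n\<leftarrow>ns. n - 1) * c (rev ns))"
      using val[of "rev ns"] ns by (simp add: index_lists_def mult_ac flip: mult.assoc)
  qed (auto simp: index_lists_def sum_list_rev)
  then show "fps_nth (value_series (\<lambda>ns. (-1) ^ (\<Sum>n\<leftarrow>ns. n - 1) * c (rev ns)) (map uminus (rev ts))) N =
      fps_nth (value_series c ts) N"
    by (simp add: value_series_def)
qed

lemma map_nth_range:
  assumes "i \<le> j" "j \<le> length w"
  shows "map (\<lambda>r. w ! (r - 1)) [i + 1..<j + 1] = take (j - i) (drop i w)"
  by (rule nth_equalityI) (use assms in \<open>auto simp del: upt_Suc\<close>)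

context
  fixes f :: "symb mpoly \<Rightarrow> 'n::cancel_comm_monoid_add malg"
    and a :: nat and w :: word and \<tau> :: "nat \<Rightarrow> rat"
  assumes f: "qhom f"
begin

text \<open>Here and in the next three lemmas only the values of \<open>\<tau>\<close> at the
  variables that occur are prescribed, so that the same evaluation remains available when another
  variable is set to zero.\<close>

lemma eval_reg_part:
  assumes "i \<le> length w" and "\<And>r. i < r \<Longrightarrow> r \<le> length w \<Longrightarrow> \<tau> r = snd (w ! (r - 1))"
  shows "eval_series f \<tau> (length w) (gen_series (sym_coeff (b # map fst (drop i w))) (map tvar [i + 1..<length w + 1])) =
    reg_mould f b (drop i w)"
proof -
  have "map \<tau> [i + 1..<length w + 1] = map snd (map (\<lambda>r. w ! (r - 1)) [i + 1..<length w + 1])"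
    using assms by auto
  also have "\<dots> = map snd (drop i w)" using assms by (subst map_nth_range) auto
  finally show ?thesis unfolding reg_mould_def
    by (subst eval_gen_series_map[OF f, where g = \<tau>]) (auto intro!: eval_series_tvar[OF f])
qed

lemma eval_reg_part_shift:
  assumes "i < length w" and "\<And>r. i + 1 < r \<Longrightarrow> r \<le> length w \<Longrightarrow> \<tau> r = snd (w ! (r - 1))" and "\<tau> (i + 1) = c"
  shows "eval_series f \<tau> (length w) (gen_series (sym_coeff (b # map fst (drop (i + 1) w)))
      (map (\<lambda>r. tvar r - tvar (i + 1)) [i + 2..<length w + 1])) =
    reg_mould f b (shift c (drop (i + 1) w))"
proof -
  have "map (\<lambda>r. \<tau> r - c) [(i + 1) + 1..<length w + 1] =
      map (\<lambda>x. snd x - c) (map (\<lambda>r. w ! (r - 1)) [(i + 1) + 1..<length w + 1])"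
    using assms by auto
  also have "\<dots> = map snd (shift c (drop (i + 1) w))" using assms by (subst map_nth_range) auto
  finally show ?thesis unfolding reg_mould_def using assms
    by (subst eval_gen_series_map[OF f, where g = "\<lambda>r. \<tau> r - c"]) (auto simp: eval_series_tvar_diff[OF f])
qed

lemma eval_inv_part:
  assumes "i \<le> length w" and "\<And>r. 1 \<le> r \<Longrightarrow> r \<le> i \<Longrightarrow> \<tau> r = snd (w ! (r - 1))"
  shows "eval_series f \<tau> (length w) (gen_series (inv_coeff (a # map fst (take i w))) (map (\<lambda>r. - tvar r) (rev [1..<i + 1]))) =
    (-1) ^ i * inv_mould f a (take i w)"
proof -
  have "map (\<lambda>r. - \<tau> r) (rev [1..<i + 1]) = map (\<lambda>x. - snd x) (rev (map (\<lambda>r. w ! (r - 1)) [0 + 1..<i + 1]))"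
    using assms by (auto simp: rev_map)
  also have "\<dots> = map (\<lambda>x. - snd x) (rev (take i w))" using assms by (subst map_nth_range) auto
  finally have 1: "map (\<lambda>r. - \<tau> r) (rev [1..<i + 1]) = \<dots>" .
  have "eval_series f \<tau> (length w) (gen_series (inv_coeff (a # map fst (take i w))) (map (\<lambda>r. - tvar r) (rev [1..<i + 1]))) =
      value_series (\<lambda>ns. f (inv_coeff (a # map fst (take i w)) ns)) (map (\<lambda>r. - \<tau> r) (rev [1..<i + 1]))"
    by (rule eval_gen_series_map[OF f], rule eval_series_minus_tvar[OF f]) (use assms in auto)
  then show ?thesis unfolding 1 inv_mould_def using assms by (simp add: min_absorb2)
qed

lemma eval_inv_part_shift:
  assumes "i < length w" and "\<And>r. 1 \<le> r \<Longrightarrow> r \<le> i \<Longrightarrow> \<tau> r = snd (w ! (r - 1))" and "\<tau> (i + 1) = c"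
  shows "eval_series f \<tau> (length w) (gen_series (inv_coeff (a # map fst (take i w)))
      (map (\<lambda>r. tvar (i + 1) - tvar r) (rev [1..<i + 1]))) =
    (-1) ^ i * inv_mould f a (shift c (take i w))"
proof -
  have "map (\<lambda>r. c - \<tau> r) (rev [1..<i + 1]) = map (\<lambda>x. c - snd x) (rev (map (\<lambda>r. w ! (r - 1)) [0 + 1..<i + 1]))"
    using assms by (auto simp: rev_map)
  also have "\<dots> = map (\<lambda>x. c - snd x) (rev (take i w))" using assms by (subst map_nth_range) auto
  also have "\<dots> = map (\<lambda>x. - snd x) (rev (shift c (take i w)))"
    by (auto simp: shift_def rev_map split_def)
  finally have 1: "map (\<lambda>r. c - \<tau> r) (rev [1..<i + 1]) = \<dots>" .
  have "eval_series f \<tau> (length w) (gen_series (inv_coeff (a # map fst (take i w)))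
      (map (\<lambda>r. tvar (i + 1) - tvar r) (rev [1..<i + 1]))) =
      value_series (\<lambda>ns. f (inv_coeff (a # map fst (take i w)) ns)) (map (\<lambda>r. c - \<tau> r) (rev [1..<i + 1]))"
    unfolding assms(3)[symmetric]
    by (rule eval_gen_series_map[OF f], rule eval_series_tvar_diff[OF f]) (use assms in auto)
  then show ?thesis unfolding 1 inv_mould_def using assms by (simp add: min_absorb2)
qed

end

text \<open>After multiplication by z, the first sum of the recursion yields, up to sign, the
  products of R(u), z and A(v) with v nonempty; the two other sums together yield the one-letter
  part of \<open>pole\<close> and the block sum of \<open>pole\<close>. The left side of the
  recursion supplies the missing term with v empty.\<close>

lemma inverse_moulds_symb:
  fixes f :: "symb mpoly \<Rightarrow> 'n::cancel_comm_monoid_add malg"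
  assumes f: "qhom f"
  shows "inverse_moulds qinv fps_X (log_mould f) (inv_mould f) (reg_mould f)"
  unfolding inverse_moulds_def
proof (intro conjI allI impI reg_mould_Nil[OF f])
  fix a and w :: word assume g: "good a w"
  let ?R = "inv_mould f" and ?A = "reg_mould f" and ?e = "log_mould f" and ?D = "\<lambda>_ :: nat. pole qinv (fps_X :: 'n malg fps)"
  show "mm ?R (mm ?D ?A) a w = block_sum (block ?e ?R ?A) (pole qinv fps_X) a w"
  proof (cases "w = []")
    case True
    then show ?thesis by (simp add: mm_def inv_mould_Nil[OF f] reg_mould_Nil[OF f] pole_def)
  next
    case False
    define d where "d = length w"
    define p where "p = a # map fst w"
    define \<tau> where "\<tau> = (\<lambda>i. map snd w ! (i - 1))"
    have \<tau>: "\<tau> (i + 1) = snd (w ! i)" if "i < d" for i using that by (simp add: \<tau>_def d_def)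
    have tk: "take (i + 1) p = a # map fst (take i w)" for i by (simp add: p_def take_map)
    have dr: "drop i p = endp a (take i w) # map fst (drop i w)" if "i \<le> d" for i
    proof (cases i)
      case (Suc k)
      then show ?thesis using that
        by (simp add: p_def d_def drop_map take_Suc_conv_app_nth flip: Cons_nth_drop_Suc)
    qed (simp add: p_def)
    define S1 where "S1 = (\<lambda>j. (-1) ^ (d - 1 + j) *
           gen_series (inv_coeff (take (j + 1) p)) (map (\<lambda>r. - tvar r) (rev [1..<j + 1])) *
           gen_series (sym_coeff (drop j p)) (map tvar [j + 1..<d + 1]))"
    define S2 where "S2 = (\<lambda>j. (-1) ^ (d - 1 + j) *
           gen_series (inv_coeff (take j p)) (map (\<lambda>r. - tvar r) (rev [1..<j])) *
           gen_series (sym_coeff (drop j p)) (map tvar [j + 1..<d + 1]))"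
    define S3 where "S3 = (\<lambda>j. (-1) ^ (d + j) *
           gen_series (inv_coeff (take j p)) (map (\<lambda>r. tvar j - tvar r) (rev [1..<j])) *
           exp_series (log_coeff (hd p) (last p)) j *
           gen_series (sym_coeff (drop j p)) (map (\<lambda>r. tvar r - tvar j) [j + 1..<d + 1]))"
    define S where "S = (\<Sum>j\<in>{0..<d}. S1 j) + (\<Sum>j\<in>{1..d}. div_t j (S2 j)) + (\<Sum>j\<in>{1..d}. div_t j (S3 j))"
    have d0: "d \<noteq> 0" using False by (simp add: d_def)
    have "inv_coeff p = (\<lambda>ns. (-1) ^ (\<Sum>n\<leftarrow>ns. n - 1) * scoeff S (texp (rev ns)))"
      by (subst inv_coeff.simps) (use d0 in \<open>simp add: S_def S1_def S2_def S3_def Let_def p_def d_def\<close>)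
    \<comment> \<open>The sign and the reversed index list in \<open>inv_coeff\<close> cancel
      against the negated reversed arguments in \<open>inv_mould\<close>.\<close>
    then have "value_series (\<lambda>ns. f (inv_coeff p ns)) (map (\<lambda>x. - snd x) (rev w)) =
        value_series (\<lambda>ns. (-1) ^ (\<Sum>n\<leftarrow>ns. n - 1) * f (scoeff S (texp (rev ns)))) (map uminus (rev (map snd w)))"
      by (simp add: qhomD[OF f] rev_map comp_def)
    also have "\<dots> = eval_series f \<tau> d S"
      by (subst value_series_rev_neg) (simp add: eval_series_eq_value_series[symmetric] \<tau>_def d_def)
    finally have R: "?R a w = (-1) ^ d * eval_series f \<tau> d S"
      by (simp add: inv_mould_def p_def d_def)
    define t where "t = (\<lambda>i. ?A (endp a (take i w)) (drop i w))"
    define u where "u = (\<lambda>i c. ?R a (shift c (take i w)) * ?A (fst (w ! i)) (shift c (drop (i + 1) w)))"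
    have E1: "eval_series f \<tau> d (S1 i) = (-1) ^ (d - 1) * (?R a (take i w) * t i)" if "i < d" for i
    proof -
      have e1: "eval_series f \<tau> (length w) (gen_series (inv_coeff (a # map fst (take i w))) (map (\<lambda>r. - tvar r) (rev [1..<i + 1]))) =
          (-1) ^ i * ?R a (take i w)"
        by (rule eval_inv_part[OF f]) (use that in \<open>auto simp: d_def \<tau>_def\<close>)
      have e2: "eval_series f \<tau> (length w) (gen_series (sym_coeff (endp a (take i w) # map fst (drop i w))) (map tvar [i + 1..<length w + 1])) =
          ?A (endp a (take i w)) (drop i w)"
        by (rule eval_reg_part[OF f]) (use that in \<open>auto simp: d_def \<tau>_def\<close>)
      have "eval_series f \<tau> d (S1 i) = (-1) ^ (d - 1 + i) * ((-1) ^ i * ?R a (take i w)) * t i"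
        unfolding S1_def eval_series_mult[OF f] eval_series_sign[OF f] tk dr[OF less_imp_le[OF that]] t_def d_def e1 e2 ..
      then show ?thesis by (simp add: power_add mult_ac)
    qed
    have dr': "drop (i + 1) p = fst (w ! i) # map fst (drop (i + 1) w)" if "i < d" for i
      using that by (simp add: p_def d_def drop_map flip: Cons_nth_drop_Suc)
    \<comment> \<open>\<open>S2 (i + 1)\<close> does not contain t_(i+1), so \<open>\<tau>'\<close>
      is left free at this variable.\<close>
    have E2: "eval_series f \<tau>' d (S2 (i + 1)) = (-1) ^ d * u i 0"
      if "i < d" "\<And>r. 1 \<le> r \<Longrightarrow> r \<le> d \<Longrightarrow> r \<noteq> i + 1 \<Longrightarrow> \<tau>' r = snd (w ! (r - 1))" for i \<tau>'
    proof -
      have e1: "eval_series f \<tau>' (length w) (gen_series (inv_coeff (a # map fst (take i w))) (map (\<lambda>r. - tvar r) (rev [1..<i + 1]))) =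
          (-1) ^ i * ?R a (take i w)"
        by (rule eval_inv_part[OF f]) (use that in \<open>auto simp: d_def\<close>)
      have e2: "eval_series f \<tau>' (length w) (gen_series (sym_coeff (fst (w ! i) # map fst (drop (i + 1) w))) (map tvar [i + 1 + 1..<length w + 1])) =
          ?A (fst (w ! i)) (drop (i + 1) w)"
        by (rule eval_reg_part[OF f]) (use that in \<open>auto simp: d_def\<close>)
      have "eval_series f \<tau>' d (S2 (i + 1)) = (-1) ^ (d - 1 + (i + 1)) * ((-1) ^ i * ?R a (take i w)) * ?A (fst (w ! i)) (drop (i + 1) w)"
        unfolding S2_def eval_series_mult[OF f] eval_series_sign[OF f] tk dr'[OF that(1)] d_def e1 e2 ..
      moreover have "d - 1 + (i + 1) = d + i" using d0 by simp
      ultimately show ?thesis by (simp add: power_add mult_ac u_def)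
    qed
    have E3: "eval_series f \<tau>' d (S3 (i + 1)) = - ((-1) ^ d * (?e a (endp a w) c * u i c))"
      if "i < d" "\<And>r. 1 \<le> r \<Longrightarrow> r \<le> d \<Longrightarrow> r \<noteq> i + 1 \<Longrightarrow> \<tau>' r = snd (w ! (r - 1))" "\<tau>' (i + 1) = c" for i \<tau>' c
    proof -
      have hl: "hd p = a" "last p = endp a w" by (auto simp: p_def endp_def last_map)
      have e1: "eval_series f \<tau>' (length w) (gen_series (inv_coeff (a # map fst (take i w)))
          (map (\<lambda>r. tvar (i + 1) - tvar r) (rev [1..<i + 1]))) = (-1) ^ i * ?R a (shift c (take i w))"
        by (rule eval_inv_part_shift[OF f]) (use that in \<open>auto simp: d_def\<close>)
      have e2: "eval_series f \<tau>' (length w) (gen_series (sym_coeff (fst (w ! i) # map fst (drop (i + 1) w)))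
          (map (\<lambda>r. tvar r - tvar (i + 1)) [i + 1 + 1..<length w + 1])) =
          ?A (fst (w ! i)) (shift c (drop (i + 1) w))"
        unfolding add.assoc one_add_one
        by (rule eval_reg_part_shift[OF f]) (use that in \<open>auto simp: d_def\<close>)
      have e3: "eval_series f \<tau>' (length w) (exp_series (log_coeff a (endp a w)) (i + 1)) = ?e a (endp a w) c"
        using that by (simp add: eval_series_exp[OF f] d_def log_mould_def)
      have "eval_series f \<tau>' d (S3 (i + 1)) = (-1) ^ (d + (i + 1)) * ((-1) ^ i * ?R a (shift c (take i w))) *
          ?e a (endp a w) c * ?A (fst (w ! i)) (shift c (drop (i + 1) w))"
        unfolding S3_def eval_series_mult[OF f] eval_series_sign[OF f] tk dr'[OF that(1)] d_def hl e1 e2 e3 ..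
      then show ?thesis by (simp add: power_add mult_ac u_def)
    qed
    \<comment> \<open>By \<open>E2\<close> the quotient of \<open>S2\<close> contributes nothing.
      The term \<open>u i 0\<close> comes from the value of \<open>S3\<close> at t_(i+1) = 0, where
      the exponential is 1: it is the polar part of \<open>S2\<close> in disguise, since the two
      polar parts cancel.\<close>
    have E23: "fps_X * (eval_series f \<tau> d (div_t (i + 1) (S2 (i + 1))) + eval_series f \<tau> d (div_t (i + 1) (S3 (i + 1)))) =
        (-1) ^ d * (qinv (snd (w ! i)) * (u i 0 - ?e a (endp a w) (snd (w ! i)) * u i (snd (w ! i))))"
      if i: "i < d" for i
    proof -
      let ?c = "snd (w ! i)"
      let ?Y = "eval_series f \<tau> d (div_t (i + 1) (S2 (i + 1))) + eval_series f \<tau> d (div_t (i + 1) (S3 (i + 1)))"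
      have e0: "?e a b 0 = 1" for b by (simp add: log_mould_def)
      have c: "?c \<noteq> 0" using g i by (auto simp: good_def d_def)
      have "fps_X * fps_const (pconst ?c) * ?Y = (-1) ^ d * (u i 0 - ?e a (endp a w) ?c * u i ?c)"
        using eval_series_div_t[OF f, of "i + 1" d \<tau> "S2 (i + 1)"] eval_series_div_t[OF f, of "i + 1" d \<tau> "S3 (i + 1)"] i
          E2[of i \<tau>] E2[of i "\<tau>(i + 1 := 0)"] E3[of i \<tau> ?c] E3[of i "\<tau>(i + 1 := 0)" 0] \<tau>[OF i]
        by (simp add: distrib_left e0 \<tau>_def d_def algebra_simps)
      then have "fps_const (pconst (1 / ?c)) * (fps_X * fps_const (pconst ?c) * ?Y) =
          fps_const (pconst (1 / ?c)) * ((-1) ^ d * (u i 0 - ?e a (endp a w) ?c * u i ?c))"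
        by (rule arg_cong)
      moreover have "fps_const (pconst (1 / ?c)) * (fps_X * fps_const (pconst ?c) * ?Y) = fps_X * ?Y"
      proof -
        have "fps_const (pconst (1 / ?c)) * (fps_X * fps_const (pconst ?c) * ?Y) =
          fps_const (pconst (1 / ?c) * pconst ?c) * (fps_X * ?Y)"
          by (simp only: fps_const_mult[symmetric] mult_ac)
        also have "pconst (1 / ?c) * pconst ?c = (1 :: 'n malg)"
          using c by (simp flip: pconst_simps(4))
        finally show ?thesis by simp
      qed
      ultimately show ?thesis by (simp add: qinv_def mult_ac)
    qed
    have "fps_X * ?R a w = (-1) ^ d * (fps_X * eval_series f \<tau> d S)"
      by (simp add: R mult_ac)
    also have "fps_X * eval_series f \<tau> d S = fps_X * (\<Sum>i<d. eval_series f \<tau> d (S1 i)) +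
       (\<Sum>i<d. fps_X * (eval_series f \<tau> d (div_t (i + 1) (S2 (i + 1))) + eval_series f \<tau> d (div_t (i + 1) (S3 (i + 1)))))"
    proof -
      have "(\<Sum>j\<in>{1..d}. F j) = (\<Sum>i<d. F (i + 1))" for F :: "nat \<Rightarrow> 'n malg fps"
        by (rule sum.reindex_bij_witness[where i = "\<lambda>i. i + 1" and j = "\<lambda>i. i - 1"]) auto
      then show ?thesis
        by (simp add: S_def eval_series_add[OF f] eval_series_sum[OF f] distrib_left sum.distrib sum_distrib_left
            atLeast0LessThan)
    qed
    also have "\<dots> = (\<Sum>i<d. (-1) ^ (d - 1) * (fps_X * (?R a (take i w) * t i))) +
       (\<Sum>i<d. (-1) ^ d * (qinv (snd (w ! i)) * (u i 0 - ?e a (endp a w) (snd (w ! i)) * u i (snd (w ! i)))))"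
      unfolding sum_distrib_left
      by (intro arg_cong2[where f = "(+)"] sum.cong refl E23) (auto simp: E1 mult_ac)
    also have "(-1) ^ d * \<dots> = - (\<Sum>i<d. fps_X * (?R a (take i w) * t i)) +
       (\<Sum>i<d. qinv (snd (w ! i)) * (u i 0 - ?e a (endp a w) (snd (w ! i)) * u i (snd (w ! i))))"
    proof -
      have "(-1) ^ d * ((-1) ^ (d - 1) * x) = - x" for x :: "'n malg fps"
        using d0 by (cases d) simp_all
      then show ?thesis by (simp add: distrib_left sum_distrib_left sum_negf)
    qed
    finally have main: "fps_X * ?R a w + (\<Sum>i<d. fps_X * (?R a (take i w) * t i)) - (\<Sum>i<d. qinv (snd (w ! i)) * u i 0) =
       - (\<Sum>i<d. qinv (snd (w ! i)) * (?e a (endp a w) (snd (w ! i)) * u i (snd (w ! i))))"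
      by (simp add: right_diff_distrib sum_subtractf)
    \<comment> \<open>Only the cuts after no letter and after one letter contribute, because
      \<open>pole\<close> vanishes on longer words.\<close>
    have mmD: "mm ?D ?A b v = fps_X * ?A b v - (if v = [] then 0 else qinv (snd (hd v)) * ?A (fst (hd v)) (tl v))" for b v
    proof (cases v)
      case (Cons x v')
      have "split_sum (\<lambda>u v. pole qinv fps_X (x # u) * ?A (endp b (x # u)) v) v' = - (qinv (snd x) * ?A (fst x) v')"
      proof (cases v')
        case (Cons y v'')
        then show ?thesis by (simp add: pole_def)
      qed (simp add: pole_def)
      then show ?thesis by (simp add: mm_def Cons) (simp add: pole_def)
    qed (simp add: mm_def pole_def)
    have "mm ?R (mm ?D ?A) a w = (\<Sum>i\<le>d. ?R a (take i w) * mm ?D ?A (endp a (take i w)) (drop i w))"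
      by (simp add: mm_def[of ?R] split_sum_index d_def)
    also have "\<dots> = (\<Sum>i\<le>d. fps_X * (?R a (take i w) * t i)) - (\<Sum>i\<le>d. if i < d then qinv (snd (w ! i)) * u i 0 else 0)"
      unfolding sum_subtractf[symmetric]
      by (intro sum.cong refl) (auto simp: mmD t_def d_def u_def hd_drop_conv_nth tl_drop drop_Suc algebra_simps)
    also have "(\<Sum>i\<le>d. fps_X * (?R a (take i w) * t i)) = fps_X * ?R a w + (\<Sum>i<d. fps_X * (?R a (take i w) * t i))"
      by (simp add: lessThan_Suc_atMost[symmetric] t_def d_def reg_mould_Nil[OF f])
    also have "(\<Sum>i\<le>d. if i < d then qinv (snd (w ! i)) * u i 0 else 0) = (\<Sum>i<d. qinv (snd (w ! i)) * u i 0)"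
      by (simp add: lessThan_Suc_atMost[symmetric])
    also note main
    also have "- (\<Sum>i<d. qinv (snd (w ! i)) * (?e a (endp a w) (snd (w ! i)) * u i (snd (w ! i)))) =
        block_sum (block ?e ?R ?A) (pole qinv fps_X) a w"
    proof -
      have "endp (fst (w ! i)) (drop (Suc i) w) = endp a w" if "i < d" for i
        using endp_append[of a "take i w" "w ! i # drop (Suc i) w"] that
        by (simp add: d_def Cons_nth_drop_Suc del: endp_append)
      then show ?thesis
        by (simp add: block_sum_pole False mark_sum_index block_def u_def d_def mult_ac)
    qed
    finally show ?thesis .
  qed
qed

section \<open>The coproduct on symbols in terms of moulds\<close>

text \<open>\<open>cut_points\<close> with i_1 = s prescribed, so that the first block can be split
  off and the next one starts from its own \<open>s\<close>.\<close>

definition cuts :: "nat \<Rightarrow> nat \<Rightarrow> (nat list \<times> nat list) set" where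
  "cuts s d = {(is, js). length is = length js + 1 \<and> hd is = s \<and> last is = d + 1 \<and>
     (\<forall>a<length js. is ! a \<le> js ! a \<and> js ! a < is ! (a + 1))}"

lemma cuts_hd_le: "(is, js) \<in> cuts s d \<Longrightarrow> s \<le> d + 1"
proof (induction js arbitrary: "is" s)
  case (Cons j js)
  obtain i i' is' where is': "is = i # i' # is'"
    using Cons.prems by (cases "is"; cases "tl is") (auto simp: cuts_def)
  have "(i' # is', js) \<in> cuts i' d"
    using Cons.prems by (auto simp: cuts_def is' All_less_Suc2)
  from Cons.IH[OF this] show ?case using Cons.prems by (auto simp: cuts_def is' All_less_Suc2)
qed (auto simp: cuts_def length_Suc_conv)

lemma cuts_rec:
  assumes "s \<le> d"
  shows "cuts s d = (\<lambda>(j, i', is, js). (s # is, j # js)) `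
    (SIGMA j:{s..d}. SIGMA i':{j+1..d+1}. cuts i' d)"
proof (intro equalityI subsetI)
  fix x assume x: "x \<in> cuts s d"
  obtain "is" js where xx: "x = (is, js)" by force
  have "js \<noteq> []" using x assms by (auto simp: xx cuts_def length_Suc_conv)
  then obtain j js' where js: "js = j # js'" by (cases js) auto
  then obtain i i' is' where is': "is = i # i' # is'"
    using x by (cases "is"; cases "tl is") (auto simp: cuts_def xx)
  have 1: "(i' # is', js') \<in> cuts i' d" and 2: "i = s" "s \<le> j" "j < i'"
    using x by (auto simp: cuts_def is' js xx All_less_Suc2)
  then have "i' \<le> d + 1" using cuts_hd_le by blast
  then have "(j, i', i' # is', js') \<in> (SIGMA j:{s..d}. SIGMA i':{j+1..d+1}. cuts i' d)"
    using 1 2 by auto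
  moreover have "x = (\<lambda>(j, i', is, js). (s # is, j # js)) (j, i', i' # is', js')"
    by (simp add: xx js is' 2)
  ultimately show "x \<in> (\<lambda>(j, i', is, js). (s # is, j # js)) ` (SIGMA j:{s..d}. SIGMA i':{j+1..d+1}. cuts i' d)"
    by blast
next
  fix x assume "x \<in> (\<lambda>(j, i', is, js). (s # is, j # js)) ` (SIGMA j:{s..d}. SIGMA i':{j+1..d+1}. cuts i' d)"
  then obtain j i' "is" js where x: "x = (s # is, j # js)" "s \<le> j" "j < i'" and c: "(is, js) \<in> cuts i' d"
    by (auto simp: Suc_le_eq)
  then obtain is' where "is = i' # is'" by (cases "is") (auto simp: cuts_def)
  then show "x \<in> cuts s d" using x c by (auto simp: cuts_def All_less_Suc2)
qed

lemma cuts_end: "cuts (d + 1) d = {([d + 1], [])}"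
proof -
  have "js = []" if c: "(is, js) \<in> cuts (d + 1) d" for "is" js
  proof (cases js)
    case (Cons j js')
    then obtain i i' is' where is': "is = i # i' # is'"
      using c by (cases "is"; cases "tl is") (auto simp: cuts_def)
    have "(i' # is', js') \<in> cuts i' d" "d + 1 < i'"
      using c by (auto simp: cuts_def is' Cons All_less_Suc2)
    then show ?thesis using cuts_hd_le[of "i' # is'" js' i' d] by simp
  qed
  note Nil = this
  show ?thesis
  proof (intro equalityI subsetI)
    fix x assume x: "x \<in> cuts (d + 1) d"
    obtain "is" js where xx: "x = (is, js)" by force
    have "js = []" using Nil x xx by blast
    then show "x \<in> {([d + 1], [])}" using x by (auto simp: xx cuts_def length_Suc_conv)
  qed (simp add: cuts_def)
qed

lemma cuts_props:
  "s \<le> d + 1 \<Longrightarrow> finite (cuts s d) \<and> (\<forall>(is, js)\<in>cuts s d. sorted_wrt (<) is \<and> set is \<subseteq> {s..d + 1} \<and> set js \<subseteq> {s..d})"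
proof (induction "d + 1 - s" arbitrary: s rule: less_induct)
  case less
  show ?case
  proof (cases "s = d + 1")
    case True
    then show ?thesis by (simp only: cuts_end) simp
  next
    case False
    then have s: "s \<le> d" using less.prems by simp
    have IH: "finite (cuts i' d)" "(is, js) \<in> cuts i' d \<Longrightarrow> sorted_wrt (<) is \<and> set is \<subseteq> {i'..d + 1} \<and> set js \<subseteq> {i'..d}"
      if "s < i'" "i' \<le> d + 1" for i' "is" js
      using less.hyps[of i'] bspec[OF conjunct2[OF less.hyps[of i']], of "(is, js)"] that s by auto
    have fin: "finite (cuts s d)"
      unfolding cuts_rec[OF s] by (intro finite_imageI finite_SigmaI IH) auto
    have "sorted_wrt (<) (s # is) \<and> set (s # is) \<subseteq> {s..d + 1} \<and> set (j # js) \<subseteq> {s..d}"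
      if "s \<le> j" "j \<le> d" "j < i'" "i' \<le> d + 1" "(is, js) \<in> cuts i' d" for j i' "is" js
      using IH(2)[of i' "is" js] that by fastforce
    note props = this
    show ?thesis
    proof (intro conjI ballI)
      fix x assume "x \<in> cuts s d"
      then have "x \<in> (\<lambda>(j, i', is, js). (s # is, j # js)) ` (SIGMA j:{s..d}. SIGMA i':{j+1..d+1}. cuts i' d)"
        by (simp only: cuts_rec[OF s])
      then obtain j i' "is" js where x: "x = (s # is, j # js)" and 1: "s \<le> j" "j \<le> d" "j < i'" "i' \<le> d + 1" and 2: "(is, js) \<in> cuts i' d"
        by (auto simp: Suc_le_eq)
      show "case x of (is, js) \<Rightarrow> sorted_wrt (<) is \<and> set is \<subseteq> {s..d + 1} \<and> set js \<subseteq> {s..d}"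
        using props[OF 1 2] by (simp only: x prod.case)
    qed (rule fin)
  qed
qed

lemma sum_Sigma3:
  assumes "finite A" "\<And>x. x \<in> A \<Longrightarrow> finite (B x)" "\<And>x y. x \<in> A \<Longrightarrow> y \<in> B x \<Longrightarrow> finite (C y)"
  shows "(\<Sum>(x, y, z)\<in>(SIGMA x:A. SIGMA y:B x. C y). g x y z) = (\<Sum>x\<in>A. \<Sum>y\<in>B x. \<Sum>z\<in>C y. g x y z)"
proof -
  have "(\<Sum>x\<in>A. \<Sum>y\<in>B x. \<Sum>z\<in>C y. g x y z) = (\<Sum>x\<in>A. \<Sum>(y, z)\<in>Sigma (B x) C. g x y z)"
    by (intro sum.cong refl sum.Sigma) (auto intro: assms)
  also have "\<dots> = (\<Sum>(x, y, z)\<in>(SIGMA x:A. SIGMA y:B x. C y). g x y z)"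
    by (subst sum.Sigma) (auto intro!: assms finite_SigmaI simp: split_def)
  finally show ?thesis by simp
qed

text \<open>The triple (i, j, i') stands for the block of the letters i, ..., i' - 1 with marked
  letter j. Letters are counted from 1, and \<open>P i\<close> is the point where letter i starts,
  so the contracted letter ends at \<open>P i'\<close>. The induction splits off the first
  block.\<close>

lemma block_sum_cuts:
  fixes w :: word and a :: nat and B :: "'k::comm_ring_1 blockfun"
  defines "d \<equiv> length w" and "P \<equiv> (\<lambda>i. (a # map fst w) ! (i - 1))" and "t \<equiv> (\<lambda>j. snd (w ! (j - 1)))"
  assumes "1 \<le> s" "s \<le> d + 1"
  shows "(\<Sum>(is, js)\<in>cuts s d. F (map (\<lambda>(i, j). (P i, t j)) (zip (tl is) js)) *
      (\<Prod>r<length js. B (P (is ! r)) (take (js ! r - is ! r) (drop (is ! r - 1) w)) (w ! (js ! r - 1))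
         (take (is ! (r + 1) - js ! r - 1) (drop (js ! r) w)))) = block_sum B F (P s) (drop (s - 1) w)"
  using assms(4,5)
proof (induction "d + 1 - s" arbitrary: s F rule: less_induct)
  case less
  let ?B = "\<lambda>i j i'. B (P i) (take (j - i) (drop (i - 1) w)) (w ! (j - 1)) (take (i' - j - 1) (drop j w))"
  let ?C = "\<lambda>is js. map (\<lambda>(i, j). (P i, t j)) (zip (tl is) js)"
  show ?case
  proof (cases "s = d + 1")
    case True
    show ?thesis unfolding True cuts_end by (simp add: d_def)
  next
    case False
    then have s: "1 \<le> s" "s \<le> d" using less.prems by auto
    have inj: "inj_on (\<lambda>(j, i', is, js). (s # is, j # js)) (SIGMA j:{s..d}. SIGMA i':{j+1..d+1}. cuts i' d)"
      by (auto simp: inj_on_def cuts_def)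
    have fin: "finite (cuts i' d)" if "i' \<le> d + 1" for i' using cuts_props that by blast
    have "(\<Sum>(is, js)\<in>cuts s d. F (?C is js) * (\<Prod>r<length js. ?B (is ! r) (js ! r) (is ! (r + 1)))) =
      (\<Sum>(j, i', is, js)\<in>(SIGMA j:{s..d}. SIGMA i':{j+1..d+1}. cuts i' d).
         F (?C (s # is) (j # js)) * (\<Prod>r<Suc (length js). ?B ((s # is) ! r) ((j # js) ! r) ((s # is) ! (r + 1))))"
      unfolding cuts_rec[OF s(2)] by (subst sum.reindex[OF inj]) (simp add: split_def)
    also have "\<dots> = (\<Sum>j=s..d. \<Sum>i'=j+1..d+1. \<Sum>(is, js)\<in>cuts i' d.
         F (?C (s # is) (j # js)) * (\<Prod>r<Suc (length js). ?B ((s # is) ! r) ((j # js) ! r) ((s # is) ! (r + 1))))"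
      using sum_Sigma3[of "{s..d}" "\<lambda>j. {j+1..d+1}" "\<lambda>i'. cuts i' d" "\<lambda>j i' (is, js).
         F (?C (s # is) (j # js)) * (\<Prod>r<Suc (length js). ?B ((s # is) ! r) ((j # js) ! r) ((s # is) ! (r + 1)))"] fin
      by (simp add: split_def)
    also have "\<dots> = (\<Sum>j=s..d. \<Sum>i'=j+1..d+1. ?B s j i' *
         block_sum B (\<lambda>w'. F ((P i', t j) # w')) (P i') (drop (i' - 1) w))"
    proof (intro sum.cong refl)
      fix j i' assume j: "j \<in> {s..d}" and i': "i' \<in> {j+1..d+1}"
      have "(\<Sum>(is, js)\<in>cuts i' d.
         F (?C (s # is) (j # js)) * (\<Prod>r<Suc (length js). ?B ((s # is) ! r) ((j # js) ! r) ((s # is) ! (r + 1)))) =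
       (\<Sum>(is, js)\<in>cuts i' d. ?B s j i' *
         (F ((P i', t j) # ?C is js) * (\<Prod>r<length js. ?B (is ! r) (js ! r) (is ! (r + 1)))))"
      proof (intro sum.cong refl, clarify)
        fix "is" js assume c: "(is, js) \<in> cuts i' d"
        then obtain is' where is': "is = i' # is'" by (cases "is") (auto simp: cuts_def)
        show "F (?C (s # is) (j # js)) * (\<Prod>r<Suc (length js). ?B ((s # is) ! r) ((j # js) ! r) ((s # is) ! (r + 1))) =
          ?B s j i' * (F ((P i', t j) # ?C is js) * (\<Prod>r<length js. ?B (is ! r) (js ! r) (is ! (r + 1))))"
          unfolding prod.lessThan_Suc_shift by (simp add: is' mult_ac)
      qed
      also have "\<dots> = ?B s j i' * (\<Sum>(is, js)\<in>cuts i' d.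
         F ((P i', t j) # ?C is js) * (\<Prod>r<length js. ?B (is ! r) (js ! r) (is ! (r + 1))))"
        by (simp add: sum_distrib_left split_def)
      also have "(\<Sum>(is, js)\<in>cuts i' d. F ((P i', t j) # ?C is js) * (\<Prod>r<length js. ?B (is ! r) (js ! r) (is ! (r + 1)))) =
         block_sum B (\<lambda>w'. F ((P i', t j) # w')) (P i') (drop (i' - 1) w)"
        by (rule less.hyps) (use j i' s in auto)
      finally show "(\<Sum>(is, js)\<in>cuts i' d.
         F (?C (s # is) (j # js)) * (\<Prod>r<Suc (length js). ?B ((s # is) ! r) ((j # js) ! r) ((s # is) ! (r + 1)))) =
         ?B s j i' * block_sum B (\<lambda>w'. F ((P i', t j) # w')) (P i') (drop (i' - 1) w)" .
    qed
    \<comment> \<open>Here k = j - s and l = i' - j - 1 are the lengths of the two parts of the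
      block, the parameters of the index forms of \<open>mark_sum\<close> and
      \<open>split_sum\<close>.\<close>
    also have "\<dots> = (\<Sum>k<length (drop (s - 1) w). \<Sum>l\<le>length (drop (Suc k) (drop (s - 1) w)).
        ?B s (s + k) (s + k + 1 + l) *
         block_sum B (\<lambda>w'. F ((P (s + k + 1 + l), t (s + k)) # w')) (P (s + k + 1 + l)) (drop (s + k + l) w))"
    proof (rule sum.reindex_bij_witness[where i = "\<lambda>k. s + k" and j = "\<lambda>j. j - s"])
      fix j assume j: "j \<in> {s..d}"
      show "(\<Sum>l\<le>length (drop (Suc (j - s)) (drop (s - 1) w)). ?B s (s + (j - s)) (s + (j - s) + 1 + l) *
         block_sum B (\<lambda>w'. F ((P (s + (j - s) + 1 + l), t (s + (j - s))) # w')) (P (s + (j - s) + 1 + l)) (drop (s + (j - s) + l) w)) =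
         (\<Sum>i'=j+1..d+1. ?B s j i' * block_sum B (\<lambda>w'. F ((P i', t j) # w')) (P i') (drop (i' - 1) w))"
        by (rule sum.reindex_bij_witness[where i = "\<lambda>i'. i' - j - 1" and j = "\<lambda>l. j + 1 + l"])
          (use j s in \<open>auto simp: d_def\<close>)
    qed (use s in \<open>auto simp: d_def\<close>)
    also have "\<dots> = block_sum B F (P s) (drop (s - 1) w)"
    proof -
      have ne: "drop (s - 1) w \<noteq> []" using s by (auto simp: d_def)
      show ?thesis
        unfolding block_sum.simps[of B F "P s" "drop (s - 1) w"] mark_sum_index split_sum_index if_not_P[OF ne]
      proof (intro sum.cong refl)
        fix k l assume k: "k \<in> {..<length (drop (s - 1) w)}"
          and l: "l \<in> {..length (drop (Suc k) (drop (s - 1) w))}"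
        have x: "drop (s - 1) w ! k = w ! (s + k - 1)" "take k (drop (s - 1) w) = take (s + k - s) (drop (s - 1) w)"
           "drop (Suc k) (drop (s - 1) w) = drop (s + k) w" 
          using s k by (auto simp: d_def add.commute)
        have e: "endp (fst (w ! (s + k - 1))) (take l (drop (s + k) w)) = P (s + k + 1 + l)"
        proof (cases l)
          case 0
          then show ?thesis using s k by (auto simp: P_def d_def nth_Cons split: nat.splits)
        next
          case (Suc m)
          then have "l \<le> length (drop (s + k) w)" using l s by simp
          then have "take l (drop (s + k) w) = take m (drop (s + k) w) @ [w ! (s + k + m)]"
            using Suc by (simp add: take_Suc_conv_app_nth)
          then show ?thesis using Suc l s by (simp add: P_def)
        qed
        show "?B s (s + k) (s + k + 1 + l) *
           block_sum B (\<lambda>w'. F ((P (s + k + 1 + l), t (s + k)) # w')) (P (s + k + 1 + l)) (drop (s + k + l) w) =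
           B (P s) (take k (drop (s - 1) w)) (drop (s - 1) w ! k) (take l (drop (Suc k) (drop (s - 1) w))) *
           block_sum B (\<lambda>w'. F ((endp (fst (drop (s - 1) w ! k)) (take l (drop (Suc k) (drop (s - 1) w))), snd (drop (s - 1) w ! k)) # w'))
            (endp (fst (drop (s - 1) w ! k)) (take l (drop (Suc k) (drop (s - 1) w)))) (drop l (drop (Suc k) (drop (s - 1) w)))"
          unfolding x e by (simp add: t_def add.commute)
      qed
    qed
    finally show ?thesis .
  qed
qed

section \<open>The regular mould of a convolution\<close>

lemma qhom_inversion: "qhom inversion"
  unfolding inversion_def by (rule qhom_phom)

lemma qhom_ptensor_map_inversion: "qhom (ptensor_map inversion inversion)"
  unfolding ptensor_map_eq
  by (intro qhom_phom2 qhom_comp[OF qhom_inl2] qhom_comp[OF qhom_inr2] qhom_inversion)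

lemma qhom_cop: "qhom cop"
  unfolding cop_def[abs_def] cop_bar_def
  by (rule qhom_comp[OF qhom_ptensor_map_inversion qhom_phom])

lemma phom2_inl2: "qhom f \<Longrightarrow> qhom g \<Longrightarrow> phom2 f g (inl2 x) = f x"
  by (simp add: inl2_def phom2_ptensor qhom_1)

lemma phom2_inr2: "qhom f \<Longrightarrow> qhom g \<Longrightarrow> phom2 f g (inr2 x) = g x"
  by (simp add: inr2_def phom2_ptensor qhom_1)

lemma phom2_ptensor_map:
  assumes "qhom f" "qhom g" "qhom k" "qhom l"
  shows "phom2 f g (ptensor_map k l z) = phom2 (\<lambda>x. f (k x)) (\<lambda>x. g (l x)) z"
  unfolding ptensor_map_eq
  by (rule qhom2_eqI[OF qhom_comp[OF qhom_phom2[OF assms(1,2)] qhom_phom2[OF qhom_comp[OF qhom_inl2 assms(3)] qhom_comp[OF qhom_inr2 assms(4)]]]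
        qhom_phom2[OF qhom_comp[OF assms(1,3)] qhom_comp[OF assms(2,4)]]])
    (simp_all add: assms qhom_comp qhom_inl2 qhom_inr2 phom2_inl2 phom2_inr2)

text \<open>A list of length one is both increasing and decreasing, hence the separate case of empty
  \<open>ns\<close>, where the coefficient is 1.\<close>

lemma inversion_regular:
  assumes "sorted_wrt (<) p" "length p = length ns + 1"
  shows "inversion (sym_coeff p ns) = sym_coeff p ns"
proof (cases "ns = []")
  case True
  then show ?thesis by (simp add: qhom_1[OF qhom_inversion])
next
  case False
  then obtain x y q where "p = x # y # q" using assms(2) by (cases p; cases "tl p") auto
  then have "\<not> sorted_wrt (>) p" using assms(1) by auto
  then show ?thesis using False by (simp add: inversion_def)
qed

lemma inversion_inverted:
  assumes "sorted_wrt (<) p" "length p = length ns + 1"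
  shows "inversion (sym_coeff (rev p) ns) = inv_coeff p ns"
proof (cases "ns = []")
  case True
  then have "length p = Suc 0" using assms by simp
  then obtain a where "p = [a]" by (auto simp: length_Suc_conv)
  then show ?thesis using True by (simp add: qhom_1[OF qhom_inversion] inv_coeff_singleton)
next
  case False
  then show ?thesis using assms by (simp add: inversion_def sorted_wrt_rev)
qed

lemma cop_log_coeff: "cop (log_coeff a b) = inl2 (log_coeff a b) + inr2 (log_coeff a b)"
proof -
  have "cop (pvar (Log i)) = inl2 (pvar (Log i)) + inr2 (pvar (Log i))" for i
  proof -
    have q: "qhom (\<lambda>x. inl2 (inversion x))" "qhom (\<lambda>x. inr2 (inversion x))"
      by (rule qhom_comp[OF qhom_inl2 qhom_inversion] qhom_comp[OF qhom_inr2 qhom_inversion])+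
    have "inversion (pvar (Log i)) = pvar (Log i)" by (simp add: inversion_def)
    then show ?thesis
      by (simp add: cop_def cop_bar_def ptensor_map_eq qhom_add[OF qhom_phom2[OF q]] phom2_inl2[OF q] phom2_inr2[OF q]
          flip: inl2_def inr2_def)
  qed
  then show ?thesis
    by (simp add: log_coeff_eq qhomD[OF qhom_cop] qhomD[OF qhom_inl2] qhomD[OF qhom_inr2] sum.distrib)
qed

lemma log_mould_cop:
  assumes "qhom f" "qhom g"
  shows "log_mould (\<lambda>x. phom2 f g (cop x)) a b t = log_mould f a b t * log_mould g a b t"
  using assms by (simp add: log_mould_def cop_log_coeff qhomD[OF qhom_phom2] phom2_inl2 phom2_inr2 distrib_left fps_exp_malg_add)

lemma sorted_map_nth:
  assumes "sorted_wrt (<) (q :: nat list)" "sorted_wrt (<) is" "set is \<subseteq> {1..length q}"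
  shows "sorted_wrt (<) (map (\<lambda>i. q ! (i - 1)) is)"
  unfolding sorted_wrt_map
proof (rule sorted_wrt_mono_rel[OF _ assms(2)])
  fix x y assume "x \<in> set is" "y \<in> set is" "x < y"
  moreover from this have "x \<in> {1..length q}" "y \<in> {1..length q}" using assms(3) by blast+
  ultimately show "q ! (x - 1) < q ! (y - 1)"
    by (intro sorted_wrt_nth_less[OF assms(1)]) auto
qed

lemma inversion_log_coeff: "inversion (log_coeff a b) = log_coeff a b"
  by (simp add: log_coeff_eq qhomD[OF qhom_inversion]) (simp add: inversion_def)

text \<open>The letters before i_1 give the regular mould of \<open>g\<close>. Every later block
  becomes one letter for \<open>f\<close>, while its weights are seen by \<open>g\<close>. So the
  sum over i_1 is a product of moulds, and the sum over the remaining cuts is a block sum.\<close>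

lemma reg_mould_cop:
  fixes f g :: "symb mpoly \<Rightarrow> 'n::cancel_comm_monoid_add malg" and w :: word
  assumes f: "qhom f" and g: "qhom g" and sorted: "sorted_wrt (<) (a # map fst w)"
  defines "B \<equiv> block (log_mould g) (inv_mould g) (reg_mould g)"
  shows "reg_mould (\<lambda>x. phom2 f g (cop x)) a w = mm (reg_mould g) (\<lambda>a. block_sum B (reg_mould f a) a) a w"
proof (cases "w = []")
  case True
  then show ?thesis
    using reg_mould_Nil[OF qhom_comp[OF qhom_phom2[OF f g] qhom_cop]] f g
    by (simp add: mm_def reg_mould_Nil)
next
  case False
  define d where "d = length w"
  define p where "p = a # map fst w"
  define P where "P = (\<lambda>i. p ! (i - 1))"
  define \<tau> where "\<tau> = (\<lambda>i. map snd w ! (i - 1))"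
  \<comment> \<open>\<open>f\<close> and \<open>g\<close> preceded by the inversion, so that
    \<open>h\<close> applies to the series of the coproduct as they stand before inversion.\<close>
  define h where "h = phom2 (\<lambda>x. f (inversion x)) (\<lambda>x. g (inversion x))"
  have len: "length p = d + 1" by (simp add: p_def d_def)
  have fi: "qhom (\<lambda>x. f (inversion x))" and gi: "qhom (\<lambda>x. g (inversion x))"
    using qhom_comp[OF f qhom_inversion] qhom_comp[OF g qhom_inversion] .
  have h: "qhom h" unfolding h_def by (rule qhom_phom2[OF fi gi])
  have sort: "sorted_wrt (<) (map P is)" if "sorted_wrt (<) is" "set is \<subseteq> {1..d + 1}" for "is"
    unfolding P_def by (rule sorted_map_nth) (use sorted that len p_def in auto)
  have Pseg: "map P [i..<j + 1] = P i # map fst (take (j - i) (drop (i - 1) w))" if "1 \<le> i" "i \<le> j" "j \<le> d + 1" for i j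
    by (rule nth_equalityI) (use that in \<open>auto simp: P_def p_def d_def nth_Cons split: nat.splits simp del: upt_Suc\<close>)
  have \<tau>seg: "map (\<lambda>r. c (\<tau> r)) [i..<j] = map (\<lambda>x. c (snd x)) (take (j - i) (drop (i - 1) w))"
    if "1 \<le> i" "j \<le> d + 1" for i j and c :: "rat \<Rightarrow> rat"
    by (rule nth_equalityI) (use that in \<open>auto simp: \<tau>_def d_def\<close>)
  have \<tau>nth: "\<tau> j = snd (w ! (j - 1))" if "1 \<le> j" "j \<le> d" for j
    using that by (auto simp: \<tau>_def d_def)
  have left: "h (left_coeff q ns) = f (sym_coeff q ns)" if "sorted_wrt (<) q" "length q = length ns + 1" for q ns
    unfolding h_def left_coeff_def phom2_ptensor[OF fi gi] inversion_regular[OF that] by (simp add: qhom_1[OF gi])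
  have right: "h (right_coeff q ns) = g (sym_coeff q ns)" if "sorted_wrt (<) q" "length q = length ns + 1" for q ns
    unfolding h_def right_coeff_def phom2_ptensor[OF fi gi] inversion_regular[OF that] by (simp add: qhom_1[OF fi])
  have inv: "h (right_coeff (rev q) ns) = g (inv_coeff q ns)" if "sorted_wrt (<) q" "length q = length ns + 1" for q ns
    unfolding h_def right_coeff_def phom2_ptensor[OF fi gi] inversion_inverted[OF that] by (simp add: qhom_1[OF fi])
  have tvar: "eval_series h \<tau> d (tvar r) = fps_const (pconst (\<tau> r)) * fps_X" if "1 \<le> r" "r \<le> d" for r
    by (rule eval_series_tvar[OF h that])
  \<comment> \<open>\<open>C\<close> is the contracted word of a cut and \<open>bl\<close> the
    factor of one block; \<open>X1\<close>, \<open>X2\<close>, \<open>X3\<close> below are the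
    series of the left tensor factor, of the initial part and of one block.\<close>
  define C where "C = (\<lambda>is js. map (\<lambda>(i, j). (P i, snd (w ! (j - 1)))) (zip (tl is) js))"
  define bl where "bl = (\<lambda>i j i'. B (P i) (take (j - i) (drop (i - 1) w)) (w ! (j - 1)) (take (i' - j - 1) (drop j w)))"
  define X1 where "X1 = (\<lambda>is js. gen_series (left_coeff (map P is)) (map tvar js))"
  define X2 where "X2 = (\<lambda>s. gen_series (right_coeff (map P [1..<s + 1])) (map tvar [1..<s]))"
  define X3 where "X3 = (\<lambda>i j i'. (-1) ^ (j - i) *
          exp_series (ptensor 1 (log_coeff (P i) (P i'))) j *
          gen_series (right_coeff (map P (rev [i..<j + 1]))) (map (\<lambda>r. tvar j - tvar r) (rev [i..<j])) *
          gen_series (right_coeff (map P [j + 1..<i' + 1])) (map (\<lambda>r. tvar r - tvar j) [j + 1..<i']) :: symb mpoly2 mseries)"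
  have X1: "eval_series h \<tau> d (X1 is js) = reg_mould f (P s) (C is js)"
    if cut: "(is, js) \<in> cuts s d" and "1 \<le> s" "s \<le> d + 1" for "is" js s
  proof -
    have "is": "sorted_wrt (<) is" "set is \<subseteq> {s..d + 1}" "set js \<subseteq> {s..d}"
      using bspec[OF conjunct2[OF cuts_props[OF that(3)]] that(1)] by auto
    obtain is' where is': "is = s # is'" and len': "length is' = length js"
      using cut by (cases "is") (auto simp: cuts_def)
    have jr: "\<tau> (js ! i) = snd (w ! (js ! i - 1))" if "i < length js" for i
    proof -
      have "js ! i \<in> {s..d}" using nth_mem[OF that] "is"(3) by blast
      then show ?thesis using \<open>1 \<le> s\<close> by (intro \<tau>nth) auto
    qed
    have "map P is = P s # map fst (C is js)" "map \<tau> js = map snd (C is js)"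
      unfolding C_def is' using len' jr by (auto intro!: nth_equalityI)
    moreover have "eval_series h \<tau> d (X1 is js) = value_series (\<lambda>ns. h (left_coeff (map P is) ns)) (map \<tau> js)"
      unfolding X1_def by (rule eval_gen_series_map[OF h tvar]) (use "is"(3) that in auto)
    moreover have "value_series (\<lambda>ns. h (left_coeff (map P is) ns)) (map \<tau> js) =
       value_series (\<lambda>ns. f (sym_coeff (map P is) ns)) (map \<tau> js)"
      by (intro value_series_cong refl left sort "is") (use "is" len' that is' in auto)
    ultimately show ?thesis by (simp add: reg_mould_def)
  qed
  have X2: "eval_series h \<tau> d (X2 s) = reg_mould g a (take (s - 1) w)" if "1 \<le> s" "s \<le> d + 1" for s
  proof -
    have 1: "map P [1..<s + 1] = a # map fst (take (s - 1) w)" 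
      using Pseg[of 1 s] that by (simp add: P_def p_def)
    have 2: "map \<tau> [1..<s] = map snd (take (s - 1) w)" using \<tau>seg[of 1 s "\<lambda>x. x"] that by simp
    have "eval_series h \<tau> d (X2 s) = value_series (\<lambda>ns. h (right_coeff (map P [1..<s + 1]) ns)) (map \<tau> [1..<s])"
      unfolding X2_def by (rule eval_gen_series_map[OF h tvar]) (use that in auto)
    also have "\<dots> = value_series (\<lambda>ns. g (sym_coeff (map P [1..<s + 1]) ns)) (map \<tau> [1..<s])"
      by (intro value_series_cong refl right sort) (use that in \<open>auto simp del: upt_Suc\<close>)
    finally show ?thesis by (simp only: 1 2 reg_mould_def)
  qed
  have X3: "eval_series h \<tau> d (X3 i j i') = bl i j i'" if ij: "1 \<le> i" "i \<le> j" "j < i'" "i' \<le> d + 1" for i j i'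
  proof -
    let ?u = "take (j - i) (drop (i - 1) w)" let ?v = "take (i' - j - 1) (drop j w)" let ?x = "w ! (j - 1)"
    have jd: "1 \<le> j" "j \<le> d" using that by auto
    have s1: "map P [i..<j + 1] = P i # map fst ?u" using that by (intro Pseg) auto
    have s2: "map P [j + 1..<i' + 1] = fst ?x # map fst ?v"
      using that Pseg[of "j + 1" i'] by (simp add: P_def p_def d_def nth_Cons split: nat.splits)
    have u: "length ?u = j - i" using that by (simp add: d_def)
    have "endp (P i) (?u @ ?x # ?v) = P i'"
    proof -
      have "last (fst ?x # map fst ?v) = P i'"
        unfolding s2[symmetric] using that by (simp add: last_map)
      then show ?thesis by (auto simp: endp_def last_map split: if_splits)
    qed
    then have e: "endp (fst ?x) ?v = P i'" by simp
    have e1: "eval_series h \<tau> d (exp_series (ptensor 1 (log_coeff (P i) (P i'))) j) =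
        log_mould g (P i) (P i') (snd ?x)"
      unfolding eval_series_exp[OF h jd] by (simp add: log_mould_def \<tau>nth[OF jd] h_def phom2_ptensor[OF fi gi]
          qhom_1[OF fi] inversion_log_coeff)
    have td: "eval_series h \<tau> d (tvar r - tvar r') = fps_const (pconst (\<tau> r - \<tau> r')) * fps_X"
      if "1 \<le> r" "r \<le> d" "1 \<le> r'" "r' \<le> d" for r r' by (rule eval_series_tvar_diff[OF h that])
    have "eval_series h \<tau> d (gen_series (right_coeff (map P (rev [i..<j + 1]))) (map (\<lambda>r. tvar j - tvar r) (rev [i..<j]))) =
        value_series (\<lambda>ns. h (right_coeff (map P (rev [i..<j + 1])) ns)) (map (\<lambda>r. \<tau> j - \<tau> r) (rev [i..<j]))"
      by (rule eval_gen_series_map[OF h td]) (use that in auto)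
    also have "\<dots> = value_series (\<lambda>ns. g (inv_coeff (map P [i..<j + 1]) ns)) (map (\<lambda>r. \<tau> j - \<tau> r) (rev [i..<j]))"
      unfolding rev_map[symmetric]
      by (intro value_series_cong refl inv sort) (use that in \<open>auto simp del: upt_Suc\<close>)
    also have "map (\<lambda>r. \<tau> j - \<tau> r) (rev [i..<j]) = map (\<lambda>x. - snd x) (rev (shift (snd ?x) ?u))"
      using \<tau>seg[of i j "\<lambda>x. \<tau> j - x"] that \<tau>nth[OF jd] by (simp add: rev_map[symmetric] shift_def split_def)
    finally have e2: "(-1) ^ (j - i) * eval_series h \<tau> d (gen_series (right_coeff (map P (rev [i..<j + 1]))) (map (\<lambda>r. tvar j - tvar r) (rev [i..<j]))) =
       inv_mould g (P i) (shift (snd ?x) ?u)"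
      unfolding s1 inv_mould_def by (simp only: shift_simps u)
    have "eval_series h \<tau> d (gen_series (right_coeff (map P [j + 1..<i' + 1])) (map (\<lambda>r. tvar r - tvar j) [j + 1..<i'])) =
        value_series (\<lambda>ns. h (right_coeff (map P [j + 1..<i' + 1]) ns)) (map (\<lambda>r. \<tau> r - \<tau> j) [j + 1..<i'])"
      by (rule eval_gen_series_map[OF h td]) (use that in auto)
    also have "\<dots> = value_series (\<lambda>ns. g (sym_coeff (map P [j + 1..<i' + 1]) ns)) (map (\<lambda>r. \<tau> r - \<tau> j) [j + 1..<i'])"
      by (intro value_series_cong refl right sort) (use that in \<open>auto simp del: upt_Suc\<close>)
    also have "map (\<lambda>r. \<tau> r - \<tau> j) [j + 1..<i'] = map snd (shift (snd ?x) ?v)"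
      using \<tau>seg[of "j + 1" i' "\<lambda>x. x - \<tau> j"] that \<tau>nth[OF jd] by (simp add: shift_def split_def)
    finally have e3: "eval_series h \<tau> d (gen_series (right_coeff (map P [j + 1..<i' + 1])) (map (\<lambda>r. tvar r - tvar j) [j + 1..<i'])) =
       reg_mould g (fst ?x) (shift (snd ?x) ?v)"
      unfolding s2 reg_mould_def by (simp only: shift_simps)
    have "eval_series h \<tau> d (X3 i j i') = log_mould g (P i) (P i') (snd ?x) *
       ((-1) ^ (j - i) * eval_series h \<tau> d (gen_series (right_coeff (map P (rev [i..<j + 1]))) (map (\<lambda>r. tvar j - tvar r) (rev [i..<j])))) *
       reg_mould g (fst ?x) (shift (snd ?x) ?v)"
      unfolding X3_def eval_series_mult[OF h] eval_series_sign[OF h] e1 e3 by (simp only: mult_ac)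
    then show ?thesis unfolding e2 bl_def B_def block_def e .
  qed
  have summand: "eval_series h \<tau> d (X1 is js * X2 (hd is) * (\<Prod>r<length js. X3 (is ! r) (js ! r) (is ! (r + 1)))) =
      reg_mould g a (take (s - 1) w) * (reg_mould f (P s) (C is js) * (\<Prod>r<length js. bl (is ! r) (js ! r) (is ! (r + 1))))"
    if c: "(is, js) \<in> cuts s d" and s: "1 \<le> s" "s \<le> d + 1" for "is" js s
  proof -
    have hd: "hd is = s" using c by (simp add: cuts_def)
    have "set is \<subseteq> {s..d + 1}"
      using bspec[OF conjunct2[OF cuts_props[OF s(2)]] c] by auto
    moreover have "length is = length js + 1" using c by (simp add: cuts_def)
    ultimately have rng: "1 \<le> is ! r \<and> is ! r \<le> d + 1" if "r < length js + 1" for r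
      using that s(1) by (metis atLeastAtMost_iff nth_mem order_trans subsetD)
    have "eval_series h \<tau> d (X3 (is ! r) (js ! r) (is ! (r + 1))) = bl (is ! r) (js ! r) (is ! (r + 1))" if "r < length js" for r
      by (rule X3) (use that rng[of r] rng[of "r + 1"] c in \<open>auto simp: cuts_def\<close>)
    then show ?thesis
      by (simp add: eval_series_mult[OF h] eval_series_prod[OF h] X1[OF c s] X2[OF s] hd mult_ac)
  qed
  have cop_series: "cop_series p = (\<Sum>(is, js)\<in>cut_points d. X1 is js * X2 (hd is) * (\<Prod>r<length js. X3 (is ! r) (js ! r) (is ! (r + 1))))"
    unfolding cop_series_def X1_def X2_def X3_def Let_def P_def len by simp
  \<comment> \<open>The cuts are sorted by i_1 = s, which turns their sum into the product of
    moulds.\<close>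
  have cp: "cut_points d = (\<Union>s\<in>{1..d + 1}. cuts s d)"
  proof (intro equalityI subsetI)
    fix x assume x: "x \<in> cut_points d"
    then have "x \<in> cuts (hd (fst x)) d" "1 \<le> hd (fst x)"
      by (auto simp: cut_points_def cuts_def split: prod.splits)
    moreover then have "hd (fst x) \<le> d + 1" using cuts_hd_le[of "fst x" "snd x"] by simp
    ultimately show "x \<in> (\<Union>s\<in>{1..d + 1}. cuts s d)" by auto
  qed (auto simp: cut_points_def cuts_def)
  have "reg_mould (\<lambda>x. phom2 f g (cop x)) a w = value_series (\<lambda>ns. h (scoeff (cop_series p) (texp ns))) (map snd w)"
    unfolding reg_mould_def p_def[symmetric]
  proof (rule value_series_cong[OF refl])
    fix ns :: "nat list" assume "length ns = length (map snd w)"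
    then have "ns \<noteq> []" using False by auto
    then have "sym_coeff p ns = pvar (Sym p ns)" by simp
    then show "phom2 f g (cop (sym_coeff p ns)) = h (scoeff (cop_series p) (texp ns))"
      unfolding cop_def phom2_ptensor_map[OF f g qhom_inversion qhom_inversion] h_def
      by (simp add: cop_bar_def)
  qed
  also have "\<dots> = eval_series h \<tau> d (cop_series p)"
    by (simp add: eval_series_eq_value_series[symmetric] \<tau>_def d_def)
  also have "\<dots> = (\<Sum>x\<in>cut_points d. eval_series h \<tau> d (case x of (is, js) \<Rightarrow>
       X1 is js * X2 (hd is) * (\<Prod>r<length js. X3 (is ! r) (js ! r) (is ! (r + 1)))))"
    by (simp add: cop_series eval_series_sum[OF h])
  also have "\<dots> = (\<Sum>s\<in>{1..d + 1}. \<Sum>x\<in>cuts s d. eval_series h \<tau> d (case x of (is, js) \<Rightarrow>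
       X1 is js * X2 (hd is) * (\<Prod>r<length js. X3 (is ! r) (js ! r) (is ! (r + 1)))))"
    unfolding cp by (rule sum.UNION_disjoint) (use cuts_props in \<open>auto simp: cuts_def\<close>)
  also have "\<dots> = (\<Sum>s\<in>{1..d + 1}. reg_mould g a (take (s - 1) w) * block_sum B (reg_mould f (P s)) (P s) (drop (s - 1) w))"
  proof (intro sum.cong refl)
    fix s assume "s \<in> {1..d + 1}"
    then have s: "1 \<le> s" "s \<le> d + 1" by auto
    have "(\<Sum>x\<in>cuts s d. eval_series h \<tau> d (case x of (is, js) \<Rightarrow>
       X1 is js * X2 (hd is) * (\<Prod>r<length js. X3 (is ! r) (js ! r) (is ! (r + 1))))) =
       (\<Sum>(is, js)\<in>cuts s d. reg_mould g a (take (s - 1) w) * (reg_mould f (P s) (C is js) * (\<Prod>r<length js. bl (is ! r) (js ! r) (is ! (r + 1)))))"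
      by (intro sum.cong refl) (auto simp only: summand[OF _ s] split_def prod.collapse)
    also have "\<dots> = reg_mould g a (take (s - 1) w) * (\<Sum>(is, js)\<in>cuts s d. reg_mould f (P s) (C is js) * (\<Prod>r<length js. bl (is ! r) (js ! r) (is ! (r + 1))))"
      by (simp add: sum_distrib_left split_def)
    also have "(\<Sum>(is, js)\<in>cuts s d. reg_mould f (P s) (C is js) * (\<Prod>r<length js. bl (is ! r) (js ! r) (is ! (r + 1)))) =
        block_sum B (reg_mould f (P s)) (P s) (drop (s - 1) w)"
      using block_sum_cuts[OF s[unfolded d_def], where F = "reg_mould f (P s)" and B = B and a = a]
      unfolding C_def bl_def P_def p_def d_def .
    finally show "(\<Sum>x\<in>cuts s d. eval_series h \<tau> d (case x of (is, js) \<Rightarrow>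
       X1 is js * X2 (hd is) * (\<Prod>r<length js. X3 (is ! r) (js ! r) (is ! (r + 1))))) =
       reg_mould g a (take (s - 1) w) * block_sum B (reg_mould f (P s)) (P s) (drop (s - 1) w)" .
  qed
  also have "\<dots> = (\<Sum>i\<le>d. reg_mould g a (take i w) * block_sum B (reg_mould f (P (i + 1))) (P (i + 1)) (drop i w))"
    by (rule sum.reindex_bij_witness[where i = "\<lambda>i. i + 1" and j = "\<lambda>i. i - 1"]) auto
  also have "\<dots> = mm (reg_mould g) (\<lambda>a. block_sum B (reg_mould f a) a) a w"
  proof -
    have "endp a (take i w) = P (i + 1)" if "i \<le> d" for i
      using that by (cases i) (auto simp: P_def p_def d_def take_Suc_conv_app_nth)
    then show ?thesis by (simp add: mm_def split_sum_index d_def)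
  qed
  finally show ?thesis .
qed

section \<open>Recovering coefficients from specialisations\<close>

lemma index_value_Cons: "index_value (x # ts) (n # ns) = x ^ (n - 1) * index_value ts ns"
  unfolding index_value_def length_Cons prod.lessThan_Suc_shift by simp

text \<open>With all coordinates but the first fixed, the first still ranges over all but finitely
  many rationals. So the coefficients of the powers of the first coordinate vanish, and the
  induction applies to these coefficients as polynomials in the others.\<close>

lemma index_polynomial_zero:
  assumes "finite I" "\<And>ns. ns \<in> I \<Longrightarrow> length ns = l \<and> 0 \<notin> set ns"
    and "\<And>ts. length ts = l \<Longrightarrow> distinct ts \<Longrightarrow> 0 \<notin> set ts \<Longrightarrow> (\<Sum>ns\<in>I. index_value ts ns * b ns) = (0 :: rat)"
    and "ns \<in> I"
  shows "b ns = 0"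
  using assms
proof (induction l arbitrary: I b ns)
  case 0
  then have "I = {[]}" "ns = []" by auto
  then show ?case using "0.prems"(3)[of "[]"] by (simp add: index_value_def)
next
  case (Suc l)
  define k where "k = hd ns - 1"
  have ns: "ns = (k + 1) # tl ns" 
    using Suc.prems(2)[OF Suc.prems(4)] by (cases ns) (auto simp: k_def)
  define I' where "I' = tl ` {ms \<in> I. hd ms - 1 = k}"
  have inj: "inj_on tl {ms \<in> I. hd ms - 1 = k}"
  proof (rule inj_onI)
    fix x y assume "x \<in> {ms \<in> I. hd ms - 1 = k}" "y \<in> {ms \<in> I. hd ms - 1 = k}" "tl x = tl y"
    then show "x = y" using Suc.prems(2)[of x] Suc.prems(2)[of y] by (cases x; cases y) auto
  qed
  have "b ((k + 1) # tl ns) = 0"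
  proof (rule Suc.IH[of I' "\<lambda>ms. b ((k + 1) # ms)" "tl ns"])
    show "finite I'" using Suc.prems(1) by (simp add: I'_def)
    show "length ms = l \<and> 0 \<notin> set ms" if "ms \<in> I'" for ms
    proof -
      obtain m where m: "m \<in> I" "ms = tl m" using \<open>ms \<in> I'\<close> by (auto simp: I'_def)
      then show ?thesis using Suc.prems(2)[of m] by (cases m) auto
    qed
    show "tl ns \<in> I'" unfolding I'_def using Suc.prems(4) by (auto simp: k_def)
    fix ts :: "rat list" assume ts: "length ts = l" "distinct ts" "0 \<notin> set ts"
    \<comment> \<open>The polynomial in the first coordinate, the others being \<open>ts\<close>;
      its coefficient at \<open>k\<close> is the sum over \<open>I'\<close> in the goal.\<close>
    define q where "q = (\<Sum>ms\<in>I. monom (index_value ts (tl ms) * b ms) (hd ms - 1))"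
    have "poly q x = 0" if "x \<notin> insert 0 (set ts)" for x
    proof -
      have "poly q x = (\<Sum>ms\<in>I. index_value (x # ts) ms * b ms)"
        unfolding q_def poly_sum
      proof (intro sum.cong refl)
        fix ms assume "ms \<in> I"
        then obtain m ms' where "ms = m # ms'" using Suc.prems(2)[of ms] by (cases ms) auto
        then show "poly (monom (index_value ts (tl ms) * b ms) (hd ms - 1)) x = index_value (x # ts) ms * b ms"
          by (simp add: poly_monom index_value_Cons)
      qed
      also have "\<dots> = 0" using ts that by (intro Suc.prems(3)) auto
      finally show ?thesis .
    qed
    then have "- insert 0 (set ts) \<subseteq> {x. poly q x = 0}" by auto
    moreover have "infinite (- insert 0 (set ts) :: rat set)"
      by (simp add: Compl_eq_Diff_UNIV infinite_UNIV_char_0)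
    ultimately have "q = 0" using poly_roots_finite finite_subset by blast
    then have "coeff q k = 0" by simp
    then have "0 = (\<Sum>ms\<in>I. if hd ms - 1 = k then index_value ts (tl ms) * b ms else 0)"
      by (simp add: q_def coeff_sum)
    also have "\<dots> = (\<Sum>ms\<in>{ms \<in> I. hd ms - 1 = k}. index_value ts (tl ms) * b ms)"
      by (rule sum.inter_filter[symmetric]) (rule Suc.prems(1))
    also have "\<dots> = (\<Sum>ms\<in>{ms \<in> I. hd ms - 1 = k}. index_value ts (tl ms) * b ((k + 1) # tl ms))"
    proof (intro sum.cong refl)
      fix ms assume ms: "ms \<in> {ms \<in> I. hd ms - 1 = k}"
      then have "ms = (k + 1) # tl ms" using Suc.prems(2)[of ms] by (cases ms) auto
      then show "index_value ts (tl ms) * b ms = index_value ts (tl ms) * b ((k + 1) # tl ms)" by simp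
    qed
    also have "\<dots> = (\<Sum>ms\<in>I'. index_value ts ms * b ((k + 1) # ms))"
      unfolding I'_def by (subst sum.reindex[OF inj]) simp
    finally show "(\<Sum>ms\<in>I'. index_value ts ms * b ((k + 1) # ms)) = 0" ..
  qed
  then show ?case using ns by simp
qed

lemma lookup_pconst_mult: "lookup (pconst c * p) m = c * lookup p m"
  unfolding pconst_def mult_map_scale_conv_mult[symmetric] by (simp add: map.rep_eq when_def)

text \<open>The coefficient of z^N, with N the sum of the n_i - 1, is polynomial in the \<tau>'s.
  Comparing the coefficients at one monomial \<open>k\<close> of the target algebra reduces the
  claim to rational polynomials.\<close>

lemma value_series_eqD:
  fixes c c' :: "nat list \<Rightarrow> 'n::cancel_comm_monoid_add malg"
  assumes eq: "\<And>ts. length ts = length ns \<Longrightarrow> distinct ts \<Longrightarrow> 0 \<notin> set ts \<Longrightarrow> value_series c ts = value_series c' ts"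
    and ns: "0 \<notin> set ns"
  shows "c ns = c' ns"
proof (rule poly_mapping_eqI)
  fix k
  let ?l = "length ns"
  define N where "N = sum_list ns - ?l"
  have "length xs \<le> sum_list xs" if "0 \<notin> set xs" for xs :: "nat list"
    using that by (induction xs) auto
  from this[OF ns] have mem: "ns \<in> index_lists ?l N" using ns by (simp add: index_lists_def N_def)
  have "lookup (c ns) k - lookup (c' ns) k = 0"
  proof (rule index_polynomial_zero[OF finite_index_lists, of ?l N ?l "\<lambda>ns. lookup (c ns) k - lookup (c' ns) k" ns])
    fix ts :: "rat list" assume ts: "length ts = ?l" "distinct ts" "0 \<notin> set ts"
    have "(\<Sum>ms\<in>index_lists ?l N. pconst (index_value ts ms) * c ms) = (\<Sum>ms\<in>index_lists ?l N. pconst (index_value ts ms) * c' ms)"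
      using arg_cong[OF eq[OF ts], of "\<lambda>F. fps_nth F N"] ts(1) by (simp add: value_series_def)
    then have "lookup (\<Sum>ms\<in>index_lists ?l N. pconst (index_value ts ms) * c ms) k =
        lookup (\<Sum>ms\<in>index_lists ?l N. pconst (index_value ts ms) * c' ms) k" by simp
    then show "(\<Sum>ms\<in>index_lists ?l N. index_value ts ms * (lookup (c ms) k - lookup (c' ms) k)) = 0"
      by (simp add: lookup_sum lookup_pconst_mult right_diff_distrib sum_subtractf)
  qed (use mem in \<open>auto simp: index_lists_def\<close>)
  then show "lookup (c ns) k = lookup (c' ns) k" by simp
qed

section \<open>Coassociativity, counit and naturality on symbols\<close>

abbreviation symb_block :: "(symb mpoly \<Rightarrow> 'n::cancel_comm_monoid_add malg) \<Rightarrow> 'n malg fps blockfun" where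
  "symb_block f \<equiv> block (log_mould f) (inv_mould f) (reg_mould f)"

lemma fps_X_cancel: "fps_X * x = fps_X * y \<Longrightarrow> x = (y :: 'a::comm_ring_1 fps)"
  by (metis fps_ext fps_X_mult_nth diff_Suc_1 nat.distinct(1))

text \<open>The bridge from moulds to homomorphisms: a regular symbol is recovered from the regular
  mould at the words with its end points, the \<tau>'s running over all distinct nonzero
  values.\<close>

lemma qhom_eq_H_symbI:
  fixes f g :: "symb mpoly \<Rightarrow> 'n::cancel_comm_monoid_add malg"
  assumes f: "qhom f" and g: "qhom g"
    and log: "\<And>a b. f (log_coeff a b) = g (log_coeff a b)"
    and reg: "\<And>a w. good a w \<Longrightarrow> reg_mould f a w = reg_mould g a w"
    and x: "x \<in> carrier H_symb"
  shows "f x = g x"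
proof (rule qhom_eq_pvarI[OF f g])
  fix m s assume "m \<in> keys x" "s \<in> keys m"
  then have "s \<in> symb_gens" using x by (auto simp: H_symb_def free_alg_def)
  then show "f (pvar s) = g (pvar s)"
    unfolding symb_gens_def
  proof (elim UnE CollectE exE conjE)
    fix i assume "s = Log i"
    then show ?thesis using log[of i "Suc i"] by (simp add: log_coeff_def)
  next
    fix p ns assume s: "s = Sym p ns" "ns \<noteq> []" "length p = length ns + 1" "0 \<notin> set ns" "sorted_wrt (<) p"
    obtain a q where p: "p = a # q" using s(3) by (cases p) auto
    have "f (sym_coeff p ns) = g (sym_coeff p ns)"
    proof (rule value_series_eqD[OF _ s(4)])
      fix ts :: "rat list" assume ts: "length ts = length ns" "distinct ts" "0 \<notin> set ts"
      have w: "map fst (zip q ts) = q" "map snd (zip q ts) = ts" using ts s(3) p by auto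
      then have "good a (zip q ts)" using ts s(5) p by (simp add: good_def)
      from reg[OF this] show "value_series (\<lambda>ns. f (sym_coeff p ns)) ts = value_series (\<lambda>ns. g (sym_coeff p ns)) ts"
        unfolding reg_mould_def w p .
    qed
    then show ?thesis using s by simp
  qed
qed

lemma good_append1: "good a (u @ v) \<Longrightarrow> good a u" and good_append2: "good a (u @ v) \<Longrightarrow> good (endp a u) v"
  using good_append by blast+

lemma good_sorted: "good a w \<Longrightarrow> sorted_wrt (<) (a # map fst w)"
  by (simp add: good_def)

lemma block_sum_good_cong:
  assumes g: "good a w"
    and F: "\<And>w'. good a w' \<Longrightarrow> F w' = G w'"
    and e: "\<And>a b t. e a b t = e' a b t"
    and R: "\<And>a w. good a w \<Longrightarrow> R a w = R' a w" and A: "\<And>a w. good a w \<Longrightarrow> A a w = A' a w"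
  shows "block_sum (block e R A) F a w = block_sum (block e' R' A') G a w"
proof (rule block_sum_cong)
  fix w' assume "subseq (map fst w') (map fst w)" "subseq (map snd w') (map snd w)"
  then show "F w' = G w'" using good_subseq[OF g] F by blast
next
  fix a' u x v w1 w2 assume w: "w = w1 @ u @ x # v @ w2" and a': "a' = endp a w1"
  then have "good a' ((u @ x # v) @ w2)" using good_append2[of a w1] g by simp
  then have "good a' (u @ x # v)" by (rule good_append1)
  then show "block e R A a' u x v = block e' R' A' a' u x v"
    by (simp add: block_def e R A good_shift)
qed

lemma mm_good_cong:
  assumes g: "good a w" and "\<And>a w. good a w \<Longrightarrow> U a w = U' a w" "\<And>a w. good a w \<Longrightarrow> V a w = V' a w"
  shows "mm U V a w = mm U' V' a w"
  unfolding mm_def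
  by (intro split_sum_cong refl arg_cong2[where f = "(*)"] assms(2,3)) (use g good_append in blast)+

text \<open>The inverted symbols are pinned down by the regular ones: by
  \<open>inverse_moulds_comp\<close> the right side solves the inversion equation of the convolution
  with the same regular mould, and solutions are unique.\<close>

lemma inv_mould_cop:
  assumes f: "qhom f" and g: "qhom g" and w: "good a w"
  shows "inv_mould (\<lambda>x. phom2 f g (cop x)) a w = mm (\<lambda>a. block_sum (symb_block g) (inv_mould f a) a) (inv_mould g) a w"
proof (rule inverse_moulds_unique[OF inverse_moulds_symb _ fps_X_cancel _ w])
  let ?h = "\<lambda>x. phom2 f g (cop x)"
  show "qhom ?h" by (rule qhom_comp[OF qhom_phom2[OF f g] qhom_cop])
  have "log_mould ?h = (\<lambda>a b t. log_mould f a b t * log_mould g a b t)"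
    by (intro ext) (rule log_mould_cop[OF f g])
  then show "inverse_moulds qinv fps_X (log_mould ?h) (mm (\<lambda>a. block_sum (symb_block g) (inv_mould f a) a) (inv_mould g))
      (mm (reg_mould g) (\<lambda>a. block_sum (symb_block g) (reg_mould f a) a))"
    using inverse_moulds_comp[OF inverse_moulds_symb[OF f] inverse_moulds_symb[OF g] exp_mould_log_mould[OF g]] by simp
  show "reg_mould ?h a w = mm (reg_mould g) (\<lambda>a. block_sum (symb_block g) (reg_mould f a) a) a w" if "good a w" for a w
    by (rule reg_mould_cop[OF f g good_sorted[OF that]])
qed

text \<open>On good words the data of the composite of two substitutions are exactly the three
  moulds of the convolution.\<close>

lemma block_sum_cop:
  assumes f: "qhom f" and g: "qhom g" and w: "good a w"
  shows "block_sum (symb_block (\<lambda>x. phom2 f g (cop x))) F a w =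
    block_sum (symb_block g) (block_sum (symb_block f) F a) a w"
  unfolding block_sum_block_sum[OF exp_mould_log_mould[OF g]]
  by (rule block_sum_good_cong[OF w refl])
    (simp_all add: log_mould_cop[OF f g] inv_mould_cop[OF f g] reg_mould_cop[OF f g good_sorted])

text \<open>With A_f and T_f for the regular mould and the substitution of f, both sides have the
  regular mould A_k (T_k A_g) (T_k T_g A_f): for the left side T_k is multiplicative, for the right
  side T_k T_g is the substitution of the convolution of g and k. The inclusions into the tensor
  cube are a special case of \<open>f\<close>, \<open>g\<close>, \<open>k\<close>.\<close>

theorem coassoc_symb:
  fixes f g k :: "symb mpoly \<Rightarrow> 'n::cancel_comm_monoid_add malg"
  assumes f: "qhom f" and g: "qhom g" and k: "qhom k" and x: "x \<in> carrier H_symb"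
  shows "phom2 (\<lambda>x. phom2 f g (cop x)) k (cop x) = phom2 f (\<lambda>x. phom2 g k (cop x)) (cop x)"
proof -
  let ?fg = "\<lambda>x. phom2 f g (cop x)" and ?gk = "\<lambda>x. phom2 g k (cop x)"
  have fg: "qhom ?fg" and gk: "qhom ?gk" by (intro qhom_comp[OF qhom_phom2 qhom_cop] f g k)+
  show ?thesis
  proof (rule qhom_eq_H_symbI[OF _ _ _ _ x, where f = "\<lambda>x. phom2 ?fg k (cop x)" and g = "\<lambda>x. phom2 f ?gk (cop x)"])
    show "qhom (\<lambda>x. phom2 ?fg k (cop x))" "qhom (\<lambda>x. phom2 f ?gk (cop x))"
      by (intro qhom_comp[OF qhom_phom2 qhom_cop] fg gk f k)+
    show "phom2 ?fg k (cop (log_coeff a b)) = phom2 f ?gk (cop (log_coeff a b))" for a b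
      by (simp add: cop_log_coeff qhom_add[OF qhom_phom2] phom2_inl2 phom2_inr2 f g k fg gk add.assoc)
    fix a w assume w: "good a w"
    have "reg_mould (\<lambda>x. phom2 ?fg k (cop x)) a w = mm (reg_mould k) (\<lambda>a. block_sum (symb_block k) (reg_mould ?fg a) a) a w"
      by (rule reg_mould_cop[OF fg k good_sorted[OF w]])
    also have "\<dots> = mm (reg_mould k) (\<lambda>a. block_sum (symb_block k) (mm (reg_mould g) (\<lambda>a. block_sum (symb_block g) (reg_mould f a) a) a) a) a w"
      by (rule mm_good_cong[OF w refl], rule block_sum_good_cong) (simp_all add: reg_mould_cop[OF f g good_sorted])
    also have "\<dots> = mm (mm (reg_mould k) (\<lambda>a. block_sum (symb_block k) (reg_mould g a) a))
        (\<lambda>a. block_sum (symb_block k) (block_sum (symb_block g) (reg_mould f a) a) a) a w"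
      by (simp add: block_sum_mm_fun mm_assoc_fun)
    also have "\<dots> = mm (reg_mould ?gk) (\<lambda>a. block_sum (symb_block ?gk) (reg_mould f a) a) a w"
      by (rule mm_good_cong[OF w]) (simp_all add: reg_mould_cop[OF g k good_sorted] block_sum_cop[OF g k])
    also have "\<dots> = reg_mould (\<lambda>x. phom2 f ?gk (cop x)) a w"
      by (rule reg_mould_cop[OF f gk good_sorted[OF w], symmetric])
    finally show "reg_mould (\<lambda>x. phom2 ?fg k (cop x)) a w = reg_mould (\<lambda>x. phom2 f ?gk (cop x)) a w" .
  qed
qed

section \<open>The counit\<close>

definition augmentation :: "symb mpoly \<Rightarrow> 'n::cancel_comm_monoid_add malg" where
  "augmentation = phom (\<lambda>_. 0)"

lemma qhom_augmentation: "qhom augmentation"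
  unfolding augmentation_def by (rule qhom_phom)

lemma augmentation_log_coeff: "augmentation (log_coeff a b) = 0"
  by (simp add: log_coeff_eq qhomD[OF qhom_augmentation]) (simp add: augmentation_def)

definition unit_mould :: "'k::comm_ring_1 mould" where
  "unit_mould a w = (if w = [] then 1 else 0)"

lemma reg_mould_augmentation:
  "reg_mould (augmentation :: symb mpoly \<Rightarrow> 'a::cancel_comm_monoid_add malg) = unit_mould"
proof (intro ext)
  fix a w
  show "reg_mould augmentation a w = (unit_mould a w :: 'a malg fps)"
  proof (cases "w = []")
    case False
    have "value_series (\<lambda>ns. augmentation (sym_coeff (a # map fst w) ns) :: 'a malg) (map snd w) = value_series (\<lambda>ns. 0) (map snd w)"
      by (rule value_series_cong) (use False in \<open>auto simp: augmentation_def\<close>)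
    also have "\<dots> = (0 :: 'a malg fps)" by (rule fps_ext) (simp add: value_series_def)
    finally show ?thesis using False by (simp add: reg_mould_def unit_mould_def del: sym_coeff.simps)
  qed (simp add: reg_mould_Nil[OF qhom_augmentation] unit_mould_def)
qed

lemma mm_unit_right: "mm U unit_mould a w = U a w"
proof -
  have "split_sum (\<lambda>u v. F u * (if v = [] then 1 else 0)) w = F w" for F :: "word \<Rightarrow> 'a"
    by (induction w arbitrary: F) auto
  then show ?thesis by (simp add: mm_def unit_mould_def)
qed

lemma mm_unit_left: "mm unit_mould U a w = U a w"
proof -
  have "mm unit_mould U a w = split_sum (\<lambda>u v. if u = [] then U a v else 0) w"
    unfolding mm_def by (intro split_sum_cong refl) (simp add: unit_mould_def)
  then show ?thesis by (simp add: split_sum_Nil_left)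
qed

lemma block_unit: "block (\<lambda>a b t. 1) unit_mould unit_mould a u x v = (if u = [] \<and> v = [] then 1 else 0)"
  by (simp add: block_def unit_mould_def)

lemma log_mould_augmentation: "log_mould augmentation a b t = 1"
  by (simp add: log_mould_def augmentation_log_coeff)

text \<open>By uniqueness: with unit moulds on both sides the inversion equation reads
  \<open>pole\<close> = \<open>pole\<close>.\<close>

lemma inv_mould_augmentation:
  assumes "good a w"
  shows "inv_mould augmentation a w = unit_mould a w"
proof (rule inverse_moulds_unique[OF inverse_moulds_symb[OF qhom_augmentation] _ fps_X_cancel _ assms])
  show "inverse_moulds qinv fps_X (log_mould augmentation) unit_mould unit_mould"
    unfolding inverse_moulds_def log_mould_augmentation[abs_def]
    by (auto simp: mm_unit_left mm_unit_right block_sum_single_letters[OF block_unit] unit_mould_def)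
qed (simp_all add: reg_mould_augmentation)

text \<open>With the augmentation on the left the contracted word must be empty, which leaves only
  the initial part. With the augmentation on the right all weights are trivial, so there is no
  initial part and every block is a single letter.\<close>

theorem counit_symb:
  fixes f :: "symb mpoly \<Rightarrow> 'n::cancel_comm_monoid_add malg"
  assumes f: "qhom f" and x: "x \<in> carrier H_symb"
  shows "phom2 augmentation f (cop x) = f x" "phom2 f augmentation (cop x) = f x"
proof -
  note a = qhom_augmentation
  show "phom2 augmentation f (cop x) = f x"
  proof (rule qhom_eq_H_symbI[OF _ f _ _ x, where f = "\<lambda>x. phom2 augmentation f (cop x)"])
    show "qhom (\<lambda>x. phom2 augmentation f (cop x))" by (intro qhom_comp[OF qhom_phom2 qhom_cop] f a)
    show "phom2 augmentation f (cop (log_coeff b c)) = f (log_coeff b c)" for b c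
      by (simp add: cop_log_coeff qhom_add[OF qhom_phom2] phom2_inl2 phom2_inr2 f a augmentation_log_coeff)
    fix b w assume w: "good b w"
    have "block_sum B (unit_mould b) b w = unit_mould b w" for B :: "'n malg fps blockfun" and b w
      unfolding unit_mould_def by simp
    then have "(\<lambda>b. block_sum (symb_block f) (unit_mould b) b) = unit_mould" by (intro ext) simp
    then show "reg_mould (\<lambda>x. phom2 augmentation f (cop x)) b w = reg_mould f b w"
      by (simp add: reg_mould_cop[OF a f good_sorted[OF w]] reg_mould_augmentation mm_unit_right)
  qed
  show "phom2 f augmentation (cop x) = f x"
  proof (rule qhom_eq_H_symbI[OF _ f _ _ x, where f = "\<lambda>x. phom2 f augmentation (cop x)"])
    show "qhom (\<lambda>x. phom2 f augmentation (cop x))" by (intro qhom_comp[OF qhom_phom2 qhom_cop] f a)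
    show "phom2 f augmentation (cop (log_coeff b c)) = f (log_coeff b c)" for b c
      by (simp add: cop_log_coeff qhom_add[OF qhom_phom2] phom2_inl2 phom2_inr2 f a augmentation_log_coeff)
    fix b w assume w: "good b w"
    have "block_sum (symb_block augmentation) (reg_mould f b) b w =
        block_sum (block (\<lambda>a b t. 1) unit_mould unit_mould) (reg_mould f b) b w"
      by (rule block_sum_good_cong[OF w])
        (simp_all add: log_mould_augmentation inv_mould_augmentation reg_mould_augmentation)
    also have "\<dots> = reg_mould f b w" by (rule block_sum_single_letters[OF block_unit])
    finally show "reg_mould (\<lambda>x. phom2 f augmentation (cop x)) b w = reg_mould f b w"
      by (simp add: reg_mould_cop[OF f a good_sorted[OF w]] reg_mould_augmentation mm_unit_left)
  qed
qed

text \<open>The substitution of x_(P(i)->P(i+1)) for x_i, the counterpart on symbols of a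
  contraction. Arguments are stored by end points, so on symbols it is just the application of
  \<open>P\<close>.\<close>

fun relabel_gen :: "(nat \<Rightarrow> nat) \<Rightarrow> symb \<Rightarrow> symb mpoly" where
  "relabel_gen P (Log i) = log_coeff (P i) (P (i + 1))"
| "relabel_gen P (Sym p ns) = pvar (Sym (map P p) ns)"

definition relabel_symb :: "(nat \<Rightarrow> nat) \<Rightarrow> symb mpoly \<Rightarrow> symb mpoly" where
  "relabel_symb P = phom (relabel_gen P)"

lemma qhom_relabel_symb: "qhom (relabel_symb P)"
  unfolding relabel_symb_def by (rule qhom_phom)

lemma relabel_symb_log_coeff: "relabel_symb P (log_coeff a b) = log_coeff (P a) (P b)"
proof -
  have "relabel_symb P (\<Sum>r<b. pvar (Log r)) = log_coeff (P 0) (P b)" for b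
    by (induction b) (simp_all add: qhomD[OF qhom_relabel_symb], simp_all add: relabel_symb_def log_coeff_eq)
  then show ?thesis
    by (simp add: log_coeff_eq[of a b] qhom_diff[OF qhom_relabel_symb]) (simp add: log_coeff_eq)
qed

lemma relabel_symb_sym_coeff: "relabel_symb P (sym_coeff p ns) = sym_coeff (map P p) ns"
  by (simp add: qhom_1[OF qhom_relabel_symb]) (simp add: relabel_symb_def)

lemma reg_mould_relabel:
  "reg_mould (\<lambda>x. f (relabel_symb P x)) a w = reg_mould f (P a) (relabel P w)"
  by (simp add: reg_mould_def relabel_symb_sym_coeff del: sym_coeff.simps)

lemma log_mould_relabel:
  "log_mould (\<lambda>x. f (relabel_symb P x)) a b t = log_mould f (P a) (P b) t"
  by (simp add: log_mould_def relabel_symb_log_coeff)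

lemma good_relabel: "strict_mono P \<Longrightarrow> good a w \<Longrightarrow> good (P a) (relabel P w)"
  unfolding good_def relabel_simps list.map(2)[symmetric]
  by (auto simp: sorted_wrt_map strict_mono_less)

lemma pole_relabel [simp]: "pole q z (relabel P w) = pole q z w"
  by (cases w; cases "tl w") (auto simp: pole_def split: list.splits)

text \<open>By uniqueness again: products of moulds, block sums and \<open>pole\<close> commute with
  relabelling, so the relabelled inverse mould solves the same equation.\<close>

lemma inv_mould_relabel:
  assumes f: "qhom f" and P: "strict_mono P" and w: "good a w"
  shows "inv_mould (\<lambda>x. f (relabel_symb P x)) a w = inv_mould f (P a) (relabel P w)"
proof (rule inverse_moulds_unique[OF inverse_moulds_symb _ fps_X_cancel _ w])
  show "qhom (\<lambda>x. f (relabel_symb P x))" by (rule qhom_comp[OF f qhom_relabel_symb])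
  let ?e = "log_mould (\<lambda>x. f (relabel_symb P x))"
  let ?R = "\<lambda>a w. inv_mould f (P a) (relabel P w)" and ?A = "\<lambda>a w. reg_mould f (P a) (relabel P w)"
  show "inverse_moulds qinv fps_X ?e ?R ?A"
    unfolding inverse_moulds_def
  proof (intro conjI allI impI)
    show "?A a [] = 1" for a using reg_mould_Nil[OF f] by simp
    fix a w assume g: "good a w"
    have D: "mm (\<lambda>_. pole qinv fps_X) ?A = (\<lambda>a w. mm (\<lambda>_. pole qinv fps_X) (reg_mould f) (P a) (relabel P w))"
      by (intro ext) (use mm_relabel[of "\<lambda>_. pole qinv fps_X" P "reg_mould f"] in simp)
    have "mm ?R (mm (\<lambda>_. pole qinv fps_X) ?A) a w = mm (inv_mould f) (mm (\<lambda>_. pole qinv fps_X) (reg_mould f)) (P a) (relabel P w)"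
      unfolding D by (rule mm_relabel)
    also have "\<dots> = block_sum (symb_block f) (pole qinv fps_X) (P a) (relabel P w)"
      using inverse_moulds_symb[OF f] good_relabel[OF P g] by (simp add: inverse_moulds_def)
    also have "\<dots> = block_sum (block ?e ?R ?A) (\<lambda>w'. pole qinv fps_X (relabel P w')) a w"
      by (rule block_sum_relabel[symmetric]) (simp add: block_def log_mould_relabel)
    finally show "mm ?R (mm (\<lambda>_. pole qinv fps_X) ?A) a w = block_sum (block ?e ?R ?A) (pole qinv fps_X) a w" by simp
  qed
qed (simp_all add: reg_mould_relabel)

text \<open>This naturality makes the coproduct compatible with evaluation at a contracted element;
  as for coassociativity, it is read off from the regular moulds.\<close>

theorem cop_relabel:
  fixes f g :: "symb mpoly \<Rightarrow> 'n::cancel_comm_monoid_add malg"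
  assumes f: "qhom f" and g: "qhom g" and P: "strict_mono P" and x: "x \<in> carrier H_symb"
  shows "phom2 f g (cop (relabel_symb P x)) = phom2 (\<lambda>x. f (relabel_symb P x)) (\<lambda>x. g (relabel_symb P x)) (cop x)"
proof (rule qhom_eq_H_symbI[OF _ _ _ _ x, where f = "\<lambda>x. phom2 f g (cop (relabel_symb P x))" and
    g = "\<lambda>x. phom2 (\<lambda>x. f (relabel_symb P x)) (\<lambda>x. g (relabel_symb P x)) (cop x)"])
  let ?f = "\<lambda>x. f (relabel_symb P x)" and ?g = "\<lambda>x. g (relabel_symb P x)"
  have f': "qhom ?f" and g': "qhom ?g" using qhom_comp[OF f qhom_relabel_symb] qhom_comp[OF g qhom_relabel_symb] .
  show "qhom (\<lambda>x. phom2 f g (cop (relabel_symb P x)))"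
    using qhom_comp[OF qhom_comp[OF qhom_phom2[OF f g] qhom_cop] qhom_relabel_symb] .
  show "qhom (\<lambda>x. phom2 ?f ?g (cop x))"
    by (rule qhom_comp[OF qhom_phom2[OF f' g'] qhom_cop])
  show "phom2 f g (cop (relabel_symb P (log_coeff a b))) = phom2 ?f ?g (cop (log_coeff a b))" for a b
    by (simp add: relabel_symb_log_coeff cop_log_coeff qhom_add[OF qhom_phom2] phom2_inl2 phom2_inr2 f g f' g')
  fix a w assume w: "good a w"
  have "reg_mould (\<lambda>x. phom2 f g (cop (relabel_symb P x))) a w = reg_mould (\<lambda>x. phom2 f g (cop x)) (P a) (relabel P w)"
    by (rule reg_mould_relabel[of "\<lambda>x. phom2 f g (cop x)"])
  also have "\<dots> = mm (reg_mould g) (\<lambda>a. block_sum (symb_block g) (reg_mould f a) a) (P a) (relabel P w)"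
    by (rule reg_mould_cop[OF f g good_sorted[OF good_relabel[OF P w]]])
  also have "\<dots> = mm (\<lambda>a w. reg_mould g (P a) (relabel P w))
      (\<lambda>a w. block_sum (symb_block g) (reg_mould f (P a)) (P a) (relabel P w)) a w"
    by (rule mm_relabel[symmetric])
  also have "\<dots> = mm (reg_mould ?g) (\<lambda>a. block_sum (symb_block ?g) (reg_mould ?f a) a) a w"
  proof (rule mm_good_cong[OF w])
    fix a w assume w: "good a w"
    have "block_sum (symb_block g) (reg_mould f (P a)) (P a) (relabel P w) =
       block_sum (block (log_mould ?g) (\<lambda>a w. inv_mould g (P a) (relabel P w)) (\<lambda>a w. reg_mould g (P a) (relabel P w)))
         (\<lambda>w'. reg_mould f (P a) (relabel P w')) a w"
      by (rule block_sum_relabel[symmetric]) (simp add: block_def log_mould_relabel)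
    also have "\<dots> = block_sum (symb_block ?g) (reg_mould ?f a) a w"
      by (rule block_sum_good_cong[OF w]) (simp_all add: reg_mould_relabel inv_mould_relabel[OF g P])
    finally show "block_sum (symb_block g) (reg_mould f (P a)) (P a) (relabel P w) = block_sum (symb_block ?g) (reg_mould ?f a) a w" .
  qed (simp add: reg_mould_relabel)
  also have "\<dots> = reg_mould (\<lambda>x. phom2 ?f ?g (cop x)) a w"
    by (rule reg_mould_cop[OF f' g' good_sorted[OF w], symmetric])
  finally show "reg_mould (\<lambda>x. phom2 f g (cop (relabel_symb P x))) a w = reg_mould (\<lambda>x. phom2 ?f ?g (cop x)) a w" .
qed

section \<open>Supports and weights\<close>

text \<open>One notion for weights and for supports: a constant family is a monoid grading exactly
  if its value is a submonoid.\<close>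

definition monoid_grading :: "(nat \<Rightarrow> 'm::cancel_comm_monoid_add set) \<Rightarrow> bool" where
  "monoid_grading D \<longleftrightarrow> 0 \<in> D 0 \<and> (\<forall>i j m n. m \<in> D i \<longrightarrow> n \<in> D j \<longrightarrow> m + n \<in> D (i + j))"

context
  fixes D :: "nat \<Rightarrow> 'm::cancel_comm_monoid_add set"
  assumes D: "monoid_grading D"
begin

lemma keys_1_grading: "keys (1 :: 'm malg) \<subseteq> D 0"
  using D by (simp add: monoid_grading_def)

lemma keys_pconst_grading: "keys (pconst c :: 'm malg) \<subseteq> D 0"
  using D by (simp add: monoid_grading_def pconst_def)

lemma keys_add_grading: "keys (p :: 'm malg) \<subseteq> D k \<Longrightarrow> keys q \<subseteq> D k \<Longrightarrow> keys (p + q) \<subseteq> D k"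
  using keys_add[of p q] by blast

lemma keys_mult_grading: "keys (p :: 'm malg) \<subseteq> D k \<Longrightarrow> keys q \<subseteq> D l \<Longrightarrow> keys (p * q) \<subseteq> D (k + l)"
  using keys_mult[of p q] D by (fastforce simp: monoid_grading_def)

lemma keys_sum_grading: "(\<And>i. i \<in> A \<Longrightarrow> keys (f i :: 'm malg) \<subseteq> D k) \<Longrightarrow> keys (sum f A) \<subseteq> D k"
  by (induction A rule: infinite_finite_induct) (simp_all add: keys_add_grading)

lemma keys_prod_grading:
  "(\<And>i. i \<in> A \<Longrightarrow> keys (f i :: 'm malg) \<subseteq> D (k i)) \<Longrightarrow> finite A \<Longrightarrow> keys (prod f A) \<subseteq> D (sum k A)"
proof (induction A rule: infinite_finite_induct)
  case empty
  then show ?case using keys_1_grading by simp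
next
  case (insert x F)
  then show ?case by (simp add: keys_mult_grading)
qed simp

lemma keys_power_grading: "keys (p :: 'm malg) \<subseteq> D k \<Longrightarrow> keys (p ^ n) \<subseteq> D (n * k)"
proof (induction n)
  case 0
  then show ?case using keys_1_grading by simp
next
  case (Suc n)
  then show ?case by (simp add: keys_mult_grading)
qed

text \<open>The offset \<open>c\<close> is the depth: in the generating series of symbols of depth l
  the coefficient of a monomial of degree m has weight m + l, because t_i carries the exponent n_i -
  1.\<close>

definition graded_series :: "nat \<Rightarrow> 'm malg mseries \<Rightarrow> bool" where
  "graded_series c F \<longleftrightarrow> (\<forall>m. keys (scoeff F m) \<subseteq> D (sdegree m + c))"

lemma graded_series_add: "graded_series c F \<Longrightarrow> graded_series c G \<Longrightarrow> graded_series c (F + G)"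
  unfolding graded_series_def plus_mseries_def scoeff_Series by (intro allI keys_add_grading) blast+

lemma graded_series_0: "graded_series c 0"
  by (simp add: graded_series_def zero_mseries_def)

lemma graded_series_sum: "(\<And>i. i \<in> A \<Longrightarrow> graded_series c (f i)) \<Longrightarrow> graded_series c (sum f A)"
  by (induction A rule: infinite_finite_induct) (auto intro: graded_series_add graded_series_0)

lemma graded_series_uminus: "graded_series c F \<Longrightarrow> graded_series c (- F)"
  by (simp add: graded_series_def uminus_mseries_def)

lemma graded_series_1: "graded_series 0 1"
  using D by (auto simp: graded_series_def one_mseries_def monoid_grading_def)

lemma graded_series_mult:
  assumes "graded_series c F" "graded_series e G"
  shows "graded_series (c + e) (F * G)"
  unfolding graded_series_def times_mseries_def scoeff_Series
proof (intro allI keys_sum_grading, clarify)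
  fix a b :: "nat \<Rightarrow>\<^sub>0 nat" and x assume "x \<in> keys (scoeff F a * scoeff G b)"
  then have "x \<in> D ((sdegree a + c) + (sdegree b + e))"
    using keys_mult_grading assms unfolding graded_series_def by blast
  then show "x \<in> D (sdegree (a + b) + (c + e))" by (simp add: sdegree_add ac_simps)
qed

lemma graded_series_prod:
  "finite A \<Longrightarrow> (\<And>i. i \<in> A \<Longrightarrow> graded_series (c i) (f i)) \<Longrightarrow> graded_series (sum c A) (prod f A)"
  by (induction A rule: finite_induct) (auto intro: graded_series_mult graded_series_1)

lemma graded_series_sign: "graded_series 0 ((-1) ^ n)"
proof (induction n)
  case (Suc n)
  then show ?case using graded_series_mult[OF graded_series_uminus[OF graded_series_1] Suc] by simp
qed (simp add: graded_series_1)

lemma graded_series_div_t: "graded_series c F \<Longrightarrow> graded_series (c + 1) (div_t j F)"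
  unfolding graded_series_def div_t_def scoeff_Series
proof
  fix m assume "\<forall>m. keys (scoeff F m) \<subseteq> D (sdegree m + c)"
  then have "keys (scoeff F (m + Poly_Mapping.single j 1)) \<subseteq> D (sdegree (m + Poly_Mapping.single j 1) + c)" by blast
  then show "keys (scoeff F (m + Poly_Mapping.single j 1)) \<subseteq> D (sdegree m + (c + 1))"
    by (simp add: sdegree_add)
qed

text \<open>Each power of t_j comes with one factor \<open>a\<close> of weight 1, so the offset is
  0.\<close>

lemma graded_series_exp:
  assumes "keys a \<subseteq> D 1"
  shows "graded_series 0 (exp_series a j)"
  unfolding graded_series_def exp_series_def scoeff_Series
proof
  fix m :: "nat \<Rightarrow>\<^sub>0 nat"
  show "keys (if keys m \<subseteq> {j} then pconst (1 / fact (lookup m j)) * a ^ lookup m j else 0) \<subseteq> D (sdegree m + 0)"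
  proof (cases "keys m \<subseteq> {j}")
    case True
    then have "sdegree m = lookup m j" using sdegree_superset[of "{j}" m] by simp
    then show ?thesis
      using keys_mult_grading[OF keys_pconst_grading keys_power_grading[OF assms, of "lookup m j"]] True by simp
  qed simp
qed

end

text \<open>Series with rational coefficients, such as the linear forms that are substituted for the
  t_i.\<close>

definition const_series :: "'m::cancel_comm_monoid_add malg mseries \<Rightarrow> bool" where
  "const_series F \<longleftrightarrow> (\<forall>m. keys (scoeff F m) \<subseteq> {0})"

lemma const_grading: "monoid_grading (\<lambda>_. {0})"
  by (simp add: monoid_grading_def)

lemma const_series_iff: "const_series F \<longleftrightarrow> graded_series (\<lambda>_. {0}) c F"
  by (simp add: const_series_def graded_series_def[OF const_grading])

lemma const_series_tvar: "const_series (tvar i)"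
  by (auto simp: const_series_def tvar_def)

lemma const_series_uminus: "const_series F \<Longrightarrow> const_series (- F)"
  unfolding const_series_iff[where c = 0] by (rule graded_series_uminus[OF const_grading])

lemma const_series_diff: "const_series F \<Longrightarrow> const_series G \<Longrightarrow> const_series (F - G)"
  using graded_series_add[OF const_grading, of 0 F "- G"] const_series_uminus[of G]
  by (simp add: const_series_iff[where c = 0])

lemma const_series_power: "const_series F \<Longrightarrow> const_series (F ^ n)"
proof (induction n)
  case 0
  then show ?case using graded_series_1[OF const_grading] by (simp add: const_series_iff[where c = 0])
next
  case (Suc n)
  then show ?case using graded_series_mult[OF const_grading, of 0 F 0 "F ^ n"] by (simp add: const_series_iff[where c = 0])
qed

lemma const_series_prod: "finite A \<Longrightarrow> (\<And>i. i \<in> A \<Longrightarrow> const_series (f i)) \<Longrightarrow> const_series (prod f A)"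
  using graded_series_prod[OF const_grading, of A "\<lambda>_. 0" f] by (simp add: const_series_iff[where c = 0])

text \<open>The powers of the linear forms have rational coefficients, so all weight sits in the
  index list, whose sum is the degree plus the depth.\<close>

lemma graded_series_gen_series:
  fixes D :: "nat \<Rightarrow> 'm::cancel_comm_monoid_add set"
  assumes D: "monoid_grading D"
    and c: "\<And>ns. length ns = length L \<Longrightarrow> 0 \<notin> set ns \<Longrightarrow> keys (c ns) \<subseteq> D (sum_list ns)"
    and L: "\<And>F. F \<in> set L \<Longrightarrow> const_series F"
  shows "graded_series D (length L) (gen_series c L)"
  unfolding graded_series_def[OF D] gen_series_def scoeff_Series
proof (intro allI keys_sum_grading[OF D])
  fix m :: "nat \<Rightarrow>\<^sub>0 nat" and ns assume "ns \<in> {ns. length ns = length L \<and> 0 \<notin> set ns \<and> sum_list ns = sdegree m + length L}"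
  then have ns: "length ns = length L" "0 \<notin> set ns" "sum_list ns = sdegree m + length L" by auto
  have "const_series (\<Prod>i<length L. L ! i ^ (ns ! i - 1))"
    by (intro const_series_prod const_series_power L) auto
  then have "keys (scoeff (\<Prod>i<length L. L ! i ^ (ns ! i - 1)) m) \<subseteq> D 0"
    using D by (auto simp: const_series_def monoid_grading_def)
  from keys_mult_grading[OF D c[OF ns(1,2)] this]
  show "keys (c ns * scoeff (\<Prod>i<length L. L ! i ^ (ns ! i - 1)) m) \<subseteq> D (sdegree m + length L)"
    by (simp add: ns(3))
qed

section \<open>Weights of monomials and of their pairs\<close>

definition weight :: "('g \<Rightarrow> nat) \<Rightarrow> ('g \<Rightarrow>\<^sub>0 nat) \<Rightarrow> nat" where
  "weight wt m = (\<Sum>g\<in>keys m. lookup m g * wt g)"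

lemma weight_superset: "finite S \<Longrightarrow> keys m \<subseteq> S \<Longrightarrow> weight wt m = (\<Sum>g\<in>S. lookup m g * wt g)"
  unfolding weight_def by (rule sum.mono_neutral_left) (auto simp: in_keys_iff)

lemma weight_add: "weight wt (m + n) = weight wt m + weight wt n"
  using keys_add[of m n]
  by (subst (1 2 3) weight_superset[of "keys m \<union> keys n"]) (auto simp: lookup_add sum.distrib distrib_right)

lemma weight_0 [simp]: "weight wt 0 = 0"
  by (simp add: weight_def)

lemma weight_single [simp]: "weight wt (Poly_Mapping.single g k) = k * wt g"
  by (subst weight_superset[of "{g}"]) auto

definition grading1 :: "('g \<Rightarrow> nat) \<Rightarrow> 'g set \<Rightarrow> nat \<Rightarrow> ('g \<Rightarrow>\<^sub>0 nat) set" where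
  "grading1 wt V k = {m. keys m \<subseteq> V \<and> weight wt m = k}"

definition grading2 :: "('g \<Rightarrow> nat) \<Rightarrow> 'g set \<Rightarrow> nat \<Rightarrow> (('g \<Rightarrow>\<^sub>0 nat) \<times> ('g \<Rightarrow>\<^sub>0 nat)) set" where
  "grading2 wt V k = {(m, n). keys m \<subseteq> V \<and> keys n \<subseteq> V \<and> weight wt m + weight wt n = k}"

lemma monoid_grading1: "monoid_grading (grading1 wt V)"
  using keys_add by (fastforce simp: monoid_grading_def grading1_def weight_add)

lemma monoid_grading2: "monoid_grading (grading2 wt V)"
  unfolding monoid_grading_def
proof (intro conjI allI impI)
  fix i j x y assume xy: "x \<in> grading2 wt V i" "y \<in> grading2 wt V j"
  obtain m n m' n' where e: "x = (m, n)" "y = (m', n')" by fastforce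
  have "keys (m + m') \<subseteq> V" "keys (n + n') \<subseteq> V"
    using xy keys_add[of m m'] keys_add[of n n'] by (auto simp: e grading2_def)
  then show "x + y \<in> grading2 wt V (i + j)" using xy by (simp add: e grading2_def weight_add)
qed (simp add: grading2_def zero_prod_def)

lemma keys_pvar: "keys (pvar g) = {Poly_Mapping.single g 1}"
  by (simp add: pvar_def)

lemma keys_pvar_grading1: "g \<in> V \<Longrightarrow> wt g = k \<Longrightarrow> keys (pvar g) \<subseteq> grading1 wt V k"
  by (simp add: keys_pvar grading1_def)

lemma keys_inl2: "keys (inl2 p) \<subseteq> (\<lambda>m. (m, 0)) ` keys p"
  and keys_inr2: "keys (inr2 p) \<subseteq> (\<lambda>m. (0, m)) ` keys p"
proof -
  have *: "keys (monoid_lift (\<lambda>m. Poly_Mapping.single (f m) 1) p :: 'b malg) \<subseteq> f ` keys p" for f :: "('a \<Rightarrow>\<^sub>0 nat) \<Rightarrow> 'b::cancel_comm_monoid_add"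
  proof
    fix x assume x: "x \<in> keys (monoid_lift (\<lambda>m. Poly_Mapping.single (f m) 1) p :: 'b malg)"
    show "x \<in> f ` keys p"
    proof (rule ccontr)
      assume "x \<notin> f ` keys p"
      then have "lookup (monoid_lift (\<lambda>m. Poly_Mapping.single (f m) 1) p :: 'b malg) x = 0"
        by (auto simp: monoid_lift_def lookup_sum pconst_mult_single lookup_single when_def intro!: sum.neutral)
      then show False using x by (simp add: in_keys_iff)
    qed
  qed
  show "keys (inl2 p) \<subseteq> (\<lambda>m. (m, 0)) ` keys p" "keys (inr2 p) \<subseteq> (\<lambda>m. (0, m)) ` keys p"
    unfolding inl2_eq inr2_eq by (rule *)+
qed

lemma keys_inl2_grading: "keys p \<subseteq> grading1 wt V k \<Longrightarrow> keys (inl2 p) \<subseteq> grading2 wt V k"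
  using keys_inl2[of p] by (fastforce simp: grading1_def grading2_def)

lemma keys_inr2_grading: "keys p \<subseteq> grading1 wt V k \<Longrightarrow> keys (inr2 p) \<subseteq> grading2 wt V k"
  using keys_inr2[of p] by (fastforce simp: grading1_def grading2_def)

lemma keys_monoid_lift_grading:
  assumes D: "monoid_grading D" and M: "\<And>m. m \<in> keys p \<Longrightarrow> keys (M m) \<subseteq> D k"
  shows "keys (monoid_lift M p) \<subseteq> D k"
  unfolding monoid_lift_def
  by (rule keys_sum_grading[OF D]) (use keys_mult_grading[OF D keys_pconst_grading[OF D] M] in simp)

lemma keys_qhom_grading:
  assumes D: "monoid_grading D" and f: "qhom f" and p: "keys p \<subseteq> grading1 wt V k"
    and V: "\<And>g. g \<in> V \<Longrightarrow> keys (f (pvar g)) \<subseteq> D (wt g)"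
  shows "keys (f p) \<subseteq> D k"
proof -
  have "f p = monoid_lift (\<lambda>m. f (Poly_Mapping.single m 1)) p"
    by (rule qhom_eqI[OF f qhom_monoid_lift]) (simp_all add: qhom_1[OF f] qhom_single_add[OF f])
  also have "keys \<dots> \<subseteq> D k"
  proof (rule keys_monoid_lift_grading[OF D])
    fix m assume "m \<in> keys p"
    then have m: "keys m \<subseteq> V" "weight wt m = k" using p by (auto simp: grading1_def)
    have "keys (\<Prod>g\<in>keys m. f (pvar g) ^ lookup m g) \<subseteq> D (\<Sum>g\<in>keys m. lookup m g * wt g)"
      by (intro keys_prod_grading[OF D] keys_power_grading[OF D] V) (use m in auto)
    then show "keys (f (Poly_Mapping.single m 1)) \<subseteq> D k"
      using m by (simp add: monomial_prod qhom_prod[OF f] qhom_power[OF f] weight_def)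
  qed
  finally show ?thesis .
qed

lemma keys_phom2_grading:
  assumes D: "monoid_grading D" and f: "qhom f" and g: "qhom g" and z: "keys z \<subseteq> grading2 wt V k"
    and V: "\<And>s. s \<in> V \<Longrightarrow> keys (f (pvar s)) \<subseteq> D (wt s)" "\<And>s. s \<in> V \<Longrightarrow> keys (g (pvar s)) \<subseteq> D (wt s)"
  shows "keys (phom2 f g z) \<subseteq> D k"
  unfolding phom2_def
proof (rule keys_monoid_lift_grading[OF D], clarify)
  fix m n x assume mn: "(m, n) \<in> keys z" and x: "x \<in> keys (f (Poly_Mapping.single m 1) * g (Poly_Mapping.single n 1))"
  have "keys (Poly_Mapping.single m (1::rat)) \<subseteq> grading1 wt V (weight wt m)"
    "keys (Poly_Mapping.single n (1::rat)) \<subseteq> grading1 wt V (weight wt n)"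
    using z mn by (auto simp: grading1_def grading2_def)
  then have "keys (f (Poly_Mapping.single m 1)) \<subseteq> D (weight wt m)" "keys (g (Poly_Mapping.single n 1)) \<subseteq> D (weight wt n)"
    by (auto dest: keys_qhom_grading[OF D f _ V(1)] keys_qhom_grading[OF D g _ V(2)] simp del: keys_single)
  from keys_mult_grading[OF D this] show "x \<in> D k" using x z mn by (auto simp: grading2_def)
qed

section \<open>Weights and variables in the inversion and in the coproduct\<close>

fun symb_weight :: "symb \<Rightarrow> nat" where
  "symb_weight (Log i) = 1"
| "symb_weight (Sym p ns) = sum_list ns"

text \<open>The generators involving \<open>x\<^sub>1, \<dots>, x\<^sub>n\<close> only.\<close>

definition bounded_gens :: "nat \<Rightarrow> symb set" where
  "bounded_gens n = {Log i | i. 1 \<le> i \<and> i \<le> n} \<union>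
     {Sym p ns | p ns. ns \<noteq> [] \<and> length p = length ns + 1 \<and> set p \<subseteq> {1..n + 1} \<and> 0 \<notin> set ns \<and> sorted_wrt (<) p}"

definition bounded_bar_gens :: "nat \<Rightarrow> symb set" where
  "bounded_bar_gens n = bounded_gens n \<union>
     {Sym p ns | p ns. ns \<noteq> [] \<and> length p = length ns + 1 \<and> set p \<subseteq> {1..n + 1} \<and> 0 \<notin> set ns \<and> sorted_wrt (>) p}"

lemma bounded_gens_subset: "bounded_gens n \<subseteq> symb_gens"
  by (fastforce simp: bounded_gens_def symb_gens_def)

lemma keys_sym_coeff:
  assumes "length p = length ns + 1" "set p \<subseteq> {1..n + 1}" "0 \<notin> set ns" "sorted_wrt (<) p"
  shows "keys (sym_coeff p ns) \<subseteq> grading1 symb_weight (bounded_gens n) (sum_list ns)"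
proof (cases "ns = []")
  case True
  then show ?thesis using keys_1_grading[OF monoid_grading1] by simp
next
  case False
  then have "Sym p ns \<in> bounded_gens n" using assms by (auto simp: bounded_gens_def)
  then show ?thesis using keys_pvar_grading1[of "Sym p ns" "bounded_gens n" symb_weight] False by simp
qed

lemma keys_log_coeff:
  assumes "a \<in> {1..n + 1}" "b \<in> {1..n + 1}"
  shows "keys (log_coeff a b) \<subseteq> grading1 symb_weight (bounded_gens n) 1"
proof -
  have "keys (\<Sum>r=a..<b. pvar (Log r)) \<subseteq> grading1 symb_weight (bounded_gens n) 1" if "a \<in> {1..n + 1}" "b \<in> {1..n + 1}" for a b
    by (intro keys_sum_grading[OF monoid_grading1] keys_pvar_grading1) (use that in \<open>auto simp: bounded_gens_def\<close>)
  then show ?thesis using assms by (simp add: log_coeff_def)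
qed

lemma sdegree_texp: "0 \<notin> set ns \<Longrightarrow> sdegree (texp ns) + length ns = sum_list ns"
proof -
  assume ns: "0 \<notin> set ns"
  have "sdegree (texp ns) = (\<Sum>i\<in>{1..length ns}. ns ! (i - 1) - 1)"
    by (subst sdegree_superset[of "{1..length ns}"]) (auto simp: lookup_texp in_keys_iff split: if_splits)
  also have "\<dots> = (\<Sum>i<length ns. ns ! i - 1)"
    by (rule sum.reindex_bij_witness[where i = "\<lambda>i. i + 1" and j = "\<lambda>i. i - 1"]) auto
  finally have 1: "sdegree (texp ns) = (\<Sum>i<length ns. ns ! i - 1)" .
  have "length xs \<le> sum_list xs" if "0 \<notin> set xs" for xs :: "nat list"
    using that by (induction xs) auto
  from this[OF ns] have "ns \<in> index_lists (length ns) (sum_list ns - length ns)" using ns by (simp add: index_lists_def)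
  from sum_index_lists_minus[OF this] \<open>length ns \<le> sum_list ns\<close> show ?thesis by (simp add: 1)
qed

text \<open>The offsets of the factors add up to d in the first sum of the recursion and to d - 1 in
  the two others, where \<open>div_t\<close> raises them to d. All end points come from
  \<open>p\<close>, so no variable beyond x_n appears.\<close>

lemma keys_inv_coeff:
  assumes "length p = length ns + 1" "set p \<subseteq> {1..n + 1}" "0 \<notin> set ns" "sorted_wrt (<) p"
  shows "keys (inv_coeff p ns) \<subseteq> grading1 symb_weight (bounded_gens n) (sum_list ns)"
  using assms
proof (induction "length p" arbitrary: p ns rule: less_induct)
  case less
  let ?D = "grading1 symb_weight (bounded_gens n)"
  note D = monoid_grading1[of symb_weight "bounded_gens n"]
  define d where "d = length p - 1"
  have len: "length p = d + 1" "length ns = d" using less.prems(1) by (auto simp: d_def)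
  show ?case
  proof (cases "d = 0")
    case True
    then show ?thesis using keys_1_grading[OF D] len by (subst inv_coeff.simps) simp
  next
    case False
    have inv: "graded_series ?D j (gen_series (inv_coeff (take (j + 1) p)) (map F (rev [1..<j + 1])))"
      if "j < d" "\<And>r. const_series (F r)" for j and F :: "nat \<Rightarrow> symb mpoly mseries"
    proof -
      have "graded_series ?D (length (map F (rev [1..<j + 1]))) (gen_series (inv_coeff (take (j + 1) p)) (map F (rev [1..<j + 1])))"
      proof (rule graded_series_gen_series[OF D])
        fix ms :: "nat list" assume ms: "length ms = length (map F (rev [1..<j + 1]))" "0 \<notin> set ms"
        have "set (take (j + 1) p) \<subseteq> {1..n + 1}" using set_take_subset less.prems(2) by (rule order_trans)
        then show "keys (inv_coeff (take (j + 1) p) ms) \<subseteq> ?D (sum_list ms)"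
          by (intro less.hyps) (use ms that(1) len less.prems(4) in \<open>auto simp: sorted_wrt_take\<close>)
      qed (use that(2) in auto)
      then show ?thesis by (simp del: upt_Suc)
    qed
    have reg: "graded_series ?D (d - j) (gen_series (sym_coeff (drop j p)) (map F [j + 1..<d + 1]))"
      if "j \<le> d" "\<And>r. const_series (F r)" for j and F :: "nat \<Rightarrow> symb mpoly mseries"
    proof -
      have "graded_series ?D (length (map F [j + 1..<d + 1])) (gen_series (sym_coeff (drop j p)) (map F [j + 1..<d + 1]))"
      proof (rule graded_series_gen_series[OF D])
        fix ms :: "nat list" assume ms: "length ms = length (map F [j + 1..<d + 1])" "0 \<notin> set ms"
        have "set (drop j p) \<subseteq> {1..n + 1}" using set_drop_subset less.prems(2) by (rule order_trans)
        then show "keys (sym_coeff (drop j p) ms) \<subseteq> ?D (sum_list ms)"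
          by (intro keys_sym_coeff) (use ms that(1) len less.prems(4) in \<open>auto simp: sorted_wrt_drop\<close>)
      qed (use that(2) in auto)
      then show ?thesis using that(1) by (simp del: upt_Suc)
    qed
    have log: "graded_series ?D 0 (exp_series (log_coeff (hd p) (last p)) j)" for j
    proof (rule graded_series_exp[OF D keys_log_coeff])
      have "p \<noteq> []" using len by auto
      then show "hd p \<in> {1..n + 1}" "last p \<in> {1..n + 1}"
        using hd_in_set last_in_set less.prems(2) by blast+
    qed
    note mult = graded_series_mult[OF D]
    have S1: "graded_series ?D d ((-1) ^ (d - 1 + j) *
           gen_series (inv_coeff (take (j + 1) p)) (map (\<lambda>r. - tvar r) (rev [1..<j + 1])) *
           gen_series (sym_coeff (drop j p)) (map tvar [j + 1..<d + 1]))" if "j < d" for j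
      using mult[OF mult[OF graded_series_sign[OF D] inv[of j "\<lambda>r. - tvar r"]] reg[of j tvar]] that
      by (simp add: const_series_uminus const_series_tvar del: upt_Suc)
    have S2: "graded_series ?D (d - 1) ((-1) ^ (d - 1 + j) *
           gen_series (inv_coeff (take j p)) (map (\<lambda>r. - tvar r) (rev [1..<j])) *
           gen_series (sym_coeff (drop j p)) (map tvar [j + 1..<d + 1]))" if "1 \<le> j" "j \<le> d" for j
      using mult[OF mult[OF graded_series_sign[OF D] inv[of "j - 1" "\<lambda>r. - tvar r"]] reg[of j tvar]] that
      by (simp add: const_series_uminus const_series_tvar del: upt_Suc)
    have S3: "graded_series ?D (d - 1) ((-1) ^ (d + j) *
           gen_series (inv_coeff (take j p)) (map (\<lambda>r. tvar j - tvar r) (rev [1..<j])) *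
           exp_series (log_coeff (hd p) (last p)) j *
           gen_series (sym_coeff (drop j p)) (map (\<lambda>r. tvar r - tvar j) [j + 1..<d + 1]))" if "1 \<le> j" "j \<le> d" for j
      using mult[OF mult[OF mult[OF graded_series_sign[OF D] inv[of "j - 1" "\<lambda>r. tvar j - tvar r"]] log] reg[of j "\<lambda>r. tvar r - tvar j"]] that
      by (simp add: const_series_diff const_series_tvar del: upt_Suc)
    have div: "graded_series ?D (d - 1) F \<Longrightarrow> graded_series ?D d (div_t j F)" for F j
      using graded_series_div_t[OF D, of "d - 1" F j] False by simp
    have inv: "inv_coeff p ns = (-1) ^ (\<Sum>n\<leftarrow>ns. n - 1) * scoeff
       ((\<Sum>j\<in>{0..<d}. (-1) ^ (d - 1 + j) *
           gen_series (inv_coeff (take (j + 1) p)) (map (\<lambda>r. - tvar r) (rev [1..<j + 1])) *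
           gen_series (sym_coeff (drop j p)) (map tvar [j + 1..<d + 1])) +
        (\<Sum>j\<in>{1..d}. div_t j ((-1) ^ (d - 1 + j) *
           gen_series (inv_coeff (take j p)) (map (\<lambda>r. - tvar r) (rev [1..<j])) *
           gen_series (sym_coeff (drop j p)) (map tvar [j + 1..<d + 1]))) +
        (\<Sum>j\<in>{1..d}. div_t j ((-1) ^ (d + j) *
           gen_series (inv_coeff (take j p)) (map (\<lambda>r. tvar j - tvar r) (rev [1..<j])) *
           exp_series (log_coeff (hd p) (last p)) j *
           gen_series (sym_coeff (drop j p)) (map (\<lambda>r. tvar r - tvar j) [j + 1..<d + 1]))))
       (texp (rev ns))" (is "_ = _ * scoeff ?S _")
      by (subst inv_coeff.simps) (simp only: Let_def d_def[symmetric] False if_False)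
    have "graded_series ?D d ?S"
      by (intro graded_series_add[OF D] graded_series_sum[OF D] S1 div S2 S3) auto
    then have "keys (scoeff ?S (texp (rev ns))) \<subseteq> ?D (sdegree (texp (rev ns)) + d)"
      unfolding graded_series_def[OF D] by blast
    also have "sdegree (texp (rev ns)) + d = sum_list ns"
      using sdegree_texp[of "rev ns"] less.prems(3) len by (simp add: sum_list_rev)
    finally have "keys (scoeff ?S (texp (rev ns))) \<subseteq> ?D (sum_list ns)" .
    moreover have "keys ((-1) ^ k :: symb mpoly) \<subseteq> ?D 0" for k
      using keys_pconst_grading[OF D, of "(-1) ^ k"] by simp
    ultimately show ?thesis
      unfolding inv using keys_mult_grading[OF D, of _ 0 _ "sum_list ns"] by simp
  qed
qed

lemma grading1_mono: "V \<subseteq> W \<Longrightarrow> grading1 wt V k \<subseteq> grading1 wt W k"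
  by (auto simp: grading1_def)

lemma keys_sym_coeff_rev:
  assumes "length p = length ns + 1" "set p \<subseteq> {1..n + 1}" "0 \<notin> set ns" "sorted_wrt (<) p"
  shows "keys (sym_coeff (rev p) ns) \<subseteq> grading1 symb_weight (bounded_bar_gens n) (sum_list ns)"
proof (cases "ns = []")
  case True
  then show ?thesis using keys_1_grading[OF monoid_grading1] by simp
next
  case False
  then have "Sym (rev p) ns \<in> bounded_bar_gens n" using assms by (auto simp: bounded_bar_gens_def sorted_wrt_rev)
  then show ?thesis using keys_pvar_grading1[of "Sym (rev p) ns" "bounded_bar_gens n" symb_weight] False by simp
qed

lemma cut_points_cuts: "(is, js) \<in> cut_points d \<longleftrightarrow> (is, js) \<in> cuts (hd is) d \<and> 1 \<le> hd is"
  by (auto simp: cut_points_def cuts_def)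

text \<open>The depths of the contracted word, of the initial part and of the two parts of each
  block add up to d, by telescoping over the cuts; this is why the coproduct preserves
  weight.\<close>

lemma sum_cut_lengths:
  assumes "(is, js) \<in> cuts s d" "1 \<le> s"
  shows "length js + (s - 1) + (\<Sum>r<length js. (js ! r - is ! r) + (is ! (r + 1) - js ! r - 1)) = d"
proof -
  have len: "length is = length js + 1" and hd: "hd is = s" and last: "last is = d + 1"
    and ij: "\<And>r. r < length js \<Longrightarrow> is ! r \<le> js ! r \<and> js ! r < is ! (r + 1)"
    using assms(1) by (auto simp: cuts_def)
  have "is \<noteq> []" using len by auto
  then have ends: "is ! 0 = s" "is ! length js = d + 1" using hd last len by (auto simp: hd_conv_nth last_conv_nth)
  have "(\<Sum>r<length js. int ((js ! r - is ! r) + (is ! (r + 1) - js ! r - 1))) = (\<Sum>r<length js. int (is ! Suc r) - int (is ! r) - 1)"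
    by (intro sum.cong refl) (use ij in fastforce)
  also have "\<dots> = (int d + 1 - int s) - int (length js)"
    using sum_lessThan_telescope[of "\<lambda>r. int (is ! r)" "length js"] ends by (simp add: sum_subtractf)
  finally have "int (length js + (s - 1) + (\<Sum>r<length js. (js ! r - is ! r) + (is ! (r + 1) - js ! r - 1))) = int d"
    using assms(2) by (simp add: of_nat_diff)
  then show ?thesis by linarith
qed

lemma keys_cop_gen_Sym:
  assumes "length p = length ns + 1" "set p \<subseteq> {1..n + 1}" "0 \<notin> set ns" "sorted_wrt (<) p"
  shows "keys (cop_gen (Sym p ns)) \<subseteq> grading2 symb_weight (bounded_bar_gens n) (sum_list ns)"
proof -
  let ?D = "grading2 symb_weight (bounded_bar_gens n)"
  note D = monoid_grading2[of symb_weight "bounded_bar_gens n"]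
  define d where "d = length ns"
  define P where "P = (\<lambda>i. p ! (i - 1))"
  have len: "length p = d + 1" using assms(1) by (simp add: d_def)
  have sub: "bounded_gens n \<subseteq> bounded_bar_gens n" by (auto simp: bounded_bar_gens_def)
  have sort: "sorted_wrt (<) (map P is)" and bd: "set (map P is) \<subseteq> {1..n + 1}"
    if "sorted_wrt (<) is" "set is \<subseteq> {1..d + 1}" for "is"
  proof -
    show "sorted_wrt (<) (map P is)"
      unfolding P_def by (rule sorted_map_nth) (use assms(4) that len in auto)
    have "P i \<in> set p" if "i \<in> {1..d + 1}" for i unfolding P_def using that len by auto
    then have "P i \<in> {1..n + 1}" if "i \<in> set is" for i using that \<open>set is \<subseteq> {1..d + 1}\<close> assms(2) by blast
    then show "set (map P is) \<subseteq> {1..n + 1}" by auto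
  qed
  have reg: "keys (sym_coeff (map P is) ms) \<subseteq> grading1 symb_weight (bounded_bar_gens n) (sum_list ms)"
    if "sorted_wrt (<) is" "set is \<subseteq> {1..d + 1}" "length is = length ms + 1" "0 \<notin> set ms" for "is" ms
    using keys_sym_coeff[of "map P is" ms n] sort[OF that(1,2)] bd[OF that(1,2)] that grading1_mono[OF sub]
    by (simp del: sym_coeff.simps) blast
  have inv: "keys (sym_coeff (rev (map P is)) ms) \<subseteq> grading1 symb_weight (bounded_bar_gens n) (sum_list ms)"
    if "sorted_wrt (<) is" "set is \<subseteq> {1..d + 1}" "length is = length ms + 1" "0 \<notin> set ms" for "is" ms
    by (rule keys_sym_coeff_rev[OF _ bd[OF that(1,2)] _ sort[OF that(1,2)]]) (use that in auto)
  have X1: "graded_series ?D (length js) (gen_series (left_coeff (map P is)) (map tvar js))"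
    if "sorted_wrt (<) is" "set is \<subseteq> {1..d + 1}" "length is = length js + 1" for "is" js
  proof -
    have "graded_series ?D (length (map tvar js :: symb mpoly2 mseries list)) (gen_series (left_coeff (map P is)) (map tvar js))"
    proof (rule graded_series_gen_series[OF D])
      fix ms :: "nat list" assume "length ms = length (map tvar js :: symb mpoly2 mseries list)" "0 \<notin> set ms"
      then show "keys (left_coeff (map P is) ms) \<subseteq> ?D (sum_list ms)"
        unfolding left_coeff_def inl2_def[symmetric] by (intro keys_inl2_grading reg) (use that in auto)
    qed (auto simp: const_series_tvar)
    then show ?thesis by simp
  qed
  have X2: "graded_series ?D (length L) (gen_series (right_coeff (map P [i..<j])) L)"
    if "1 \<le> i" "j \<le> d + 2" "j - i = length L + 1" "\<And>F. F \<in> set L \<Longrightarrow> const_series F" for i j L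
  proof (rule graded_series_gen_series[OF D])
    fix ms :: "nat list" assume "length ms = length L" "0 \<notin> set ms"
    then show "keys (right_coeff (map P [i..<j]) ms) \<subseteq> ?D (sum_list ms)"
      unfolding right_coeff_def inr2_def[symmetric] by (intro keys_inr2_grading reg) (use that in auto)
  qed (rule that)
  have X3: "graded_series ?D (length L) (gen_series (right_coeff (map P (rev [i..<j]))) L)"
    if "1 \<le> i" "j \<le> d + 2" "j - i = length L + 1" "\<And>F. F \<in> set L \<Longrightarrow> const_series F" for i j L
  proof (rule graded_series_gen_series[OF D])
    fix ms :: "nat list" assume "length ms = length L" "0 \<notin> set ms"
    then show "keys (right_coeff (map P (rev [i..<j])) ms) \<subseteq> ?D (sum_list ms)"
      unfolding right_coeff_def inr2_def[symmetric] rev_map[symmetric]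
      by (intro keys_inr2_grading inv) (use that in auto)
  qed (rule that)
  have X4: "graded_series ?D 0 (exp_series (ptensor 1 (log_coeff (P i) (P i'))) j)" if "i \<in> {1..d + 1}" "i' \<in> {1..d + 1}" for i i' j
  proof (rule graded_series_exp[OF D])
    have "P i \<in> {1..n + 1}" "P i' \<in> {1..n + 1}" using bd[of "[i]"] bd[of "[i']"] that by auto
    from keys_log_coeff[OF this] show "keys (ptensor 1 (log_coeff (P i) (P i'))) \<subseteq> ?D 1"
      unfolding inr2_def[symmetric] using grading1_mono[OF sub] by (intro keys_inr2_grading) blast
  qed
  note mult = graded_series_mult[OF D]
  have term': "graded_series ?D d (gen_series (left_coeff (map P is)) (map tvar js) *
       gen_series (right_coeff (map P [1..<hd is + 1])) (map tvar [1..<hd is]) *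
       (\<Prod>a<length js. let i = is ! a; j = js ! a; i' = is ! (a + 1) in
          (-1) ^ (j - i) *
          exp_series (ptensor 1 (log_coeff (P i) (P i'))) j *
          gen_series (right_coeff (map P (rev [i..<j + 1]))) (map (\<lambda>r. tvar j - tvar r) (rev [i..<j])) *
          gen_series (right_coeff (map P [j + 1..<i' + 1])) (map (\<lambda>r. tvar r - tvar j) [j + 1..<i'])))"
    if c: "(is, js) \<in> cut_points d" for "is" js
  proof -
    define s where "s = hd is"
    have cs: "(is, js) \<in> cuts s d" "1 \<le> s" using c by (auto simp: cut_points_cuts s_def)
    have sd: "s \<le> d + 1" using cuts_hd_le cs by blast
    have ps: "sorted_wrt (<) is" "set is \<subseteq> {1..d + 1}"
      using bspec[OF conjunct2[OF cuts_props[OF sd]] cs(1)] cs(2) by auto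
    have li: "length is = length js + 1" using cs by (simp add: cuts_def)
    have rng: "is ! r \<in> {1..d + 1}" if "r < length js + 1" for r
      by (rule subsetD[OF ps(2) nth_mem]) (use that li in simp)
    have ij: "is ! r \<le> js ! r \<and> js ! r < is ! (r + 1)" if "r < length js" for r
      using cs that by (auto simp: cuts_def)
    have F: "graded_series ?D (0 + 0 + (js ! a - is ! a) + (is ! (a + 1) - js ! a - 1)) (let i = is ! a; j = js ! a; i' = is ! (a + 1) in
          (-1) ^ (j - i) *
          exp_series (ptensor 1 (log_coeff (P i) (P i'))) j *
          gen_series (right_coeff (map P (rev [i..<j + 1]))) (map (\<lambda>r. tvar j - tvar r) (rev [i..<j])) *
          gen_series (right_coeff (map P [j + 1..<i' + 1])) (map (\<lambda>r. tvar r - tvar j) [j + 1..<i']))" if a: "a < length js" for a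
    proof -
      have r: "is ! a \<in> {1..d + 1}" "is ! (a + 1) \<in> {1..d + 1}" "is ! a \<le> js ! a" "js ! a < is ! (a + 1)"
        using rng[of a] rng[of "a + 1"] ij[OF a] a by auto
      have 1: "graded_series ?D (js ! a - is ! a) (gen_series (right_coeff (map P (rev [is ! a..<js ! a + 1]))) (map (\<lambda>r. tvar (js ! a) - tvar r) (rev [is ! a..<js ! a])))"
      proof -
        define L :: "symb mpoly2 mseries list" where "L = map (\<lambda>r. tvar (js ! a) - tvar r) (rev [is ! a..<js ! a])"
        have "graded_series ?D (length L) (gen_series (right_coeff (map P (rev [is ! a..<js ! a + 1]))) L)"
          by (rule X3) (use r in \<open>auto simp: L_def const_series_diff const_series_tvar\<close>)
        then show ?thesis unfolding L_def by (simp del: upt_Suc)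
      qed
      have 2: "graded_series ?D (is ! (a + 1) - js ! a - 1) (gen_series (right_coeff (map P [js ! a + 1..<is ! (a + 1) + 1])) (map (\<lambda>r. tvar r - tvar (js ! a)) [js ! a + 1..<is ! (a + 1)]))"
      proof -
        define L :: "symb mpoly2 mseries list" where "L = map (\<lambda>r. tvar r - tvar (js ! a)) [js ! a + 1..<is ! (a + 1)]"
        have "graded_series ?D (length L) (gen_series (right_coeff (map P [js ! a + 1..<is ! (a + 1) + 1])) L)"
          by (rule X2) (use r in \<open>auto simp: L_def const_series_diff const_series_tvar\<close>)
        then show ?thesis unfolding L_def by (simp del: upt_Suc)
      qed
      show ?thesis unfolding Let_def
        by (rule mult[OF mult[OF mult[OF graded_series_sign[OF D] X4[OF r(1,2)]] 1] 2])
    qed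
    have G: "graded_series ?D (s - 1) (gen_series (right_coeff (map P [1..<hd is + 1])) (map tvar [1..<hd is]))"
    proof -
      define L :: "symb mpoly2 mseries list" where "L = map tvar [1..<s]"
      have "graded_series ?D (length L) (gen_series (right_coeff (map P [1..<s + 1])) L)"
        by (rule X2) (use cs(2) sd in \<open>auto simp: L_def const_series_tvar\<close>)
      then show ?thesis unfolding L_def s_def by (simp del: upt_Suc)
    qed
    have tot: "length js + (s - 1) + (\<Sum>a<length js. 0 + 0 + (js ! a - is ! a) + (is ! (a + 1) - js ! a - 1)) = d"
      using sum_cut_lengths[OF cs] by simp
    show ?thesis unfolding tot[symmetric]
      by (rule mult[OF mult[OF X1[OF ps li] G] graded_series_prod[OF D finite_lessThan]]) (rule F, simp)
  qed
  have "graded_series ?D d (cop_series p)"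
    unfolding cop_series_def Let_def
    by (rule graded_series_sum[OF D], clarify) (use term' in \<open>simp add: len P_def Let_def del: upt_Suc\<close>)
  then have "keys (scoeff (cop_series p) (texp ns)) \<subseteq> ?D (sdegree (texp ns) + d)"
    unfolding graded_series_def[OF D] by blast
  then show ?thesis using sdegree_texp[OF assms(3)] by (simp add: d_def)
qed

lemma qhom_inl2_inversion: "qhom (\<lambda>x. inl2 (inversion x))"
  and qhom_inr2_inversion: "qhom (\<lambda>x. inr2 (inversion x))"
  by (rule qhom_comp[OF qhom_inl2 qhom_inversion] qhom_comp[OF qhom_inr2 qhom_inversion])+

lemma keys_inversion_pvar:
  assumes "g \<in> bounded_bar_gens n"
  shows "keys (inversion (pvar g)) \<subseteq> grading1 symb_weight (bounded_gens n) (symb_weight g)"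
proof (cases g)
  case (Log i)
  then show ?thesis using assms
    by (auto simp: inversion_def bounded_bar_gens_def bounded_gens_def keys_pvar grading1_def)
next
  case (Sym p ns)
  show ?thesis
  proof (cases "sorted_wrt (>) p")
    case True
    then have "sorted_wrt (<) (rev p)" by (simp add: sorted_wrt_rev)
    moreover have "length p = length ns + 1" "set p \<subseteq> {1..n + 1}" "0 \<notin> set ns"
      using assms by (auto simp: Sym bounded_bar_gens_def bounded_gens_def)
    ultimately show ?thesis using keys_inv_coeff[of "rev p" ns n] True by (simp add: inversion_def Sym)
  next
    case False
    then have "g \<in> bounded_gens n" using assms by (auto simp: Sym bounded_bar_gens_def)
    then show ?thesis using False keys_pvar_grading1[of g "bounded_gens n" symb_weight] by (simp add: inversion_def Sym)
  qed
qed

lemma keys_cop_pvar: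
  assumes "g \<in> bounded_gens n"
  shows "keys (cop (pvar g)) \<subseteq> grading2 symb_weight (bounded_gens n) (symb_weight g)"
proof (cases g)
  case (Log i)
  have "g \<in> bounded_gens n" using assms .
  then have "keys (pvar (Log i)) \<subseteq> grading1 symb_weight (bounded_gens n) 1"
    using Log by (intro keys_pvar_grading1) auto
  then have "keys (inl2 (pvar (Log i)) + inr2 (pvar (Log i))) \<subseteq> grading2 symb_weight (bounded_gens n) 1"
    by (intro keys_add_grading[OF monoid_grading2] keys_inl2_grading keys_inr2_grading)
  then show ?thesis using cop_log_coeff[of i "Suc i"] by (simp add: log_coeff_def Log)
next
  case (Sym p ns)
  have "keys (cop_gen g) \<subseteq> grading2 symb_weight (bounded_bar_gens n) (symb_weight g)"
    unfolding Sym symb_weight.simps by (rule keys_cop_gen_Sym) (use assms in \<open>auto simp: Sym bounded_gens_def\<close>)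
  then have "keys (ptensor_map inversion inversion (cop_gen g)) \<subseteq> grading2 symb_weight (bounded_gens n) (symb_weight g)"
    unfolding ptensor_map_eq
    by (rule keys_phom2_grading[OF monoid_grading2 qhom_inl2_inversion qhom_inr2_inversion])
      (auto intro!: keys_inl2_grading keys_inr2_grading keys_inversion_pvar)
  then show ?thesis by (simp add: cop_def cop_bar_def)
qed

section \<open>The antipode on symbols\<close>

lemma symb_gens_bounded: "g \<in> symb_gens \<Longrightarrow> \<exists>n. g \<in> bounded_gens n"
proof (cases g)
  case (Log i)
  assume "g \<in> symb_gens"
  then show ?thesis using Log by (auto simp: symb_gens_def bounded_gens_def)
next
  case (Sym p ns)
  assume g: "g \<in> symb_gens"
  have "x \<le> Max (set p)" if "x \<in> set p" for x using that by simp
  moreover have "1 \<le> x" if "x \<in> set p" for x using g that Sym by (cases x) (auto simp: symb_gens_def)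
  ultimately have "set p \<subseteq> {1..Max (set p) + 1}" by (meson atLeastAtMost_iff subsetI trans_le_add1)
  then have "g \<in> bounded_gens (Max (set p))" using g Sym by (auto simp: bounded_gens_def symb_gens_def)
  then show ?thesis ..
qed

lemma symb_weight_pos: "g \<in> bounded_gens n \<Longrightarrow> symb_weight g > 0"
  by (auto simp: bounded_gens_def neq_Nil_conv)

lemma weight_pos:
  assumes "keys m \<subseteq> bounded_gens n" "m \<noteq> 0"
  shows "weight symb_weight m > 0"
proof -
  obtain g where g: "g \<in> keys m" using assms(2) by (metis ex_in_conv keys_eq_empty)
  then have "g \<in> bounded_gens n" using assms(1) by blast
  then have "0 < lookup m g * symb_weight g" using g symb_weight_pos by (simp add: in_keys_iff)
  also have "\<dots> \<le> weight symb_weight m" unfolding weight_def using g by (intro member_le_sum) auto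
  finally show ?thesis .
qed

lemma bounded_gens_H_symb: "g \<in> bounded_gens n \<Longrightarrow> pvar g \<in> carrier H_symb"
  using bounded_gens_subset by (auto simp: H_symb_def free_alg_def keys_pvar)

text \<open>By the counit axiom the only term of the coproduct with right factor \<open>1\<close> is \<open>g \<otimes> 1\<close>.\<close>

lemma keys_cop_reduced:
  assumes g: "g \<in> bounded_gens N" and mn: "(m, n) \<in> keys (cop (pvar g) - inl2 (pvar g))"
  shows "keys m \<subseteq> bounded_gens N \<and> keys n \<subseteq> bounded_gens N \<and> weight symb_weight m < symb_weight g"
proof -
  let ?z = "cop (pvar g) - inl2 (pvar g)"
  have aug: "augmentation (Poly_Mapping.single k (1::rat)) = (if k = 0 then 1 else 0 :: symb mpoly)" for k :: "symb \<Rightarrow>\<^sub>0 nat"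
  proof (cases "k = 0")
    case True
    then show ?thesis using qhom_1[OF qhom_augmentation] by simp
  next
    case False
    then obtain s where "s \<in> keys k" by (metis ex_in_conv keys_eq_empty)
    then have "(\<Prod>s\<in>keys k. (0 :: symb mpoly) ^ lookup k s) = 0"
      by (intro prod_zero bexI[of _ s]) (auto simp: in_keys_iff zero_power)
    then show ?thesis using False
      by (simp add: monomial_prod qhom_prod[OF qhom_augmentation] qhom_power[OF qhom_augmentation])
        (simp add: augmentation_def)
  qed
  \<comment> \<open>The augmentation on the right factor reads off the terms whose right factor is
    1.\<close>
  have look: "lookup (phom2 (\<lambda>x. x) augmentation z) k = lookup z (k, 0)" for z :: "symb mpoly2" and k
  proof -
    have "lookup (phom2 (\<lambda>x. x) augmentation z) k = (\<Sum>x\<in>keys z. if x = (k, 0) then lookup z x else 0)"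
      unfolding phom2_def monoid_lift_def lookup_sum
      by (intro sum.cong refl) (auto simp: aug lookup_pconst_mult lookup_single when_def split: if_splits)
    also have "\<dots> = lookup z (k, 0)" by (simp add: sum.delta in_keys_iff)
    finally show ?thesis .
  qed
  have "phom2 (\<lambda>x. x) augmentation ?z = 0"
    using counit_symb(2)[OF qhom_id bounded_gens_H_symb[OF g]]
    by (simp add: qhom_diff[OF qhom_phom2[OF qhom_id qhom_augmentation]] phom2_inl2[OF qhom_id qhom_augmentation])
  then have "lookup ?z (m, 0) = 0" using look[of ?z m] by simp
  then have "n \<noteq> 0" using mn by (auto simp: in_keys_iff)
  have "keys (inl2 (pvar g)) \<subseteq> grading2 symb_weight (bounded_gens N) (symb_weight g)"
    by (intro keys_inl2_grading keys_pvar_grading1 g refl)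
  then have "keys ?z \<subseteq> grading2 symb_weight (bounded_gens N) (symb_weight g)"
    using keys_add_grading[OF monoid_grading2 keys_cop_pvar[OF g], of "- inl2 (pvar g)"]
    by simp
  then have "keys m \<subseteq> bounded_gens N" "keys n \<subseteq> bounded_gens N" "weight symb_weight m + weight symb_weight n = symb_weight g"
    using mn by (auto simp: grading2_def)
  then show ?thesis using weight_pos[OF _ \<open>n \<noteq> 0\<close>] by fastforce
qed

text \<open>The antipode should satisfy S(g) = - sum of S(g') g'' over the terms of the coproduct
  other than g tensor 1, and there g' has smaller weight than g. This is unrolled into approximants:
  all weights being positive, the n-th one is final on generators of weight at most n.\<close>

primrec antipode_step :: "nat \<Rightarrow> symb mpoly \<Rightarrow> symb mpoly" where
  "antipode_step 0 = augmentation"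
| "antipode_step (Suc n) = phom (\<lambda>g. - phom2 (antipode_step n) (\<lambda>x. x) (cop (pvar g) - inl2 (pvar g)))"

lemma qhom_antipode_step: "qhom (antipode_step n)"
  by (cases n) (simp_all add: qhom_augmentation qhom_phom)

lemma phom2_cong:
  "(\<And>m n. (m, n) \<in> keys z \<Longrightarrow> f (Poly_Mapping.single m 1) = f' (Poly_Mapping.single m 1)) \<Longrightarrow>
   (\<And>m n. (m, n) \<in> keys z \<Longrightarrow> g (Poly_Mapping.single n 1) = g' (Poly_Mapping.single n 1)) \<Longrightarrow>
    phom2 f g z = phom2 f' g' z"
  unfolding phom2_def monoid_lift_def by (intro sum.cong refl) auto

lemma symb_weight_le: "g \<in> keys m \<Longrightarrow> symb_weight g \<le> weight symb_weight m"
proof -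
  assume g: "g \<in> keys m"
  then have "symb_weight g \<le> lookup m g * symb_weight g" by (auto simp: in_keys_iff)
  also have "\<dots> \<le> weight symb_weight m" unfolding weight_def using g by (intro member_le_sum) auto
  finally show ?thesis .
qed

lemma qhom_single_cong:
  assumes "qhom f" "qhom f'" "\<And>g. g \<in> keys m \<Longrightarrow> f (pvar g) = f' (pvar g)"
  shows "f (Poly_Mapping.single m 1) = f' (Poly_Mapping.single m 1)"
  by (rule qhom_eq_pvarI[OF assms(1,2)]) (use assms(3) in auto)

lemma antipode_step_stable:
  "g \<in> bounded_gens N \<Longrightarrow> symb_weight g \<le> n \<Longrightarrow> antipode_step (Suc n) (pvar g) = antipode_step n (pvar g)"
proof (induction n arbitrary: g)
  case 0
  then show ?case using symb_weight_pos by fastforce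
next
  case (Suc n)
  have "phom2 (antipode_step (Suc n)) (\<lambda>x. x) (cop (pvar g) - inl2 (pvar g)) =
      phom2 (antipode_step n) (\<lambda>x. x) (cop (pvar g) - inl2 (pvar g))"
  proof (rule phom2_cong[OF _ refl], rule qhom_single_cong[OF qhom_antipode_step qhom_antipode_step])
    fix m k s assume "(m, k) \<in> keys (cop (pvar g) - inl2 (pvar g))" and s: "s \<in> keys m"
    from keys_cop_reduced[OF Suc.prems(1) this(1)] symb_weight_le[OF s] s Suc.prems(2)
    show "antipode_step (Suc n) (pvar s) = antipode_step n (pvar s)" by (intro Suc.IH) auto
  qed
  then show ?case by (subst (1 2) antipode_step.simps(2)) (simp only: phom_pvar)
qed

lemma antipode_step_eq:
  assumes "g \<in> bounded_gens N" "symb_weight g \<le> n"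
  shows "antipode_step n (pvar g) = antipode_step (symb_weight g) (pvar g)"
  using assms(2) by (induction n rule: dec_induct) (use antipode_step_stable[OF assms(1)] in auto)

definition antipode :: "symb mpoly \<Rightarrow> symb mpoly" where
  "antipode = phom (\<lambda>g. antipode_step (symb_weight g) (pvar g))"

lemma qhom_antipode: "qhom antipode"
  unfolding antipode_def by (rule qhom_phom)

lemma antipode_pvar:
  assumes g: "g \<in> bounded_gens N"
  shows "antipode (pvar g) = - phom2 antipode (\<lambda>x. x) (cop (pvar g) - inl2 (pvar g))"
proof -
  obtain k where k: "symb_weight g = Suc k" using symb_weight_pos[OF g] by (cases "symb_weight g") auto
  have "phom2 (antipode_step k) (\<lambda>x. x) (cop (pvar g) - inl2 (pvar g)) = phom2 antipode (\<lambda>x. x) (cop (pvar g) - inl2 (pvar g))"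
  proof (rule phom2_cong[OF _ refl], rule qhom_single_cong[OF qhom_antipode_step qhom_antipode])
    fix m n s assume "(m, n) \<in> keys (cop (pvar g) - inl2 (pvar g))" and s: "s \<in> keys m"
    from keys_cop_reduced[OF g this(1)] symb_weight_le[OF s] s k
    have "s \<in> bounded_gens N" "symb_weight s \<le> k" by auto
    from antipode_step_eq[OF this] show "antipode_step k (pvar s) = antipode (pvar s)" by (simp add: antipode_def)
  qed
  then show ?thesis by (simp add: antipode_def k)
qed

text \<open>On a generator this is the recursion for the antipode, with the term S(g) belonging to g
  tensor 1 brought to the other side.\<close>

theorem antipode_symb:
  assumes x: "x \<in> carrier H_symb"
  shows "phom2 antipode (\<lambda>x. x) (cop x) = augmentation x"
proof (rule qhom_eq_pvarI[OF qhom_comp[OF qhom_phom2[OF qhom_antipode qhom_id] qhom_cop] qhom_augmentation])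
  fix m g assume "m \<in> keys x" "g \<in> keys m"
  then have "g \<in> symb_gens" using x by (auto simp: H_symb_def free_alg_def)
  then obtain N where g: "g \<in> bounded_gens N" using symb_gens_bounded by blast
  show "phom2 antipode (\<lambda>x. x) (cop (pvar g)) = augmentation (pvar g)"
    using antipode_pvar[OF g]
    by (simp add: qhom_diff[OF qhom_phom2[OF qhom_antipode qhom_id]] phom2_inl2[OF qhom_antipode qhom_id])
      (simp add: augmentation_def)
qed

text \<open>Needed twice: the antipode must stay in the domain of an evaluation, and it must
  preserve degrees.\<close>

lemma keys_antipode_pvar:
  "g \<in> bounded_gens N \<Longrightarrow> keys (antipode (pvar g)) \<subseteq> grading1 symb_weight (bounded_gens N) (symb_weight g)"
proof (induction "symb_weight g" arbitrary: g rule: less_induct)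
  case less
  let ?z = "cop (pvar g) - inl2 (pvar g)"
  have "keys (phom2 antipode (\<lambda>x. x) ?z) \<subseteq> grading1 symb_weight (bounded_gens N) (symb_weight g)"
    unfolding phom2_def
  proof (rule keys_monoid_lift_grading[OF monoid_grading1], clarify)
    fix m n y assume mn: "(m, n) \<in> keys ?z"
      and y: "y \<in> keys (antipode (Poly_Mapping.single m 1) * Poly_Mapping.single n 1)"
    note r = keys_cop_reduced[OF less.prems mn]
    have "keys ?z \<subseteq> grading2 symb_weight (bounded_gens N) (symb_weight g)"
      using keys_add_grading[OF monoid_grading2 keys_cop_pvar[OF less.prems], of "- inl2 (pvar g)"]
        keys_inl2_grading[OF keys_pvar_grading1[OF less.prems refl]]
      by simp
    then have w: "weight symb_weight m + weight symb_weight n = symb_weight g" using mn by (auto simp: grading2_def)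
    have "keys (Poly_Mapping.single m (1::rat)) \<subseteq> grading1 symb_weight (keys m) (weight symb_weight m)"
      by (simp add: grading1_def)
    then have 1: "keys (antipode (Poly_Mapping.single m 1)) \<subseteq> grading1 symb_weight (bounded_gens N) (weight symb_weight m)"
    proof (rule keys_qhom_grading[OF monoid_grading1 qhom_antipode])
      fix s assume s: "s \<in> keys m"
      then show "keys (antipode (pvar s)) \<subseteq> grading1 symb_weight (bounded_gens N) (symb_weight s)"
        using symb_weight_le[OF s] r by (intro less.hyps) auto
    qed
    have 2: "keys (Poly_Mapping.single n (1::rat)) \<subseteq> grading1 symb_weight (bounded_gens N) (weight symb_weight n)"
      using r by (simp add: grading1_def)
    show "y \<in> grading1 symb_weight (bounded_gens N) (symb_weight g)"
      using keys_mult_grading[OF monoid_grading1 1 2] y w by auto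
  qed
  then show ?case unfolding antipode_pvar[OF less.prems] by simp
qed

lemma antipode_log_coeff: "antipode (log_coeff a b) = - log_coeff a b"
proof -
  have 1: "antipode_step (Suc 0) (pvar (Log i)) = - pvar (Log i)" for i
    using cop_log_coeff[of i "Suc i"] phom2_inr2[OF qhom_augmentation qhom_id]
    by (simp add: log_coeff_def)
  then have "antipode (pvar (Log i)) = - pvar (Log i)" for i
    by (simp add: antipode_def del: antipode_step.simps)
  then show ?thesis by (simp add: log_coeff_eq qhomD[OF qhom_antipode] sum_negf)
qed

text \<open>By induction on the weight, through the recursion for the antipode and
  \<open>cop_relabel\<close>. The condition \<open>P 0 = 0\<close> keeps end points positive, so
  that relabelled symbols are again generators.\<close>

lemma antipode_relabel_pvar:
  assumes P: "strict_mono P" "P 0 = 0"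
  shows "g \<in> bounded_gens N \<Longrightarrow> antipode (relabel_symb P (pvar g)) = relabel_symb P (antipode (pvar g))"
proof (induction "symb_weight g" arbitrary: g rule: less_induct)
  case less
  let ?r = "relabel_symb P"
  note r = qhom_relabel_symb[of P]
  show ?case
  proof (cases g)
    case (Log i)
    show ?thesis using antipode_log_coeff[of i "Suc i"] relabel_symb_log_coeff[of P i "Suc i"]
      by (simp add: Log log_coeff_def qhom_uminus[OF r] antipode_log_coeff[unfolded log_coeff_def])
  next
    case (Sym p ns)
    have p: "ns \<noteq> []" "length p = length ns + 1" "set p \<subseteq> {1..N + 1}" "0 \<notin> set ns" "sorted_wrt (<) p"
      using less.prems by (auto simp: Sym bounded_gens_def)
    have rg: "?r (pvar g) = pvar (Sym (map P p) ns)" by (simp add: relabel_symb_def Sym)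
    have "P i \<ge> 1" if "i \<ge> 1" for i using strict_mono_less[OF P(1), of 0 i] P(2) that by simp
    moreover have "P i \<le> P (N + 1)" if "i \<le> N + 1" for i using strict_mono_leD[OF P(1) that] .
    ultimately have "set (map P p) \<subseteq> {1..P (N + 1) + 1}" using p(3) by fastforce
    moreover have "sorted_wrt (<) (map P p)" using p(5) strict_mono_less[OF P(1)] by (simp add: sorted_wrt_map)
    ultimately have g': "Sym (map P p) ns \<in> bounded_gens (P (N + 1))" using p by (auto simp: bounded_gens_def)
    let ?z = "cop (pvar g) - inl2 (pvar g)"
    have A: "phom2 antipode (\<lambda>x. x) (cop (?r (pvar g)) - inl2 (?r (pvar g))) = phom2 (\<lambda>x. antipode (?r x)) ?r ?z"
      using cop_relabel[OF qhom_antipode qhom_id P(1) bounded_gens_H_symb[OF less.prems]]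
      by (simp add: qhom_diff[OF qhom_phom2] qhom_antipode qhom_id qhom_comp r phom2_inl2 qhom_comp[OF qhom_antipode r])
    also have "\<dots> = phom2 (\<lambda>x. ?r (antipode x)) ?r ?z"
    proof (rule phom2_cong[OF _ refl], rule qhom_single_cong[OF qhom_comp[OF qhom_antipode r] qhom_comp[OF r qhom_antipode]])
      fix m n s assume "(m, n) \<in> keys ?z" and s: "s \<in> keys m"
      from keys_cop_reduced[OF less.prems this(1)] symb_weight_le[OF s] s
      show "antipode (?r (pvar s)) = ?r (antipode (pvar s))" by (intro less.hyps) auto
    qed
    also have "\<dots> = ?r (phom2 antipode (\<lambda>x. x) ?z)"
      by (rule qhom_eqI[OF qhom_phom2[OF qhom_comp[OF r qhom_antipode] r] qhom_comp[OF r qhom_phom2[OF qhom_antipode qhom_id]]])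
        (auto simp: phom2_def qhom_mult[OF r])
    finally have B: "phom2 antipode (\<lambda>x. x) (cop (?r (pvar g)) - inl2 (?r (pvar g))) = ?r (phom2 antipode (\<lambda>x. x) ?z)" .
    show ?thesis
      unfolding antipode_pvar[OF less.prems] qhom_uminus[OF r] B[symmetric] unfolding rg by (rule antipode_pvar[OF g'])
  qed
qed

section \<open>Algebras over the rationals\<close>

lemma rat_alg_simps [simp]: "carrier rat_alg = UNIV" "monoid.mult rat_alg = (*)" "one rat_alg = 1" "zero rat_alg = 0"
  "add rat_alg = (+)" "module.smult rat_alg = (*)"
  by (simp_all add: rat_alg_def)

lemma cring_rat_alg: "cring rat_alg"
proof (intro cringI abelian_groupI comm_monoidI)
  show "\<exists>y\<in>carrier rat_alg. y \<oplus>\<^bsub>rat_alg\<^esub> x = \<zero>\<^bsub>rat_alg\<^esub>" for x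
    by (rule bexI[of _ "- x"]) auto
qed (auto simp: algebra_simps)

locale qalgebra = algebra rat_alg A for A :: "(rat, 'a, 'x) module_scheme" (structure)
begin

lemma q_unary:
  assumes "x \<in> carrier A"
  shows "c \<odot> x \<in> carrier A" "(c + d) \<odot> x = c \<odot> x \<oplus> d \<odot> x" "c \<odot> (d \<odot> x) = (c * d) \<odot> x"
    "1 \<odot> x = x" "0 \<odot> x = \<zero>"
  using assms smult_closed[of c x] smult_l_distr[of c d x] smult_assoc1[of c d x] smult_one[of x] smult_l_null[of x]
  by simp_all

lemma q_binary:
  assumes "x \<in> carrier A" "y \<in> carrier A"
  shows "c \<odot> (x \<oplus> y) = c \<odot> x \<oplus> c \<odot> y" "(c \<odot> x) \<otimes> y = c \<odot> (x \<otimes> y)" "x \<otimes> (c \<odot> y) = c \<odot> (x \<otimes> y)"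
  using assms smult_r_distr[of c x y] smult_assoc2[of c x y] smult_assoc2[of c y x]
    m_comm[of x "c \<odot> y"] m_comm[of x y] smult_closed[of c y] by simp_all

lemma q_zero: "c \<odot> \<zero> = \<zero>"
  using smult_r_null[of c] by simp

lemmas q_simps = q_unary q_binary q_zero

text \<open>Linear extension with values in an algebra given by a carrier, in the shape of
  \<open>alg_eval\<close>, \<open>alg_eval_tensor\<close> and, for a chosen representative,
  \<open>tensor_lift\<close>.\<close>

definition lin :: "('i \<Rightarrow> 'a) \<Rightarrow> ('i \<Rightarrow>\<^sub>0 rat) \<Rightarrow> 'a" where
  "lin M p = (\<Oplus>x\<in>keys p. lookup p x \<odot> M x)"

lemma lin_superset:
  assumes "finite S" "keys p \<subseteq> S" "M \<in> S \<rightarrow> carrier A"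
  shows "lin M p = (\<Oplus>x\<in>S. lookup p x \<odot> M x)"
  unfolding lin_def
  by (rule add.finprod_mono_neutral_cong_left) (use assms in \<open>auto simp: in_keys_iff q_simps Pi_def\<close>)

lemma lin_closed: "M \<in> keys p \<rightarrow> carrier A \<Longrightarrow> lin M p \<in> carrier A"
  unfolding lin_def by (rule finsum_closed) (auto simp: q_simps)

lemma lin_zero [simp]: "lin M 0 = \<zero>"
  by (simp add: lin_def)

lemma lin_single: "M x \<in> carrier A \<Longrightarrow> lin M (Poly_Mapping.single x c) = c \<odot> M x"
  by (subst lin_superset[of "{x}"]) (auto simp: q_simps)

lemma lin_add:
  assumes "M \<in> keys p \<rightarrow> carrier A" "M \<in> keys q \<rightarrow> carrier A"
  shows "lin M (p + q) = lin M p \<oplus> lin M q"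
proof -
  have M: "M \<in> keys p \<union> keys q \<rightarrow> carrier A" using assms by auto
  have "lin M (p + q) = (\<Oplus>x\<in>keys p \<union> keys q. lookup (p + q) x \<odot> M x)"
    by (rule lin_superset) (use keys_add[of p q] M in auto)
  also have "\<dots> = (\<Oplus>x\<in>keys p \<union> keys q. lookup p x \<odot> M x \<oplus> lookup q x \<odot> M x)"
    by (rule finsum_cong'[OF refl]) (use M in \<open>auto simp: lookup_add q_simps Pi_iff\<close>)
  also have "\<dots> = (\<Oplus>x\<in>keys p \<union> keys q. lookup p x \<odot> M x) \<oplus> (\<Oplus>x\<in>keys p \<union> keys q. lookup q x \<odot> M x)"
    by (rule finsum_addf) (use M in \<open>auto simp: q_simps\<close>)
  finally show ?thesis using M by (simp add: lin_superset[of "keys p \<union> keys q"])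
qed

lemma lin_sum:
  assumes "\<And>i. i \<in> I \<Longrightarrow> M \<in> keys (f i) \<rightarrow> carrier A"
  shows "lin M (sum f I) = (\<Oplus>i\<in>I. lin M (f i))"
  using assms
proof (induction I rule: infinite_finite_induct)
  case (insert x F)
  have "keys (sum f F) \<subseteq> (\<Union>i\<in>F. keys (f i))"
    using insert.hyps(1) by (induction F rule: finite_induct) (use keys_add in fastforce)+
  then have "M \<in> keys (sum f F) \<rightarrow> carrier A" using insert.prems by blast
  then have "lin M (sum f (insert x F)) = lin M (f x) \<oplus> lin M (sum f F)"
    using insert by (simp add: lin_add)
  also have "lin M (sum f F) = (\<Oplus>i\<in>F. lin M (f i))" using insert.IH insert.prems by blast
  also have "lin M (f x) \<oplus> \<dots> = (\<Oplus>i\<in>insert x F. lin M (f i))"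
    using insert by (subst finsum_insert) (auto intro!: lin_closed)
  finally show ?case .
qed (auto simp: finsum_infinite)

lemma lin_cong: "(\<And>x. x \<in> keys p \<Longrightarrow> M x = N x) \<Longrightarrow> N \<in> keys p \<rightarrow> carrier A \<Longrightarrow> lin M p = lin N p"
  unfolding lin_def by (rule finsum_cong') (auto simp: q_simps)

lemma smult_finsum: "f \<in> I \<rightarrow> carrier A \<Longrightarrow> c \<odot> (\<Oplus>i\<in>I. f i) = (\<Oplus>i\<in>I. c \<odot> f i)"
proof (induction I rule: infinite_finite_induct)
  case (insert x F)
  then show ?case by (simp add: Pi_def q_simps finsum_insert)
qed (auto simp: finsum_infinite q_simps)

lemma lin_map_scale:
  assumes "M \<in> keys p \<rightarrow> carrier A"
  shows "lin M (Poly_Mapping.map ((*) c) p) = c \<odot> lin M p"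
proof -
  have l: "lookup (Poly_Mapping.map ((*) c) p) x = c * lookup p x" for x
    by (simp add: map.rep_eq when_def)
  have "lin M (Poly_Mapping.map ((*) c) p) = (\<Oplus>x\<in>keys p. c \<odot> (lookup p x \<odot> M x))"
    using assms by (subst lin_superset[of "keys p"]) (auto simp: in_keys_iff l q_simps Pi_iff intro!: finsum_cong')
  then show ?thesis unfolding lin_def using assms by (subst smult_finsum) (auto simp: q_simps)
qed

end

lemma qalgebraI:
  assumes "cring A"
    and "\<And>c x. x \<in> carrier A \<Longrightarrow> c \<odot>\<^bsub>A\<^esub> x \<in> carrier A"
    and "\<And>c d x. x \<in> carrier A \<Longrightarrow> (c + d) \<odot>\<^bsub>A\<^esub> x = c \<odot>\<^bsub>A\<^esub> x \<oplus>\<^bsub>A\<^esub> d \<odot>\<^bsub>A\<^esub> x"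
    and "\<And>c x y. x \<in> carrier A \<Longrightarrow> y \<in> carrier A \<Longrightarrow> c \<odot>\<^bsub>A\<^esub> (x \<oplus>\<^bsub>A\<^esub> y) = c \<odot>\<^bsub>A\<^esub> x \<oplus>\<^bsub>A\<^esub> c \<odot>\<^bsub>A\<^esub> y"
    and "\<And>c d x. x \<in> carrier A \<Longrightarrow> (c * d) \<odot>\<^bsub>A\<^esub> x = c \<odot>\<^bsub>A\<^esub> (d \<odot>\<^bsub>A\<^esub> x)"
    and "\<And>x. x \<in> carrier A \<Longrightarrow> 1 \<odot>\<^bsub>A\<^esub> x = x"
    and "\<And>c x y. x \<in> carrier A \<Longrightarrow> y \<in> carrier A \<Longrightarrow> (c \<odot>\<^bsub>A\<^esub> x) \<otimes>\<^bsub>A\<^esub> y = c \<odot>\<^bsub>A\<^esub> (x \<otimes>\<^bsub>A\<^esub> y)"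
  shows "qalgebra A"
  unfolding qalgebra_def by (rule algebraI[OF cring_rat_alg assms(1)]) (simp_all add: assms)

lemma alg_homD:
  assumes "h \<in> alg_hom A B"
  shows alg_hom_closed: "x \<in> carrier A \<Longrightarrow> h x \<in> carrier B"
    and alg_hom_add: "x \<in> carrier A \<Longrightarrow> y \<in> carrier A \<Longrightarrow> h (x \<oplus>\<^bsub>A\<^esub> y) = h x \<oplus>\<^bsub>B\<^esub> h y"
    and alg_hom_mult: "x \<in> carrier A \<Longrightarrow> y \<in> carrier A \<Longrightarrow> h (x \<otimes>\<^bsub>A\<^esub> y) = h x \<otimes>\<^bsub>B\<^esub> h y"
    and alg_hom_one: "h \<one>\<^bsub>A\<^esub> = \<one>\<^bsub>B\<^esub>"
    and alg_hom_smult: "x \<in> carrier A \<Longrightarrow> h (c \<odot>\<^bsub>A\<^esub> x) = c \<odot>\<^bsub>B\<^esub> h x"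
  using assms by (auto simp: alg_hom_def ring_hom_def)

lemma alg_homI:
  assumes "\<And>x. x \<in> carrier A \<Longrightarrow> h x \<in> carrier B"
    and "\<And>x y. x \<in> carrier A \<Longrightarrow> y \<in> carrier A \<Longrightarrow> h (x \<oplus>\<^bsub>A\<^esub> y) = h x \<oplus>\<^bsub>B\<^esub> h y"
    and "\<And>x y. x \<in> carrier A \<Longrightarrow> y \<in> carrier A \<Longrightarrow> h (x \<otimes>\<^bsub>A\<^esub> y) = h x \<otimes>\<^bsub>B\<^esub> h y"
    and "h \<one>\<^bsub>A\<^esub> = \<one>\<^bsub>B\<^esub>"
    and "\<And>c x. x \<in> carrier A \<Longrightarrow> h (c \<odot>\<^bsub>A\<^esub> x) = c \<odot>\<^bsub>B\<^esub> h x"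
  shows "h \<in> alg_hom A B"
  using assms by (auto simp: alg_hom_def ring_hom_def)

lemma alg_hom_comp: "g \<in> alg_hom B C \<Longrightarrow> f \<in> alg_hom A B \<Longrightarrow> (\<lambda>x. g (f x)) \<in> alg_hom A C"
  by (rule alg_homI) (simp_all add: alg_homD[of g] alg_homD[of f])

lemma alg_hom_id: "(\<lambda>x. x) \<in> alg_hom A A"
  by (rule alg_homI) simp_all

lemma alg_hom_zero:
  assumes "h \<in> alg_hom A B" "qalgebra A" "qalgebra B"
  shows "h \<zero>\<^bsub>A\<^esub> = \<zero>\<^bsub>B\<^esub>"
proof -
  interpret A: qalgebra A by fact interpret B: qalgebra B by fact
  have "h (0 \<odot>\<^bsub>A\<^esub> \<one>\<^bsub>A\<^esub>) = 0 \<odot>\<^bsub>B\<^esub> h \<one>\<^bsub>A\<^esub>" by (rule alg_hom_smult[OF assms(1)]) simp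
  then show ?thesis by (simp add: alg_hom_one[OF assms(1)] A.q_simps B.q_simps)
qed

lemma alg_hom_finsum:
  assumes "h \<in> alg_hom A B" "qalgebra A" "qalgebra B" "f \<in> I \<rightarrow> carrier A"
  shows "h (finsum A f I) = finsum B (\<lambda>i. h (f i)) I"
proof -
  interpret A: qalgebra A by fact interpret B: qalgebra B by fact
  show ?thesis using assms(4)
  proof (induction I rule: infinite_finite_induct)
    case (insert x F)
    then show ?case
      by (simp add: Pi_def A.finsum_insert B.finsum_insert alg_homD[OF assms(1)] A.finsum_closed)
  qed (auto simp: A.finsum_infinite B.finsum_infinite alg_hom_zero[OF assms(1-3)])
qed

lemma alg_hom_lin:
  assumes "h \<in> alg_hom A B" "qalgebra A" "qalgebra B" "M \<in> keys p \<rightarrow> carrier A"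
  shows "h (qalgebra.lin A M p) = qalgebra.lin B (\<lambda>x. h (M x)) p"
proof -
  interpret A: qalgebra A by fact interpret B: qalgebra B by fact
  show ?thesis unfolding A.lin_def B.lin_def
    using assms(4) by (subst alg_hom_finsum[OF assms(1-3)])
     (auto simp: A.q_simps B.q_simps alg_homD[OF assms(1)] Pi_iff intro!: B.finsum_cong')
qed

section \<open>Monoid algebras\<close>

text \<open>The common form of \<open>free_alg\<close>, where monomials are added, and of
  \<open>tensor_free\<close>, where pairs are multiplied componentwise. The operation is a parameter
  because in the second case the monoid laws hold on the carriers only.\<close>

definition monoid_alg :: "'i set \<Rightarrow> ('i \<Rightarrow> 'i \<Rightarrow> 'i) \<Rightarrow> 'i \<Rightarrow> (rat, 'i \<Rightarrow>\<^sub>0 rat) module" where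
  "monoid_alg K f e =
    \<lparr>carrier = {u. keys u \<subseteq> K},
     monoid.mult = (\<lambda>u v. \<Sum>x\<in>keys u. \<Sum>y\<in>keys v. Poly_Mapping.single (f x y) (lookup u x * lookup v y)),
     one = Poly_Mapping.single e 1, zero = 0, add = (+), module.smult = (\<lambda>c. Poly_Mapping.map ((*) c))\<rparr>"

lemma monoid_alg_simps: "carrier (monoid_alg K f e) = {u. keys u \<subseteq> K}"
  "monoid.mult (monoid_alg K f e) = (\<lambda>u v. \<Sum>x\<in>keys u. \<Sum>y\<in>keys v. Poly_Mapping.single (f x y) (lookup u x * lookup v y))"
  "one (monoid_alg K f e) = Poly_Mapping.single e 1" "zero (monoid_alg K f e) = 0"
  "add (monoid_alg K f e) = (+)" "module.smult (monoid_alg K f e) = (\<lambda>c. Poly_Mapping.map ((*) c))"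
  by (simp_all add: monoid_alg_def)

lemma lookup_map_scale: "lookup (Poly_Mapping.map ((*) c) p) x = c * lookup p x" for c :: rat
  by (simp add: map.rep_eq when_def)

lemma keys_sum_subset: "(\<And>i. i \<in> I \<Longrightarrow> keys (f i) \<subseteq> K) \<Longrightarrow> keys (sum f I) \<subseteq> K"
proof (induction I rule: infinite_finite_induct)
  case (insert x F)
  then show ?case using keys_add[of "f x" "sum f F"] by auto
qed auto

locale comm_monoid_on =
  fixes K :: "'i set" and f :: "'i \<Rightarrow> 'i \<Rightarrow> 'i" and e :: 'i
  assumes f_closed: "x \<in> K \<Longrightarrow> y \<in> K \<Longrightarrow> f x y \<in> K" and e_closed: "e \<in> K"
    and f_assoc: "x \<in> K \<Longrightarrow> y \<in> K \<Longrightarrow> z \<in> K \<Longrightarrow> f (f x y) z = f x (f y z)"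
    and f_comm: "x \<in> K \<Longrightarrow> y \<in> K \<Longrightarrow> f x y = f y x" and f_unit: "x \<in> K \<Longrightarrow> f e x = x"
begin

abbreviation "MA \<equiv> monoid_alg K f e"

lemma mult_superset:
  assumes "finite S" "finite T" "keys u \<subseteq> S" "keys v \<subseteq> T"
  shows "monoid.mult MA u v = (\<Sum>x\<in>S. \<Sum>y\<in>T. Poly_Mapping.single (f x y) (lookup u x * lookup v y))"
proof -
  have "(\<Sum>y\<in>keys v. Poly_Mapping.single (f x y) (lookup u x * lookup v y)) =
      (\<Sum>y\<in>T. Poly_Mapping.single (f x y) (lookup u x * lookup v y))" for x
    by (rule sum.mono_neutral_left) (use assms in \<open>auto simp: in_keys_iff\<close>)
  then show ?thesis
    unfolding monoid_alg_simps
    by (simp, intro sum.mono_neutral_left) (use assms in \<open>auto simp: in_keys_iff intro!: sum.neutral\<close>)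
qed

lemma mult_add_left: "monoid.mult MA (u + v) w = monoid.mult MA u w + monoid.mult MA v w"
  using keys_add[of u v]
  by (subst (1 2 3) mult_superset[of "keys u \<union> keys v" "keys w"])
    (auto simp: lookup_add distrib_right single_add sum.distrib)

lemma mult_sum_left: "monoid.mult MA (sum g I) w = (\<Sum>i\<in>I. monoid.mult MA (g i) w)"
  by (induction I rule: infinite_finite_induct) (auto simp: mult_add_left, auto simp: monoid_alg_simps)

lemma mult_single_left: "monoid.mult MA (Poly_Mapping.single x a) v = (\<Sum>y\<in>keys v. Poly_Mapping.single (f x y) (a * lookup v y))"
  by (subst mult_superset[of "{x}" "keys v"]) auto

lemma mult_single_single: "monoid.mult MA (Poly_Mapping.single x a) (Poly_Mapping.single y b) = Poly_Mapping.single (f x y) (a * b)"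
  by (subst mult_superset[of "{x}" "{y}"]) auto

lemma keys_mult_subset: "keys u \<subseteq> K \<Longrightarrow> keys v \<subseteq> K \<Longrightarrow> keys (monoid.mult MA u v) \<subseteq> K"
  unfolding monoid_alg_simps by (intro keys_sum_subset) (use f_closed in \<open>auto split: if_splits\<close>)

lemma mult_comm: "keys u \<subseteq> K \<Longrightarrow> keys v \<subseteq> K \<Longrightarrow> monoid.mult MA u v = monoid.mult MA v u"
  unfolding monoid_alg_simps
  by (subst sum.swap, intro sum.cong refl) (use f_comm in \<open>auto simp: mult.commute subset_iff\<close>)

lemma mult_sum_right: "keys u \<subseteq> K \<Longrightarrow> (\<And>i. i \<in> I \<Longrightarrow> keys (g i) \<subseteq> K) \<Longrightarrow> monoid.mult MA u (sum g I) = (\<Sum>i\<in>I. monoid.mult MA u (g i))"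
  using mult_comm[of u "sum g I"] mult_comm[of u] keys_sum_subset[of I g K] by (simp add: mult_sum_left)

lemma mult_assoc':
  assumes u: "keys u \<subseteq> K" and v: "keys v \<subseteq> K" and w: "keys w \<subseteq> K"
  shows "monoid.mult MA (monoid.mult MA u v) w = monoid.mult MA u (monoid.mult MA v w)"
proof -
  have cl: "f x y \<in> K" if "x \<in> keys v" "y \<in> keys w" for x y using that v w f_closed by blast
  have "monoid.mult MA (monoid.mult MA u v) w = (\<Sum>x\<in>keys u. \<Sum>y\<in>keys v. \<Sum>z\<in>keys w.
      Poly_Mapping.single (f (f x y) z) (lookup u x * lookup v y * lookup w z))"
    by (subst (2) monoid_alg_simps) (simp add: mult_sum_left mult_single_left)
  also have "\<dots> = (\<Sum>x\<in>keys u. \<Sum>y\<in>keys v. \<Sum>z\<in>keys w.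
      Poly_Mapping.single (f x (f y z)) (lookup u x * (lookup v y * lookup w z)))"
    by (intro sum.cong refl) (use u v w f_assoc in \<open>auto simp: mult.assoc subset_iff\<close>)
  also have "\<dots> = (\<Sum>x\<in>keys u. monoid.mult MA (Poly_Mapping.single x (lookup u x)) (monoid.mult MA v w))"
  proof (intro sum.cong refl)
    fix x assume "x \<in> keys u"
    then have x: "keys (Poly_Mapping.single x (lookup u x)) \<subseteq> K" using u by auto
    have "monoid.mult MA (Poly_Mapping.single x (lookup u x)) (monoid.mult MA v w) =
      (\<Sum>y\<in>keys v. \<Sum>z\<in>keys w. monoid.mult MA (Poly_Mapping.single x (lookup u x)) (Poly_Mapping.single (f y z) (lookup v y * lookup w z)))"
      unfolding monoid_alg_simps(2)[of K f e, THEN fun_cong, THEN fun_cong, of v w]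
      by (subst mult_sum_right[OF x], (intro keys_sum_subset, use cl in \<open>auto split: if_splits\<close>)[1],
          intro sum.cong refl, subst mult_sum_right[OF x]) (use cl in \<open>auto split: if_splits\<close>)
    then show "(\<Sum>y\<in>keys v. \<Sum>z\<in>keys w. Poly_Mapping.single (f x (f y z)) (lookup u x * (lookup v y * lookup w z))) =
       monoid.mult MA (Poly_Mapping.single x (lookup u x)) (monoid.mult MA v w)"
      by (simp add: mult_single_single)
  qed
  also have "\<dots> = monoid.mult MA u (monoid.mult MA v w)"
    by (simp flip: mult_sum_left malg_decomp)
  finally show ?thesis .
qed

lemma qalgebra_monoid_alg: "qalgebra MA"
proof (rule qalgebraI)
  note c = monoid_alg_simps(1,3-6)
  show "cring MA"
  proof (intro cringI abelian_groupI comm_monoidI)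
    show "\<exists>y\<in>carrier MA. y \<oplus>\<^bsub>MA\<^esub> x = \<zero>\<^bsub>MA\<^esub>" if "x \<in> carrier MA" for x
      by (rule bexI[of _ "- x"]) (use that in \<open>auto simp: c in_keys_iff subset_iff\<close>)
    show "\<one>\<^bsub>MA\<^esub> \<otimes>\<^bsub>MA\<^esub> x = x" if "x \<in> carrier MA" for x
    proof -
      have "\<one>\<^bsub>MA\<^esub> \<otimes>\<^bsub>MA\<^esub> x = (\<Sum>y\<in>keys x. Poly_Mapping.single y (lookup x y))"
        unfolding c mult_single_left by (intro sum.cong refl) (use that f_unit in \<open>auto simp: c\<close>)
      then show ?thesis by (simp flip: malg_decomp)
    qed
    show "x \<oplus>\<^bsub>MA\<^esub> y \<in> carrier MA" if "x \<in> carrier MA" "y \<in> carrier MA" for x y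
      using that keys_add[of x y] by (auto simp: c)
    show "x \<otimes>\<^bsub>MA\<^esub> y \<in> carrier MA" if "x \<in> carrier MA" "y \<in> carrier MA" for x y
      using that keys_mult_subset[of x y] by (simp add: c)
    show "x \<otimes>\<^bsub>MA\<^esub> y \<otimes>\<^bsub>MA\<^esub> z = x \<otimes>\<^bsub>MA\<^esub> (y \<otimes>\<^bsub>MA\<^esub> z)" if "x \<in> carrier MA" "y \<in> carrier MA" "z \<in> carrier MA" for x y z
      using that mult_assoc'[of x y z] by (simp add: c)
    show "x \<otimes>\<^bsub>MA\<^esub> y = y \<otimes>\<^bsub>MA\<^esub> x" if "x \<in> carrier MA" "y \<in> carrier MA" for x y
      using that mult_comm[of x y] by (simp add: c)
  qed (auto simp: c mult_add_left e_closed add_ac)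
  show "c \<odot>\<^bsub>MA\<^esub> x \<in> carrier MA" if "x \<in> carrier MA" for c x
    using that by (auto simp: c in_keys_iff lookup_map_scale subset_iff)
  show "(c \<odot>\<^bsub>MA\<^esub> x) \<otimes>\<^bsub>MA\<^esub> y = c \<odot>\<^bsub>MA\<^esub> (x \<otimes>\<^bsub>MA\<^esub> y)" if "x \<in> carrier MA" "y \<in> carrier MA" for c x y
  proof -
    have "(c \<odot>\<^bsub>MA\<^esub> x) \<otimes>\<^bsub>MA\<^esub> y = (\<Sum>a\<in>keys x. \<Sum>b\<in>keys y. Poly_Mapping.single (f a b) (c * lookup x a * lookup y b))"
      by (subst mult_superset[of "keys x" "keys y"]) (auto simp: monoid_alg_simps(6) in_keys_iff lookup_map_scale)
    also have "\<dots> = c \<odot>\<^bsub>MA\<^esub> (x \<otimes>\<^bsub>MA\<^esub> y)"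
    proof (rule poly_mapping_eqI)
      fix k
      show "lookup (\<Sum>a\<in>keys x. \<Sum>b\<in>keys y. Poly_Mapping.single (f a b) (c * lookup x a * lookup y b)) k = lookup (c \<odot>\<^bsub>MA\<^esub> (x \<otimes>\<^bsub>MA\<^esub> y)) k"
        unfolding monoid_alg_simps(2,6) lookup_map_scale lookup_sum sum_distrib_left
        by (intro sum.cong refl) (auto simp: lookup_single when_def)
    qed
    finally show ?thesis .
  qed
qed (auto simp: monoid_alg_simps lookup_map_scale lookup_add algebra_simps intro!: poly_mapping_eqI)

theorem lin_alg_hom:
  assumes B: "qalgebra B" and M: "M \<in> K \<rightarrow> carrier B" "M e = \<one>\<^bsub>B\<^esub>"
    and mult: "\<And>x y. x \<in> K \<Longrightarrow> y \<in> K \<Longrightarrow> M (f x y) = M x \<otimes>\<^bsub>B\<^esub> M y"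
  shows "qalgebra.lin B M \<in> alg_hom MA B"
proof -
  interpret B: qalgebra B by fact
  have Mk: "M \<in> keys p \<rightarrow> carrier B" if "keys p \<subseteq> K" for p :: "'i \<Rightarrow>\<^sub>0 rat" using M that by auto
  show ?thesis
  proof (rule alg_homI)
    show "B.lin M \<one>\<^bsub>MA\<^esub> = \<one>\<^bsub>B\<^esub>" using M(2) by (simp add: monoid_alg_simps B.lin_single B.q_simps)
    fix u v assume "u \<in> carrier MA" "v \<in> carrier MA"
    then have u: "keys u \<subseteq> K" and v: "keys v \<subseteq> K" by (auto simp: monoid_alg_simps)
    have Mu: "M x \<in> carrier B" if "x \<in> keys u" for x using M u that by auto
    have Mv: "M x \<in> carrier B" if "x \<in> keys v" for x using M v that by auto
    have Muv: "M (f x y) \<in> carrier B" if "x \<in> keys u" "y \<in> keys v" for x y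
      using M u v that f_closed by blast
    have "B.lin M (u \<otimes>\<^bsub>MA\<^esub> v) = (\<Oplus>\<^bsub>B\<^esub>x\<in>keys u. \<Oplus>\<^bsub>B\<^esub>y\<in>keys v. (lookup u x * lookup v y) \<odot>\<^bsub>B\<^esub> M (f x y))"
      unfolding monoid_alg_simps
    proof (subst B.lin_sum)
      fix x assume x: "x \<in> keys u"
      show "M \<in> keys (\<Sum>y\<in>keys v. Poly_Mapping.single (f x y) (lookup u x * lookup v y)) \<rightarrow> carrier B"
        by (rule Mk, rule keys_sum_subset) (use x u v f_closed in \<open>auto split: if_splits\<close>)
    next
      show "(\<Oplus>\<^bsub>B\<^esub>x\<in>keys u. B.lin M (\<Sum>y\<in>keys v. Poly_Mapping.single (f x y) (lookup u x * lookup v y))) =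
         (\<Oplus>\<^bsub>B\<^esub>x\<in>keys u. \<Oplus>\<^bsub>B\<^esub>y\<in>keys v. (lookup u x * lookup v y) \<odot>\<^bsub>B\<^esub> M (f x y))"
      proof (rule B.finsum_cong'[OF refl])
        fix x assume x: "x \<in> keys u"
        show "B.lin M (\<Sum>y\<in>keys v. Poly_Mapping.single (f x y) (lookup u x * lookup v y)) =
          (\<Oplus>\<^bsub>B\<^esub>y\<in>keys v. (lookup u x * lookup v y) \<odot>\<^bsub>B\<^esub> M (f x y))"
          by (subst B.lin_sum) (use Muv x in \<open>auto simp: B.lin_single B.q_simps intro!: B.finsum_cong'\<close>)
      qed (use Muv in \<open>auto intro!: B.finsum_closed simp: B.q_simps\<close>)
    qed
    also have "\<dots> = (\<Oplus>\<^bsub>B\<^esub>x\<in>keys u. \<Oplus>\<^bsub>B\<^esub>y\<in>keys v. (lookup u x \<odot>\<^bsub>B\<^esub> M x) \<otimes>\<^bsub>B\<^esub> (lookup v y \<odot>\<^bsub>B\<^esub> M y))"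
    proof (intro B.finsum_cong'[OF refl])
      fix x y assume "x \<in> keys u" "y \<in> keys v"
      then show "(lookup u x * lookup v y) \<odot>\<^bsub>B\<^esub> M (f x y) = (lookup u x \<odot>\<^bsub>B\<^esub> M x) \<otimes>\<^bsub>B\<^esub> (lookup v y \<odot>\<^bsub>B\<^esub> M y)"
        using mult[OF subsetD[OF u] subsetD[OF v], of x y] Mu[of x] Mv[of y] by (simp add: B.q_simps mult.commute)
    qed (use Mu Mv in \<open>auto intro!: B.finsum_closed simp: B.q_simps\<close>)
    also have "\<dots> = (\<Oplus>\<^bsub>B\<^esub>x\<in>keys u. (lookup u x \<odot>\<^bsub>B\<^esub> M x) \<otimes>\<^bsub>B\<^esub> B.lin M v)"
      unfolding B.lin_def using Mu Mv
      by (intro B.finsum_cong'[OF refl] B.finsum_rdistr[symmetric]) (auto intro!: B.finsum_closed simp: B.q_simps)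
    also have "\<dots> = B.lin M u \<otimes>\<^bsub>B\<^esub> B.lin M v"
      unfolding B.lin_def[of M u] using Mu B.lin_closed[OF Mk[OF v]]
      by (intro B.finsum_ldistr[symmetric]) (auto simp: B.q_simps)
    finally show "B.lin M (u \<otimes>\<^bsub>MA\<^esub> v) = B.lin M u \<otimes>\<^bsub>B\<^esub> B.lin M v" .
  qed (auto simp: monoid_alg_simps Mk B.lin_closed B.lin_add B.lin_map_scale)
qed

lemma alg_hom_eq_lin:
  assumes B: "qalgebra B" and h: "h \<in> alg_hom MA B" and p: "p \<in> carrier MA"
  shows "h p = qalgebra.lin B (\<lambda>x. h (Poly_Mapping.single x 1)) p"
proof -
  interpret B: qalgebra B by fact
  interpret MA: qalgebra MA by (rule qalgebra_monoid_alg)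
  have pk: "keys p \<subseteq> K" using p by (simp add: monoid_alg_simps)
  have fs: "finsum MA g I = sum g I" if "finite I" "g \<in> I \<rightarrow> carrier MA" for g :: "'i \<Rightarrow> 'i \<Rightarrow>\<^sub>0 rat" and I
    using that
  proof (induction I rule: finite_induct)
    case empty
    show ?case by (simp add: monoid_alg_simps)
  next
    case (insert x F)
    then show ?case by (simp add: MA.finsum_insert Pi_def) (simp add: monoid_alg_simps)
  qed
  have "MA.lin (\<lambda>x. Poly_Mapping.single x 1) p = (\<Sum>x\<in>keys p. Poly_Mapping.map ((*) (lookup p x)) (Poly_Mapping.single x 1))"
    unfolding MA.lin_def using pk by (subst fs) (auto simp: monoid_alg_simps split: if_splits)
  also have "\<dots> = p" by (simp flip: malg_decomp)
  finally have "h p = h (MA.lin (\<lambda>x. Poly_Mapping.single x 1) p)" by simp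
  also have "\<dots> = B.lin (\<lambda>x. h (Poly_Mapping.single x 1)) p"
    by (rule alg_hom_lin[OF h qalgebra_monoid_alg B]) (use pk in \<open>auto simp: monoid_alg_simps\<close>)
  finally show ?thesis .
qed

lemma alg_hom_monoid_alg_eqI:
  assumes B: "qalgebra B" and "h \<in> alg_hom MA B" "k \<in> alg_hom MA B" "p \<in> carrier MA"
    and "\<And>x. x \<in> keys p \<Longrightarrow> h (Poly_Mapping.single x 1) = k (Poly_Mapping.single x 1)"
  shows "h p = k p"
proof -
  interpret B: qalgebra B by fact
  have "k (Poly_Mapping.single x 1) \<in> carrier B" if "x \<in> keys p" for x
    using that assms(4) by (intro alg_hom_closed[OF assms(3)]) (auto simp: monoid_alg_simps)
  then show ?thesis
    unfolding alg_hom_eq_lin[OF assms(1,2,4)] alg_hom_eq_lin[OF assms(1,3,4)]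
    by (intro B.lin_cong assms(5)) auto
qed

end

section \<open>Quotients\<close>

lemma alg_quot_simps: "carrier (alg_quot A I) = carrier (A Quot I)" "monoid.mult (alg_quot A I) = monoid.mult (A Quot I)"
  "one (alg_quot A I) = one (A Quot I)" "zero (alg_quot A I) = zero (A Quot I)" "add (alg_quot A I) = add (A Quot I)"
  "module.smult (alg_quot A I) = (\<lambda>c U. \<Union>u\<in>U. I +>\<^bsub>A\<^esub> (c \<odot>\<^bsub>A\<^esub> u))"
  by (simp_all add: alg_quot_def)

locale qideal = qalgebra A + ideal I A for A :: "(rat, 'a, 'x) module_scheme" (structure) and I
begin

lemma smult_I: "i \<in> I \<Longrightarrow> c \<odot> i \<in> I"
proof -
  assume i: "i \<in> I"
  then have "c \<odot> i = (c \<odot> \<one>) \<otimes> i" by (simp add: q_simps)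
  then show ?thesis using I_l_closed[OF i q_unary(1)[OF one_closed]] by simp
qed

lemma carrier_quot: "carrier (alg_quot A I) = (\<lambda>a. I +> a) ` carrier A"
  by (auto simp: alg_quot_simps FactRing_simps)

lemma class_eq: "a \<in> carrier A \<Longrightarrow> u \<in> I +> a \<Longrightarrow> I +> u = I +> a"
  using a_repr_independence'[of u a] by simp

lemma class_eq_I: "i \<in> I \<Longrightarrow> I +> i = I"
  by (rule a_rcos_const)

lemma smult_class:
  assumes a: "a \<in> carrier A"
  shows "c \<odot>\<^bsub>alg_quot A I\<^esub> (I +> a) = I +> (c \<odot> a)"
proof -
  have "I +> (c \<odot> u) = I +> (c \<odot> a)" if u: "u \<in> I +> a" for u
  proof -
    obtain i where i: "i \<in> I" "u = i \<oplus> a" using u by (auto simp: a_r_coset_def')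
    then have "c \<odot> u \<in> I +> (c \<odot> a)" using a smult_I[of i c] by (auto simp: a_r_coset_def' q_simps)
    then show ?thesis using a by (intro class_eq) (simp_all add: q_simps)
  qed
  then have "(\<Union>u\<in>I +> a. I +> (c \<odot> u)) = (\<Union>u\<in>I +> a. I +> (c \<odot> a))"
    by (intro SUP_cong refl)
  moreover have "I +> a \<noteq> {}" using a_rcos_self[OF a] by blast
  ultimately show ?thesis by (simp only: alg_quot_simps UN_constant if_False)
qed

lemma quot_ops:
  assumes "a \<in> carrier A" "b \<in> carrier A"
  shows "(I +> a) \<oplus>\<^bsub>alg_quot A I\<^esub> (I +> b) = I +> (a \<oplus> b)" "(I +> a) \<otimes>\<^bsub>alg_quot A I\<^esub> (I +> b) = I +> (a \<otimes> b)"
  using assms by (simp_all add: alg_quot_simps FactRing_simps rcoset_mult_add a_rcos_sum)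

lemma quot_one: "\<one>\<^bsub>alg_quot A I\<^esub> = I +> \<one>" and quot_zero: "\<zero>\<^bsub>alg_quot A I\<^esub> = I"
  by (simp_all add: alg_quot_simps FactRing_simps)

lemma qalgebra_quot: "qalgebra (alg_quot A I)"
proof (rule qalgebraI)
  interpret Q: cring "A Quot I" by (rule quotient_is_cring) (rule is_cring)
  show "cring (alg_quot A I)"
  proof (intro cringI abelian_groupI comm_monoidI)
    show "\<exists>y\<in>carrier (alg_quot A I). y \<oplus>\<^bsub>alg_quot A I\<^esub> x = \<zero>\<^bsub>alg_quot A I\<^esub>" if "x \<in> carrier (alg_quot A I)" for x
      using that Q.l_neg[of x] Q.a_inv_closed[of x] by (auto simp: alg_quot_simps)
    show "x \<oplus>\<^bsub>alg_quot A I\<^esub> y = y \<oplus>\<^bsub>alg_quot A I\<^esub> x" "x \<otimes>\<^bsub>alg_quot A I\<^esub> y = y \<otimes>\<^bsub>alg_quot A I\<^esub> x"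
      if "x \<in> carrier (alg_quot A I)" "y \<in> carrier (alg_quot A I)" for x y
      using that Q.a_comm[of x y] Q.m_comm[of x y] by (simp_all add: alg_quot_simps(1-5))
  qed (simp_all add: alg_quot_simps(1-5) Q.m_assoc Q.l_distr Q.a_assoc)
qed (auto simp: carrier_quot smult_class quot_ops q_simps)

lemma class_alg_hom: "(\<lambda>a. I +> a) \<in> alg_hom A (alg_quot A I)"
  by (rule alg_homI) (auto simp: carrier_quot smult_class quot_ops quot_one)

text \<open>The induced map uses a chosen representative, to match the form of
  \<open>tensor_lift\<close>; the choice does not affect the value because \<open>h\<close> vanishes
  on \<open>I\<close>.\<close>

lemma quot_lift:
  assumes h: "h \<in> alg_hom A B" and B: "qalgebra B" and 0: "\<And>i. i \<in> I \<Longrightarrow> h i = \<zero>\<^bsub>B\<^esub>"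
  shows "(\<lambda>U. h (SOME u. u \<in> U)) \<in> alg_hom (alg_quot A I) B"
    and "a \<in> carrier A \<Longrightarrow> h (SOME u. u \<in> I +> a) = h a"
proof -
  interpret B: qalgebra B by fact
  show *: "h (SOME u. u \<in> I +> a) = h a" if a: "a \<in> carrier A" for a
  proof -
    have "(SOME u. u \<in> I +> a) \<in> I +> a" using a_rcos_self[OF a] by (rule someI)
    then obtain i where "i \<in> I" "(SOME u. u \<in> I +> a) = i \<oplus> a" by (auto simp: a_r_coset_def')
    then show ?thesis using a by (simp add: alg_homD[OF h] 0)
  qed
  show "(\<lambda>U. h (SOME u. u \<in> U)) \<in> alg_hom (alg_quot A I) B"
    by (rule alg_homI) (auto simp: carrier_quot smult_class quot_ops quot_one * alg_homD[OF h] q_simps)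
qed

end

lemma alg_hom_genideal:
  assumes h: "h \<in> alg_hom A B" and A: "qalgebra A" and B: "qalgebra B"
    and S: "S \<subseteq> carrier A" "\<And>s. s \<in> S \<Longrightarrow> h s = \<zero>\<^bsub>B\<^esub>" and x: "x \<in> Idl\<^bsub>A\<^esub> S"
  shows "h x = \<zero>\<^bsub>B\<^esub>"
proof -
  interpret A: qalgebra A by fact interpret B: qalgebra B by fact
  have "h \<in> ring_hom A B" using h by (simp add: alg_hom_def)
  then have H: "ring_hom_ring A B h" by (rule ring_hom_ringI2[OF A.ring_axioms B.ring_axioms])
  have "Idl\<^bsub>A\<^esub> S \<subseteq> a_kernel A B h"
    by (rule A.genideal_minimal[OF ring_hom_ring.kernel_is_ideal[OF H]]) (use S in \<open>auto simp: a_kernel_def'\<close>)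
  then show ?thesis using x by (auto simp: a_kernel_def')
qed

section \<open>Tensor products\<close>

lemma tensor_free_eq: "tensor_free A B = monoid_alg (carrier A \<times> carrier B)
    (\<lambda>x y. (fst x \<otimes>\<^bsub>A\<^esub> fst y, snd x \<otimes>\<^bsub>B\<^esub> snd y)) (\<one>\<^bsub>A\<^esub>, \<one>\<^bsub>B\<^esub>)"
  by (simp add: tensor_free_def monoid_alg_def)

lemma map_scale_single: "Poly_Mapping.map ((*) c) (Poly_Mapping.single x (d::rat)) = Poly_Mapping.single x (c * d)"
  by (rule poly_mapping_eqI) (auto simp: lookup_map_scale lookup_single when_def)

locale qalgebra_pair = A: qalgebra A + B: qalgebra B
  for A :: "(rat, 'a, 'x) module_scheme" and B :: "(rat, 'b, 'y) module_scheme"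
begin

abbreviation "TF \<equiv> tensor_free A B"
abbreviation "T \<equiv> tensor A B"
abbreviation "TI \<equiv> tensor_ideal A B"
abbreviation "pt \<equiv> pure_tensor A B"

lemma comm_monoid_on_pairs: "comm_monoid_on (carrier A \<times> carrier B) (\<lambda>x y. (fst x \<otimes>\<^bsub>A\<^esub> fst y, snd x \<otimes>\<^bsub>B\<^esub> snd y)) (\<one>\<^bsub>A\<^esub>, \<one>\<^bsub>B\<^esub>)"
  by unfold_locales (auto simp: A.m_ac B.m_ac)

sublocale P: comm_monoid_on "carrier A \<times> carrier B" "\<lambda>x y. (fst x \<otimes>\<^bsub>A\<^esub> fst y, snd x \<otimes>\<^bsub>B\<^esub> snd y)" "(\<one>\<^bsub>A\<^esub>, \<one>\<^bsub>B\<^esub>)"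
  by (rule comm_monoid_on_pairs)

lemma qalgebra_TF: "qalgebra TF"
  unfolding tensor_free_eq by (rule P.qalgebra_monoid_alg)

lemma TF_simps: "carrier TF = {u. keys u \<subseteq> carrier A \<times> carrier B}" "one TF = Poly_Mapping.single (\<one>\<^bsub>A\<^esub>, \<one>\<^bsub>B\<^esub>) 1"
  "zero TF = 0" "add TF = (+)" "module.smult TF = (\<lambda>c. Poly_Mapping.map ((*) c))"
  by (simp_all add: tensor_free_def)

lemma TF_mult_single: "Poly_Mapping.single (a, b) 1 \<otimes>\<^bsub>TF\<^esub> Poly_Mapping.single (a', b') 1 =
    Poly_Mapping.single (a \<otimes>\<^bsub>A\<^esub> a', b \<otimes>\<^bsub>B\<^esub> b') 1"
  unfolding tensor_free_eq by (simp add: P.mult_single_single)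

lemma relation_cases:
  assumes "r \<in> tensor_relations A B"
  obtains a a' b where "a \<in> carrier A" "a' \<in> carrier A" "b \<in> carrier B"
      "r = Poly_Mapping.single (a \<oplus>\<^bsub>A\<^esub> a', b) 1 - (Poly_Mapping.single (a, b) 1 + Poly_Mapping.single (a', b) 1)"
  | a b b' where "a \<in> carrier A" "b \<in> carrier B" "b' \<in> carrier B"
      "r = Poly_Mapping.single (a, b \<oplus>\<^bsub>B\<^esub> b') 1 - (Poly_Mapping.single (a, b) 1 + Poly_Mapping.single (a, b') 1)"
  | c a b where "a \<in> carrier A" "b \<in> carrier B"
      "r = Poly_Mapping.single (c \<odot>\<^bsub>A\<^esub> a, b) 1 - Poly_Mapping.single (a, b) c"
  | c a b where "a \<in> carrier A" "b \<in> carrier B"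
      "r = Poly_Mapping.single (a, c \<odot>\<^bsub>B\<^esub> b) 1 - Poly_Mapping.single (a, b) c"
  using assms unfolding tensor_relations_def diff_diff_add
  by (elim UnE CollectE exE conjE) (rule that(1) that(2) that(3) that(4); assumption)+

lemma single_carrier [simp]: "a \<in> carrier A \<Longrightarrow> b \<in> carrier B \<Longrightarrow> Poly_Mapping.single (a, b) c \<in> carrier TF"
  by (auto simp: TF_simps split: if_splits)

lemma add_carrier: "u \<in> carrier TF \<Longrightarrow> v \<in> carrier TF \<Longrightarrow> u + v \<in> carrier TF"
  using keys_add[of u v] by (auto simp: TF_simps)

lemma diff_carrier: "u \<in> carrier TF \<Longrightarrow> v \<in> carrier TF \<Longrightarrow> u - v \<in> carrier TF"
proof -
  have "keys (u - v) \<subseteq> keys u \<union> keys v" by (auto simp: in_keys_iff lookup_minus)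
  then show "u \<in> carrier TF \<Longrightarrow> v \<in> carrier TF \<Longrightarrow> u - v \<in> carrier TF" by (auto simp: TF_simps)
qed

lemma relations_subset: "tensor_relations A B \<subseteq> carrier TF"
proof
  fix r assume "r \<in> tensor_relations A B"
  then show "r \<in> carrier TF"
    by (cases rule: relation_cases)
      (simp_all only: diff_carrier add_carrier single_carrier A.q_simps B.q_simps A.a_closed B.a_closed)
qed

sublocale Q: qideal TF TI
proof -
  interpret TF: qalgebra TF by (rule qalgebra_TF)
  show "qideal TF TI"
    unfolding qideal_def tensor_ideal_def by (intro conjI qalgebra_TF TF.genideal_ideal relations_subset)
qed

lemma relation_in_ideal: "r \<in> tensor_relations A B \<Longrightarrow> r \<in> TI"
  unfolding tensor_ideal_def using Q.genideal_self[OF relations_subset] by blast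

lemma qalgebra_tensor: "qalgebra T"
  unfolding tensor_def by (rule Q.qalgebra_quot)

lemma class_hom: "(\<lambda>u. TI +>\<^bsub>TF\<^esub> u) \<in> alg_hom TF T"
  unfolding tensor_def by (rule Q.class_alg_hom)

lemma pt_closed: "a \<in> carrier A \<Longrightarrow> b \<in> carrier B \<Longrightarrow> pt a b \<in> carrier T"
  unfolding pure_tensor_def by (rule alg_hom_closed[OF class_hom]) simp

lemma class_diff:
  assumes "u - v \<in> TI" "u \<in> carrier TF" "v \<in> carrier TF"
  shows "TI +>\<^bsub>TF\<^esub> u = TI +>\<^bsub>TF\<^esub> v"
proof (rule Q.class_eq[OF assms(3)])
  have "u = (u - v) \<oplus>\<^bsub>TF\<^esub> v" by (simp add: TF_simps)
  then show "u \<in> TI +>\<^bsub>TF\<^esub> v" using assms by (auto simp: a_r_coset_def')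
qed

lemma class_add: "u \<in> carrier TF \<Longrightarrow> v \<in> carrier TF \<Longrightarrow> TI +>\<^bsub>TF\<^esub> (u + v) = (TI +>\<^bsub>TF\<^esub> u) \<oplus>\<^bsub>T\<^esub> (TI +>\<^bsub>TF\<^esub> v)"
  using alg_hom_add[OF class_hom, of u v] by (simp add: TF_simps)

lemma class_single: "a \<in> carrier A \<Longrightarrow> b \<in> carrier B \<Longrightarrow> TI +>\<^bsub>TF\<^esub> Poly_Mapping.single (a, b) c = c \<odot>\<^bsub>T\<^esub> pt a b"
  using alg_hom_smult[OF class_hom, of "Poly_Mapping.single (a, b) 1" c]
  by (simp add: pure_tensor_def TF_simps(5) map_scale_single)

lemma pt_add_left:
  assumes "a \<in> carrier A" "a' \<in> carrier A" "b \<in> carrier B"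
  shows "pt (a \<oplus>\<^bsub>A\<^esub> a') b = pt a b \<oplus>\<^bsub>T\<^esub> pt a' b"
proof -
  have "TI +>\<^bsub>TF\<^esub> Poly_Mapping.single (a \<oplus>\<^bsub>A\<^esub> a', b) 1 = TI +>\<^bsub>TF\<^esub> (Poly_Mapping.single (a, b) 1 + Poly_Mapping.single (a', b) 1)"
    using assms by (intro class_diff relation_in_ideal add_carrier single_carrier A.a_closed)
      (auto simp: tensor_relations_def diff_diff_add[symmetric])
  then show ?thesis using assms by (simp add: class_add pure_tensor_def)
qed

lemma pt_add_right:
  assumes "a \<in> carrier A" "b \<in> carrier B" "b' \<in> carrier B"
  shows "pt a (b \<oplus>\<^bsub>B\<^esub> b') = pt a b \<oplus>\<^bsub>T\<^esub> pt a b'"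
proof -
  have "TI +>\<^bsub>TF\<^esub> Poly_Mapping.single (a, b \<oplus>\<^bsub>B\<^esub> b') 1 = TI +>\<^bsub>TF\<^esub> (Poly_Mapping.single (a, b) 1 + Poly_Mapping.single (a, b') 1)"
    using assms by (intro class_diff relation_in_ideal add_carrier single_carrier B.a_closed)
      (auto simp: tensor_relations_def diff_diff_add[symmetric])
  then show ?thesis using assms by (simp add: class_add pure_tensor_def)
qed

lemma pt_smult_left:
  assumes "a \<in> carrier A" "b \<in> carrier B"
  shows "pt (c \<odot>\<^bsub>A\<^esub> a) b = c \<odot>\<^bsub>T\<^esub> pt a b"
proof -
  have "TI +>\<^bsub>TF\<^esub> Poly_Mapping.single (c \<odot>\<^bsub>A\<^esub> a, b) 1 = TI +>\<^bsub>TF\<^esub> Poly_Mapping.single (a, b) c"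
    using assms by (intro class_diff relation_in_ideal single_carrier A.q_simps(1)) (auto simp: tensor_relations_def)
  then show ?thesis unfolding class_single[OF assms] by (simp add: pure_tensor_def)
qed

lemma pt_smult_right:
  assumes "a \<in> carrier A" "b \<in> carrier B"
  shows "pt a (c \<odot>\<^bsub>B\<^esub> b) = c \<odot>\<^bsub>T\<^esub> pt a b"
proof -
  have "TI +>\<^bsub>TF\<^esub> Poly_Mapping.single (a, c \<odot>\<^bsub>B\<^esub> b) 1 = TI +>\<^bsub>TF\<^esub> Poly_Mapping.single (a, b) c"
    using assms by (intro class_diff relation_in_ideal single_carrier B.q_simps(1)) (auto simp: tensor_relations_def)
  then show ?thesis unfolding class_single[OF assms] by (simp add: pure_tensor_def)
qed

lemma pt_mult:
  assumes "a \<in> carrier A" "b \<in> carrier B" "a' \<in> carrier A" "b' \<in> carrier B"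
  shows "pt a b \<otimes>\<^bsub>T\<^esub> pt a' b' = pt (a \<otimes>\<^bsub>A\<^esub> a') (b \<otimes>\<^bsub>B\<^esub> b')"
  using alg_hom_mult[OF class_hom, of "Poly_Mapping.single (a, b) 1" "Poly_Mapping.single (a', b') 1"] assms
  by (simp add: pure_tensor_def TF_mult_single)

lemma pt_one: "pt \<one>\<^bsub>A\<^esub> \<one>\<^bsub>B\<^esub> = \<one>\<^bsub>T\<^esub>"
  using alg_hom_one[OF class_hom] by (simp add: pure_tensor_def TF_simps)

lemma pt_left_hom: "(\<lambda>a. pt a \<one>\<^bsub>B\<^esub>) \<in> alg_hom A T"
  by (rule alg_homI) (simp_all add: pt_closed pt_add_left pt_smult_left pt_mult pt_one)

lemma pt_right_hom: "(\<lambda>b. pt \<one>\<^bsub>A\<^esub> b) \<in> alg_hom B T"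
  by (rule alg_homI) (simp_all add: pt_closed pt_add_right pt_smult_right pt_mult pt_one)

lemma pt_eq_mult: "a \<in> carrier A \<Longrightarrow> b \<in> carrier B \<Longrightarrow> pt a b = pt a \<one>\<^bsub>B\<^esub> \<otimes>\<^bsub>T\<^esub> pt \<one>\<^bsub>A\<^esub> b"
  by (simp add: pt_mult)

lemma carrier_tensor: "carrier T = (\<lambda>u. TI +>\<^bsub>TF\<^esub> u) ` carrier TF"
  unfolding tensor_def by (rule Q.carrier_quot)

text \<open>The bilinear maps in the counit and antipode axioms are products of two homomorphisms
  into a commutative algebra. Their lifts are then algebra homomorphisms, which are determined by
  their values on pure tensors.\<close>

theorem tensor_lift_hom:
  assumes M: "qalgebra M" and f: "f \<in> alg_hom A M" and g: "g \<in> alg_hom B M"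
    and \<phi>: "\<And>a b. a \<in> carrier A \<Longrightarrow> b \<in> carrier B \<Longrightarrow> \<phi> a b = f a \<otimes>\<^bsub>M\<^esub> g b"
  shows "tensor_lift M \<phi> \<in> alg_hom T M"
    and "a \<in> carrier A \<Longrightarrow> b \<in> carrier B \<Longrightarrow> tensor_lift M \<phi> (pt a b) = f a \<otimes>\<^bsub>M\<^esub> g b"
proof -
  interpret M: qalgebra M by fact
  define F where "F = (\<lambda>x. \<phi> (fst x) (snd x))"
  have Fc: "F \<in> carrier A \<times> carrier B \<rightarrow> carrier M"
    by (auto simp: F_def \<phi> alg_homD[OF f] alg_homD[OF g])
  have L: "M.lin F \<in> alg_hom TF M"
    unfolding tensor_free_eq
  proof (rule P.lin_alg_hom[OF M Fc])
    show "F (\<one>\<^bsub>A\<^esub>, \<one>\<^bsub>B\<^esub>) = \<one>\<^bsub>M\<^esub>" by (simp add: F_def \<phi> alg_homD[OF f] alg_homD[OF g])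
    fix x y assume "x \<in> carrier A \<times> carrier B" "y \<in> carrier A \<times> carrier B"
    then show "F (fst x \<otimes>\<^bsub>A\<^esub> fst y, snd x \<otimes>\<^bsub>B\<^esub> snd y) = F x \<otimes>\<^bsub>M\<^esub> F y"
      by (auto simp: F_def \<phi> alg_homD[OF f] alg_homD[OF g] M.m_ac)
  qed
  have Lsingle: "M.lin F (Poly_Mapping.single (a, b) c) = c \<odot>\<^bsub>M\<^esub> (f a \<otimes>\<^bsub>M\<^esub> g b)" if "a \<in> carrier A" "b \<in> carrier B" for a b c
    using that by (subst M.lin_single) (auto simp: F_def \<phi> alg_homD[OF f] alg_homD[OF g])
  \<comment> \<open>Subtraction is no operation of the carrier algebra, so the difference is
    cancelled from an addition.\<close>
  have Ldiff: "M.lin F (u - v) = \<zero>\<^bsub>M\<^esub>"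
    if "u - v \<in> carrier TF" "v \<in> carrier TF" "M.lin F u = M.lin F v" for u v
  proof -
    have "M.lin F u = M.lin F ((u - v) \<oplus>\<^bsub>TF\<^esub> v)" by (simp add: TF_simps)
    also have "\<dots> = M.lin F (u - v) \<oplus>\<^bsub>M\<^esub> M.lin F v" using that by (intro alg_hom_add[OF L])
    finally have "M.lin F v = M.lin F (u - v) \<oplus>\<^bsub>M\<^esub> M.lin F v" using that(3) by simp
    then show ?thesis
      using alg_hom_closed[OF L that(2)] alg_hom_closed[OF L that(1)] M.add.l_cancel_one'[of "M.lin F v" "M.lin F (u - v)"]
      by simp
  qed
  have Ladd: "M.lin F (u + v) = M.lin F u \<oplus>\<^bsub>M\<^esub> M.lin F v" if "u \<in> carrier TF" "v \<in> carrier TF" for u v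
    using alg_hom_add[OF L that] by (simp add: TF_simps)
  have "M.lin F r = \<zero>\<^bsub>M\<^esub>" if r: "r \<in> tensor_relations A B" for r
  proof -
    have rc: "r \<in> carrier TF" using relations_subset r by blast
    obtain u v where uv: "r = u - v" "v \<in> carrier TF" "M.lin F u = M.lin F v"
    proof -
      from r show thesis
        by (cases rule: relation_cases) (rule that, assumption; simp add: Lsingle Ladd add_carrier A.q_simps B.q_simps
            alg_homD[OF f] alg_homD[OF g] M.q_simps M.l_distr M.r_distr)+
    qed
    then show ?thesis using Ldiff rc by simp
  qed
  then have 0: "M.lin F i = \<zero>\<^bsub>M\<^esub>" if "i \<in> TI" for i
    using alg_hom_genideal[OF L qalgebra_TF M relations_subset] that unfolding tensor_ideal_def by blast
  have eq: "tensor_lift M \<phi> U = M.lin F (SOME u. u \<in> U)" for U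
    by (simp add: tensor_lift_def M.lin_def F_def Let_def)
  show "tensor_lift M \<phi> \<in> alg_hom T M"
    unfolding eq[abs_def] tensor_def by (rule Q.quot_lift(1)[OF L M 0])
  show "tensor_lift M \<phi> (pt a b) = f a \<otimes>\<^bsub>M\<^esub> g b" if "a \<in> carrier A" "b \<in> carrier B"
    using that Q.quot_lift(2)[OF L M 0, of "Poly_Mapping.single (a, b) 1"]
    by (simp add: eq pure_tensor_def Lsingle M.q_simps alg_homD[OF f] alg_homD[OF g])
qed

theorem tensor_hom_eqI:
  assumes M: "qalgebra M" and h: "h \<in> alg_hom T M" and k: "k \<in> alg_hom T M"
    and eq: "\<And>a b. a \<in> carrier A \<Longrightarrow> b \<in> carrier B \<Longrightarrow> h (pt a b) = k (pt a b)" and U: "U \<in> carrier T"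
  shows "h U = k U"
proof -
  obtain u where u: "u \<in> carrier TF" "U = TI +>\<^bsub>TF\<^esub> u" using U by (auto simp: carrier_tensor)
  have "h (TI +>\<^bsub>TF\<^esub> u) = k (TI +>\<^bsub>TF\<^esub> u)"
  proof (rule P.alg_hom_monoid_alg_eqI[OF M, folded tensor_free_eq])
    show "(\<lambda>u. h (TI +>\<^bsub>TF\<^esub> u)) \<in> alg_hom TF M" "(\<lambda>u. k (TI +>\<^bsub>TF\<^esub> u)) \<in> alg_hom TF M"
      by (rule alg_hom_comp[OF h class_hom] alg_hom_comp[OF k class_hom])+
    show "h (TI +>\<^bsub>TF\<^esub> Poly_Mapping.single x 1) = k (TI +>\<^bsub>TF\<^esub> Poly_Mapping.single x 1)" if "x \<in> keys u" for x
      using eq[of "fst x" "snd x"] u(1) that by (auto simp: pure_tensor_def TF_simps)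
  qed (rule u(1))
  then show ?thesis by (simp add: u(2))
qed

end

lemma qalgebra_pairI: "qalgebra A \<Longrightarrow> qalgebra B \<Longrightarrow> qalgebra_pair A B"
  by (simp add: qalgebra_pair_def)

section \<open>Homomorphisms from polynomial algebras\<close>

lemma times_malg_eq: "(p * q :: 'm::cancel_comm_monoid_add malg) =
    (\<Sum>x\<in>keys p. \<Sum>y\<in>keys q. Poly_Mapping.single (x + y) (lookup p x * lookup q y))"
  by (subst (1) malg_decomp[of p], subst (1) malg_decomp[of q]) (simp add: sum_product mult_single)

lemma map_scale_eq_pconst: "Poly_Mapping.map ((*) c) p = pconst c * (p :: 'm::cancel_comm_monoid_add malg)"
  by (rule poly_mapping_eqI) (simp add: lookup_map_scale lookup_pconst_mult)

definition malg_on :: "'m::cancel_comm_monoid_add set \<Rightarrow> (rat, 'm malg) module" where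
  "malg_on K = monoid_alg K (+) 0"

abbreviation submonoid_on :: "'m::cancel_comm_monoid_add set \<Rightarrow> bool" where
  "submonoid_on K \<equiv> monoid_grading (\<lambda>_. K)"

lemma submonoid_comm_monoid_on: "submonoid_on K \<Longrightarrow> comm_monoid_on K (+) 0"
  by unfold_locales (auto simp: monoid_grading_def add_ac)

lemma malg_on_simps: "carrier (malg_on K) = {u. keys u \<subseteq> K}" "monoid.mult (malg_on K) = (*)" "one (malg_on K) = 1"
  "zero (malg_on K) = 0" "add (malg_on K) = (+)" "module.smult (malg_on K) = (\<lambda>c p. pconst c * p)"
  by (auto simp: malg_on_def monoid_alg_simps fun_eq_iff times_malg_eq map_scale_eq_pconst)

definition mons :: "'g set \<Rightarrow> ('g \<Rightarrow>\<^sub>0 nat) set" where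
  "mons V = {m. keys m \<subseteq> V}"

lemma free_alg_eq: "free_alg V = malg_on (mons V)"
  by (simp add: malg_on_def monoid_alg_def free_alg_def mons_def subset_iff Ball_def fun_eq_iff times_malg_eq map_scale_eq_pconst)

lemma grading1_mons: "grading1 (\<lambda>_. 0) V k = (if k = 0 then mons V else {})"
  by (auto simp: grading1_def mons_def weight_def)

lemma submonoid_mons: "submonoid_on (mons V)"
  using keys_add[of _ _] by (fastforce simp: monoid_grading_def mons_def)

lemma submonoid_times: "submonoid_on K \<Longrightarrow> submonoid_on L \<Longrightarrow> submonoid_on (K \<times> L)"
  by (auto simp: monoid_grading_def zero_prod_def)

lemma mons_induct [consumes 1, case_names zero add var]:
  assumes m: "m \<in> mons V" and "P 0" and add: "\<And>m n. m \<in> mons V \<Longrightarrow> n \<in> mons V \<Longrightarrow> P m \<Longrightarrow> P n \<Longrightarrow> P (m + n)"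
    and "\<And>g. g \<in> V \<Longrightarrow> P (Poly_Mapping.single g 1)"
  shows "P m"
proof -
  have add': "m + n \<in> mons V \<and> P (m + n)" if "m \<in> mons V \<and> P m" "n \<in> mons V \<and> P n" for m n
    using that add submonoid_mons[of V] by (auto simp: monoid_grading_def)
  have s: "Poly_Mapping.single g k \<in> mons V \<and> P (Poly_Mapping.single g k)" if "g \<in> V" for g k
  proof (induction k)
    case 0
    then show ?case using assms(2) by (simp add: mons_def)
  next
    case (Suc k)
    have "Poly_Mapping.single g (Suc k) = Poly_Mapping.single g 1 + Poly_Mapping.single g k"
      by (simp flip: single_add)
    then show ?case using add'[of "Poly_Mapping.single g 1" "Poly_Mapping.single g k"] Suc assms(4)[OF that] that
      by (simp add: mons_def)
  qed
  have sum: "(\<Sum>g\<in>G. Poly_Mapping.single g (lookup m g)) \<in> mons V \<and> P (\<Sum>g\<in>G. Poly_Mapping.single g (lookup m g))"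
    if "finite G" "G \<subseteq> V" for G
    using that
  proof (induction G rule: finite_induct)
    case empty
    then show ?case using assms(2) by (simp add: mons_def)
  next
    case (insert g G)
    then show ?case using add'[OF s[of g "lookup m g"]] by simp
  qed
  have eq: "m = (\<Sum>g\<in>keys m. Poly_Mapping.single g (lookup m g))"
    by (rule poly_mapping_eqI) (auto simp: lookup_sum lookup_single when_def in_keys_iff)
  show ?thesis using sum[of "keys m"] m unfolding eq[symmetric] by (simp add: mons_def)
qed

lemma qalgebra_malg_on: "submonoid_on K \<Longrightarrow> qalgebra (malg_on K)"
  unfolding malg_on_def by (rule comm_monoid_on.qalgebra_monoid_alg[OF submonoid_comm_monoid_on])

lemma qalgebra_free_alg: "qalgebra (free_alg V)"
  unfolding free_alg_eq by (rule qalgebra_malg_on[OF submonoid_mons])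

lemma pvar_free_alg: "g \<in> V \<Longrightarrow> pvar g \<in> carrier (free_alg V)"
  by (auto simp: free_alg_eq malg_on_simps mons_def keys_pvar)

lemma malg_hom_eqI:
  assumes "submonoid_on K" "qalgebra M" "h \<in> alg_hom (malg_on K) M" "k \<in> alg_hom (malg_on K) M" "p \<in> carrier (malg_on K)"
    and "\<And>x. x \<in> K \<Longrightarrow> h (Poly_Mapping.single x 1) = k (Poly_Mapping.single x 1)"
  shows "h p = k p"
  using comm_monoid_on.alg_hom_monoid_alg_eqI[OF submonoid_comm_monoid_on[OF assms(1)] assms(2)
      assms(3,4,5)[unfolded malg_on_def]] assms(5,6)
  by (auto simp: malg_on_simps)

lemma lin_malg_hom:
  assumes "submonoid_on K" "qalgebra B" "M \<in> K \<rightarrow> carrier B" "M 0 = \<one>\<^bsub>B\<^esub>"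
    and "\<And>x y. x \<in> K \<Longrightarrow> y \<in> K \<Longrightarrow> M (x + y) = M x \<otimes>\<^bsub>B\<^esub> M y"
  shows "qalgebra.lin B M \<in> alg_hom (malg_on K) B"
  unfolding malg_on_def by (rule comm_monoid_on.lin_alg_hom[OF submonoid_comm_monoid_on[OF assms(1)] assms(2-5)])

lemma malg_hom_single_0: "h \<in> alg_hom (malg_on K) M \<Longrightarrow> h (Poly_Mapping.single 0 1) = \<one>\<^bsub>M\<^esub>"
  using alg_hom_one[of h "malg_on K" M] by (simp add: malg_on_simps)

lemma malg_hom_single_add:
  "h \<in> alg_hom (malg_on K) M \<Longrightarrow> m \<in> K \<Longrightarrow> n \<in> K \<Longrightarrow>
    h (Poly_Mapping.single (m + n) 1) = h (Poly_Mapping.single m 1) \<otimes>\<^bsub>M\<^esub> h (Poly_Mapping.single n 1)"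
  using alg_hom_mult[of h "malg_on K" M "Poly_Mapping.single m 1" "Poly_Mapping.single n 1"]
  by (simp add: malg_on_simps mult_single)

lemma malg_hom_single_closed: "h \<in> alg_hom (malg_on K) M \<Longrightarrow> m \<in> K \<Longrightarrow> h (Poly_Mapping.single m 1) \<in> carrier M"
  by (erule alg_hom_closed) (simp add: malg_on_simps)

lemma qhom_malg_hom: "qhom f \<Longrightarrow> (\<And>p. keys p \<subseteq> K \<Longrightarrow> keys (f p) \<subseteq> L) \<Longrightarrow> f \<in> alg_hom (malg_on K) (malg_on L)"
  by (rule alg_homI) (simp_all add: malg_on_simps qhomD)

lemma qhom_free_alg_hom:
  assumes "submonoid_on K" "qhom f" "\<And>g. g \<in> V \<Longrightarrow> keys (f (pvar g)) \<subseteq> K"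
  shows "f \<in> alg_hom (free_alg V) (malg_on K)"
  unfolding free_alg_eq
  \<comment> \<open>With all weights zero and a constant family, the lemma on weights becomes one on
    supports.\<close>
  by (rule qhom_malg_hom[OF assms(2)], rule keys_qhom_grading[OF assms(1,2), of _ "\<lambda>_. 0" V 0])
    (use assms(3) in \<open>auto simp: grading1_mons\<close>)

text \<open>The inclusion of the left factor for arbitrary monoids, so that it can be iterated for
  threefold tensor products.\<close>

definition pinl :: "'m malg \<Rightarrow> ('m::cancel_comm_monoid_add \<times> 'n::cancel_comm_monoid_add) malg" where
  "pinl = monoid_lift (\<lambda>m. Poly_Mapping.single (m, 0) 1)"

definition pinr :: "'n malg \<Rightarrow> ('m::cancel_comm_monoid_add \<times> 'n::cancel_comm_monoid_add) malg" where
  "pinr = monoid_lift (\<lambda>m. Poly_Mapping.single (0, m) 1)"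

lemma qhom_pinl: "qhom pinl" and qhom_pinr: "qhom pinr"
  unfolding pinl_def pinr_def by (rule qhom_monoid_lift; auto simp: mult_single zero_prod_def[symmetric])+

lemma keys_monoid_lift_submonoid:
  assumes "submonoid_on L" "\<And>m. m \<in> K \<Longrightarrow> keys (M m) \<subseteq> L" "keys p \<subseteq> K"
  shows "keys (monoid_lift M p) \<subseteq> L"
  by (rule keys_monoid_lift_grading[OF assms(1)]) (use assms in blast)

lemma pinl_hom:
  assumes "submonoid_on K" "submonoid_on L"
  shows "pinl \<in> alg_hom (malg_on K) (malg_on (K \<times> L))" and "pinr \<in> alg_hom (malg_on L) (malg_on (K \<times> L))"
  unfolding pinl_def pinr_def
  by (rule qhom_malg_hom[OF qhom_pinl[unfolded pinl_def]] qhom_malg_hom[OF qhom_pinr[unfolded pinr_def]];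
      erule keys_monoid_lift_submonoid[OF submonoid_times[OF assms], rotated]; use assms in \<open>auto simp: monoid_grading_def\<close>)+

context qalgebra
begin

lemma alg_eval_hom:
  fixes V :: "'g set" and f :: "'g \<Rightarrow> 'a"
  assumes f: "\<And>g. g \<in> V \<Longrightarrow> f g \<in> carrier A"
  shows "alg_eval A f \<in> alg_hom (free_alg V) A" and "g \<in> V \<Longrightarrow> alg_eval A f (pvar g) = f g"
proof -
  define M where "M = (\<lambda>m :: 'g \<Rightarrow>\<^sub>0 nat. \<Otimes>g\<in>keys m. f g [^] lookup m g)"
  have eq: "alg_eval A f = lin M" by (simp add: fun_eq_iff alg_eval_def lin_def M_def)
  have sup: "M m = (\<Otimes>g\<in>S. f g [^] lookup m g)" if "finite S" "keys m \<subseteq> S" "S \<subseteq> V" for m S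
    unfolding M_def by (rule finprod_mono_neutral_cong_left) (use that f in \<open>auto simp: in_keys_iff\<close>)
  have Mc: "M m \<in> carrier A" if "keys m \<subseteq> V" for m
    unfolding M_def using that f by (intro finprod_closed) auto
  show "alg_eval A f \<in> alg_hom (free_alg V) A"
    unfolding eq free_alg_eq
  proof (rule lin_malg_hom[OF submonoid_mons qalgebra_axioms])
    fix m n assume mn: "m \<in> mons V" "n \<in> mons V"
    let ?S = "keys m \<union> keys n"
    have "M (m + n) = (\<Otimes>g\<in>?S. f g [^] lookup m g \<otimes> f g [^] lookup n g)"
      by (subst sup[of ?S]) (use mn f keys_add[of m n] in \<open>auto simp: mons_def lookup_add nat_pow_mult intro!: finprod_cong'\<close>)
    also have "\<dots> = M m \<otimes> M n"
      by (subst finprod_multf) (use mn f in \<open>auto simp: mons_def sup[of ?S]\<close>)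
    finally show "M (m + n) = M m \<otimes> M n" .
  qed (auto simp: Mc mons_def, simp add: M_def)
  show "alg_eval A f (pvar g) = f g" if "g \<in> V"
  proof -
    have "M (Poly_Mapping.single g 1) = f g"
      by (subst sup[of "{g}"]) (use that f in auto)
    then show ?thesis using f[OF that] by (simp add: eq pvar_def lin_single q_simps)
  qed
qed

lemma free_alg_hom_eqI:
  fixes V :: "'g set"
  assumes h: "h \<in> alg_hom (free_alg V) A" and k: "k \<in> alg_hom (free_alg V) A"
    and eq: "\<And>g. g \<in> V \<Longrightarrow> h (pvar g) = k (pvar g)" and p: "p \<in> carrier (free_alg V)"
  shows "h p = k p"
proof (rule malg_hom_eqI[OF submonoid_mons qalgebra_axioms h[unfolded free_alg_eq] k[unfolded free_alg_eq] p[unfolded free_alg_eq]])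
  fix m :: "'g \<Rightarrow>\<^sub>0 nat" assume m: "m \<in> mons V"
  note h' = h[unfolded free_alg_eq] and k' = k[unfolded free_alg_eq]
  from m show "h (Poly_Mapping.single m 1) = k (Poly_Mapping.single m 1)"
  proof (induction m rule: mons_induct)
    case zero
    show ?case by (simp add: malg_hom_single_0[OF h'] malg_hom_single_0[OF k'] del: single_one)
  next
    case (add m n)
    then show ?case by (simp add: malg_hom_single_add[OF h'] malg_hom_single_add[OF k'])
  next
    case (var g)
    then show ?case using eq[of g] by (simp add: pvar_def)
  qed
qed

text \<open>The counterpart of \<open>phom2\<close> for homomorphisms into an algebra given by a
  carrier.\<close>

definition pair_eval :: "('m malg \<Rightarrow> 'a) \<Rightarrow> ('n malg \<Rightarrow> 'a) \<Rightarrow> ('m::cancel_comm_monoid_add \<times> 'n::cancel_comm_monoid_add) malg \<Rightarrow> 'a" where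
  "pair_eval F G = lin (\<lambda>mn. F (Poly_Mapping.single (fst mn) 1) \<otimes> G (Poly_Mapping.single (snd mn) 1))"

context
  fixes K :: "'m::cancel_comm_monoid_add set" and L :: "'n::cancel_comm_monoid_add set" and F G
  assumes K: "submonoid_on K" and L: "submonoid_on L"
    and F: "F \<in> alg_hom (malg_on K) A" and G: "G \<in> alg_hom (malg_on L) A"
begin

lemma pair_eval_hom: "pair_eval F G \<in> alg_hom (malg_on (K \<times> L)) A"
  unfolding pair_eval_def
  by (rule lin_malg_hom[OF submonoid_times[OF K L] qalgebra_axioms])
    (auto simp: malg_hom_single_0[OF F] malg_hom_single_0[OF G] malg_hom_single_add[OF F] malg_hom_single_add[OF G]
      malg_hom_single_closed[OF F] malg_hom_single_closed[OF G] m_ac simp del: single_one)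

lemma pair_eval_single: "m \<in> K \<Longrightarrow> n \<in> L \<Longrightarrow>
    pair_eval F G (Poly_Mapping.single (m, n) 1) = F (Poly_Mapping.single m 1) \<otimes> G (Poly_Mapping.single n 1)"
  by (simp add: pair_eval_def lin_single malg_hom_single_closed[OF F] malg_hom_single_closed[OF G] q_simps)

lemma pair_eval_cong:
  assumes "\<And>m. m \<in> K \<Longrightarrow> F (Poly_Mapping.single m 1) = F' (Poly_Mapping.single m 1)"
    "\<And>n. n \<in> L \<Longrightarrow> G (Poly_Mapping.single n 1) = G' (Poly_Mapping.single n 1)" and z: "z \<in> carrier (malg_on (K \<times> L))"
  shows "pair_eval F' G' z = pair_eval F G z"
  unfolding pair_eval_def
  by (rule lin_cong) (use z assms malg_hom_single_closed[OF F] malg_hom_single_closed[OF G] in \<open>auto simp: malg_on_simps\<close>)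

end

lemma pair_eval_pinl:
  assumes K: "submonoid_on K" and L: "submonoid_on L"
    and F: "F \<in> alg_hom (malg_on K) A" and G: "G \<in> alg_hom (malg_on L) A"
  shows "x \<in> carrier (malg_on K) \<Longrightarrow> pair_eval F G (pinl x) = F x"
    and "y \<in> carrier (malg_on L) \<Longrightarrow> pair_eval F G (pinr y) = G y"
proof -
  have 0: "0 \<in> K" "0 \<in> L" using K L by (auto simp: monoid_grading_def)
  show "pair_eval F G (pinl x) = F x" if "x \<in> carrier (malg_on K)"
    by (rule malg_hom_eqI[OF K qalgebra_axioms alg_hom_comp[OF pair_eval_hom[OF K L F G] pinl_hom(1)[OF K L]] F that])
      (simp add: pinl_def pair_eval_single[OF K L F G] 0 malg_hom_single_0[OF G] malg_hom_single_closed[OF F] del: single_one)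
  show "pair_eval F G (pinr y) = G y" if "y \<in> carrier (malg_on L)"
    by (rule malg_hom_eqI[OF L qalgebra_axioms alg_hom_comp[OF pair_eval_hom[OF K L F G] pinl_hom(2)[OF K L]] G that])
      (simp add: pinr_def pair_eval_single[OF K L F G] 0 malg_hom_single_0[OF F] malg_hom_single_closed[OF G] del: single_one)
qed

lemma phom2_hom:
  fixes V :: "'g set"
  assumes S: "submonoid_on S" and F: "qhom F" "F \<in> alg_hom (free_alg V) (malg_on S)"
    and G: "qhom G" "G \<in> alg_hom (free_alg V) (malg_on S)"
  shows "phom2 F G \<in> alg_hom (malg_on (mons V \<times> mons V)) (malg_on S)"
proof (rule qhom_malg_hom[OF qhom_phom2[OF F(1) G(1)]])
  fix z :: "'g mpoly2" assume z: "keys z \<subseteq> mons V \<times> mons V"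
  show "keys (phom2 F G z) \<subseteq> S"
    unfolding phom2_def
  proof (rule keys_monoid_lift_submonoid[OF S _ z])
    fix mn :: "('g \<Rightarrow>\<^sub>0 nat) \<times> ('g \<Rightarrow>\<^sub>0 nat)" assume mn: "mn \<in> mons V \<times> mons V"
    obtain m n where mn': "mn = (m, n)" by force
    have "keys (F (Poly_Mapping.single m 1)) \<subseteq> S" "keys (G (Poly_Mapping.single n 1)) \<subseteq> S"
      using mn malg_hom_single_closed[OF F(2)[unfolded free_alg_eq], of m] malg_hom_single_closed[OF G(2)[unfolded free_alg_eq], of n]
      by (auto simp: mn' malg_on_simps)
    then show "keys (case mn of (m, n) \<Rightarrow> F (Poly_Mapping.single m 1) * G (Poly_Mapping.single n 1)) \<subseteq> S"
      using keys_mult_grading[OF S] by (simp add: mn')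
  qed
qed

text \<open>The results on symbols concern targets that are monoid algebras; composing with
  \<open>h\<close> carries them over to an arbitrary algebra.\<close>

lemma alg_hom_phom2:
  assumes S: "submonoid_on S" and h: "h \<in> alg_hom (malg_on S) A"
    and F: "qhom F" "F \<in> alg_hom (free_alg V) (malg_on S)"
    and G: "qhom G" "G \<in> alg_hom (free_alg V) (malg_on S)"
    and z: "z \<in> carrier (malg_on (mons V \<times> mons V))"
  shows "h (phom2 F G z) = pair_eval (\<lambda>x. h (F x)) (\<lambda>x. h (G x)) z"
proof -
  note mm = submonoid_mons[of V] submonoid_mons[of V]
  have hF: "(\<lambda>x. h (F x)) \<in> alg_hom (malg_on (mons V)) A" and hG: "(\<lambda>x. h (G x)) \<in> alg_hom (malg_on (mons V)) A"
    using alg_hom_comp[OF h F(2)] alg_hom_comp[OF h G(2)] by (simp_all add: free_alg_eq)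
  show ?thesis
  proof (rule malg_hom_eqI[OF submonoid_times[OF mm] qalgebra_axioms alg_hom_comp[OF h phom2_hom[OF S F G]] pair_eval_hom[OF mm hF hG] z])
    fix mn assume "mn \<in> mons V \<times> mons V"
    then obtain m n where mn: "mn = (m, n)" "m \<in> mons V" "n \<in> mons V" by auto
    then show "h (phom2 F G (Poly_Mapping.single mn 1)) = pair_eval (\<lambda>x. h (F x)) (\<lambda>x. h (G x)) (Poly_Mapping.single mn 1)"
      using alg_hom_mult[OF h malg_hom_single_closed[OF F(2)[unfolded free_alg_eq], of m]
          malg_hom_single_closed[OF G(2)[unfolded free_alg_eq], of n]]
      by (simp add: pair_eval_single[OF mm hF hG] phom2_def malg_on_simps)
  qed
qed

end

lemma cop_hom: "cop \<in> alg_hom (free_alg (bounded_gens n)) (malg_on (mons (bounded_gens n) \<times> mons (bounded_gens n)))"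
  by (rule qhom_free_alg_hom[OF submonoid_times[OF submonoid_mons submonoid_mons] qhom_cop], drule keys_cop_pvar)
    (auto simp: grading2_def mons_def)

section \<open>The free contraction algebra\<close>

lemma phom2_inl2_inr2: "phom2 inl2 inr2 z = z"
  by (rule qhom_eqI[OF qhom_phom2[OF qhom_inl2 qhom_inr2] qhom_id])
    (auto simp: phom2_def inl2_eq inr2_eq mult_single)

lemma inl2_pinl: "inl2 = pinl" and inr2_pinr: "inr2 = pinr"
  by (simp_all add: inl2_eq inr2_eq pinl_def pinr_def)

lemma grading1_subset_mons: "grading1 wt V k \<subseteq> mons V"
  by (auto simp: grading1_def mons_def)

text \<open>An index sequence as a map on all indices, so that \<open>relabel_symb\<close> applies.
  It fixes 0, and beyond the list its values keep increasing, which gives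
  \<open>strict_mono\<close>.\<close>

definition extend_seq :: "nat list \<Rightarrow> nat \<Rightarrow> nat" where
  "extend_seq p i = (if i = 0 then 0 else if i \<le> length p then p ! (i - 1) else p ! (length p - 1) + i)"

lemma extend_seq_0 [simp]: "extend_seq p 0 = 0"
  by (simp add: extend_seq_def)

lemma strict_mono_extend_seq:
  assumes "index_seq n p" shows "strict_mono (extend_seq p)"
proof (rule strict_mono_Suc_iff[THEN iffD2], rule allI)
  fix i
  have s: "sorted_wrt (<) p" "set p \<subseteq> {1..n + 1}" "p \<noteq> []" using assms by (auto simp: index_seq_def)
  then have "p ! 0 > 0" using nth_mem[of 0 p] by fastforce
  moreover have "p ! (i - 1) < p ! i" if "0 < i" "i < length p"
    using sorted_wrt_nth_less[OF s(1), of "i - 1" i] that by simp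
  ultimately show "extend_seq p i < extend_seq p (Suc i)"
    using s(3) by (auto simp: extend_seq_def not_less_eq_eq le_Suc_eq)
qed

lemma map_extend_seq: "set s \<subseteq> {1..length p} \<Longrightarrow> map (extend_seq p) s = restrict_seq p s"
  by (auto simp: restrict_seq_def extend_seq_def)

lemma restrict_seq_upt: "restrict_seq p [1..<length p + 1] = p"
  by (rule nth_equalityI) (auto simp: restrict_seq_def simp del: upt_Suc)

lemma extend_seq_mem: "index_seq n p \<Longrightarrow> i \<in> {1..length p} \<Longrightarrow> extend_seq p i \<in> {1..n + 1}"
proof -
  assume p: "index_seq n p" and i: "i \<in> {1..length p}"
  then have "p ! (i - 1) \<in> set p" by (intro nth_mem) auto
  then have "p ! (i - 1) \<in> {1..n + 1}" using p unfolding index_seq_def by blast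
  then show ?thesis using i by (simp add: extend_seq_def)
qed

lemma relabel_bounded:
  assumes p: "index_seq n p" and g: "g \<in> bounded_gens (length p - 1)"
  shows "keys (relabel_symb (extend_seq p) (pvar g)) \<subseteq> mons (bounded_gens n)"
proof (cases g)
  case (Log i)
  then have i: "1 \<le> i" "i + 1 \<le> length p" using g p by (auto simp: bounded_gens_def index_seq_def)
  then have "keys (log_coeff (extend_seq p i) (extend_seq p (i + 1))) \<subseteq> grading1 symb_weight (bounded_gens n) 1"
    using extend_seq_mem[OF p] by (intro keys_log_coeff) auto
  then show ?thesis using grading1_subset_mons by (fastforce simp: Log relabel_symb_def)
next
  case (Sym q ns)
  have l: "length p - 1 + 1 = length p" using p unfolding index_seq_def by linarith
  then have q: "ns \<noteq> []" "length q = length ns + 1" "set q \<subseteq> {1..length p}" "0 \<notin> set ns" "sorted_wrt (<) q"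
    using g unfolding bounded_gens_def Sym l by auto
  have "sorted_wrt (<) (map (extend_seq p) q)"
    using q(5) strict_mono_less[OF strict_mono_extend_seq[OF p]] by (simp add: sorted_wrt_map)
  then have "Sym (map (extend_seq p) q) ns \<in> bounded_gens n"
    using q extend_seq_mem[OF p] by (force simp: bounded_gens_def)
  then show ?thesis by (auto simp: Sym relabel_symb_def keys_pvar mons_def)
qed

lemma relabel_hom: "index_seq n p \<Longrightarrow>
    relabel_symb (extend_seq p) \<in> alg_hom (free_alg (bounded_gens (length p - 1))) (free_alg (bounded_gens n))"
  unfolding free_alg_eq[of "bounded_gens n"]
  by (rule qhom_free_alg_hom[OF submonoid_mons qhom_relabel_symb relabel_bounded])

lemma bounded_free_alg_H_symb: "u \<in> carrier (free_alg (bounded_gens n)) \<Longrightarrow> u \<in> carrier H_symb"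
  using bounded_gens_subset[of n] by (force simp: H_symb_def free_alg_def)

abbreviation generic :: "nat list \<Rightarrow> symb" where
  "generic ns \<equiv> Sym [1..<length ns + 2] ns"

lemma generic_bounded: "ns \<noteq> [] \<Longrightarrow> 0 \<notin> set ns \<Longrightarrow> generic ns \<in> bounded_gens (length ns)"
  by (auto simp: bounded_gens_def simp del: upt_Suc)

context contraction_system
begin

abbreviation "H \<equiv> con_alg X con"
abbreviation "F \<equiv> free_alg (con_gens X)"
abbreviation "clog \<equiv> con_log X con"
abbreviation "csym \<equiv> con_sym X con"
abbreviation "E \<equiv> ev X con"

lemma CLog_mem: "\<beta> \<in> X 1 \<Longrightarrow> CLog \<beta> \<in> con_gens X"
  and CSym_mem: "ns \<noteq> [] \<Longrightarrow> 0 \<notin> set ns \<Longrightarrow> \<beta> \<in> X (length ns) \<Longrightarrow> CSym \<beta> ns \<in> con_gens X"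
  by (auto simp: con_gens_def)

lemma con_pair_closed: "n \<ge> 1 \<Longrightarrow> \<alpha> \<in> X n \<Longrightarrow> 1 \<le> i \<Longrightarrow> i < j \<Longrightarrow> j \<le> n + 1 \<Longrightarrow> con n [i, j] \<alpha> \<in> X 1"
  using con_closed[of n "[i, j]" \<alpha>] by (simp add: index_seq_def)

lemma relation_carrier: "con_relations X con \<subseteq> carrier F"
proof
  have diff: "p + q - r \<in> carrier F" if "p \<in> carrier F" "q \<in> carrier F" "r \<in> carrier F" for p q r
    using that keys_add_grading[OF submonoid_mons[of "con_gens X"], of "p + q" "- r"]
      keys_add_grading[OF submonoid_mons[of "con_gens X"], of p q]
    by (simp add: free_alg_eq malg_on_simps)
  fix r assume "r \<in> con_relations X con"
  then show "r \<in> carrier F"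
    by (auto simp: con_relations_def intro!: diff pvar_free_alg CLog_mem con_pair_closed)
qed

sublocale I: qideal F "con_ideal X con"
proof -
  interpret F: qalgebra F by (rule qalgebra_free_alg)
  show "qideal F (con_ideal X con)"
    unfolding qideal_def con_ideal_def by (intro conjI qalgebra_free_alg F.genideal_ideal relation_carrier)
qed

lemma qalgebra_H: "qalgebra H"
  unfolding con_alg_def by (rule I.qalgebra_quot)

sublocale H: qalgebra H by (rule qalgebra_H)

lemma class_hom: "con_class X con \<in> alg_hom F H"
  unfolding con_alg_def con_class_def[abs_def] by (rule I.class_alg_hom)

lemma carrier_H: "carrier H = con_class X con ` carrier F"
  unfolding con_alg_def con_class_def[abs_def] by (rule I.carrier_quot)

lemma clog_closed: "\<beta> \<in> X 1 \<Longrightarrow> clog \<beta> \<in> carrier H"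
  unfolding con_log_def by (rule alg_hom_closed[OF class_hom pvar_free_alg[OF CLog_mem]])

lemma csym_closed: "ns \<noteq> [] \<Longrightarrow> 0 \<notin> set ns \<Longrightarrow> \<beta> \<in> X (length ns) \<Longrightarrow> csym \<beta> ns \<in> carrier H"
  unfolding con_sym_def by (rule alg_hom_closed[OF class_hom pvar_free_alg[OF CSym_mem]])

lemma H_hom_eqI:
  assumes "qalgebra M" "h \<in> alg_hom H M" "k \<in> alg_hom H M"
    and "\<And>\<beta>. \<beta> \<in> X 1 \<Longrightarrow> h (clog \<beta>) = k (clog \<beta>)"
    and "\<And>\<beta> ns. ns \<noteq> [] \<Longrightarrow> 0 \<notin> set ns \<Longrightarrow> \<beta> \<in> X (length ns) \<Longrightarrow> h (csym \<beta> ns) = k (csym \<beta> ns)"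
    and x: "x \<in> carrier H"
  shows "h x = k x"
proof -
  interpret M: qalgebra M by fact
  obtain p where p: "p \<in> carrier F" "x = con_class X con p" using x by (auto simp: carrier_H)
  have "h (con_class X con p) = k (con_class X con p)"
    by (rule M.free_alg_hom_eqI[OF alg_hom_comp[OF assms(2) class_hom] alg_hom_comp[OF assms(3) class_hom] _ p(1)])
      (use assms(4,5) in \<open>auto simp: con_gens_def con_log_def con_sym_def\<close>)
  then show ?thesis by (simp add: p(2))
qed

text \<open>Restates a relation as an identity of sums, since the target has no subtraction among
  its operations.\<close>

lemma relation_hom:
  assumes M: "qalgebra M" and h: "h \<in> alg_hom F M"
    and mem: "n \<ge> 1" "\<alpha> \<in> X n" "1 \<le> i1" "i1 < i2" "i2 < i3" "i3 \<le> n + 1"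
  defines "a \<equiv> pvar (CLog (con n [i1, i2] \<alpha>))" and "b \<equiv> pvar (CLog (con n [i2, i3] \<alpha>))"
    and "c \<equiv> pvar (CLog (con n [i1, i3] \<alpha>))"
  shows "h a \<oplus>\<^bsub>M\<^esub> h b = h c \<longleftrightarrow> h (a + b - c) = \<zero>\<^bsub>M\<^esub>"
proof -
  interpret M: qalgebra M by fact
  have car: "a \<in> carrier F" "b \<in> carrier F" "c \<in> carrier F"
    using mem unfolding a_def b_def c_def by (auto intro!: pvar_free_alg CLog_mem con_pair_closed)
  have r: "a + b - c \<in> carrier F"
    by (rule subsetD[OF relation_carrier]) (use mem in \<open>unfold con_relations_def a_def b_def c_def, blast\<close>)
  have "h a \<oplus>\<^bsub>M\<^esub> h b = h (a + b - c) \<oplus>\<^bsub>M\<^esub> h c"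
    using alg_hom_add[OF h car(1,2)] alg_hom_add[OF h r car(3)] by (simp add: free_alg_eq malg_on_simps)
  then show ?thesis
    using alg_hom_closed[OF h r] alg_hom_closed[OF h car(3)] by simp
qed

lemma clog_add:
  assumes "n \<ge> 1" "\<alpha> \<in> X n" "1 \<le> i1" "i1 < i2" "i2 < i3" "i3 \<le> n + 1"
  shows "clog (con n [i1, i2] \<alpha>) \<oplus>\<^bsub>H\<^esub> clog (con n [i2, i3] \<alpha>) = clog (con n [i1, i3] \<alpha>)"
  unfolding con_log_def
proof (rule relation_hom[OF qalgebra_H class_hom assms, THEN iffD2])
  let ?r = "pvar (CLog (con n [i1, i2] \<alpha>)) + pvar (CLog (con n [i2, i3] \<alpha>)) - pvar (CLog (con n [i1, i3] \<alpha>))"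
  have "?r \<in> con_relations X con" unfolding con_relations_def using assms by blast
  then have "?r \<in> con_ideal X con"
    unfolding con_ideal_def using I.genideal_self[OF relation_carrier] by blast
  then show "con_class X con ?r = \<zero>\<^bsub>H\<^esub>"
    unfolding con_class_def con_alg_def by (simp add: I.quot_zero I.class_eq_I)
qed

text \<open>The universal property of the contraction algebra: only logarithms occur in the
  relations, so the images of the symbols are free.\<close>

lemma con_lift:
  assumes M: "qalgebra M"
    and L: "\<And>\<beta>. \<beta> \<in> X 1 \<Longrightarrow> L \<beta> \<in> carrier M"
    and S: "\<And>\<beta> ns. ns \<noteq> [] \<Longrightarrow> 0 \<notin> set ns \<Longrightarrow> \<beta> \<in> X (length ns) \<Longrightarrow> S \<beta> ns \<in> carrier M"
    and rel: "\<And>n \<alpha> i1 i2 i3. n \<ge> 1 \<Longrightarrow> \<alpha> \<in> X n \<Longrightarrow> 1 \<le> i1 \<Longrightarrow> i1 < i2 \<Longrightarrow> i2 < i3 \<Longrightarrow> i3 \<le> n + 1 \<Longrightarrow>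
      L (con n [i1, i2] \<alpha>) \<oplus>\<^bsub>M\<^esub> L (con n [i2, i3] \<alpha>) = L (con n [i1, i3] \<alpha>)"
  obtains h where "h \<in> alg_hom H M" "\<And>\<beta>. \<beta> \<in> X 1 \<Longrightarrow> h (clog \<beta>) = L \<beta>"
    "\<And>\<beta> ns. ns \<noteq> [] \<Longrightarrow> 0 \<notin> set ns \<Longrightarrow> \<beta> \<in> X (length ns) \<Longrightarrow> h (csym \<beta> ns) = S \<beta> ns"
proof -
  interpret M: qalgebra M by fact
  define f where "f = case_cgen L S"
  have f: "f g \<in> carrier M" if "g \<in> con_gens X" for g
    using that L S by (auto simp: f_def con_gens_def)
  define e where "e = alg_eval M f"
  have e: "e \<in> alg_hom F M" "\<And>g. g \<in> con_gens X \<Longrightarrow> e (pvar g) = f g"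
    using M.alg_eval_hom[of "con_gens X" f] f by (auto simp: e_def)
  have "e r = \<zero>\<^bsub>M\<^esub>" if rr: "r \<in> con_relations X con" for r
  proof -
    obtain n \<alpha> i1 i2 i3 where mem: "n \<ge> 1" "\<alpha> \<in> X n" "1 \<le> i1" "i1 < i2" "i2 < i3" "i3 \<le> n + 1"
      and r: "r = pvar (CLog (con n [i1, i2] \<alpha>)) + pvar (CLog (con n [i2, i3] \<alpha>)) - pvar (CLog (con n [i1, i3] \<alpha>))"
      using rr unfolding con_relations_def by blast
    have "e (pvar (CLog (con n [i, j] \<alpha>))) = L (con n [i, j] \<alpha>)" if "1 \<le> i" "i < j" "j \<le> n + 1" for i j
      using e(2)[OF CLog_mem[OF con_pair_closed[OF mem(1,2) that]]] by (simp add: f_def)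
    then show ?thesis
      unfolding r using mem rel[OF mem] by (intro relation_hom[OF M e(1) mem, THEN iffD1]) simp
  qed
  then have 0: "e i = \<zero>\<^bsub>M\<^esub>" if "i \<in> con_ideal X con" for i
    using alg_hom_genideal[OF e(1) qalgebra_free_alg M relation_carrier] that unfolding con_ideal_def by blast
  show thesis
  proof
    show "(\<lambda>U. e (SOME u. u \<in> U)) \<in> alg_hom H M"
      unfolding con_alg_def by (rule I.quot_lift(1)[OF e(1) M 0])
  qed (simp_all add: con_log_def con_sym_def con_class_def I.quot_lift(2)[OF e(1) M 0] pvar_free_alg CLog_mem CSym_mem e(2) f_def)
qed

section \<open>Evaluation at an element of the contraction system\<close>

context
  fixes n :: nat and \<alpha> :: 'a
  assumes n: "n \<ge> 1" and \<alpha>: "\<alpha> \<in> X n"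
begin

lemma ev_gen_closed: "g \<in> bounded_gens n \<Longrightarrow> ev_gen X con n \<alpha> g \<in> carrier H"
proof (cases g)
  case (Log i)
  assume "g \<in> bounded_gens n"
  then show ?thesis using Log clog_closed[OF con_pair_closed[OF n \<alpha>, of i "i + 1"]] by (simp add: bounded_gens_def)
next
  case (Sym p ns)
  assume "g \<in> bounded_gens n"
  then have p: "ns \<noteq> []" "0 \<notin> set ns" "length p = length ns + 1" "index_seq n p"
    using Sym by (auto simp: bounded_gens_def index_seq_def Suc_le_eq)
  then show ?thesis using Sym con_closed[OF n p(4) \<alpha>] by (simp add: csym_closed)
qed

lemma ev_hom: "E n \<alpha> \<in> alg_hom (free_alg (bounded_gens n)) H"
  unfolding ev_def by (rule H.alg_eval_hom(1)[OF ev_gen_closed])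

lemma ev_pvar: "g \<in> bounded_gens n \<Longrightarrow> E n \<alpha> (pvar g) = ev_gen X con n \<alpha> g"
  unfolding ev_def by (rule H.alg_eval_hom(2)[OF ev_gen_closed])

text \<open>The sum of the [x_r]_0 telescopes to a single symbol by the defining relations of the
  contraction algebra.\<close>

lemma ev_log_coeff:
  assumes "1 \<le> a" "a < b" "b \<le> n + 1"
  shows "E n \<alpha> (log_coeff a b) = clog (con n [a, b] \<alpha>)"
proof -
  have 1: "Log r \<in> bounded_gens n" if "1 \<le> r" "r \<le> n" for r using that by (auto simp: bounded_gens_def)
  have "Suc a \<le> b" using assms by simp
  then show ?thesis using assms
  proof (induction b rule: dec_induct)
    case base
    then show ?case using ev_pvar[OF 1, of a] by (simp add: log_coeff_def)
  next
    case (step b)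
    have "log_coeff a b \<in> carrier (free_alg (bounded_gens n))"
      using keys_log_coeff[of a n b] grading1_subset_mons step by (fastforce simp: free_alg_eq malg_on_simps)
    moreover have "log_coeff a (Suc b) = log_coeff a b + pvar (Log b)" using step by (simp add: log_coeff_def)
    ultimately have "E n \<alpha> (log_coeff a (Suc b)) = E n \<alpha> (log_coeff a b) \<oplus>\<^bsub>H\<^esub> E n \<alpha> (pvar (Log b))"
      using alg_hom_add[OF ev_hom, of "log_coeff a b" "pvar (Log b)"] step pvar_free_alg[OF 1, of b]
      by (simp add: free_alg_eq malg_on_simps)
    also have "\<dots> = clog (con n [a, Suc b] \<alpha>)"
      using step clog_add[OF n \<alpha>, of a b "Suc b"] ev_pvar[OF 1, of b] by simp
    finally show ?case .
  qed
qed

text \<open>On symbols this is the composition law of contractions, with relabelling in the role of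
  the restriction of index sequences; on logarithms \<open>ev_log_coeff\<close> is needed in
  addition.\<close>

lemma ev_relabel:
  assumes p: "index_seq n p" and u: "u \<in> carrier (free_alg (bounded_gens (length p - 1)))"
  shows "E (length p - 1) (con n p \<alpha>) u = E n \<alpha> (relabel_symb (extend_seq p) u)"
proof -
  define d where "d = length p - 1"
  have d: "1 \<le> d" "length p = d + 1" "con n p \<alpha> \<in> X d"
    using p con_closed[OF n p \<alpha>] by (auto simp: d_def index_seq_def)
  have gen: "ev_gen X con d (con n p \<alpha>) g = E n \<alpha> (relabel_symb (extend_seq p) (pvar g))" if g: "g \<in> bounded_gens d" for g
  proof (cases g)
    case (Log i)
    then have i: "1 \<le> i" "i \<le> d" using g by (auto simp: bounded_gens_def)
    have s: "index_seq (length p - 1) [i, i + 1]" using i d(2) by (simp add: index_seq_def)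
    have "map (extend_seq p) [i, i + 1] = restrict_seq p [i, i + 1]"
      by (rule map_extend_seq) (use i d(2) in auto)
    then have "con d [i, i + 1] (con n p \<alpha>) = con n (map (extend_seq p) [i, i + 1]) \<alpha>"
      using con_comp[OF n p s \<alpha>, folded d_def] by simp
    moreover have "extend_seq p i < extend_seq p (i + 1)" "extend_seq p i \<in> {1..n + 1}" "extend_seq p (i + 1) \<in> {1..n + 1}"
      using strict_mono_extend_seq[OF p] extend_seq_mem[OF p] i d by (auto simp: strict_mono_less)
    ultimately show ?thesis
      by (simp add: Log relabel_symb_def ev_log_coeff)
  next
    case (Sym q ns)
    then have q: "ns \<noteq> []" "length q = length ns + 1" "set q \<subseteq> {1..length p}" "0 \<notin> set ns" "sorted_wrt (<) q"
      using g d by (auto simp: bounded_gens_def)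
    have iq: "index_seq (length p - 1) q" using q d(2) by (cases ns) (auto simp: index_seq_def)
    have "con d q (con n p \<alpha>) = con n (map (extend_seq p) q) \<alpha>"
      using con_comp[OF n p iq \<alpha>, folded d_def] map_extend_seq[OF q(3)] by simp
    moreover have "Sym (map (extend_seq p) q) ns \<in> bounded_gens n"
      using relabel_bounded[OF p, folded d_def, OF g] by (simp add: Sym relabel_symb_def keys_pvar mons_def)
    ultimately show ?thesis by (simp add: Sym relabel_symb_def ev_pvar)
  qed
  have c: "ev_gen X con d (con n p \<alpha>) g \<in> carrier H" if "g \<in> bounded_gens d" for g
    using that alg_hom_closed[OF alg_hom_comp[OF ev_hom relabel_hom[OF p]], of "pvar g", folded d_def]
    by (simp add: gen pvar_free_alg)
  have "alg_eval H (ev_gen X con d (con n p \<alpha>)) u = E n \<alpha> (relabel_symb (extend_seq p) u)"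
    by (rule H.free_alg_hom_eqI[OF H.alg_eval_hom(1)[OF c] alg_hom_comp[OF ev_hom relabel_hom[OF p], folded d_def] _ u[folded d_def]])
      (simp_all add: H.alg_eval_hom(2)[OF c] gen)
  then show ?thesis unfolding ev_def d_def by simp
qed

end

text \<open>Rests on \<open>con_id\<close>: contraction along the full sequence [1, 2] fixes the
  element.\<close>

lemma ev_clog: "\<beta> \<in> X 1 \<Longrightarrow> E 1 \<beta> (pvar (Log 1)) = clog \<beta>"
  using ev_pvar[of 1 \<beta> "Log 1"] con_id[of 1 \<beta>] by (simp add: bounded_gens_def upt_rec)

lemma ev_csym: "ns \<noteq> [] \<Longrightarrow> 0 \<notin> set ns \<Longrightarrow> \<beta> \<in> X (length ns) \<Longrightarrow> E (length ns) \<beta> (pvar (generic ns)) = csym \<beta> ns"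
  using ev_pvar[of "length ns" \<beta> "generic ns"] con_id[of "length ns" \<beta>] generic_bounded[of ns]
  by (simp add: Suc_le_eq del: upt_Suc)

text \<open>Every generator of the contraction algebra is a value of an evaluation.\<close>

lemma H_hom_ev_eqI:
  assumes "qalgebra M" "h \<in> alg_hom H M" "k \<in> alg_hom H M" "x \<in> carrier H"
    and eq: "\<And>n \<alpha> g. n \<ge> 1 \<Longrightarrow> \<alpha> \<in> X n \<Longrightarrow> g \<in> bounded_gens n \<Longrightarrow> h (E n \<alpha> (pvar g)) = k (E n \<alpha> (pvar g))"
  shows "h x = k x"
proof (rule H_hom_eqI[OF assms(1-3) _ _ assms(4)])
  show "h (clog \<beta>) = k (clog \<beta>)" if "\<beta> \<in> X 1" for \<beta>
    using eq[of 1 \<beta> "Log 1"] ev_clog[OF that] that by (simp add: bounded_gens_def)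
  show "h (csym \<beta> ns) = k (csym \<beta> ns)" if "ns \<noteq> []" "0 \<notin> set ns" "\<beta> \<in> X (length ns)" for \<beta> ns
    using eq[of "length ns" \<beta> "generic ns"] ev_csym[OF that] that generic_bounded[of ns] by (simp add: Suc_le_eq del: upt_Suc)
qed

end

context contraction_system
begin

sublocale TT: qalgebra_pair H H by (rule qalgebra_pairI[OF qalgebra_H qalgebra_H])

sublocale T: qalgebra "tensor H H" by (rule TT.qalgebra_tensor)

abbreviation "pt \<equiv> pure_tensor H H"
abbreviation "T \<equiv> tensor H H"
abbreviation "K n \<equiv> mons (bounded_gens n)"

text \<open>The tensor square of the evaluation, as a product of two homomorphisms with commuting
  images.\<close>

definition evT :: "nat \<Rightarrow> 'a \<Rightarrow> symb mpoly2 \<Rightarrow> ('a cgen mpoly set \<times> 'a cgen mpoly set \<Rightarrow>\<^sub>0 rat) set" where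
  "evT n \<alpha> = T.pair_eval (\<lambda>x. pt (E n \<alpha> x) \<one>\<^bsub>H\<^esub>) (\<lambda>x. pt \<one>\<^bsub>H\<^esub> (E n \<alpha> x))"

definition coproduct :: "('a cgen mpoly set \<Rightarrow> ('a cgen mpoly set \<times> 'a cgen mpoly set \<Rightarrow>\<^sub>0 rat) set) \<Rightarrow> bool" where
  "coproduct \<Delta> \<longleftrightarrow> \<Delta> \<in> alg_hom H T \<and>
     (\<forall>\<beta>\<in>X 1. \<Delta> (clog \<beta>) = pt \<one>\<^bsub>H\<^esub> (clog \<beta>) \<oplus>\<^bsub>T\<^esub> pt (clog \<beta>) \<one>\<^bsub>H\<^esub>) \<and>
     (\<forall>\<beta> ns. ns \<noteq> [] \<longrightarrow> 0 \<notin> set ns \<longrightarrow> \<beta> \<in> X (length ns) \<longrightarrow>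
        \<Delta> (csym \<beta> ns) = evT (length ns) \<beta> (cop (pvar (generic ns))))"

text \<open>Every regular symbol is a relabelling of one with the arguments x_1, ..., x_d, and there
  the coproduct is prescribed.\<close>

lemma bounded_gens_cases [consumes 1, case_names Log Sym]:
  assumes g: "g \<in> bounded_gens n"
    and Log: "\<And>i. g = Log i \<Longrightarrow> 1 \<le> i \<Longrightarrow> i \<le> n \<Longrightarrow> P"
    and Sym: "\<And>p ns. g = Sym p ns \<Longrightarrow> index_seq n p \<Longrightarrow> length p - 1 = length ns \<Longrightarrow> ns \<noteq> [] \<Longrightarrow> 0 \<notin> set ns \<Longrightarrow>
      pvar g = relabel_symb (extend_seq p) (pvar (generic ns)) \<Longrightarrow> P"
  shows P
proof (cases g)
  case (Log i)
  then show P using g by (intro assms(2)) (auto simp: bounded_gens_def)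
next
  case (Sym p ns)
  then have p: "ns \<noteq> []" "length p = length ns + 1" "0 \<notin> set ns" "index_seq n p"
    using g by (auto simp: bounded_gens_def index_seq_def Suc_le_eq)
  have "map (extend_seq p) [1..<length p + 1] = restrict_seq p [1..<length p + 1]"
    by (rule map_extend_seq) auto
  then have "map (extend_seq p) [1..<length p + 1] = p" by (simp only: restrict_seq_upt)
  then have "pvar g = relabel_symb (extend_seq p) (pvar (generic ns))"
    unfolding Sym relabel_symb_def phom_pvar relabel_gen.simps p(2) by (simp only: add.assoc one_add_one)
  then show P using Sym p by (intro assms(3)) auto
qed

context
  fixes n :: nat and \<alpha> :: 'a
  assumes n: "n \<ge> 1" and \<alpha>: "\<alpha> \<in> X n"
begin

lemma ev_malg_hom: "E n \<alpha> \<in> alg_hom (malg_on (K n)) H"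
  using ev_hom[OF n \<alpha>] by (simp add: free_alg_eq)

lemma ev_left_hom: "(\<lambda>x. pt (E n \<alpha> x) \<one>\<^bsub>H\<^esub>) \<in> alg_hom (malg_on (K n)) T"
  by (rule alg_hom_comp[OF TT.pt_left_hom ev_malg_hom])

lemma ev_right_hom: "(\<lambda>x. pt \<one>\<^bsub>H\<^esub> (E n \<alpha> x)) \<in> alg_hom (malg_on (K n)) T"
  by (rule alg_hom_comp[OF TT.pt_right_hom ev_malg_hom])

lemma evT_hom: "evT n \<alpha> \<in> alg_hom (malg_on (K n \<times> K n)) T"
  unfolding evT_def by (rule T.pair_eval_hom[OF submonoid_mons submonoid_mons ev_left_hom ev_right_hom])

lemma evT_single: "k \<in> K n \<Longrightarrow> l \<in> K n \<Longrightarrow> evT n \<alpha> (Poly_Mapping.single (k, l) 1) =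
    pt (E n \<alpha> (Poly_Mapping.single k 1)) (E n \<alpha> (Poly_Mapping.single l 1))"
  unfolding evT_def
  by (simp add: T.pair_eval_single[OF submonoid_mons submonoid_mons ev_left_hom ev_right_hom]
      malg_hom_single_closed[OF ev_malg_hom] flip: TT.pt_eq_mult)

lemma evT_inl2: "x \<in> carrier (malg_on (K n)) \<Longrightarrow> evT n \<alpha> (inl2 x) = pt (E n \<alpha> x) \<one>\<^bsub>H\<^esub>"
  and evT_inr2: "x \<in> carrier (malg_on (K n)) \<Longrightarrow> evT n \<alpha> (inr2 x) = pt \<one>\<^bsub>H\<^esub> (E n \<alpha> x)"
  unfolding evT_def inl2_pinl inr2_pinr
  by (rule T.pair_eval_pinl[OF submonoid_mons submonoid_mons ev_left_hom ev_right_hom]; assumption)+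

text \<open>Replaces the sum over pure tensors by \<open>evT\<close>, which is known to be an
  algebra homomorphism.\<close>

lemma alg_eval_tensor_ev:
  assumes z: "z \<in> carrier (malg_on (K n \<times> K n))"
  shows "alg_eval_tensor H (E n \<alpha>) z = evT n \<alpha> z"
proof -
  have "alg_eval_tensor H (E n \<alpha>) z = T.lin (\<lambda>mn. pt (E n \<alpha> (Poly_Mapping.single (fst mn) 1)) (E n \<alpha> (Poly_Mapping.single (snd mn) 1))) z"
    by (simp add: alg_eval_tensor_def T.lin_def)
  also have "\<dots> = evT n \<alpha> z"
    unfolding evT_def T.pair_eval_def
  proof (rule T.lin_cong)
    have c: "E n \<alpha> (Poly_Mapping.single (fst mn) 1) \<in> carrier H" "E n \<alpha> (Poly_Mapping.single (snd mn) 1) \<in> carrier H"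
      if "mn \<in> keys z" for mn
      using z that by (auto simp: malg_on_simps intro!: malg_hom_single_closed[OF ev_malg_hom])
    show "pt (E n \<alpha> (Poly_Mapping.single (fst mn) 1)) (E n \<alpha> (Poly_Mapping.single (snd mn) 1)) =
        pt (E n \<alpha> (Poly_Mapping.single (fst mn) 1)) \<one>\<^bsub>H\<^esub> \<otimes>\<^bsub>T\<^esub> pt \<one>\<^bsub>H\<^esub> (E n \<alpha> (Poly_Mapping.single (snd mn) 1))"
      if "mn \<in> keys z" for mn by (rule TT.pt_eq_mult[OF c[OF that]])
    show "(\<lambda>mn. pt (E n \<alpha> (Poly_Mapping.single (fst mn) 1)) \<one>\<^bsub>H\<^esub> \<otimes>\<^bsub>T\<^esub> pt \<one>\<^bsub>H\<^esub> (E n \<alpha> (Poly_Mapping.single (snd mn) 1)))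
        \<in> keys z \<rightarrow> carrier T"
      using c by (auto intro!: T.m_closed TT.pt_closed)
  qed
  finally show ?thesis .
qed

end

text \<open>Combines \<open>cop_relabel\<close>, taken with the two inclusions into the tensor
  square, with \<open>ev_relabel\<close>: contracting the element amounts to relabelling the
  symbol.\<close>

lemma evT_cop_relabel:
  assumes n: "n \<ge> 1" and \<alpha>: "\<alpha> \<in> X n" and p: "index_seq n p"
    and u: "u \<in> carrier (free_alg (bounded_gens (length p - 1)))"
  shows "evT (length p - 1) (con n p \<alpha>) (cop u) = evT n \<alpha> (cop (relabel_symb (extend_seq p) u))"
proof -
  define d where "d = length p - 1"
  define \<beta> where "\<beta> = con n p \<alpha>"
  define R where "R = relabel_symb (extend_seq p)"
  have d: "1 \<le> d" "\<beta> \<in> X d"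
    using p con_closed[OF n p \<alpha>] by (auto simp: d_def \<beta>_def index_seq_def)
  have u': "u \<in> carrier (free_alg (bounded_gens d))" using u by (simp add: d_def)
  have R: "R \<in> alg_hom (free_alg (bounded_gens d)) (malg_on (K n))"
    using relabel_hom[OF p] by (simp add: R_def d_def free_alg_eq)
  have qR: "qhom R" unfolding R_def by (rule qhom_relabel_symb)
  note S = submonoid_mons[of "bounded_gens n"] and S' = submonoid_mons[of "bounded_gens d"]
  have l: "(\<lambda>x. inl2 (R x)) \<in> alg_hom (free_alg (bounded_gens d)) (malg_on (K n \<times> K n))"
    unfolding inl2_pinl by (rule alg_hom_comp[OF pinl_hom(1)[OF S S] R])
  have r: "(\<lambda>x. inr2 (R x)) \<in> alg_hom (free_alg (bounded_gens d)) (malg_on (K n \<times> K n))"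
    unfolding inr2_pinr by (rule alg_hom_comp[OF pinl_hom(2)[OF S S] R])
  have ER: "E n \<alpha> (R (Poly_Mapping.single k 1)) = E d \<beta> (Poly_Mapping.single k 1)" if "k \<in> K d" for k
    using ev_relabel[OF n \<alpha> p, of "Poly_Mapping.single k 1"] that
    by (simp add: d_def \<beta>_def R_def free_alg_eq malg_on_simps)
  have Rc: "R (Poly_Mapping.single k 1) \<in> carrier (malg_on (K n))" if "k \<in> K d" for k
    by (rule malg_hom_single_closed[OF R[unfolded free_alg_eq] that])
  have cu: "cop u \<in> carrier (malg_on (K d \<times> K d))" by (rule alg_hom_closed[OF cop_hom u'])
  have "cop (R u) = phom2 (\<lambda>x. inl2 (R x)) (\<lambda>x. inr2 (R x)) (cop u)"
    using cop_relabel[OF qhom_inl2 qhom_inr2 strict_mono_extend_seq[OF p] bounded_free_alg_H_symb[OF u']]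
    by (simp add: phom2_inl2_inr2 R_def)
  also have "evT n \<alpha> \<dots> = T.pair_eval (\<lambda>x. evT n \<alpha> (inl2 (R x))) (\<lambda>x. evT n \<alpha> (inr2 (R x))) (cop u)"
    by (rule T.alg_hom_phom2[OF submonoid_times[OF S S] evT_hom[OF n \<alpha>] qhom_comp[OF qhom_inl2 qR] l qhom_comp[OF qhom_inr2 qR] r cu])
  also have "\<dots> = evT d \<beta> (cop u)"
    unfolding evT_def[of d \<beta>]
    by (rule T.pair_eval_cong[OF S' S' ev_left_hom[OF d] ev_right_hom[OF d] _ _ cu])
      (simp_all add: evT_inl2[OF n \<alpha> Rc] evT_inr2[OF n \<alpha> Rc] ER)
  finally show ?thesis by (simp add: R_def d_def \<beta>_def)
qed

lemma generic_free_alg: "ns \<noteq> [] \<Longrightarrow> 0 \<notin> set ns \<Longrightarrow> pvar (generic ns) \<in> carrier (free_alg (bounded_gens (length ns)))"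
  by (rule pvar_free_alg[OF generic_bounded])

lemma cop_generic: "ns \<noteq> [] \<Longrightarrow> 0 \<notin> set ns \<Longrightarrow> cop (pvar (generic ns)) \<in> carrier (malg_on (K (length ns) \<times> K (length ns)))"
  by (rule alg_hom_closed[OF cop_hom generic_free_alg])

lemma induced_coproduct_iff: "induced_coproduct X con \<Delta> \<longleftrightarrow> coproduct \<Delta>"
proof -
  have "(\<forall>d \<alpha> ns. d \<ge> 1 \<and> \<alpha> \<in> X d \<and> length ns = d \<and> 0 \<notin> set ns \<longrightarrow>
          \<Delta> (csym \<alpha> ns) = alg_eval_tensor H (E d \<alpha>) (cop (pvar (Sym [1..<d + 2] ns)))) \<longleftrightarrow>
     (\<forall>\<beta> ns. ns \<noteq> [] \<longrightarrow> 0 \<notin> set ns \<longrightarrow> \<beta> \<in> X (length ns) \<longrightarrow>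
        \<Delta> (csym \<beta> ns) = alg_eval_tensor H (E (length ns) \<beta>) (cop (pvar (generic ns))))"
    by (auto simp: Suc_le_eq simp del: upt_Suc)
  also have "\<dots> \<longleftrightarrow> (\<forall>\<beta> ns. ns \<noteq> [] \<longrightarrow> 0 \<notin> set ns \<longrightarrow> \<beta> \<in> X (length ns) \<longrightarrow>
        \<Delta> (csym \<beta> ns) = evT (length ns) \<beta> (cop (pvar (generic ns))))"
  proof (intro iff_allI imp_cong refl)
    fix ns :: "nat list" and \<beta> assume ns: "ns \<noteq> []" "0 \<notin> set ns" and \<beta>: "\<beta> \<in> X (length ns)"
    have l: "1 \<le> length ns" using ns by (cases ns) auto
    show "(\<Delta> (csym \<beta> ns) = alg_eval_tensor H (E (length ns) \<beta>) (cop (pvar (generic ns)))) \<longleftrightarrow>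
        (\<Delta> (csym \<beta> ns) = evT (length ns) \<beta> (cop (pvar (generic ns))))"
      by (simp only: alg_eval_tensor_ev[OF l \<beta> cop_generic[OF ns]])
  qed
  finally show ?thesis by (simp only: induced_coproduct_def coproduct_def Let_def)
qed

text \<open>By \<open>con_lift\<close> only the logarithms need a check, and their prescribed images
  are additive.\<close>

lemma coproduct_exists: "\<exists>\<Delta>. coproduct \<Delta>"
proof -
  let ?L = "\<lambda>\<beta>. pt \<one>\<^bsub>H\<^esub> (clog \<beta>) \<oplus>\<^bsub>T\<^esub> pt (clog \<beta>) \<one>\<^bsub>H\<^esub>"
  obtain \<Delta> where "\<Delta> \<in> alg_hom H T" "\<And>\<beta>. \<beta> \<in> X 1 \<Longrightarrow> \<Delta> (clog \<beta>) = ?L \<beta>"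
    "\<And>\<beta> ns. ns \<noteq> [] \<Longrightarrow> 0 \<notin> set ns \<Longrightarrow> \<beta> \<in> X (length ns) \<Longrightarrow> \<Delta> (csym \<beta> ns) = evT (length ns) \<beta> (cop (pvar (generic ns)))"
  proof (rule con_lift[OF TT.qalgebra_tensor, of ?L "\<lambda>\<beta> ns. evT (length ns) \<beta> (cop (pvar (generic ns)))"])
    show "?L \<beta> \<in> carrier T" if "\<beta> \<in> X 1" for \<beta>
      using clog_closed[OF that] by (intro T.a_closed TT.pt_closed) simp_all
    show "evT (length ns) \<beta> (cop (pvar (generic ns))) \<in> carrier T"
      if "ns \<noteq> []" "0 \<notin> set ns" "\<beta> \<in> X (length ns)" for \<beta> ns
      using that by (intro alg_hom_closed[OF evT_hom cop_generic]) (simp_all add: Suc_le_eq)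
    show "?L (con n [i1, i2] \<alpha>) \<oplus>\<^bsub>T\<^esub> ?L (con n [i2, i3] \<alpha>) = ?L (con n [i1, i3] \<alpha>)"
      if m: "n \<ge> 1" "\<alpha> \<in> X n" "1 \<le> i1" "i1 < i2" "i2 < i3" "i3 \<le> n + 1" for n \<alpha> i1 i2 i3
    proof -
      have c: "clog (con n [i1, i2] \<alpha>) \<in> carrier H" "clog (con n [i2, i3] \<alpha>) \<in> carrier H"
        using m by (auto intro!: clog_closed con_pair_closed)
      show ?thesis
        unfolding clog_add[OF m, symmetric] TT.pt_add_left[OF c H.one_closed] TT.pt_add_right[OF H.one_closed c]
        using TT.pt_closed[OF c(1) H.one_closed] TT.pt_closed[OF c(2) H.one_closed]
          TT.pt_closed[OF H.one_closed c(1)] TT.pt_closed[OF H.one_closed c(2)]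
        by (simp add: T.a_ac)
    qed
  qed blast
  then show ?thesis by (auto simp: coproduct_def)
qed

lemma coproduct_unique: "coproduct \<Delta> \<Longrightarrow> coproduct \<Delta>' \<Longrightarrow> x \<in> carrier H \<Longrightarrow> \<Delta>' x = \<Delta> x"
  by (rule H_hom_eqI[OF TT.qalgebra_tensor]) (simp_all add: coproduct_def)

section \<open>Convolution along the induced coproduct\<close>

context
  fixes \<Delta>
  assumes \<Delta>: "coproduct \<Delta>"
begin

lemma coproduct_hom: "\<Delta> \<in> alg_hom H T"
  using \<Delta> by (simp add: coproduct_def)

text \<open>The coproduct is prescribed through symbols with all arguments x_1, ..., x_d. The value
  of a general symbol at \<alpha> is the value of such a symbol at a contraction of \<alpha>, and
  \<open>evT_cop_relabel\<close> leads back to \<alpha>.\<close>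

lemma coproduct_ev:
  assumes n: "n \<ge> 1" and \<alpha>: "\<alpha> \<in> X n" and u: "u \<in> carrier (free_alg (bounded_gens n))"
  shows "\<Delta> (E n \<alpha> u) = evT n \<alpha> (cop u)"
proof (rule T.free_alg_hom_eqI[OF alg_hom_comp[OF coproduct_hom ev_hom[OF n \<alpha>]] alg_hom_comp[OF evT_hom[OF n \<alpha>] cop_hom] _ u])
  fix g assume g: "g \<in> bounded_gens n"
  have pg: "pvar g \<in> carrier (malg_on (K n))" using pvar_free_alg[OF g] by (simp add: free_alg_eq)
  from g show "\<Delta> (E n \<alpha> (pvar g)) = evT n \<alpha> (cop (pvar g))"
  proof (cases rule: bounded_gens_cases)
    case (Log i)
    have b: "con n [i, i + 1] \<alpha> \<in> X 1" using Log by (intro con_pair_closed[OF n \<alpha>]) auto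
    have "cop (pvar g) = inl2 (pvar g) + inr2 (pvar g)"
      using cop_log_coeff[of i "i + 1"] by (simp add: Log log_coeff_def)
    then have "evT n \<alpha> (cop (pvar g)) = evT n \<alpha> (inl2 (pvar g)) \<oplus>\<^bsub>T\<^esub> evT n \<alpha> (inr2 (pvar g))"
      using alg_hom_add[OF evT_hom[OF n \<alpha>] alg_hom_closed[OF pinl_hom(1)[OF submonoid_mons submonoid_mons] pg]
          alg_hom_closed[OF pinl_hom(2)[OF submonoid_mons submonoid_mons] pg]]
      by (simp add: malg_on_simps inl2_pinl inr2_pinr)
    also have "\<dots> = pt (E n \<alpha> (pvar g)) \<one>\<^bsub>H\<^esub> \<oplus>\<^bsub>T\<^esub> pt \<one>\<^bsub>H\<^esub> (E n \<alpha> (pvar g))"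
      by (simp only: evT_inl2[OF n \<alpha> pg] evT_inr2[OF n \<alpha> pg])
    also have "\<dots> = pt \<one>\<^bsub>H\<^esub> (E n \<alpha> (pvar g)) \<oplus>\<^bsub>T\<^esub> pt (E n \<alpha> (pvar g)) \<one>\<^bsub>H\<^esub>"
      using alg_hom_closed[OF ev_malg_hom[OF n \<alpha>] pg] by (intro T.a_comm TT.pt_closed) simp_all
    finally show ?thesis using \<Delta> b ev_pvar[OF n \<alpha> g] by (simp add: coproduct_def Log)
  next
    case (Sym p ns)
    have b: "con n p \<alpha> \<in> X (length ns)" using con_closed[OF n Sym(2) \<alpha>] Sym(3) by simp
    have "\<Delta> (E n \<alpha> (pvar g)) = evT (length ns) (con n p \<alpha>) (cop (pvar (generic ns)))"
      using \<Delta> b ev_pvar[OF n \<alpha> g] Sym by (simp add: coproduct_def del: upt_Suc)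
    also have "\<dots> = evT n \<alpha> (cop (pvar g))"
      using evT_cop_relabel[OF n \<alpha> Sym(2), of "pvar (generic ns)"] generic_free_alg[OF Sym(4,5)] unfolding Sym(3,6) by blast
    finally show ?thesis .
  qed
qed

definition conv :: "(rat, 'c) module \<Rightarrow> ('a cgen mpoly set \<Rightarrow> 'c) \<Rightarrow> ('a cgen mpoly set \<Rightarrow> 'c) \<Rightarrow> 'a cgen mpoly set \<Rightarrow> 'c" where
  "conv M f g x = tensor_lift M (\<lambda>a b. f a \<otimes>\<^bsub>M\<^esub> g b) (\<Delta> x)"

context
  fixes M :: "(rat, 'c) module" (structure)
  assumes M: "qalgebra M"
begin

interpretation M: qalgebra M by (rule M)

lemma conv_hom: "f \<in> alg_hom H M \<Longrightarrow> g \<in> alg_hom H M \<Longrightarrow> conv M f g \<in> alg_hom H M"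
  unfolding conv_def[abs_def] by (rule alg_hom_comp[OF TT.tensor_lift_hom(1)[OF M] coproduct_hom]) simp_all

context
  fixes n :: nat and \<alpha> :: 'a
  assumes n: "n \<ge> 1" and \<alpha>: "\<alpha> \<in> X n"
begin

lemma hom_ev: "f \<in> alg_hom H M \<Longrightarrow> (\<lambda>x. f (E n \<alpha> x)) \<in> alg_hom (malg_on (K n)) M"
  by (rule alg_hom_comp[OF _ ev_malg_hom[OF n \<alpha>]])

text \<open>Reduces convolutions on the contraction algebra to the coproduct of symbols, one
  evaluation at a time.\<close>

lemma conv_ev:
  assumes f: "f \<in> alg_hom H M" and g: "g \<in> alg_hom H M" and u: "u \<in> carrier (free_alg (bounded_gens n))"
  shows "conv M f g (E n \<alpha> u) = M.pair_eval (\<lambda>x. f (E n \<alpha> x)) (\<lambda>x. g (E n \<alpha> x)) (cop u)"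
proof -
  note S = submonoid_mons[of "bounded_gens n"]
  note tl = TT.tensor_lift_hom[OF M f g refl]
  have "tensor_lift M (\<lambda>a b. f a \<otimes> g b) (evT n \<alpha> (cop u)) = M.pair_eval (\<lambda>x. f (E n \<alpha> x)) (\<lambda>x. g (E n \<alpha> x)) (cop u)"
  proof (rule malg_hom_eqI[OF submonoid_times[OF S S] M alg_hom_comp[OF tl(1) evT_hom[OF n \<alpha>]]
        M.pair_eval_hom[OF S S hom_ev[OF f] hom_ev[OF g]] alg_hom_closed[OF cop_hom u]])
    fix kl assume "kl \<in> K n \<times> K n"
    then obtain k l where kl: "kl = (k, l)" "k \<in> K n" "l \<in> K n" by auto
    then show "tensor_lift M (\<lambda>a b. f a \<otimes> g b) (evT n \<alpha> (Poly_Mapping.single kl 1)) =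
        M.pair_eval (\<lambda>x. f (E n \<alpha> x)) (\<lambda>x. g (E n \<alpha> x)) (Poly_Mapping.single kl 1)"
      by (simp add: evT_single[OF n \<alpha>] M.pair_eval_single[OF S S hom_ev[OF f] hom_ev[OF g]]
          tl(2) malg_hom_single_closed[OF ev_malg_hom[OF n \<alpha>]])
  qed
  then show ?thesis by (simp add: conv_def coproduct_ev[OF n \<alpha> u])
qed

text \<open>\<open>coassoc_symb\<close> needs a monoid algebra as target. It is applied to the
  inclusions \<open>i1\<close>, \<open>i2\<close>, \<open>i3\<close> into the threefold tensor
  product of polynomial algebras, and the homomorphism \<open>h\<close> then maps this product to
  \<open>M\<close>.\<close>

lemma conv_assoc_ev:
  assumes f: "f \<in> alg_hom H M" and g: "g \<in> alg_hom H M" and k: "k \<in> alg_hom H M"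
    and u: "u \<in> carrier (free_alg (bounded_gens n))"
  shows "conv M (conv M f g) k (E n \<alpha> u) = conv M f (conv M g k) (E n \<alpha> u)"
proof -
  note S = submonoid_mons[of "bounded_gens n"]
  note SS = submonoid_times[OF S S] and SSS = submonoid_times[OF S submonoid_times[OF S S]]
  note p2 = M.pair_eval_hom[OF S S hom_ev[OF g] hom_ev[OF k]]
  define h where "h = M.pair_eval (\<lambda>x. f (E n \<alpha> x)) (M.pair_eval (\<lambda>x. g (E n \<alpha> x)) (\<lambda>x. k (E n \<alpha> x)))"
  have h: "h \<in> alg_hom (malg_on (K n \<times> K n \<times> K n)) M"
    unfolding h_def by (rule M.pair_eval_hom[OF S SS hom_ev[OF f] p2])
  define i1 :: "symb mpoly \<Rightarrow> ((symb \<Rightarrow>\<^sub>0 nat) \<times> (symb \<Rightarrow>\<^sub>0 nat) \<times> (symb \<Rightarrow>\<^sub>0 nat)) malg" where "i1 = pinl"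
  define i2 :: "symb mpoly \<Rightarrow> ((symb \<Rightarrow>\<^sub>0 nat) \<times> (symb \<Rightarrow>\<^sub>0 nat) \<times> (symb \<Rightarrow>\<^sub>0 nat)) malg" where "i2 = (\<lambda>x. pinr (pinl x))"
  define i3 :: "symb mpoly \<Rightarrow> ((symb \<Rightarrow>\<^sub>0 nat) \<times> (symb \<Rightarrow>\<^sub>0 nat) \<times> (symb \<Rightarrow>\<^sub>0 nat)) malg" where "i3 = (\<lambda>x. pinr (pinr x))"
  have q: "qhom i1" "qhom i2" "qhom i3"
    unfolding i1_def i2_def i3_def by (rule qhom_pinl qhom_comp[OF qhom_pinr qhom_pinl] qhom_comp[OF qhom_pinr qhom_pinr])+
  have i1: "i1 \<in> alg_hom (free_alg (bounded_gens n)) (malg_on (K n \<times> K n \<times> K n))"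
    unfolding i1_def free_alg_eq by (rule pinl_hom(1)[OF S SS])
  have i2: "i2 \<in> alg_hom (free_alg (bounded_gens n)) (malg_on (K n \<times> K n \<times> K n))"
    unfolding i2_def free_alg_eq by (rule alg_hom_comp[OF pinl_hom(2)[OF S SS] pinl_hom(1)[OF S S]])
  have i3: "i3 \<in> alg_hom (free_alg (bounded_gens n)) (malg_on (K n \<times> K n \<times> K n))"
    unfolding i3_def free_alg_eq by (rule alg_hom_comp[OF pinl_hom(2)[OF S SS] pinl_hom(2)[OF S S]])
  have hi: "h (i1 x) = f (E n \<alpha> x)" "h (i2 x) = g (E n \<alpha> x)" "h (i3 x) = k (E n \<alpha> x)"
    if x: "x \<in> carrier (malg_on (K n))" for x
    using M.pair_eval_pinl[OF S SS hom_ev[OF f] p2] M.pair_eval_pinl[OF S S hom_ev[OF g] hom_ev[OF k] x]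
      alg_hom_closed[OF pinl_hom(1)[OF S S] x] alg_hom_closed[OF pinl_hom(2)[OF S S] x] x
    by (simp_all add: h_def i1_def i2_def i3_def)
  have s: "Poly_Mapping.single m 1 \<in> carrier (malg_on (K n))" if "m \<in> K n" for m
    using that by (simp add: malg_on_simps)
  have cu: "cop x \<in> carrier (malg_on (K n \<times> K n))" if "x \<in> carrier (malg_on (K n))" for x
    by (rule alg_hom_closed[OF cop_hom]) (use that in \<open>simp add: free_alg_eq\<close>)
  have fg: "h (phom2 i1 i2 (cop x)) = conv M f g (E n \<alpha> x)" and gk: "h (phom2 i2 i3 (cop x)) = conv M g k (E n \<alpha> x)"
    if x: "x \<in> carrier (malg_on (K n))" for x
  proof -
    have x': "x \<in> carrier (free_alg (bounded_gens n))" using x by (simp add: free_alg_eq)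
    show "h (phom2 i1 i2 (cop x)) = conv M f g (E n \<alpha> x)"
      unfolding M.alg_hom_phom2[OF SSS h q(1) i1 q(2) i2 cu[OF x]] conv_ev[OF f g x']
      by (rule M.pair_eval_cong[OF S S hom_ev[OF f] hom_ev[OF g] _ _ cu[OF x]]) (simp_all add: hi s)
    show "h (phom2 i2 i3 (cop x)) = conv M g k (E n \<alpha> x)"
      unfolding M.alg_hom_phom2[OF SSS h q(2) i2 q(3) i3 cu[OF x]] conv_ev[OF g k x']
      by (rule M.pair_eval_cong[OF S S hom_ev[OF g] hom_ev[OF k] _ _ cu[OF x]]) (simp_all add: hi s)
  qed
  have u': "u \<in> carrier (malg_on (K n))" using u by (simp add: free_alg_eq)
  note c12 = alg_hom_comp[OF M.phom2_hom[OF SSS q(1) i1 q(2) i2] cop_hom]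
    and c23 = alg_hom_comp[OF M.phom2_hom[OF SSS q(2) i2 q(3) i3] cop_hom]
  have "conv M (conv M f g) k (E n \<alpha> u) = M.pair_eval (\<lambda>x. conv M f g (E n \<alpha> x)) (\<lambda>x. k (E n \<alpha> x)) (cop u)"
    by (rule conv_ev[OF conv_hom[OF f g] k u])
  also have "\<dots> = M.pair_eval (\<lambda>x. h (phom2 i1 i2 (cop x))) (\<lambda>x. h (i3 x)) (cop u)"
    by (rule M.pair_eval_cong[OF S S hom_ev[OF conv_hom[OF f g]] hom_ev[OF k] _ _ cu[OF u'], symmetric]) (simp_all add: hi s fg)
  also have "\<dots> = h (phom2 (\<lambda>x. phom2 i1 i2 (cop x)) i3 (cop u))"
    by (rule M.alg_hom_phom2[OF SSS h qhom_comp[OF qhom_phom2[OF q(1,2)] qhom_cop] c12 q(3) i3 cu[OF u'], symmetric])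
  also have "\<dots> = h (phom2 i1 (\<lambda>x. phom2 i2 i3 (cop x)) (cop u))"
    by (simp only: coassoc_symb[OF q bounded_free_alg_H_symb[OF u]])
  also have "\<dots> = M.pair_eval (\<lambda>x. h (i1 x)) (\<lambda>x. h (phom2 i2 i3 (cop x))) (cop u)"
    by (rule M.alg_hom_phom2[OF SSS h q(1) i1 qhom_comp[OF qhom_phom2[OF q(2,3)] qhom_cop] c23 cu[OF u']])
  also have "\<dots> = M.pair_eval (\<lambda>x. f (E n \<alpha> x)) (\<lambda>x. conv M g k (E n \<alpha> x)) (cop u)"
    by (rule M.pair_eval_cong[OF S S hom_ev[OF f] hom_ev[OF conv_hom[OF g k]] _ _ cu[OF u']]) (simp_all add: hi s gk)
  also have "\<dots> = conv M f (conv M g k) (E n \<alpha> u)"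
    by (rule conv_ev[OF f conv_hom[OF g k] u, symmetric])
  finally show ?thesis .
qed

end

theorem conv_assoc:
  assumes f: "f \<in> alg_hom H M" and g: "g \<in> alg_hom H M" and k: "k \<in> alg_hom H M" and x: "x \<in> carrier H"
  shows "conv M (conv M f g) k x = conv M f (conv M g k) x"
  by (rule H_hom_ev_eqI[OF M conv_hom[OF conv_hom[OF f g] k] conv_hom[OF f conv_hom[OF g k]] x])
    (rule conv_assoc_ev[OF _ _ f g k pvar_free_alg])

end

end

end

section \<open>The Hopf algebra structure\<close>

lemma qalgebra_rat_alg: "qalgebra rat_alg"
  by (rule qalgebraI[OF cring_rat_alg]) (simp_all add: algebra_simps)

lemma (in qalgebra) scalar_hom: "(\<lambda>c. c \<odot> \<one>) \<in> alg_hom rat_alg A"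
  by (rule alg_homI) (simp_all add: q_simps mult.commute)

lemma augmentation_hom: "augmentation \<in> alg_hom (free_alg V) (malg_on (mons W))"
  by (rule qhom_free_alg_hom[OF submonoid_mons qhom_augmentation]) (simp add: augmentation_def)

lemma antipode_hom: "antipode \<in> alg_hom (free_alg (bounded_gens n)) (malg_on (mons (bounded_gens n)))"
  by (rule qhom_free_alg_hom[OF submonoid_mons qhom_antipode])
    (use keys_antipode_pvar grading1_subset_mons in \<open>blast intro: order_trans\<close>)

context contraction_system
begin

definition counit :: "('a cgen mpoly set \<Rightarrow> rat) \<Rightarrow> bool" where
  "counit \<epsilon> \<longleftrightarrow> \<epsilon> \<in> alg_hom H rat_alg \<and> (\<forall>\<beta>\<in>X 1. \<epsilon> (clog \<beta>) = 0) \<and>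
     (\<forall>\<beta> ns. ns \<noteq> [] \<longrightarrow> 0 \<notin> set ns \<longrightarrow> \<beta> \<in> X (length ns) \<longrightarrow> \<epsilon> (csym \<beta> ns) = 0)"

text \<open>The antipode of symbols, evaluated at the generators; logarithms change sign, in
  agreement with the relations.\<close>

definition con_antipode :: "('a cgen mpoly set \<Rightarrow> 'a cgen mpoly set) \<Rightarrow> bool" where
  "con_antipode S \<longleftrightarrow> S \<in> alg_hom H H \<and> (\<forall>\<beta>\<in>X 1. S (clog \<beta>) = (-1) \<odot>\<^bsub>H\<^esub> clog \<beta>) \<and>
     (\<forall>\<beta> ns. ns \<noteq> [] \<longrightarrow> 0 \<notin> set ns \<longrightarrow> \<beta> \<in> X (length ns) \<longrightarrow>
        S (csym \<beta> ns) = E (length ns) \<beta> (antipode (pvar (generic ns))))"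

lemma counit_exists: "\<exists>\<epsilon>. counit \<epsilon>"
proof -
  obtain \<epsilon> where "\<epsilon> \<in> alg_hom H rat_alg" "\<And>\<beta>. \<beta> \<in> X 1 \<Longrightarrow> \<epsilon> (clog \<beta>) = 0"
    "\<And>\<beta> ns. ns \<noteq> [] \<Longrightarrow> 0 \<notin> set ns \<Longrightarrow> \<beta> \<in> X (length ns) \<Longrightarrow> \<epsilon> (csym \<beta> ns) = 0"
    by (rule con_lift[OF qalgebra_rat_alg, of "\<lambda>_. 0" "\<lambda>_ _. 0"]) auto
  then show ?thesis by (auto simp: counit_def)
qed

lemma con_antipode_exists: "\<exists>S. con_antipode S"
proof -
  obtain S where "S \<in> alg_hom H H" "\<And>\<beta>. \<beta> \<in> X 1 \<Longrightarrow> S (clog \<beta>) = (-1) \<odot>\<^bsub>H\<^esub> clog \<beta>"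
    "\<And>\<beta> ns. ns \<noteq> [] \<Longrightarrow> 0 \<notin> set ns \<Longrightarrow> \<beta> \<in> X (length ns) \<Longrightarrow> S (csym \<beta> ns) = E (length ns) \<beta> (antipode (pvar (generic ns)))"
  proof (rule con_lift[OF qalgebra_H, of "\<lambda>\<beta>. (-1) \<odot>\<^bsub>H\<^esub> clog \<beta>" "\<lambda>\<beta> ns. E (length ns) \<beta> (antipode (pvar (generic ns)))"])
    show "E (length ns) \<beta> (antipode (pvar (generic ns))) \<in> carrier H"
      if "ns \<noteq> []" "0 \<notin> set ns" "\<beta> \<in> X (length ns)" for \<beta> ns
      using that by (intro alg_hom_closed[OF ev_malg_hom] alg_hom_closed[OF antipode_hom] generic_free_alg)
        (simp_all add: Suc_le_eq)
    show "(-1) \<odot>\<^bsub>H\<^esub> clog (con n [i1, i2] \<alpha>) \<oplus>\<^bsub>H\<^esub> (-1) \<odot>\<^bsub>H\<^esub> clog (con n [i2, i3] \<alpha>) = (-1) \<odot>\<^bsub>H\<^esub> clog (con n [i1, i3] \<alpha>)"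
      if m: "n \<ge> 1" "\<alpha> \<in> X n" "1 \<le> i1" "i1 < i2" "i2 < i3" "i3 \<le> n + 1" for n \<alpha> i1 i2 i3
    proof -
      have c: "clog (con n [i1, i2] \<alpha>) \<in> carrier H" "clog (con n [i2, i3] \<alpha>) \<in> carrier H"
        using m by (auto intro!: clog_closed con_pair_closed)
      show ?thesis unfolding clog_add[OF m, symmetric] by (rule H.q_binary(1)[OF c, symmetric])
    qed
  qed (auto simp: clog_closed H.q_simps)
  then show ?thesis by (auto simp: con_antipode_def)
qed

text \<open>As for the coproduct, a general symbol is reduced to one with all arguments x_1, ...,
  x_d, here by \<open>antipode_relabel_pvar\<close>.\<close>

lemma con_antipode_ev:
  assumes S: "con_antipode S" and n: "n \<ge> 1" and \<alpha>: "\<alpha> \<in> X n" and u: "u \<in> carrier (free_alg (bounded_gens n))"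
  shows "S (E n \<alpha> u) = E n \<alpha> (antipode u)"
proof (rule H.free_alg_hom_eqI[OF alg_hom_comp[OF _ ev_hom[OF n \<alpha>]] alg_hom_comp[OF ev_malg_hom[OF n \<alpha>] antipode_hom] _ u])
  show "S \<in> alg_hom H H" using S by (simp add: con_antipode_def)
  fix g assume g: "g \<in> bounded_gens n"
  then show "S (E n \<alpha> (pvar g)) = E n \<alpha> (antipode (pvar g))"
  proof (cases rule: bounded_gens_cases)
    case (Log i)
    have b: "con n [i, i + 1] \<alpha> \<in> X 1" using Log by (intro con_pair_closed[OF n \<alpha>]) auto
    have "antipode (pvar g) = pconst (-1) * pvar g"
      using antipode_log_coeff[of i "i + 1"] by (intro poly_mapping_eqI) (simp add: Log log_coeff_def lookup_pconst_mult)
    then have "E n \<alpha> (antipode (pvar g)) = (-1) \<odot>\<^bsub>H\<^esub> E n \<alpha> (pvar g)"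
      using alg_hom_smult[OF ev_hom[OF n \<alpha>] pvar_free_alg[OF g], of "-1"] by (simp add: free_alg_eq malg_on_simps)
    then show ?thesis using S b ev_pvar[OF n \<alpha> g] by (simp add: con_antipode_def Log)
  next
    case (Sym p ns)
    have b: "con n p \<alpha> \<in> X (length ns)" using con_closed[OF n Sym(2) \<alpha>] Sym(3) by simp
    have c: "antipode (pvar (generic ns)) \<in> carrier (free_alg (bounded_gens (length p - 1)))"
      using alg_hom_closed[OF antipode_hom generic_free_alg[OF Sym(4,5)]] unfolding Sym(3) free_alg_eq .
    have "S (E n \<alpha> (pvar g)) = E (length ns) (con n p \<alpha>) (antipode (pvar (generic ns)))"
      using S b ev_pvar[OF n \<alpha> g] Sym by (simp add: con_antipode_def del: upt_Suc)
    also have "\<dots> = E n \<alpha> (antipode (pvar g))"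
      using ev_relabel[OF n \<alpha> Sym(2) c]
        antipode_relabel_pvar[OF strict_mono_extend_seq[OF Sym(2)] extend_seq_0 generic_bounded[OF Sym(4,5)]]
      unfolding Sym(3,6) by simp
    finally show ?thesis .
  qed
qed

section \<open>The Hopf algebra axioms\<close>

context
  fixes \<Delta> \<epsilon> S
  assumes \<Delta>: "coproduct \<Delta>" and \<epsilon>: "counit \<epsilon>" and S: "con_antipode S"
begin

lemma counit_hom: "\<epsilon> \<in> alg_hom H rat_alg" and antipode_H_hom: "S \<in> alg_hom H H"
  using \<epsilon> S by (simp_all add: counit_def con_antipode_def)

lemma counit_closed: "qalgebra M \<Longrightarrow> (\<lambda>x. \<epsilon> x \<odot>\<^bsub>M\<^esub> \<one>\<^bsub>M\<^esub>) \<in> alg_hom H M"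
  by (rule alg_hom_comp[OF qalgebra.scalar_hom counit_hom])

lemma augmentation_ev:
  assumes M: "qalgebra M" and h: "h \<in> alg_hom (malg_on (K n)) M" and n: "n \<ge> 1" and \<alpha>: "\<alpha> \<in> X n"
    and u: "u \<in> carrier (free_alg (bounded_gens n))"
  shows "h (augmentation u) = \<epsilon> (E n \<alpha> u) \<odot>\<^bsub>M\<^esub> \<one>\<^bsub>M\<^esub>"
proof -
  interpret M: qalgebra M by (rule M)
  show ?thesis
  proof (rule M.free_alg_hom_eqI[OF alg_hom_comp[OF h augmentation_hom] alg_hom_comp[OF counit_closed[OF M] ev_hom[OF n \<alpha>]] _ u])
    fix g assume g: "g \<in> bounded_gens n"
    have "h 0 = \<zero>\<^bsub>M\<^esub>"
      using alg_hom_zero[OF h qalgebra_malg_on[OF submonoid_mons] M] by (simp add: malg_on_simps)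
    moreover have "\<epsilon> (E n \<alpha> (pvar g)) = 0"
      using g
    proof (cases rule: bounded_gens_cases)
      case (Log i)
      have "con n [i, i + 1] \<alpha> \<in> X 1" using Log by (intro con_pair_closed[OF n \<alpha>]) auto
      then show ?thesis using \<epsilon> ev_pvar[OF n \<alpha> g] by (simp add: counit_def Log)
    next
      case (Sym p ns)
      have "con n p \<alpha> \<in> X (length ns)" using con_closed[OF n Sym(2) \<alpha>] Sym(3) by simp
      then show ?thesis using \<epsilon> ev_pvar[OF n \<alpha> g] Sym(1,4,5) by (simp add: counit_def)
    qed
    ultimately show "h (augmentation (pvar g)) = \<epsilon> (E n \<alpha> (pvar g)) \<odot>\<^bsub>M\<^esub> \<one>\<^bsub>M\<^esub>"
      by (simp add: augmentation_def M.q_simps)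
  qed
qed

lemma id_hom: "(\<lambda>x. x) \<in> alg_hom (free_alg (bounded_gens n)) (malg_on (K n))"
  by (simp add: free_alg_eq alg_hom_id)

lemma conv_counit:
  assumes M: "qalgebra M" and f: "f \<in> alg_hom H M" and x: "x \<in> carrier H"
  shows "conv \<Delta> M (\<lambda>x. \<epsilon> x \<odot>\<^bsub>M\<^esub> \<one>\<^bsub>M\<^esub>) f x = f x" "conv \<Delta> M f (\<lambda>x. \<epsilon> x \<odot>\<^bsub>M\<^esub> \<one>\<^bsub>M\<^esub>) x = f x"
proof -
  interpret M: qalgebra M by (rule M)
  let ?e = "\<lambda>x. \<epsilon> x \<odot>\<^bsub>M\<^esub> \<one>\<^bsub>M\<^esub>"
  note e = counit_closed[OF M]
  have *: "conv \<Delta> M ?e f (E n \<alpha> u) = f (E n \<alpha> u) \<and> conv \<Delta> M f ?e (E n \<alpha> u) = f (E n \<alpha> u)"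
    if n: "n \<ge> 1" and \<alpha>: "\<alpha> \<in> X n" and u: "u \<in> carrier (free_alg (bounded_gens n))" for n \<alpha> u
  proof -
    note h = hom_ev[OF \<Delta> M n \<alpha> f] and S' = submonoid_mons[of "bounded_gens n"]
    note cu = alg_hom_closed[OF cop_hom u]
    have aug: "f (E n \<alpha> (augmentation (Poly_Mapping.single m 1))) = ?e (E n \<alpha> (Poly_Mapping.single m 1))" if "m \<in> K n" for m
      by (rule augmentation_ev[OF M h n \<alpha>]) (use that in \<open>simp add: free_alg_eq malg_on_simps\<close>)
    have "conv \<Delta> M ?e f (E n \<alpha> u) = M.pair_eval (\<lambda>x. f (E n \<alpha> (augmentation x))) (\<lambda>x. f (E n \<alpha> x)) (cop u)"
      unfolding conv_ev[OF \<Delta> M n \<alpha> e f u]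
      by (rule M.pair_eval_cong[OF S' S' hom_ev[OF \<Delta> M n \<alpha> e] h _ _ cu, symmetric]) (simp_all add: aug)
    also have "\<dots> = f (E n \<alpha> (phom2 augmentation (\<lambda>x. x) (cop u)))"
      by (rule M.alg_hom_phom2[OF S' h qhom_augmentation augmentation_hom qhom_id id_hom cu, symmetric])
    also have "\<dots> = f (E n \<alpha> u)" by (simp add: counit_symb(1)[OF qhom_id bounded_free_alg_H_symb[OF u]])
    finally have 1: "conv \<Delta> M ?e f (E n \<alpha> u) = f (E n \<alpha> u)" .
    have "conv \<Delta> M f ?e (E n \<alpha> u) = M.pair_eval (\<lambda>x. f (E n \<alpha> x)) (\<lambda>x. f (E n \<alpha> (augmentation x))) (cop u)"
      unfolding conv_ev[OF \<Delta> M n \<alpha> f e u]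
      by (rule M.pair_eval_cong[OF S' S' h hom_ev[OF \<Delta> M n \<alpha> e] _ _ cu, symmetric]) (simp_all add: aug)
    also have "\<dots> = f (E n \<alpha> (phom2 (\<lambda>x. x) augmentation (cop u)))"
      by (rule M.alg_hom_phom2[OF S' h qhom_id id_hom qhom_augmentation augmentation_hom cu, symmetric])
    also have "\<dots> = f (E n \<alpha> u)" by (simp add: counit_symb(2)[OF qhom_id bounded_free_alg_H_symb[OF u]])
    finally show ?thesis using 1 by blast
  qed
  show "conv \<Delta> M ?e f x = f x"
    by (rule H_hom_ev_eqI[OF M conv_hom[OF \<Delta> M e f] f x]) (simp add: * pvar_free_alg)
  show "conv \<Delta> M f ?e x = f x"
    by (rule H_hom_ev_eqI[OF M conv_hom[OF \<Delta> M f e] f x]) (simp add: * pvar_free_alg)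
qed

lemma conv_antipode_left:
  assumes x: "x \<in> carrier H"
  shows "conv \<Delta> H S (\<lambda>x. x) x = \<epsilon> x \<odot>\<^bsub>H\<^esub> \<one>\<^bsub>H\<^esub>"
proof (rule H_hom_ev_eqI[OF qalgebra_H conv_hom[OF \<Delta> qalgebra_H antipode_H_hom alg_hom_id] counit_closed[OF qalgebra_H] x])
  fix n \<alpha> and g :: symb assume n: "n \<ge> 1" and \<alpha>: "\<alpha> \<in> X n" and g: "g \<in> bounded_gens n"
  note u = pvar_free_alg[OF g] and S' = submonoid_mons[of "bounded_gens n"] and h = ev_malg_hom[OF n \<alpha>]
  note cu = alg_hom_closed[OF cop_hom u]
  have "conv \<Delta> H S (\<lambda>x. x) (E n \<alpha> (pvar g)) = H.pair_eval (\<lambda>x. E n \<alpha> (antipode x)) (\<lambda>x. E n \<alpha> x) (cop (pvar g))"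
    unfolding conv_ev[OF \<Delta> qalgebra_H n \<alpha> antipode_H_hom alg_hom_id u]
    by (rule H.pair_eval_cong[OF S' S' hom_ev[OF \<Delta> qalgebra_H n \<alpha> antipode_H_hom] h _ _ cu, symmetric])
      (simp_all add: con_antipode_ev[OF S n \<alpha>] free_alg_eq malg_on_simps)
  also have "\<dots> = E n \<alpha> (phom2 antipode (\<lambda>x. x) (cop (pvar g)))"
    by (rule H.alg_hom_phom2[OF S' h qhom_antipode antipode_hom qhom_id id_hom cu, symmetric])
  also have "\<dots> = E n \<alpha> (augmentation (pvar g))"
    by (simp add: antipode_symb[OF bounded_free_alg_H_symb[OF u]])
  also have "\<dots> = \<epsilon> (E n \<alpha> (pvar g)) \<odot>\<^bsub>H\<^esub> \<one>\<^bsub>H\<^esub>"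
    by (rule augmentation_ev[OF qalgebra_H h n \<alpha> u])
  finally show "conv \<Delta> H S (\<lambda>x. x) (E n \<alpha> (pvar g)) = \<epsilon> (E n \<alpha> (pvar g)) \<odot>\<^bsub>H\<^esub> \<one>\<^bsub>H\<^esub>" .
qed

text \<open>\<open>tensor_lift\<close> works with an unknown representative, so equality of two
  bilinear maps on the carriers is transferred through pure tensors.\<close>

lemma conv_cong:
  assumes "qalgebra M" "f \<in> alg_hom H M" "g \<in> alg_hom H M"
    and "\<And>a b. a \<in> carrier H \<Longrightarrow> b \<in> carrier H \<Longrightarrow> \<phi> a b = f a \<otimes>\<^bsub>M\<^esub> g b" and x: "x \<in> carrier H"
  shows "tensor_lift M \<phi> (\<Delta> x) = conv \<Delta> M f g x"
  unfolding conv_def[OF \<Delta>]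
  by (rule TT.tensor_hom_eqI[OF assms(1) TT.tensor_lift_hom(1)[OF assms(1-4)] TT.tensor_lift_hom(1)[OF assms(1-3) refl]])
    (simp_all add: TT.tensor_lift_hom(2)[OF assms(1-4)] TT.tensor_lift_hom(2)[OF assms(1-3) refl]
      alg_hom_closed[OF coproduct_hom[OF \<Delta>] x])

text \<open>The left convolution inverse \<open>S\<close> of the identity has the left inverse \<open>S \<circ> S\<close>, which is therefore the identity.\<close>

lemma conv_antipode_right:
  assumes x: "x \<in> carrier H"
  shows "conv \<Delta> H (\<lambda>x. x) S x = \<epsilon> x \<odot>\<^bsub>H\<^esub> \<one>\<^bsub>H\<^esub>"
proof -
  let ?e = "\<lambda>x. \<epsilon> x \<odot>\<^bsub>H\<^esub> \<one>\<^bsub>H\<^esub>" and ?SS = "\<lambda>x. S (S x)"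
  note H = qalgebra_H and e = counit_closed[OF qalgebra_H] and i = alg_hom_id and S' = antipode_H_hom
  note SS = alg_hom_comp[OF S' S']
  have 1: "conv \<Delta> H ?SS S y = ?e y" if y: "y \<in> carrier H" for y
  proof -
    have "conv \<Delta> H ?SS S y = S (conv \<Delta> H S (\<lambda>x. x) y)"
      unfolding conv_def[OF \<Delta>]
      by (rule TT.tensor_hom_eqI[OF H TT.tensor_lift_hom(1)[OF H SS S' refl] alg_hom_comp[OF S' TT.tensor_lift_hom(1)[OF H S' i refl]]])
        (simp_all add: TT.tensor_lift_hom(2)[OF H SS S' refl] TT.tensor_lift_hom(2)[OF H S' i refl] alg_homD[OF S']
          alg_hom_closed[OF coproduct_hom[OF \<Delta>] y])
    also have "\<dots> = ?e y" by (simp add: conv_antipode_left[OF y] alg_homD[OF S'])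
    finally show ?thesis .
  qed
  have SSid: "?SS y = y" if y: "y \<in> carrier H" for y
  proof -
    have "?SS y = conv \<Delta> H ?SS ?e y" by (simp add: conv_counit(2)[OF H SS y])
    also have "\<dots> = conv \<Delta> H ?SS (conv \<Delta> H S (\<lambda>x. x)) y"
      unfolding conv_def[OF \<Delta>, of H ?SS ?e]
      by (rule conv_cong[OF H SS conv_hom[OF \<Delta> H S' i] _ y]) (simp add: conv_antipode_left)
    also have "\<dots> = conv \<Delta> H (conv \<Delta> H ?SS S) (\<lambda>x. x) y"
      by (rule conv_assoc[OF \<Delta> H SS S' i y, symmetric])
    also have "\<dots> = conv \<Delta> H ?e (\<lambda>x. x) y"
      unfolding conv_def[OF \<Delta>, of H "conv \<Delta> H ?SS S"]
      by (rule conv_cong[OF H e i _ y]) (simp add: 1)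
    also have "\<dots> = y" by (rule conv_counit(1)[OF H i y])
    finally show ?thesis .
  qed
  have "conv \<Delta> H (\<lambda>x. x) S x = conv \<Delta> H ?SS S x"
    unfolding conv_def[OF \<Delta>, of H "\<lambda>x. x"]
    by (rule conv_cong[OF H SS S' _ x]) (simp add: SSid)
  then show ?thesis by (simp add: 1 x)
qed

text \<open>Both sides are triple convolutions of the three inclusions \<open>j1\<close>,
  \<open>j2\<close>, \<open>j3\<close> of \<open>H\<close> into the threefold tensor product,
  bracketed differently, so the claim is a case of \<open>conv_assoc\<close>.\<close>

lemma coproduct_coassoc:
  assumes x: "x \<in> carrier H"
  shows "tensor_assoc H H H (tensor_map T H \<Delta> (\<lambda>b. b) (\<Delta> x)) = tensor_map H T (\<lambda>a. a) \<Delta> (\<Delta> x)"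
proof -
  note H = qalgebra_H and D = coproduct_hom[OF \<Delta>] and i = alg_hom_id
  interpret P: qalgebra_pair T H by (rule qalgebra_pairI[OF TT.qalgebra_tensor qalgebra_H])
  interpret R: qalgebra_pair H T by (rule qalgebra_pairI[OF qalgebra_H TT.qalgebra_tensor])
  note T' = R.qalgebra_tensor
  interpret T': qalgebra "tensor H T" by (rule T')
  define j1 where "j1 = (\<lambda>a. R.pt a \<one>\<^bsub>T\<^esub>)"
  define j2 where "j2 = (\<lambda>b. R.pt \<one>\<^bsub>H\<^esub> (pt b \<one>\<^bsub>H\<^esub>))"
  define j3 where "j3 = (\<lambda>c. R.pt \<one>\<^bsub>H\<^esub> (pt \<one>\<^bsub>H\<^esub> c))"
  have j: "j1 \<in> alg_hom H R.T" "j2 \<in> alg_hom H R.T" "j3 \<in> alg_hom H R.T"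
    unfolding j1_def j2_def j3_def
    by (rule R.pt_left_hom alg_hom_comp[OF R.pt_right_hom TT.pt_left_hom] alg_hom_comp[OF R.pt_right_hom TT.pt_right_hom])+
  define f12 where "f12 = tensor_lift R.T (\<lambda>a b. j1 a \<otimes>\<^bsub>R.T\<^esub> j2 b)"
  have f12: "f12 \<in> alg_hom T R.T" unfolding f12_def by (rule TT.tensor_lift_hom(1)[OF T' j(1,2) refl])
  have j23: "R.pt \<one>\<^bsub>H\<^esub> (pt b c) = j2 b \<otimes>\<^bsub>R.T\<^esub> j3 c" if "b \<in> carrier H" "c \<in> carrier H" for b c
    using that unfolding j2_def j3_def TT.pt_eq_mult[OF that] by (intro alg_hom_mult[OF R.pt_right_hom] TT.pt_closed) simp_all
  have pt3: "R.pt a (pt b c) = (j1 a \<otimes>\<^bsub>R.T\<^esub> j2 b) \<otimes>\<^bsub>R.T\<^esub> j3 c"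
    if "a \<in> carrier H" "b \<in> carrier H" "c \<in> carrier H" for a b c
  proof -
    have "R.pt a (pt b c) = j1 a \<otimes>\<^bsub>R.T\<^esub> R.pt \<one>\<^bsub>H\<^esub> (pt b c)"
      unfolding j1_def by (rule R.pt_eq_mult[OF that(1) TT.pt_closed[OF that(2,3)]])
    then show ?thesis using that alg_homD(1)[OF j(1)] alg_homD(1)[OF j(2)] alg_homD(1)[OF j(3)] by (simp add: j23 T'.m_assoc)
  qed
  \<comment> \<open>For fixed \<open>c\<close> the inner map is in general linear but not
    multiplicative. It is therefore computed on the representative that \<open>tensor_lift\<close>
    chooses, with the factor \<open>j3 c\<close> taken out of the sum.\<close>
  have inner: "tensor_lift R.T (\<lambda>a b. R.pt a (pt b c)) U = f12 U \<otimes>\<^bsub>R.T\<^esub> j3 c"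
    if U: "U \<in> carrier T" and c: "c \<in> carrier H" for U c
  proof -
    define u where "u = (SOME u. u \<in> U)"
    obtain u0 where u0: "u0 \<in> carrier TT.TF" "U = TT.TI +>\<^bsub>TT.TF\<^esub> u0" using U by (auto simp: TT.carrier_tensor)
    have "u \<in> U" unfolding u_def u0(2) by (rule someI[of "\<lambda>u. u \<in> TT.TI +>\<^bsub>TT.TF\<^esub> u0", OF TT.Q.a_rcos_self[OF u0(1)]])
    then have "u \<in> carrier TT.TF"
      using TT.Q.a_r_coset_subset_G[OF TT.Q.a_subset u0(1)] u0(2) by blast
    then have k: "fst z \<in> carrier H" "snd z \<in> carrier H" if "z \<in> keys u" for z
      using that by (auto simp: TT.TF_simps)
    have "tensor_lift R.T (\<lambda>a b. R.pt a (pt b c)) U =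
        (\<Oplus>\<^bsub>R.T\<^esub>z\<in>keys u. (lookup u z \<odot>\<^bsub>R.T\<^esub> (j1 (fst z) \<otimes>\<^bsub>R.T\<^esub> j2 (snd z))) \<otimes>\<^bsub>R.T\<^esub> j3 c)"
      unfolding tensor_lift_def Let_def u_def[symmetric]
      by (rule T'.finsum_cong'[OF refl]) (auto simp: k c pt3 T'.q_simps alg_homD(1)[OF j(1)] alg_homD(1)[OF j(2)] alg_homD(1)[OF j(3)])
    also have "\<dots> = f12 U \<otimes>\<^bsub>R.T\<^esub> j3 c"
      unfolding f12_def tensor_lift_def Let_def u_def[symmetric]
      by (rule T'.finsum_ldistr[symmetric]) (auto simp: k c T'.q_simps alg_homD(1)[OF j(1)] alg_homD(1)[OF j(2)] alg_homD(1)[OF j(3)])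
    finally show ?thesis .
  qed
  have ta: "tensor_assoc H H H = tensor_lift R.T (\<lambda>U c. tensor_lift R.T (\<lambda>a b. R.pt a (pt b c)) U)"
    by (simp add: tensor_assoc_def Let_def fun_eq_iff)
  have ta_hom: "tensor_assoc H H H \<in> alg_hom P.T R.T"
    unfolding ta by (rule P.tensor_lift_hom(1)[OF T' f12 j(3)]) (rule inner)
  have ta_pt: "tensor_assoc H H H (P.pt U c) = f12 U \<otimes>\<^bsub>R.T\<^esub> j3 c" if "U \<in> carrier T" "c \<in> carrier H" for U c
    unfolding ta using that by (intro P.tensor_lift_hom(2)[OF T' f12 j(3)] inner)
  have Dl: "(\<lambda>a. P.pt (\<Delta> a) \<one>\<^bsub>H\<^esub>) \<in> alg_hom H P.T" by (rule alg_hom_comp[OF P.pt_left_hom D])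
  have tm: "P.pt (\<Delta> a) b = P.pt (\<Delta> a) \<one>\<^bsub>H\<^esub> \<otimes>\<^bsub>P.T\<^esub> P.pt \<one>\<^bsub>T\<^esub> b" if "a \<in> carrier H" "b \<in> carrier H" for a b
    using that by (intro P.pt_eq_mult alg_hom_closed[OF D])
  have tm_hom: "tensor_map T H \<Delta> (\<lambda>b. b) \<in> alg_hom T P.T"
    unfolding tensor_map_def by (rule TT.tensor_lift_hom(1)[OF P.qalgebra_tensor Dl P.pt_right_hom]) (rule tm)
  have tm_pt: "tensor_map T H \<Delta> (\<lambda>b. b) (pt a b) = P.pt (\<Delta> a) b" if "a \<in> carrier H" "b \<in> carrier H" for a b
    unfolding tensor_map_def tm[OF that] using that by (intro TT.tensor_lift_hom(2)[OF P.qalgebra_tensor Dl P.pt_right_hom] tm)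
  have c12: "(\<lambda>x. f12 (\<Delta> x)) \<in> alg_hom H R.T" by (rule alg_hom_comp[OF f12 D])
  have "tensor_assoc H H H (tensor_map T H \<Delta> (\<lambda>b. b) (\<Delta> x)) = tensor_lift R.T (\<lambda>a b. f12 (\<Delta> a) \<otimes>\<^bsub>R.T\<^esub> j3 b) (\<Delta> x)"
  proof (rule TT.tensor_hom_eqI[OF T' alg_hom_comp[OF ta_hom tm_hom] TT.tensor_lift_hom(1)[OF T' c12 j(3) refl] _ alg_hom_closed[OF D x]])
    fix a b assume ab: "a \<in> carrier H" "b \<in> carrier H"
    then show "tensor_assoc H H H (tensor_map T H \<Delta> (\<lambda>b. b) (pt a b)) = tensor_lift R.T (\<lambda>a b. f12 (\<Delta> a) \<otimes>\<^bsub>R.T\<^esub> j3 b) (pt a b)"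
      unfolding tm_pt[OF ab] TT.tensor_lift_hom(2)[OF T' c12 j(3) refl ab]
      by (intro ta_pt alg_hom_closed[OF D])
  qed
  also have "\<dots> = conv \<Delta> R.T (conv \<Delta> R.T j1 j2) j3 x"
    by (simp add: conv_def[OF \<Delta>] f12_def)
  also have "\<dots> = conv \<Delta> R.T j1 (conv \<Delta> R.T j2 j3) x"
    by (rule conv_assoc[OF \<Delta> T' j x])
  also have "\<dots> = tensor_map H T (\<lambda>a. a) \<Delta> (\<Delta> x)"
    unfolding tensor_map_def
  proof (rule conv_cong[OF T' j(1) conv_hom[OF \<Delta> T' j(2,3)] _ x, symmetric])
    fix a b assume ab: "a \<in> carrier H" "b \<in> carrier H"
    have "conv \<Delta> R.T j2 j3 b = R.pt \<one>\<^bsub>H\<^esub> (\<Delta> b)"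
      unfolding conv_def[OF \<Delta>]
      by (rule TT.tensor_hom_eqI[OF T' TT.tensor_lift_hom(1)[OF T' j(2,3) refl] R.pt_right_hom _ alg_hom_closed[OF D ab(2)]])
        (simp add: TT.tensor_lift_hom(2)[OF T' j(2,3) refl] j23)
    then show "R.pt a (\<Delta> b) = j1 a \<otimes>\<^bsub>R.T\<^esub> conv \<Delta> R.T j2 j3 b"
      unfolding j1_def using R.pt_eq_mult[OF ab(1) alg_hom_closed[OF D ab(2)]] by simp
  qed
  finally show ?thesis .
qed

lemma con_hopf_algebra: "hopf_algebra H \<Delta> \<epsilon> S"
proof (intro hopf_algebra.intro hopf_algebra_axioms.intro)
  note H = qalgebra_H and e = counit_closed[OF qalgebra_H] and i = alg_hom_id and S' = antipode_H_hom
  show "algebra rat_alg H" by (rule H.algebra_axioms)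
  show "S \<in> lin_map H H" by (auto simp: lin_map_def alg_homD[OF S'])
  fix x assume x: "x \<in> carrier H"
  have 1: "tensor_lift H (\<lambda>a b. \<epsilon> a \<odot>\<^bsub>H\<^esub> b) (\<Delta> x) = conv \<Delta> H (\<lambda>x. \<epsilon> x \<odot>\<^bsub>H\<^esub> \<one>\<^bsub>H\<^esub>) (\<lambda>x. x) x"
    by (rule conv_cong[OF H e i _ x]) (simp add: H.q_simps)
  then show "tensor_lift H (\<lambda>a b. \<epsilon> a \<odot>\<^bsub>H\<^esub> b) (\<Delta> x) = x"
    by (simp add: conv_counit(1)[OF H i x])
  have 2: "tensor_lift H (\<lambda>a b. \<epsilon> b \<odot>\<^bsub>H\<^esub> a) (\<Delta> x) = conv \<Delta> H (\<lambda>x. x) (\<lambda>x. \<epsilon> x \<odot>\<^bsub>H\<^esub> \<one>\<^bsub>H\<^esub>) x"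
    by (rule conv_cong[OF H i e _ x]) (simp add: H.q_simps)
  then show "tensor_lift H (\<lambda>a b. \<epsilon> b \<odot>\<^bsub>H\<^esub> a) (\<Delta> x) = x"
    by (simp add: conv_counit(2)[OF H i x])
  show "tensor_lift H (\<lambda>a b. S a \<otimes>\<^bsub>H\<^esub> b) (\<Delta> x) = \<epsilon> x \<odot>\<^bsub>H\<^esub> \<one>\<^bsub>H\<^esub>"
    unfolding conv_antipode_left[OF x, symmetric] by (rule conv_cong[OF H S' i refl x])
  show "tensor_lift H (\<lambda>a b. a \<otimes>\<^bsub>H\<^esub> S b) (\<Delta> x) = \<epsilon> x \<odot>\<^bsub>H\<^esub> \<one>\<^bsub>H\<^esub>"
    unfolding conv_antipode_right[OF x, symmetric] by (rule conv_cong[OF H i S' refl x])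
qed (rule coproduct_hom[OF \<Delta>] counit_hom coproduct_coassoc; assumption?)+

end

end

section \<open>The grading\<close>

text \<open>Subspaces compatible with products, without directness. This is enough to follow degrees
  along homomorphisms, and families of eigenspaces satisfy it as well.\<close>

definition alg_grading :: "(rat, 'a, 'x) module_scheme \<Rightarrow> (nat \<Rightarrow> 'a set) \<Rightarrow> bool" where
  "alg_grading A D \<longleftrightarrow> (\<forall>k. D k \<subseteq> carrier A \<and> \<zero>\<^bsub>A\<^esub> \<in> D k \<and>
     (\<forall>x\<in>D k. \<forall>y\<in>D k. x \<oplus>\<^bsub>A\<^esub> y \<in> D k) \<and> (\<forall>c. \<forall>x\<in>D k. c \<odot>\<^bsub>A\<^esub> x \<in> D k)) \<and>
     \<one>\<^bsub>A\<^esub> \<in> D 0 \<and> (\<forall>k l. \<forall>x\<in>D k. \<forall>y\<in>D l. x \<otimes>\<^bsub>A\<^esub> y \<in> D (k + l))"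

lemma alg_gradingD:
  assumes "alg_grading A D"
  shows "x \<in> D k \<Longrightarrow> x \<in> carrier A" "\<zero>\<^bsub>A\<^esub> \<in> D k" "x \<in> D k \<Longrightarrow> y \<in> D k \<Longrightarrow> x \<oplus>\<^bsub>A\<^esub> y \<in> D k"
    "x \<in> D k \<Longrightarrow> c \<odot>\<^bsub>A\<^esub> x \<in> D k" "\<one>\<^bsub>A\<^esub> \<in> D 0" "x \<in> D k \<Longrightarrow> y \<in> D l \<Longrightarrow> x \<otimes>\<^bsub>A\<^esub> y \<in> D (k + l)"
  using assms unfolding alg_grading_def by blast+

context qalgebra
begin

lemma lin_grading:
  assumes D: "alg_grading A D" and M: "\<And>x. x \<in> keys p \<Longrightarrow> M x \<in> D k"
  shows "lin M p \<in> D k"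
proof -
  have "(\<Oplus>x\<in>I. lookup p x \<odot> M x) \<in> D k" if "finite I" "I \<subseteq> keys p" for I
    using that
  proof (induction I rule: finite_induct)
    case empty
    then show ?case using alg_gradingD(2)[OF D] by simp
  next
    case (insert x I)
    have "lookup p y \<odot> M y \<in> D k" if "y \<in> insert x I" for y
      using that insert.prems M by (intro alg_gradingD(4)[OF D]) auto
    then show ?case using insert alg_gradingD(1)[OF D, of _ k]
      by (subst finsum_insert) (auto intro!: alg_gradingD(3)[OF D])
  qed
  then show ?thesis by (simp add: lin_def)
qed

lemma hom_grading:
  assumes D: "alg_grading A D" and h: "h \<in> alg_hom (free_alg V) A" and g: "\<And>g. g \<in> V \<Longrightarrow> h (pvar g) \<in> D (wt g)"
    and p: "keys p \<subseteq> grading1 wt V k"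
  shows "h p \<in> D k"
proof -
  have h': "h \<in> alg_hom (monoid_alg (mons V) (+) 0) A" using h by (simp add: free_alg_eq malg_on_def)
  have "h p = lin (\<lambda>m. h (Poly_Mapping.single m 1)) p"
    by (rule comm_monoid_on.alg_hom_eq_lin[OF submonoid_comm_monoid_on[OF submonoid_mons] qalgebra_axioms h'])
      (simp add: monoid_alg_simps order_trans[OF p grading1_subset_mons])
  also have "\<dots> \<in> D k"
  proof (rule lin_grading[OF D])
    fix m assume "m \<in> keys p"
    then have m: "m \<in> mons V" "weight wt m = k" using p by (auto simp: grading1_def mons_def)
    from m(1) have "h (Poly_Mapping.single m 1) \<in> D (weight wt m)"
    proof (induction m rule: mons_induct)
      case zero
      show ?case using malg_hom_single_0[OF h[unfolded free_alg_eq]] alg_gradingD(5)[OF D] by (simp del: single_one)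
    next
      case (add m n)
      then show ?case
        by (simp add: malg_hom_single_add[OF h[unfolded free_alg_eq]] weight_add alg_gradingD(6)[OF D])
    next
      case (var v)
      then show ?case using g[of v] by (simp add: pvar_def)
    qed
    then show "h (Poly_Mapping.single m 1) \<in> D k" by (simp add: m(2))
  qed
  finally show ?thesis .
qed

end

text \<open>The scalars sit in degree 0, so a homomorphism into them that respects degrees vanishes
  in positive degree, as the counit must.\<close>

lemma rat_alg_grading: "alg_grading rat_alg (\<lambda>k. if k = 0 then UNIV else {0})"
  by (auto simp: alg_grading_def)

context contraction_system
begin

abbreviation "G \<equiv> con_degree X con"

lemma con_degree_eq: "G k = con_class X con ` {p. keys p \<subseteq> grading1 cgen_weight (con_gens X) k}"
proof -
  have "(p \<in> carrier F \<and> (\<forall>m\<in>keys p. (\<Sum>g\<in>keys m. lookup m g * cgen_weight g) = k)) \<longleftrightarrow>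
      keys p \<subseteq> grading1 cgen_weight (con_gens X) k" for p
    by (auto simp: grading1_def weight_def free_alg_def)
  then show ?thesis unfolding con_degree_def setcompr_eq_image by simp
qed

lemma H_grading: "alg_grading H G"
proof -
  note g = monoid_grading1[of cgen_weight "con_gens X"]
  have c: "p \<in> carrier F" if "keys p \<subseteq> grading1 cgen_weight (con_gens X) k" for p k
    using that grading1_subset_mons[of cgen_weight "con_gens X" k] by (auto simp: free_alg_eq malg_on_simps)
  have k: "keys (pconst r * p) \<subseteq> keys p" for r and p :: "'a cgen mpoly"
    by (auto simp: in_keys_iff lookup_pconst_mult)
  show ?thesis
    unfolding alg_grading_def con_degree_eq
  proof (intro conjI allI ballI; (elim imageE CollectE; hypsubst)?)
    show "con_class X con ` {p. keys p \<subseteq> grading1 cgen_weight (con_gens X) k} \<subseteq> carrier H" for k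
      using alg_hom_closed[OF class_hom c] by auto
    show "\<zero>\<^bsub>H\<^esub> \<in> con_class X con ` {p. keys p \<subseteq> grading1 cgen_weight (con_gens X) k}" for k
      using alg_hom_zero[OF class_hom qalgebra_free_alg qalgebra_H]
      by (intro image_eqI[of _ _ 0]) (simp_all add: free_alg_eq malg_on_simps)
    show "\<one>\<^bsub>H\<^esub> \<in> con_class X con ` {p. keys p \<subseteq> grading1 cgen_weight (con_gens X) 0}"
      using alg_hom_one[OF class_hom] keys_1_grading[OF g]
      by (intro image_eqI[of _ _ 1]) (simp_all add: free_alg_eq malg_on_simps)
    fix k and p :: "'a cgen mpoly" assume p: "keys p \<subseteq> grading1 cgen_weight (con_gens X) k"
    show "r \<odot>\<^bsub>H\<^esub> con_class X con p \<in> con_class X con ` {p. keys p \<subseteq> grading1 cgen_weight (con_gens X) k}" for r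
      using alg_hom_smult[OF class_hom c[OF p], of r] k[of r p] p
      by (intro image_eqI[of _ _ "pconst r * p"]) (auto simp: free_alg_eq malg_on_simps)
    fix q :: "'a cgen mpoly"
    show "con_class X con p \<oplus>\<^bsub>H\<^esub> con_class X con q \<in> con_class X con ` {p. keys p \<subseteq> grading1 cgen_weight (con_gens X) k}"
      if q: "keys q \<subseteq> grading1 cgen_weight (con_gens X) k"
      using alg_hom_add[OF class_hom c[OF p] c[OF q]] keys_add_grading[OF g p q]
      by (intro image_eqI[of _ _ "p + q"]) (simp_all add: free_alg_eq malg_on_simps)
    show "con_class X con p \<otimes>\<^bsub>H\<^esub> con_class X con q \<in> con_class X con ` {p. keys p \<subseteq> grading1 cgen_weight (con_gens X) (k + l)}"
      if q: "keys q \<subseteq> grading1 cgen_weight (con_gens X) l" for l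
      using alg_hom_mult[OF class_hom c[OF p] c[OF q]] keys_mult_grading[OF g p q]
      by (intro image_eqI[of _ _ "p * q"]) (simp_all add: free_alg_eq malg_on_simps)
  qed
qed

lemma clog_degree: "\<beta> \<in> X 1 \<Longrightarrow> clog \<beta> \<in> G 1"
  unfolding con_degree_eq con_log_def by (intro imageI CollectI keys_pvar_grading1 CLog_mem) simp_all

lemma csym_degree: "ns \<noteq> [] \<Longrightarrow> 0 \<notin> set ns \<Longrightarrow> \<beta> \<in> X (length ns) \<Longrightarrow> csym \<beta> ns \<in> G (sum_list ns)"
  unfolding con_degree_eq con_sym_def by (intro imageI CollectI keys_pvar_grading1 CSym_mem) simp_all

lemma H_hom_grading:
  assumes M: "qalgebra M" and D: "alg_grading M D" and h: "h \<in> alg_hom H M"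
    and L: "\<And>\<beta>. \<beta> \<in> X 1 \<Longrightarrow> h (clog \<beta>) \<in> D 1"
    and S: "\<And>\<beta> ns. ns \<noteq> [] \<Longrightarrow> 0 \<notin> set ns \<Longrightarrow> \<beta> \<in> X (length ns) \<Longrightarrow> h (csym \<beta> ns) \<in> D (sum_list ns)"
    and x: "x \<in> G k"
  shows "h x \<in> D k"
proof -
  interpret M: qalgebra M by (rule M)
  obtain p where p: "keys p \<subseteq> grading1 cgen_weight (con_gens X) k" "x = con_class X con p"
    using x by (auto simp: con_degree_eq)
  have "h (con_class X con p) \<in> D k"
    by (rule M.hom_grading[OF D alg_hom_comp[OF h class_hom] _ p(1)])
      (use L S in \<open>auto simp: con_gens_def con_log_def con_sym_def\<close>)
  then show ?thesis by (simp add: p(2))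
qed

lemma ev_degree:
  assumes n: "n \<ge> 1" and \<alpha>: "\<alpha> \<in> X n" and u: "keys u \<subseteq> grading1 symb_weight (bounded_gens n) k"
  shows "E n \<alpha> u \<in> G k"
proof (rule H.hom_grading[OF H_grading ev_hom[OF n \<alpha>] _ u])
  fix g assume g: "g \<in> bounded_gens n"
  then show "E n \<alpha> (pvar g) \<in> G (symb_weight g)"
  proof (cases rule: bounded_gens_cases)
    case (Log i)
    have "con n [i, i + 1] \<alpha> \<in> X 1" using Log by (intro con_pair_closed[OF n \<alpha>]) auto
    then show ?thesis using clog_degree ev_pvar[OF n \<alpha> g] by (simp add: Log)
  next
    case (Sym p ns)
    have "con n p \<alpha> \<in> X (length ns)" using con_closed[OF n Sym(2) \<alpha>] Sym(3) by simp
    then show ?thesis using csym_degree ev_pvar[OF n \<alpha> g] Sym(1,4,5) by simp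
  qed
qed

section \<open>Degrees in the tensor square and directness of the grading\<close>

abbreviation "TD \<equiv> tensor_degree H G"

definition pair_degree :: "nat \<Rightarrow> ('a cgen mpoly set \<times> 'a cgen mpoly set) set" where
  "pair_degree n = {(a, b). \<exists>i j. i + j = n \<and> a \<in> G i \<and> b \<in> G j}"

lemma tensor_degree_eq: "TD n = (\<lambda>u. TT.TI +>\<^bsub>TT.TF\<^esub> u) ` {u. keys u \<subseteq> pair_degree n}"
  unfolding tensor_degree_def pair_degree_def by blast

lemma pair_degree_carrier: "pair_degree n \<subseteq> carrier H \<times> carrier H"
  using alg_gradingD(1)[OF H_grading] by (auto simp: pair_degree_def)

lemma tensor_grading: "alg_grading T TD"
proof -
  have c: "u \<in> carrier TT.TF" if "keys u \<subseteq> pair_degree k" for k and u :: "'a cgen mpoly set \<times> 'a cgen mpoly set \<Rightarrow>\<^sub>0 rat"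
    using that pair_degree_carrier[of k] by (auto simp: TT.TF_simps)
  let ?c = "\<lambda>u. TT.TI +>\<^bsub>TT.TF\<^esub> u"
  show ?thesis
    unfolding alg_grading_def tensor_degree_eq
  proof (intro conjI allI ballI; (elim imageE CollectE; hypsubst)?)
    show "?c ` {u. keys u \<subseteq> pair_degree k} \<subseteq> carrier T" for k
      using alg_hom_closed[OF TT.class_hom c] by auto
    show "\<zero>\<^bsub>T\<^esub> \<in> ?c ` {u. keys u \<subseteq> pair_degree k}" for k
      using alg_hom_zero[OF TT.class_hom TT.qalgebra_TF TT.qalgebra_tensor]
      by (intro image_eqI[of _ _ 0]) (simp_all add: TT.TF_simps)
    show "\<one>\<^bsub>T\<^esub> \<in> ?c ` {u. keys u \<subseteq> pair_degree 0}"
      using alg_hom_one[OF TT.class_hom] alg_gradingD(5)[OF H_grading]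
      by (intro image_eqI[of _ _ "one TT.TF"]) (simp, simp add: TT.TF_simps pair_degree_def)
    fix k and u :: "'a cgen mpoly set \<times> 'a cgen mpoly set \<Rightarrow>\<^sub>0 rat" assume u: "keys u \<subseteq> pair_degree k"
    show "r \<odot>\<^bsub>T\<^esub> ?c u \<in> ?c ` {u. keys u \<subseteq> pair_degree k}" for r
      using alg_hom_smult[OF TT.class_hom c[OF u], of r] u
      by (intro image_eqI[of _ _ "Poly_Mapping.map ((*) r) u"])
        (auto simp: TT.TF_simps in_keys_iff lookup_map_scale subset_iff)
    fix v :: "'a cgen mpoly set \<times> 'a cgen mpoly set \<Rightarrow>\<^sub>0 rat"
    show "?c u \<oplus>\<^bsub>T\<^esub> ?c v \<in> ?c ` {u. keys u \<subseteq> pair_degree k}" if v: "keys v \<subseteq> pair_degree k"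
      using TT.class_add[OF c[OF u] c[OF v]] keys_add[of u v] u v
      by (intro image_eqI[of _ _ "u + v"]) auto
    show "?c u \<otimes>\<^bsub>T\<^esub> ?c v \<in> ?c ` {u. keys u \<subseteq> pair_degree (k + l)}" if v: "keys v \<subseteq> pair_degree l" for l
    proof (intro image_eqI[of _ _ "u \<otimes>\<^bsub>TT.TF\<^esub> v"] CollectI)
      show "?c u \<otimes>\<^bsub>T\<^esub> ?c v = ?c (u \<otimes>\<^bsub>TT.TF\<^esub> v)"
        by (rule alg_hom_mult[OF TT.class_hom c[OF u] c[OF v], symmetric])
      have "(fst x \<otimes>\<^bsub>H\<^esub> fst y, snd x \<otimes>\<^bsub>H\<^esub> snd y) \<in> pair_degree (k + l)" if xu: "x \<in> keys u" and yv: "y \<in> keys v" for x y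
      proof -
        obtain i j where 1: "i + j = k" "fst x \<in> G i" "snd x \<in> G j" using subsetD[OF u xu] by (auto simp: pair_degree_def)
        obtain i' j' where 2: "i' + j' = l" "fst y \<in> G i'" "snd y \<in> G j'" using subsetD[OF v yv] by (auto simp: pair_degree_def)
        have "(i + i') + (j + j') = k + l" using 1 2 by simp
        then show ?thesis
          unfolding pair_degree_def using alg_gradingD(6)[OF H_grading 1(2) 2(2)] alg_gradingD(6)[OF H_grading 1(3) 2(3)] by blast
      qed
      then show "keys (u \<otimes>\<^bsub>TT.TF\<^esub> v) \<subseteq> pair_degree (k + l)"
        unfolding tensor_free_eq monoid_alg_simps by (intro keys_sum_subset) (auto split: if_splits)
    qed
  qed
qed

lemma pt_degree: "a \<in> G i \<Longrightarrow> b \<in> G j \<Longrightarrow> pt a b \<in> TD (i + j)"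
  unfolding tensor_degree_eq pure_tensor_def by (intro imageI CollectI) (auto simp: pair_degree_def)

lemma evT_degree:
  assumes n: "n \<ge> 1" and \<alpha>: "\<alpha> \<in> X n" and z: "keys z \<subseteq> grading2 symb_weight (bounded_gens n) k"
  shows "evT n \<alpha> z \<in> TD k"
  unfolding evT_def T.pair_eval_def
proof (rule T.lin_grading[OF tensor_grading])
  fix mn assume "mn \<in> keys z"
  then obtain l m where mn: "mn = (l, m)" "keys l \<subseteq> bounded_gens n" "keys m \<subseteq> bounded_gens n" "weight symb_weight l + weight symb_weight m = k"
    using z by (auto simp: grading2_def)
  have e: "E n \<alpha> (Poly_Mapping.single m 1) \<in> G (weight symb_weight m)" if "keys m \<subseteq> bounded_gens n" for m
    using that by (intro ev_degree[OF n \<alpha>]) (auto simp: grading1_def)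
  show "pt (E n \<alpha> (Poly_Mapping.single (fst mn) 1)) \<one>\<^bsub>H\<^esub> \<otimes>\<^bsub>T\<^esub> pt \<one>\<^bsub>H\<^esub> (E n \<alpha> (Poly_Mapping.single (snd mn) 1)) \<in> TD k"
    using pt_degree[OF e[OF mn(2)] e[OF mn(3)]] alg_gradingD(1)[OF H_grading e[OF mn(2)]] alg_gradingD(1)[OF H_grading e[OF mn(3)]]
    unfolding mn(1) fst_conv snd_conv mn(4) by (subst TT.pt_eq_mult[symmetric])
qed

text \<open>
  The endomorphism multiplying each generator of weight \<open>n\<close> by \<open>2\<^sup>n\<close> respects the relations, so the
  homogeneous parts are eigenspaces for distinct eigenvalues.
\<close>

lemma degree_independent:
  assumes "finite N" "\<And>n. n \<in> N \<Longrightarrow> x n \<in> G n" "(\<Oplus>\<^bsub>H\<^esub>n\<in>N. x n) = \<zero>\<^bsub>H\<^esub>" "n \<in> N"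
  shows "x n = \<zero>\<^bsub>H\<^esub>"
proof -
  obtain \<theta> where \<theta>: "\<theta> \<in> alg_hom H H" "\<And>\<beta>. \<beta> \<in> X 1 \<Longrightarrow> \<theta> (clog \<beta>) = 2 \<odot>\<^bsub>H\<^esub> clog \<beta>"
    "\<And>\<beta> ns. ns \<noteq> [] \<Longrightarrow> 0 \<notin> set ns \<Longrightarrow> \<beta> \<in> X (length ns) \<Longrightarrow> \<theta> (csym \<beta> ns) = 2 ^ sum_list ns \<odot>\<^bsub>H\<^esub> csym \<beta> ns"
  proof (rule con_lift[OF qalgebra_H, of "\<lambda>\<beta>. 2 \<odot>\<^bsub>H\<^esub> clog \<beta>" "\<lambda>\<beta> ns. 2 ^ sum_list ns \<odot>\<^bsub>H\<^esub> csym \<beta> ns"])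
    show "2 \<odot>\<^bsub>H\<^esub> clog (con n [i1, i2] \<alpha>) \<oplus>\<^bsub>H\<^esub> 2 \<odot>\<^bsub>H\<^esub> clog (con n [i2, i3] \<alpha>) = 2 \<odot>\<^bsub>H\<^esub> clog (con n [i1, i3] \<alpha>)"
      if m: "n \<ge> 1" "\<alpha> \<in> X n" "1 \<le> i1" "i1 < i2" "i2 < i3" "i3 \<le> n + 1" for n \<alpha> i1 i2 i3
    proof -
      have c: "clog (con n [i1, i2] \<alpha>) \<in> carrier H" "clog (con n [i2, i3] \<alpha>) \<in> carrier H"
        using m by (auto intro!: clog_closed con_pair_closed)
      show ?thesis unfolding clog_add[OF m, symmetric] by (rule H.q_binary(1)[OF c, symmetric])
    qed
  qed (auto simp: clog_closed csym_closed H.q_simps)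
  \<comment> \<open>In a product of eigenvectors of \<open>\<theta>\<close> the eigenvalues
    multiply, so the eigenspaces form a grading and it is enough to look at generators.\<close>
  let ?D = "\<lambda>k. {x \<in> carrier H. \<theta> x = 2 ^ k \<odot>\<^bsub>H\<^esub> x}"
  have D: "alg_grading H ?D"
    by (auto simp: alg_grading_def alg_homD[OF \<theta>(1)] H.q_simps alg_hom_zero[OF \<theta>(1) qalgebra_H qalgebra_H] power_add mult_ac)
  have eig: "\<theta> y = 2 ^ k \<odot>\<^bsub>H\<^esub> y" if "y \<in> G k" for k y
    using H_hom_grading[OF qalgebra_H D alg_hom_id, of y k] that \<theta>(2,3) clog_closed csym_closed by simp
  show ?thesis using assms
  proof (induction N arbitrary: x n rule: finite_induct)
    case (insert m N)
    have G: "x n \<in> G n" if "n \<in> insert m N" for n using insert.prems that by blast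
    have xc: "x n \<in> carrier H" if "n \<in> insert m N" for n using alg_gradingD(1)[OF H_grading G[OF that]] .
    define s where "s = (\<Oplus>\<^bsub>H\<^esub>n\<in>N. x n)"
    have sc: "s \<in> carrier H" unfolding s_def by (rule H.finsum_closed) (use xc in auto)
    have 0: "x m \<oplus>\<^bsub>H\<^esub> s = \<zero>\<^bsub>H\<^esub>"
      using insert.prems(2) insert.hyps xc unfolding s_def by (subst (asm) H.finsum_insert) auto
    have "s = (-1) \<odot>\<^bsub>H\<^esub> x m"
    proof -
      have "(-1) \<odot>\<^bsub>H\<^esub> x m \<oplus>\<^bsub>H\<^esub> (x m \<oplus>\<^bsub>H\<^esub> s) = ((-1) + 1) \<odot>\<^bsub>H\<^esub> x m \<oplus>\<^bsub>H\<^esub> s"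
        using xc sc by (subst H.q_unary(2)) (auto simp: H.q_simps H.a_assoc)
      then show ?thesis using xc sc unfolding 0 by (simp add: H.q_simps)
    qed
    \<comment> \<open>\<open>s\<close> is the negative of \<open>x m\<close>, hence an eigenvector
      for 2^m. Applying \<open>\<theta>\<close> minus 2^m to the sum that defines \<open>s\<close>
      gives a relation over the smaller set \<open>N\<close>.\<close>
    then have ts: "\<theta> s \<oplus>\<^bsub>H\<^esub> (- (2 ^ m)) \<odot>\<^bsub>H\<^esub> s = \<zero>\<^bsub>H\<^esub>"
      using xc[of m] H.q_unary(2)[of "x m" "- (2 ^ m)" "2 ^ m"] eig[OF G, of m]
      by (simp add: alg_homD[OF \<theta>(1)] H.q_simps)
    have "\<theta> s \<oplus>\<^bsub>H\<^esub> (- (2 ^ m)) \<odot>\<^bsub>H\<^esub> s = (\<Oplus>\<^bsub>H\<^esub>n\<in>N. 2 ^ n \<odot>\<^bsub>H\<^esub> x n) \<oplus>\<^bsub>H\<^esub> (\<Oplus>\<^bsub>H\<^esub>n\<in>N. (- (2 ^ m)) \<odot>\<^bsub>H\<^esub> x n)"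
    proof (intro arg_cong2[where f = "add H"])
      have "\<theta> s = (\<Oplus>\<^bsub>H\<^esub>n\<in>N. \<theta> (x n))"
        unfolding s_def by (rule alg_hom_finsum[OF \<theta>(1) qalgebra_H qalgebra_H]) (use xc in auto)
      also have "\<dots> = (\<Oplus>\<^bsub>H\<^esub>n\<in>N. 2 ^ n \<odot>\<^bsub>H\<^esub> x n)"
        by (rule H.finsum_cong'[OF refl]) (simp_all add: Pi_def xc H.q_simps eig[OF G])
      finally show "\<theta> s = (\<Oplus>\<^bsub>H\<^esub>n\<in>N. 2 ^ n \<odot>\<^bsub>H\<^esub> x n)" .
      show "(- (2 ^ m)) \<odot>\<^bsub>H\<^esub> s = (\<Oplus>\<^bsub>H\<^esub>n\<in>N. (- (2 ^ m)) \<odot>\<^bsub>H\<^esub> x n)"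
        unfolding s_def by (rule H.smult_finsum) (use xc in auto)
    qed
    also have "\<dots> = (\<Oplus>\<^bsub>H\<^esub>n\<in>N. (2 ^ n - 2 ^ m) \<odot>\<^bsub>H\<^esub> x n)"
    proof (subst H.finsum_addf[symmetric])
      show "(\<Oplus>\<^bsub>H\<^esub>n\<in>N. 2 ^ n \<odot>\<^bsub>H\<^esub> x n \<oplus>\<^bsub>H\<^esub> (- (2 ^ m)) \<odot>\<^bsub>H\<^esub> x n) = (\<Oplus>\<^bsub>H\<^esub>n\<in>N. (2 ^ n - 2 ^ m) \<odot>\<^bsub>H\<^esub> x n)"
        by (rule H.finsum_cong'[OF refl]) (simp_all add: Pi_def xc H.q_unary(1) flip: H.q_unary(2))
    qed (simp_all add: Pi_def xc H.q_unary(1))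
    finally have "(\<Oplus>\<^bsub>H\<^esub>n\<in>N. (2 ^ n - 2 ^ m) \<odot>\<^bsub>H\<^esub> x n) = \<zero>\<^bsub>H\<^esub>" using ts by simp
    then have y: "(2 ^ n - 2 ^ m) \<odot>\<^bsub>H\<^esub> x n = \<zero>\<^bsub>H\<^esub>" if "n \<in> N" for n
      using insert.IH[of "\<lambda>n. (2 ^ n - 2 ^ m) \<odot>\<^bsub>H\<^esub> x n"] that G alg_gradingD(4)[OF H_grading] by blast
    have xN: "x n = \<zero>\<^bsub>H\<^esub>" if "n \<in> N" for n
    proof -
      have "(2::rat) ^ n - 2 ^ m \<noteq> 0" using that insert.hyps(2) by (auto simp: power_inject_exp)
      then have "x n = (1 / (2 ^ n - 2 ^ m)) \<odot>\<^bsub>H\<^esub> ((2 ^ n - 2 ^ m) \<odot>\<^bsub>H\<^esub> x n)"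
        using xc[of n] that by (simp add: H.q_simps)
      then show ?thesis unfolding y[OF that] by (simp add: H.q_simps)
    qed
    then have "s = \<zero>\<^bsub>H\<^esub>" unfolding s_def by (rule H.add.finprod_one_eqI)
    then have "x m = \<zero>\<^bsub>H\<^esub>" using 0 xc by simp
    then show ?case using insert.prems(3) xN by auto
  qed simp
qed

lemma degree_direct_sum:
  assumes x: "x \<in> carrier H"
  shows "\<exists>!f. (\<forall>n. f n \<in> G n) \<and> finite {n. f n \<noteq> \<zero>\<^bsub>H\<^esub>} \<and> x = (\<Oplus>\<^bsub>H\<^esub>n\<in>{n. f n \<noteq> \<zero>\<^bsub>H\<^esub>}. f n)"
proof -
  have sup: "(\<Oplus>\<^bsub>H\<^esub>n\<in>{n. f n \<noteq> \<zero>\<^bsub>H\<^esub>}. f n) = (\<Oplus>\<^bsub>H\<^esub>n\<in>N. f n)"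
    if "finite N" "{n. f n \<noteq> \<zero>\<^bsub>H\<^esub>} \<subseteq> N" "\<And>n. f n \<in> G n" for f N
    by (rule H.add.finprod_mono_neutral_cong_left) (use that alg_gradingD(1)[OF H_grading that(3)] in auto)
  show ?thesis
  proof (rule ex_ex1I)
    obtain p where p: "p \<in> carrier F" "x = con_class X con p" using x by (auto simp: carrier_H)
    \<comment> \<open>Existence comes from the decomposition by weight of any representative;
      uniqueness is left to \<open>degree_independent\<close>.\<close>
    define q where "q = (\<lambda>n. \<Sum>m\<in>{m \<in> keys p. weight cgen_weight m = n}. Poly_Mapping.single m (lookup p m))"
    define f where "f = (\<lambda>n. con_class X con (q n))"
    define N where "N = weight cgen_weight ` keys p"
    have qk: "keys (q n) \<subseteq> grading1 cgen_weight (con_gens X) n" for n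
      unfolding q_def using p(1) by (intro keys_sum_subset) (auto simp: grading1_def free_alg_def split: if_splits)
    have f: "f n \<in> G n" for n unfolding f_def con_degree_eq using qk by blast
    have "q n = 0" if "n \<notin> N" for n unfolding q_def using that by (intro sum.neutral) (auto simp: N_def)
    then have sub: "{n. f n \<noteq> \<zero>\<^bsub>H\<^esub>} \<subseteq> N"
      using alg_hom_zero[OF class_hom qalgebra_free_alg qalgebra_H] by (auto simp: f_def free_alg_eq malg_on_simps)
    have N: "finite N" by (simp add: N_def)
    have pq: "p = (\<Sum>n\<in>N. q n)"
      unfolding q_def N_def by (subst sum.group) (auto simp flip: malg_decomp)
    have "con_class X con (\<Sum>n\<in>M. q n) = (\<Oplus>\<^bsub>H\<^esub>n\<in>M. f n) \<and> (\<Sum>n\<in>M. q n) \<in> carrier F" if "finite M" for M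
      using that
    proof (induction M rule: finite_induct)
      case empty
      then show ?case using alg_hom_zero[OF class_hom qalgebra_free_alg qalgebra_H] by (simp add: free_alg_eq malg_on_simps)
    next
      case (insert n M)
      have qc: "q n \<in> carrier F" using qk[of n] grading1_subset_mons by (fastforce simp: free_alg_eq malg_on_simps)
      have "q n + sum q M \<in> carrier F" using insert.IH qc keys_add[of "q n" "sum q M"] by (auto simp: free_alg_eq malg_on_simps)
      moreover have "con_class X con (q n + sum q M) = f n \<oplus>\<^bsub>H\<^esub> (\<Oplus>\<^bsub>H\<^esub>n\<in>M. f n)"
        using insert.IH qc alg_hom_add[OF class_hom qc, of "sum q M"] by (simp add: f_def free_alg_eq malg_on_simps)
      ultimately show ?case using insert.hyps alg_gradingD(1)[OF H_grading f] by (simp add: H.finsum_insert)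
    qed
    then have "x = (\<Oplus>\<^bsub>H\<^esub>n\<in>N. f n)" using N pq p(2) by simp
    then show "\<exists>f. (\<forall>n. f n \<in> G n) \<and> finite {n. f n \<noteq> \<zero>\<^bsub>H\<^esub>} \<and> x = (\<Oplus>\<^bsub>H\<^esub>n\<in>{n. f n \<noteq> \<zero>\<^bsub>H\<^esub>}. f n)"
      using f finite_subset[OF sub N] sup[OF N sub f] by (intro exI[of _ f]) simp
  next
    fix f g
    assume "(\<forall>n. f n \<in> G n) \<and> finite {n. f n \<noteq> \<zero>\<^bsub>H\<^esub>} \<and> x = (\<Oplus>\<^bsub>H\<^esub>n\<in>{n. f n \<noteq> \<zero>\<^bsub>H\<^esub>}. f n)"
      and "(\<forall>n. g n \<in> G n) \<and> finite {n. g n \<noteq> \<zero>\<^bsub>H\<^esub>} \<and> x = (\<Oplus>\<^bsub>H\<^esub>n\<in>{n. g n \<noteq> \<zero>\<^bsub>H\<^esub>}. g n)"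
    then have f: "\<And>n. f n \<in> G n" "finite {n. f n \<noteq> \<zero>\<^bsub>H\<^esub>}" "x = (\<Oplus>\<^bsub>H\<^esub>n\<in>{n. f n \<noteq> \<zero>\<^bsub>H\<^esub>}. f n)"
      and g: "\<And>n. g n \<in> G n" "finite {n. g n \<noteq> \<zero>\<^bsub>H\<^esub>}" "x = (\<Oplus>\<^bsub>H\<^esub>n\<in>{n. g n \<noteq> \<zero>\<^bsub>H\<^esub>}. g n)"
      by blast+
    define N where "N = {n. f n \<noteq> \<zero>\<^bsub>H\<^esub>} \<union> {n. g n \<noteq> \<zero>\<^bsub>H\<^esub>}"
    have N: "finite N" "{n. f n \<noteq> \<zero>\<^bsub>H\<^esub>} \<subseteq> N" "{n. g n \<noteq> \<zero>\<^bsub>H\<^esub>} \<subseteq> N" using f(2) g(2) by (auto simp: N_def)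
    have c: "f n \<in> carrier H" "g n \<in> carrier H" for n using alg_gradingD(1)[OF H_grading] f(1) g(1) by blast+
    have neg: "y \<oplus>\<^bsub>H\<^esub> (-1) \<odot>\<^bsub>H\<^esub> z = \<zero>\<^bsub>H\<^esub> \<longleftrightarrow> y = z" if "y \<in> carrier H" "z \<in> carrier H" for y z
    proof -
      have z: "z \<oplus>\<^bsub>H\<^esub> (-1) \<odot>\<^bsub>H\<^esub> z = \<zero>\<^bsub>H\<^esub>"
        using that H.q_unary(2)[of z 1 "-1"] by (simp add: H.q_simps)
      then show ?thesis
        using that H.add.right_cancel[of "(-1) \<odot>\<^bsub>H\<^esub> z" y z] by (simp add: H.q_simps)
    qed
    have "(\<Oplus>\<^bsub>H\<^esub>n\<in>N. f n \<oplus>\<^bsub>H\<^esub> (-1) \<odot>\<^bsub>H\<^esub> g n) = (\<Oplus>\<^bsub>H\<^esub>n\<in>N. f n) \<oplus>\<^bsub>H\<^esub> (\<Oplus>\<^bsub>H\<^esub>n\<in>N. (-1) \<odot>\<^bsub>H\<^esub> g n)"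
      using c by (intro H.finsum_addf) (auto simp: H.q_simps)
    also have "\<dots> = x \<oplus>\<^bsub>H\<^esub> (-1) \<odot>\<^bsub>H\<^esub> x"
      using c sup[OF N(1,2) f(1)] sup[OF N(1,3) g(1)] f(3) g(3) by (subst H.smult_finsum[symmetric]) auto
    also have "\<dots> = \<zero>\<^bsub>H\<^esub>" using neg[OF x x] by simp
    finally have z: "(\<Oplus>\<^bsub>H\<^esub>n\<in>N. f n \<oplus>\<^bsub>H\<^esub> (-1) \<odot>\<^bsub>H\<^esub> g n) = \<zero>\<^bsub>H\<^esub>" .
    have d: "f n \<oplus>\<^bsub>H\<^esub> (-1) \<odot>\<^bsub>H\<^esub> g n \<in> G n" for n
      by (intro alg_gradingD(3)[OF H_grading] alg_gradingD(4)[OF H_grading] f(1) g(1))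
    have "f n \<oplus>\<^bsub>H\<^esub> (-1) \<odot>\<^bsub>H\<^esub> g n = \<zero>\<^bsub>H\<^esub>" if "n \<in> N" for n
      by (rule degree_independent[OF N(1) d z that])
    then have "f n = g n" if "n \<in> N" for n using neg[OF c] that by blast
    moreover have "f n = g n" if "n \<notin> N" for n using that by (simp add: N_def)
    ultimately show "f = g" by blast
  qed
qed

theorem con_graded_hopf_algebra:
  assumes \<Delta>: "coproduct \<Delta>" and \<epsilon>: "counit \<epsilon>" and S: "con_antipode S"
  shows "graded_hopf_algebra H G \<Delta> \<epsilon> S"
proof (intro graded_hopf_algebra.intro graded_hopf_algebra_axioms.intro con_hopf_algebra assms degree_direct_sum)
  note D = H_grading and one = alg_gradingD(5)[OF H_grading]
  show "submodule (G n) rat_alg H" for n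
  proof (rule H.submoduleI)
    show "\<ominus>\<^bsub>H\<^esub> a \<in> G n" if "a \<in> G n" for a
    proof -
      have a: "a \<in> carrier H" by (rule alg_gradingD(1)[OF D that])
      have "(-1) \<odot>\<^bsub>H\<^esub> a \<oplus>\<^bsub>H\<^esub> a = \<zero>\<^bsub>H\<^esub>"
        using a H.q_unary(2)[of a "-1" 1] by (simp add: H.q_simps)
      then have "\<ominus>\<^bsub>H\<^esub> a = (-1) \<odot>\<^bsub>H\<^esub> a" using a by (intro H.minus_equality) (simp_all add: H.q_simps)
      then show ?thesis using alg_gradingD(4)[OF D that] by simp
    qed
  qed (use alg_gradingD[OF D] in auto)
  show "\<one>\<^bsub>H\<^esub> \<in> G 0" by (rule one)
  show "a \<otimes>\<^bsub>H\<^esub> b \<in> G (m + n)" if "a \<in> G m" "b \<in> G n" for a b m n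
    by (rule alg_gradingD(6)[OF D that])
  show "\<Delta> a \<in> TD n" if a: "a \<in> G n" for a n
  proof (rule H_hom_grading[OF TT.qalgebra_tensor tensor_grading coproduct_hom[OF \<Delta>] _ _ a])
    show "\<Delta> (clog \<beta>) \<in> TD 1" if "\<beta> \<in> X 1" for \<beta>
      using \<Delta> that pt_degree[OF one clog_degree[OF that]] pt_degree[OF clog_degree[OF that] one] alg_gradingD(3)[OF tensor_grading]
      by (simp add: coproduct_def)
    show "\<Delta> (csym \<beta> ns) \<in> TD (sum_list ns)" if "ns \<noteq> []" "0 \<notin> set ns" "\<beta> \<in> X (length ns)" for \<beta> ns
      using \<Delta> that evT_degree[OF _ that(3) keys_cop_pvar[OF generic_bounded[OF that(1,2)]]]
      by (simp add: coproduct_def Suc_le_eq del: upt_Suc)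
  qed
  show "\<epsilon> a = 0" if a: "a \<in> G n" and "n > 0" for a n
    using H_hom_grading[OF qalgebra_rat_alg rat_alg_grading counit_hom[OF \<Delta> \<epsilon> S] _ _ a] \<epsilon> \<open>n > 0\<close>
    by (auto simp: counit_def)
  show "S a \<in> G n" if a: "a \<in> G n" for a n
  proof (rule H_hom_grading[OF qalgebra_H D antipode_H_hom[OF \<Delta> \<epsilon> S] _ _ a])
    show "S (clog \<beta>) \<in> G 1" if "\<beta> \<in> X 1" for \<beta>
      using S that alg_gradingD(4)[OF D clog_degree[OF that]] by (simp add: con_antipode_def)
    show "S (csym \<beta> ns) \<in> G (sum_list ns)" if "ns \<noteq> []" "0 \<notin> set ns" "\<beta> \<in> X (length ns)" for \<beta> ns
      using S that ev_degree[OF _ that(3) keys_antipode_pvar[OF generic_bounded[OF that(1,2)]]]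
      by (simp add: con_antipode_def Suc_le_eq del: upt_Suc)
  qed
qed

end

theorem theorem2p15:
  fixes X :: "nat \<Rightarrow> 'a set" and con :: "nat \<Rightarrow> nat list \<Rightarrow> 'a \<Rightarrow> 'a"
  assumes "contraction_system X con"
  shows "\<exists>\<Delta>. induced_coproduct X con \<Delta> \<and>
    (\<forall>\<Delta>'. induced_coproduct X con \<Delta>' \<longrightarrow> (\<forall>x\<in>carrier (con_alg X con). \<Delta>' x = \<Delta> x)) \<and>
    (\<exists>\<epsilon> S. graded_hopf_algebra (con_alg X con) (con_degree X con) \<Delta> \<epsilon> S)"
proof -
  interpret contraction_system X con by (rule assms)
  obtain \<Delta> where \<Delta>: "coproduct \<Delta>" using coproduct_exists by blast
  obtain \<epsilon> where \<epsilon>: "counit \<epsilon>" using counit_exists by blast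
  obtain S where S: "con_antipode S" using con_antipode_exists by blast
  show ?thesis
    unfolding induced_coproduct_iff
    using \<Delta> coproduct_unique[OF \<Delta>] con_graded_hopf_algebra[OF \<Delta> \<epsilon> S] by blast
qed

end
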